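(* Let $S \subset \mathbb{R}^2$ be a bounded connected open set. For each $\beta \in (0,\infty)$, let $\Omega_\beta \subset \mathbb{R}^3$ be the broken sheared waveguide with cross-section $S$, let $-\Delta^D_{\Omega_\beta}$ be the Dirichlet Laplacian in $\Omega_\beta$, and let $E_1(\beta)$ be the first eigenvalue of the operator $T(\beta) = -\partial_{y_1}^2 - (1+\beta^2)\partial_{y_2}^2$ in $L^2(S)$ with Dirichlet boundary conditions. Then, for each $\beta \in (0,\infty)$, $$\sigma_{ess}(-\Delta^D_{\Omega_\beta}) = [E_1(\beta), \infty).$$
   Context: Broken sheared waveguide: let $S \subset \mathbb{R}^2$ be a bounded connected open set, with points $y=(y_1,y_2)$, and $\beta \in (0,\infty)$. With $\{e_1,e_2,e_3\}$ the canonical basis of $\mathbb{R}^3$, put $r_\beta(x) = (x,0,\beta|x|)$ for $x \in \mathbb{R}$, $\mathcal{L}_\beta : \mathbb{R}\times S \to \mathbb{R}^3$, $\mathcal{L}_\beta(x,y_1,y_2) = r_\beta(x) + y_1 e_2 + y_2 e_3 = (x, y_1, \beta|x| + y_2)$, and $\Omega_\beta := \mathcal{L}_\beta(\mathbb{R}\times S)$. Dirichlet Laplacian: $-\Delta^D_{\Omega_\beta}$ is the self-adjoint operator in $L^2(\Omega_\beta)$ associated with the quadratic form $\psi \mapsto \int_{\Omega_\beta} |\nabla\psi|^2\,d\mathbf{x}$ with domain $H^1_0(\Omega_\beta)$. Transverse operator: $T(\beta) := -\partial_{y_1}^2 - (1+\beta^2)\partial_{y_2}^2$ in $L^2(S)$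 with domain $\{v \in H^1_0(S) : T(\beta)v \in L^2(S)\}$ (equivalently, the self-adjoint operator associated with the form $v \mapsto \int_S (|\partial_{y_1} v|^2 + (1+\beta^2)|\partial_{y_2} v|^2)\,dy$ on $H^1_0(S)$); $E_1(\beta)$ is its first (lowest) eigenvalue. $\sigma_{ess}$ denotes the essential spectrum, i.e. the complement in the spectrum of the set of isolated eigenvalues of finite multiplicity. *)

theory Defs
  imports "HOL-Analysis.Analysis"
begin

text \<open>
  Elements of \<open>L\<^sup>2(\<Omega>)\<close> are represented by complex-valued functions on the ambient space. Only their
  values on \<open>\<Omega>\<close> matter, and functions that agree almost everywhere on \<open>\<Omega>\<close> represent the same
  element; equality in \<open>L\<^sup>2(\<Omega>)\<close> is therefore always written with \<open>AE\<close>.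
\<close>

definition L2_space :: "'a::euclidean_space set \<Rightarrow> ('a \<Rightarrow> complex) set" where
  "L2_space \<Omega> = {f \<in> borel_measurable (lebesgue_on \<Omega>).
     integrable (lebesgue_on \<Omega>) (\<lambda>x. (cmod (f x))\<^sup>2)}"

definition L2_inner :: "'a::euclidean_space set \<Rightarrow> ('a \<Rightarrow> complex) \<Rightarrow> ('a \<Rightarrow> complex) \<Rightarrow> complex" where
  "L2_inner \<Omega> f g = (\<integral>x. f x * cnj (g x) \<partial>lebesgue_on \<Omega>)"

definition L2_norm :: "'a::euclidean_space set \<Rightarrow> ('a \<Rightarrow> complex) \<Rightarrow> real" where
  "L2_norm \<Omega> f = sqrt (\<integral>x. (cmod (f x))\<^sup>2 \<partial>lebesgue_on \<Omega>)"


definition partial_deriv :: "'a::euclidean_space \<Rightarrow> ('a \<Rightarrow> complex) \<Rightarrow> 'a \<Rightarrow> complex" where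
  "partial_deriv b f x = frechet_derivative f (at x) b"

primrec C_k :: "nat \<Rightarrow> ('a::euclidean_space \<Rightarrow> complex) \<Rightarrow> bool" where
  "C_k 0 f \<longleftrightarrow> continuous_on UNIV f"
| "C_k (Suc k) f \<longleftrightarrow>
     (\<forall>x. f differentiable at x) \<and> (\<forall>b\<in>Basis. C_k k (partial_deriv b f))"

text \<open>\<open>C\<^sub>c\<^sup>\<infinity>(\<Omega>)\<close>, as functions on the whole space extended by zero.\<close>

definition test_functions :: "'a::euclidean_space set \<Rightarrow> ('a \<Rightarrow> complex) set" where
  "test_functions \<Omega> = {\<phi>. (\<forall>k. C_k k \<phi>) \<and>
     compact (closure {x. \<phi> x \<noteq> 0}) \<and> closure {x. \<phi> x \<noteq> 0} \<subseteq> \<Omega>}"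

definition has_weak_partial ::
    "'a::euclidean_space set \<Rightarrow> 'a \<Rightarrow> ('a \<Rightarrow> complex) \<Rightarrow> ('a \<Rightarrow> complex) \<Rightarrow> bool" where
  "has_weak_partial \<Omega> b u g \<longleftrightarrow> (\<forall>\<phi>\<in>test_functions \<Omega>.
     (\<integral>x. u x * partial_deriv b \<phi> x \<partial>lebesgue_on \<Omega>) = - (\<integral>x. g x * \<phi> x \<partial>lebesgue_on \<Omega>))"

definition H1_space :: "'a::euclidean_space set \<Rightarrow> ('a \<Rightarrow> complex) set" where
  "H1_space \<Omega> = {u \<in> L2_space \<Omega>. \<forall>b\<in>Basis. \<exists>g\<in>L2_space \<Omega>. has_weak_partial \<Omega> b u g}"

text \<open>For \<open>u\<close> in \<open>H\<^sup>1(\<Omega>)\<close>, \<open>\<Omega>\<close> open, the weak derivative is unique up to almost-everywhere equality.\<close>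

definition weak_partial ::
    "'a::euclidean_space set \<Rightarrow> 'a \<Rightarrow> ('a \<Rightarrow> complex) \<Rightarrow> 'a \<Rightarrow> complex" where
  "weak_partial \<Omega> b u = (SOME g. g \<in> L2_space \<Omega> \<and> has_weak_partial \<Omega> b u g)"

definition H1_norm :: "'a::euclidean_space set \<Rightarrow> ('a \<Rightarrow> complex) \<Rightarrow> real" where
  "H1_norm \<Omega> u = sqrt ((L2_norm \<Omega> u)\<^sup>2 + (\<Sum>b\<in>Basis. (L2_norm \<Omega> (weak_partial \<Omega> b u))\<^sup>2))"

text \<open>\<open>H\<^sup>1\<^sub>0(\<Omega>)\<close> is the closure of \<open>C\<^sub>c\<^sup>\<infinity>(\<Omega>)\<close> in \<open>H\<^sup>1(\<Omega>)\<close>.\<close>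

definition H10_space :: "'a::euclidean_space set \<Rightarrow> ('a \<Rightarrow> complex) set" where
  "H10_space \<Omega> = {u \<in> H1_space \<Omega>.
     \<forall>\<epsilon>>0. \<exists>\<phi>\<in>test_functions \<Omega>. H1_norm \<Omega> (\<lambda>x. u x - \<phi> x) < \<epsilon>}"


text \<open>
  An unbounded operator \<open>A\<close> in \<open>L\<^sup>2(\<Omega>)\<close> is represented by its graph, the set of pairs \<open>(u, f)\<close> with
  \<open>u\<close> in the domain of \<open>A\<close> and \<open>A u = f\<close>.
\<close>

type_synonym 'a operator = "(('a \<Rightarrow> complex) \<times> ('a \<Rightarrow> complex)) set"

text \<open>
  The resolvent set: \<open>A - z\<close> maps the domain of \<open>A\<close> bijectively onto \<open>L\<^sup>2(\<Omega>)\<close>, with bounded inverse.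
  Injectivity is contained in the norm estimate.
\<close>

definition resolvent_set :: "'a::euclidean_space set \<Rightarrow> 'a operator \<Rightarrow> complex set" where
  "resolvent_set \<Omega> A = {z.
     (\<forall>f\<in>L2_space \<Omega>. \<exists>(u, g)\<in>A. AE x in lebesgue_on \<Omega>. g x - z * u x = f x) \<and>
     (\<exists>C. \<forall>(u, g)\<in>A. L2_norm \<Omega> u \<le> C * L2_norm \<Omega> (\<lambda>x. g x - z * u x))}"

definition spectrum :: "'a::euclidean_space set \<Rightarrow> 'a operator \<Rightarrow> complex set" where
  "spectrum \<Omega> A = - resolvent_set \<Omega> A"

definition eigenspace ::
    "'a::euclidean_space set \<Rightarrow> 'a operator \<Rightarrow> complex \<Rightarrow> ('a \<Rightarrow> complex) set" where
  "eigenspace \<Omega> A z = {u. \<exists>g. (u, g) \<in> A \<and> (AE x in lebesgue_on \<Omega>. g x = z * u x)}"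

definition is_eigenvalue :: "'a::euclidean_space set \<Rightarrow> 'a operator \<Rightarrow> complex \<Rightarrow> bool" where
  "is_eigenvalue \<Omega> A z \<longleftrightarrow>
     (\<exists>u\<in>eigenspace \<Omega> A z. \<not> (AE x in lebesgue_on \<Omega>. u x = 0))"

definition finite_multiplicity :: "'a::euclidean_space set \<Rightarrow> 'a operator \<Rightarrow> complex \<Rightarrow> bool" where
  "finite_multiplicity \<Omega> A z \<longleftrightarrow>
     (\<exists>B. finite B \<and> B \<subseteq> eigenspace \<Omega> A z \<and>
       (\<forall>u\<in>eigenspace \<Omega> A z. \<exists>c. AE x in lebesgue_on \<Omega>. u x = (\<Sum>w\<in>B. c w * w x)))"

definition essential_spectrum :: "'a::euclidean_space set \<Rightarrow> 'a operator \<Rightarrow> complex set" where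
  "essential_spectrum \<Omega> A = spectrum \<Omega> A -
     {z. z isolated_in spectrum \<Omega> A \<and> is_eigenvalue \<Omega> A z \<and> finite_multiplicity \<Omega> A z}"

text \<open>The lowest eigenvalue of an operator all of whose eigenvalues are real.\<close>

definition first_eigenvalue :: "'a::euclidean_space set \<Rightarrow> 'a operator \<Rightarrow> real" where
  "first_eigenvalue \<Omega> A = (LEAST r::real. is_eigenvalue \<Omega> A (complex_of_real r))"

text \<open>
  The operator associated with a sesquilinear form \<open>a\<close> with domain \<open>D\<close>: \<open>u\<close> lies in its domain iff
  \<open>a u\<close> is represented by some \<open>f\<close> in \<open>L\<^sup>2(\<Omega>)\<close>, which is then the value at \<open>u\<close>.
\<close>

definition form_operator ::
    "'a::euclidean_space set \<Rightarrow> ('a \<Rightarrow> complex) set \<Rightarrow>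
     (('a \<Rightarrow> complex) \<Rightarrow> ('a \<Rightarrow> complex) \<Rightarrow> complex) \<Rightarrow> 'a operator" where
  "form_operator \<Omega> D a =
     {(u, f). u \<in> D \<and> f \<in> L2_space \<Omega> \<and> (\<forall>v\<in>D. a u v = L2_inner \<Omega> f v)}"

text \<open>The sesquilinear form of the quadratic form \<open>\<psi> \<mapsto> \<integral> \<bar>\<nabla>\<psi>\<bar>\<^sup>2\<close>.\<close>

definition gradient_form ::
    "'a::euclidean_space set \<Rightarrow> ('a \<Rightarrow> complex) \<Rightarrow> ('a \<Rightarrow> complex) \<Rightarrow> complex" where
  "gradient_form \<Omega> u v =
     (\<Sum>b\<in>Basis. L2_inner \<Omega> (weak_partial \<Omega> b u) (weak_partial \<Omega> b v))"

definition dirichlet_laplacian :: "'a::euclidean_space set \<Rightarrow> 'a operator" where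
  "dirichlet_laplacian \<Omega> = form_operator \<Omega> (H10_space \<Omega>) (gradient_form \<Omega>)"


text \<open>
  \<open>\<real>\<^sup>2\<close> and \<open>\<real>\<^sup>3\<close> are the Euclidean spaces \<open>real \<times> real\<close> and \<open>real \<times> real \<times> real\<close>.
\<close>

definition bent_curve :: "real \<Rightarrow> real \<Rightarrow> real \<times> real \<times> real" where
  "bent_curve \<beta> x = (x, 0, \<beta> * \<bar>x\<bar>)"

definition shear_map :: "real \<Rightarrow> real \<times> real \<times> real \<Rightarrow> real \<times> real \<times> real" where
  "shear_map \<beta> = (\<lambda>(x, y\<^sub>1, y\<^sub>2). bent_curve \<beta> x + y\<^sub>1 *\<^sub>R (0, 1, 0) + y\<^sub>2 *\<^sub>R (0, 0, 1))"

definition broken_sheared_waveguide :: "real \<Rightarrow> (real \<times> real) set \<Rightarrow> (real \<times> real \<times> real) set" where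
  "broken_sheared_waveguide \<beta> S = shear_map \<beta> ` (UNIV \<times> S)"

text \<open>
  The differential expression \<open>-\<partial>\<^sub>1\<^sup>2 - (1 + \<beta>\<^sup>2) \<partial>\<^sub>2\<^sup>2\<close>, and the operator \<open>T(\<beta>)\<close> acting by it in
  the distributional sense on those \<open>v\<close> in \<open>H\<^sup>1\<^sub>0(S)\<close> for which the result is in \<open>L\<^sup>2(S)\<close>.
\<close>

definition transverse_expression ::
    "real \<Rightarrow> (real \<times> real \<Rightarrow> complex) \<Rightarrow> real \<times> real \<Rightarrow> complex" where
  "transverse_expression \<beta> \<phi> y =
     - partial_deriv (1, 0) (partial_deriv (1, 0) \<phi>) y
     - complex_of_real (1 + \<beta>\<^sup>2) * partial_deriv (0, 1) (partial_deriv (0, 1) \<phi>) y"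

definition transverse_operator :: "real \<Rightarrow> (real \<times> real) set \<Rightarrow> (real \<times> real) operator" where
  "transverse_operator \<beta> S =
     {(v, f). v \<in> H10_space S \<and> f \<in> L2_space S \<and>
       (\<forall>\<phi>\<in>test_functions S.
         (\<integral>y. v y * transverse_expression \<beta> \<phi> y \<partial>lebesgue_on S) =
         (\<integral>y. f y * \<phi> y \<partial>lebesgue_on S))}"

end

theory Submission
  imports Defs
begin

text \<open>
  Below \<open>E\<^sub>1\<close> the spectrum is discrete. Cut the waveguide, far out on both branches, by planes
  orthogonal to the branch. In coordinates adapted to such a plane its intersection with the waveguide
  is \<open>S\<close> and the tangential part of the gradient is the form of \<open>T(\<beta>)\<close>, so that
  \<open>\<integral> \<bar>\<nabla>\<psi>\<bar>\<^sup>2 \<ge> E\<^sub>1 \<integral> \<bar>\<psi>\<bar>\<^sup>2\<close> over the outer parts. The middle part is bounded, and there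
  Rellich's theorem, in the form \<open>\<integral>\<^sub>K \<bar>\<psi>\<bar>\<^sup>2 \<le> \<epsilon> \<integral> \<bar>\<nabla>\<psi>\<bar>\<^sup>2 + C \<Sum> \<bar>\<langle>\<psi>, w\<rangle>\<bar>\<^sup>2\<close> with finitely many
  \<open>w\<close>, makes the form minus \<open>r < E\<^sub>1\<close> coercive up to finite rank. Hence points of the spectrum
  below \<open>r\<close> are eigenvalues, and an infinite orthonormal family of eigenvectors is impossible.

  Conversely, for \<open>r = E\<^sub>1 + k\<^sup>2 / (1 + \<beta>\<^sup>2)\<close> slowly modulated plane waves \<open>\<chi>(s / N) e\<^bsup>iks\<^esup>\<close> along one
  branch, times a near-minimiser of the Rayleigh quotient on \<open>S\<close>, are approximate eigenfunctions in
  the form sense. So \<open>[E\<^sub>1, \<infinity>)\<close> lies in the spectrum, and it has no isolated points.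
\<close>

section \<open>Semi-Hilbert spaces\<close>

text \<open>The cutting planes are orthogonal to the branch, not \<open>x\<close> constant as the
  definition of the tube suggests, because in orthogonal coordinates the gradient splits without a
  mixed term. Moving \<open>s\<close> by one travels sqrt(1 + \<beta>^2), moving y2 by one travels 1
  / sqrt(1 + \<beta>^2): hence the 1 / (1 + \<beta>^2) in front of k^2 and the weight 1 + \<beta>^2
  in T, while volume is preserved. The kink of |x| stays in the bounded middle part.

  Two obstacles shape the rest. For a rough \<open>S\<close> the operator domain has no explicit
  description, and the near-minimiser on \<open>S\<close> is a mere test function whose image under
  T is uncontrolled; so residuals are measured against the form domain only, where Cauchy-Schwarz
  for the nonnegative form minus E1 bounds them. And compactness enters only as an inequality with
  finitely many inner products: it passes from test functions to the form domain by density, and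
  Bolzano-Weierstrass for finitely many numbers takes the place of compact operators. Solvability
  rests on Riesz representation, without a spectral theorem.\<close>

text \<open>Vectors are representatives of almost-everywhere classes, so \<open>ip\<close> is only semidefinite and
  vectors are determined up to \<open>sq = 0\<close>.\<close>

locale semi_inner =
  fixes V :: "('a \<Rightarrow> complex) set" and ip :: "('a \<Rightarrow> complex) \<Rightarrow> ('a \<Rightarrow> complex) \<Rightarrow> complex"
  assumes zero_mem: "(\<lambda>x. 0) \<in> V"
    and comb_mem: "u \<in> V \<Longrightarrow> v \<in> V \<Longrightarrow> (\<lambda>x. u x + c * v x) \<in> V"
    and ip_comb: "u \<in> V \<Longrightarrow> v \<in> V \<Longrightarrow> w \<in> V \<Longrightarrow> ip (\<lambda>x. u x + c * v x) w = ip u w + c * ip v w"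
    and ip_cnj: "u \<in> V \<Longrightarrow> v \<in> V \<Longrightarrow> ip v u = cnj (ip u v)"
    and ip_nonneg: "u \<in> V \<Longrightarrow> 0 \<le> Re (ip u u)"
begin

definition sq :: "('a \<Rightarrow> complex) \<Rightarrow> real" where "sq u = Re (ip u u)"

lemma sq_nonneg: "u \<in> V \<Longrightarrow> 0 \<le> sq u"
  by (simp add: sq_def ip_nonneg)

lemma diff_mem: "u \<in> V \<Longrightarrow> v \<in> V \<Longrightarrow> (\<lambda>x. u x - v x) \<in> V"
  using comb_mem[of u v "-1"] by simp

lemma add_mem: "u \<in> V \<Longrightarrow> v \<in> V \<Longrightarrow> (\<lambda>x. u x + v x) \<in> V"
  using comb_mem[of u v "1"] by simp

lemma scale_mem: "v \<in> V \<Longrightarrow> (\<lambda>x. c * v x) \<in> V"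
  using comb_mem[OF zero_mem, of v c] by simp

lemma sum_mem: "(\<And>i. i \<in> I \<Longrightarrow> w i \<in> V) \<Longrightarrow> (\<lambda>x. \<Sum>i\<in>I. c i * w i x) \<in> V"
proof (induction I rule: infinite_finite_induct)
  case (insert i F)
  then show ?case
    using comb_mem[of "\<lambda>x. \<Sum>i\<in>F. c i * w i x" "w i" "c i"] by (simp add: add.commute)
qed (simp_all add: zero_mem)

lemma ip_diff: "u \<in> V \<Longrightarrow> v \<in> V \<Longrightarrow> w \<in> V \<Longrightarrow> ip (\<lambda>x. u x - v x) w = ip u w - ip v w"
  using ip_comb[of u v w "-1"] by simp

lemma ip_zero: "w \<in> V \<Longrightarrow> ip (\<lambda>x. 0) w = 0"
  using ip_comb[of w w w "-1"] by simp

lemma ip_scale: "v \<in> V \<Longrightarrow> w \<in> V \<Longrightarrow> ip (\<lambda>x. c * v x) w = c * ip v w"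
  using ip_comb[OF zero_mem, of v w c] by (simp add: ip_zero)

lemma ip_comb_right:
  assumes "u \<in> V" "v \<in> V" "w \<in> V"
  shows "ip w (\<lambda>x. u x + c * v x) = ip w u + cnj c * ip w v"
  using ip_comb[OF assms, of c] ip_cnj[of "\<lambda>x. u x + c * v x" w] ip_cnj[of u w] ip_cnj[of v w]
    comb_mem[OF assms(1,2), of c] assms by simp

lemma ip_diff_right: "u \<in> V \<Longrightarrow> v \<in> V \<Longrightarrow> w \<in> V \<Longrightarrow> ip w (\<lambda>x. u x - v x) = ip w u - ip w v"
  using ip_comb_right[of u v w "-1"] by simp

lemma ip_scale_right: "v \<in> V \<Longrightarrow> w \<in> V \<Longrightarrow> ip w (\<lambda>x. c * v x) = cnj c * ip w v"
  using ip_scale[of v w c] ip_cnj[of "\<lambda>x. c * v x" w] ip_cnj[of v w] scale_mem[of v c] by simp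

lemma ip_sum:
  assumes "\<And>i. i \<in> I \<Longrightarrow> w i \<in> V" "v \<in> V"
  shows "ip (\<lambda>x. \<Sum>i\<in>I. c i * w i x) v = (\<Sum>i\<in>I. c i * ip (w i) v)"
  using assms(1)
proof (induction I rule: infinite_finite_induct)
  case (insert i F)
  then show ?case
    using ip_comb[of "\<lambda>x. \<Sum>i\<in>F. c i * w i x" "w i" v "c i"] sum_mem[of F w c] assms(2)
    by (simp add: add.commute)
qed (simp_all add: ip_zero assms(2))

lemma ip_self: "u \<in> V \<Longrightarrow> ip u u = complex_of_real (sq u)"
  using ip_cnj[of u u] unfolding sq_def by (simp add: complex_eq_iff)

lemma sq_comb:
  assumes "u \<in> V" "v \<in> V"
  shows "sq (\<lambda>x. u x + c * v x) = sq u + 2 * Re (c * ip v u) + (cmod c)\<^sup>2 * sq v"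
proof -
  have "ip (\<lambda>x. u x + c * v x) (\<lambda>x. u x + c * v x)
      = ip u u + cnj c * ip u v + (c * ip v u + c * cnj c * ip v v)"
    by (simp add: ip_comb ip_comb_right assms comb_mem algebra_simps)
  moreover have "ip u v = cnj (ip v u)" by (rule ip_cnj) (use assms in auto)
  moreover have "c * cnj c * ip v v = complex_of_real ((cmod c)\<^sup>2 * sq v)"
    by (simp add: ip_self[OF assms(2)] complex_norm_square[symmetric])
  ultimately show ?thesis
    unfolding sq_def by simp
qed

lemma sq_scale: "v \<in> V \<Longrightarrow> sq (\<lambda>x. c * v x) = (cmod c)\<^sup>2 * sq v"
  using sq_comb[OF zero_mem, of v c] zero_mem ip_zero[OF zero_mem] ip_cnj[of "\<lambda>x. 0" v] ip_zero[of v]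
  by (simp add: sq_def)

lemma normalize:
  assumes "v \<in> V" "sq v \<noteq> 0"
  obtains c where "sq (\<lambda>x. c * v x) = 1" "(cmod c)\<^sup>2 = 1 / sq v"
proof
  let ?c = "complex_of_real (1 / sqrt (sq v))"
  have pos: "sq v > 0" using assms sq_nonneg[of v] by simp
  then show c2: "(cmod ?c)\<^sup>2 = 1 / sq v" by (simp add: power_divide norm_divide)
  show "sq (\<lambda>x. ?c * v x) = 1" using sq_scale[OF assms(1), of ?c] c2 pos by simp
qed

lemma sq_minus_commute: "u \<in> V \<Longrightarrow> v \<in> V \<Longrightarrow> sq (\<lambda>x. u x - v x) = sq (\<lambda>x. v x - u x)"
  using sq_scale[of "\<lambda>x. v x - u x" "-1"] by (simp add: diff_mem)

text \<open>With a semidefinite form \<open>sq v = 0\<close> does not make \<open>v\<close> vanish,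
  so the degenerate case needs its own argument: there the quadratic in the coefficient of
  \<open>v\<close> becomes affine, and an affine function bounded below is constant.\<close>

lemma cauchy_schwarz:
  assumes "u \<in> V" "v \<in> V"
  shows "(cmod (ip v u))\<^sup>2 \<le> sq u * sq v"
proof (cases "sq v = 0")
  case False
  then have pos: "sq v > 0" using sq_nonneg[OF assms(2)] by simp
  \<comment> \<open>The minimiser of the quadratic in \<open>sq_comb\<close>.\<close>
  define c where "c = - cnj (ip v u) / complex_of_real (sq v)"
  have 1: "c * ip v u = complex_of_real (- (cmod (ip v u))\<^sup>2 / sq v)"
    unfolding c_def by (simp add: complex_norm_square mult.commute del: of_real_power)
  have 2: "(cmod c)\<^sup>2 * sq v = (cmod (ip v u))\<^sup>2 / sq v"
    unfolding c_def using pos by (simp add: norm_divide power_divide power2_eq_square)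
  have "0 \<le> sq (\<lambda>x. u x + c * v x)" by (simp add: sq_nonneg comb_mem assms)
  also have "\<dots> = sq u - (cmod (ip v u))\<^sup>2 / sq v"
    unfolding sq_comb[OF assms] 1 2 by simp
  finally show ?thesis using pos by (simp add: field_simps)
next
  case True
  have *: "2 * t * (cmod (ip v u))\<^sup>2 \<le> sq u" for t :: real
  proof -
    define c where "c = - complex_of_real t * cnj (ip v u)"
    have 1: "c * ip v u = complex_of_real (- t * (cmod (ip v u))\<^sup>2)"
      unfolding c_def by (simp only: complex_norm_square of_real_mult of_real_minus) (simp add: mult_ac)
    have "0 \<le> sq (\<lambda>x. u x + c * v x)" by (simp add: sq_nonneg comb_mem assms)
    then show ?thesis unfolding sq_comb[OF assms] 1 True by simp
  qed
  have "(cmod (ip v u))\<^sup>2 = 0"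
  proof (rule ccontr)
    assume n: "(cmod (ip v u))\<^sup>2 \<noteq> 0"
    then have "2 * ((sq u + 1) / (cmod (ip v u))\<^sup>2) * (cmod (ip v u))\<^sup>2 = 2 * (sq u + 1)" by simp
    then show False using *[of "(sq u + 1) / (cmod (ip v u))\<^sup>2"] sq_nonneg[OF assms(1)] by simp
  qed
  then show ?thesis using True by simp
qed

lemma cauchy_schwarz_sqrt:
  assumes "u \<in> V" "v \<in> V"
  shows "cmod (ip u v) \<le> sqrt (sq u) * sqrt (sq v)"
  using cauchy_schwarz[OF assms(2,1)]
  by (metis real_sqrt_le_mono real_sqrt_mult real_sqrt_abs abs_norm_cancel mult.commute)

lemma triangle:
  assumes "u \<in> V" "v \<in> V"
  shows "sqrt (sq (\<lambda>x. u x + v x)) \<le> sqrt (sq u) + sqrt (sq v)"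
proof -
  have "sq (\<lambda>x. u x + v x) = sq u + 2 * Re (ip v u) + sq v"
    using sq_comb[OF assms, of 1] by simp
  also have "\<dots> \<le> sq u + 2 * (sqrt (sq v) * sqrt (sq u)) + sq v"
    using cauchy_schwarz_sqrt[OF assms(2,1)] complex_Re_le_cmod[of "ip v u"] by simp
  also have "\<dots> = (sqrt (sq u) + sqrt (sq v))\<^sup>2"
    using sq_nonneg assms by (simp add: power2_sum)
  finally show ?thesis using sq_nonneg assms
    by (metis real_le_lsqrt add_nonneg_nonneg real_sqrt_ge_zero)
qed

lemma triangle_diff:
  assumes "u \<in> V" "v \<in> V" "w \<in> V"
  shows "sqrt (sq (\<lambda>x. u x - w x)) \<le> sqrt (sq (\<lambda>x. u x - v x)) + sqrt (sq (\<lambda>x. v x - w x))"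
  using triangle[of "\<lambda>x. u x - v x" "\<lambda>x. v x - w x"] assms by (simp add: diff_mem)

lemma parallelogram:
  assumes "u \<in> V" "v \<in> V"
  shows "sq (\<lambda>x. u x - v x) \<le> 2 * sq u + 2 * sq v"
proof -
  have "sq (\<lambda>x. u x + v x) + sq (\<lambda>x. u x - v x) = 2 * sq u + 2 * sq v"
    using sq_comb[OF assms, of 1] sq_comb[OF assms, of "-1"] by simp
  then show ?thesis using sq_nonneg[OF add_mem[OF assms]] by linarith
qed

lemma sq_add_le:
  assumes "u \<in> V" "v \<in> V"
  shows "sq (\<lambda>x. u x + c * v x) \<le> 2 * sq u + 2 * (cmod c)\<^sup>2 * sq v"
  using parallelogram[OF assms(1) scale_mem[OF assms(2), of "-c"]] sq_scale[OF assms(2), of "-c"] by simp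

lemma tendsto_ip:
  assumes "\<And>n. s n \<in> V" "u \<in> V" "v \<in> V" "(\<lambda>n. sq (\<lambda>x. s n x - u x)) \<longlonglongrightarrow> 0"
  shows "(\<lambda>n. ip (s n) v) \<longlonglongrightarrow> ip u v"
proof -
  have "(\<lambda>n. ip (s n) v - ip u v) \<longlonglongrightarrow> 0"
  proof (rule Lim_null_comparison)
    show "\<forall>\<^sub>F n in sequentially. norm (ip (s n) v - ip u v) \<le> sqrt (sq (\<lambda>x. s n x - u x)) * sqrt (sq v)"
      using cauchy_schwarz_sqrt[OF diff_mem[OF assms(1,2)] assms(3)] ip_diff[OF assms(1,2,3)] by simp
    show "(\<lambda>n. sqrt (sq (\<lambda>x. s n x - u x)) * sqrt (sq v)) \<longlonglongrightarrow> 0"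
      using tendsto_mult[OF tendsto_real_sqrt[OF assms(4)] tendsto_const[of "sqrt (sq v)"]] by simp
  qed
  then show ?thesis by (simp add: LIM_zero_iff)
qed

lemma tendsto_ip_right:
  assumes "\<And>n. s n \<in> V" "u \<in> V" "v \<in> V" "(\<lambda>n. sq (\<lambda>x. s n x - u x)) \<longlonglongrightarrow> 0"
  shows "(\<lambda>n. ip v (s n)) \<longlonglongrightarrow> ip v u"
  using tendsto_cnj[OF tendsto_ip[OF assms]] ip_cnj[OF assms(1) assms(3)] ip_cnj[OF assms(2,3)] by simp

lemma tendsto_sq:
  assumes "\<And>n. s n \<in> V" "u \<in> V" "(\<lambda>n. sq (\<lambda>x. s n x - u x)) \<longlonglongrightarrow> 0"
  shows "(\<lambda>n. sq (s n)) \<longlonglongrightarrow> sq u"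
proof -
  have *: "sq (s n) = sq (\<lambda>x. s n x - u x) + 2 * Re (ip (s n) u) - sq u" for n
    using sq_comb[OF assms(1,2), of n "-1"] ip_cnj[OF assms(1,2), of n] by simp
  have "(\<lambda>n. sq (\<lambda>x. s n x - u x) + 2 * Re (ip (s n) u) - sq u) \<longlonglongrightarrow> 0 + 2 * Re (ip u u) - sq u"
    by (intro tendsto_intros assms tendsto_ip)
  then show ?thesis unfolding * by (simp add: sq_def)
qed

end

text \<open>\<open>t\<close> may be negative: the uses are \<open>t = 1\<close> for form norms and
  \<open>t = - E1\<close> for the form minus its lowest value, which is why nonnegativity of the sum
  is a hypothesis.\<close>

lemma semi_inner_add:
  assumes "semi_inner V a" "semi_inner L b" "V \<subseteq> L"
    and nonneg: "\<And>u. u \<in> V \<Longrightarrow> 0 \<le> Re (a u u + complex_of_real t * b u u)"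
  shows "semi_inner V (\<lambda>u v. a u v + complex_of_real t * b u v)"
proof -
  interpret A: semi_inner V a by fact
  interpret B: semi_inner L b by fact
  show ?thesis
  proof
    fix u v w c assume "u \<in> V" "v \<in> V" "w \<in> V"
    then have m: "u \<in> V" "v \<in> V" "w \<in> V" "u \<in> L" "v \<in> L" "w \<in> L" using assms(3) by auto
    show "a (\<lambda>x. u x + c * v x) w + complex_of_real t * b (\<lambda>x. u x + c * v x) w
        = a u w + complex_of_real t * b u w + c * (a v w + complex_of_real t * b v w)"
      using A.ip_comb[OF m(1-3), of c] B.ip_comb[OF m(4-6), of c] by (simp add: algebra_simps)
  next
    fix u v assume "u \<in> V" "v \<in> V"
    then have m: "u \<in> V" "v \<in> V" "u \<in> L" "v \<in> L" using assms(3) by auto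
    show "a v u + complex_of_real t * b v u = cnj (a u v + complex_of_real t * b u v)"
      using A.ip_cnj[OF m(1,2)] B.ip_cnj[OF m(3,4)] by simp
  qed (fact A.zero_mem A.comb_mem nonneg)+
qed

locale semi_hilbert = semi_inner +
  assumes complete: "(\<And>n. s n \<in> V) \<Longrightarrow>
      (\<And>e. e > 0 \<Longrightarrow> \<exists>N. \<forall>m\<ge>N. \<forall>n\<ge>N. sq (\<lambda>x. s m x - s n x) < e) \<Longrightarrow>
      \<exists>u\<in>V. (\<lambda>n. sq (\<lambda>x. s n x - u x)) \<longlonglongrightarrow> 0"
begin

text \<open>The representing vector minimises \<open>v \<mapsto> sq v - 2 Re (F v)\<close>: by the parallelogram identity
  minimising sequences are Cauchy.\<close>

theorem riesz:
  assumes lin: "\<And>u v c. u \<in> V \<Longrightarrow> v \<in> V \<Longrightarrow> F (\<lambda>x. u x + c * v x) = F u + c * F v"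
    and bdd: "\<And>v. v \<in> V \<Longrightarrow> (cmod (F v))\<^sup>2 \<le> K * sq v"
  shows "\<exists>u\<in>V. \<forall>v\<in>V. F v = ip v u"
proof -
  define J where "J v = sq v - 2 * Re (F v)" for v
  \<comment> \<open>Completing the square: \<open>J v\<close> is at least x^2 - 2 sqrt|K| x with x
    the seminorm of \<open>v\<close>.\<close>
  have Jlow: "- \<bar>K\<bar> \<le> J v" if "v \<in> V" for v
  proof -
    have "Re (F v) \<le> cmod (F v)" by (rule complex_Re_le_cmod)
    also have "\<dots> \<le> sqrt (\<bar>K\<bar> * sq v)"
      using bdd[OF that] sq_nonneg[OF that]
      by (intro real_le_rsqrt) (meson abs_ge_self mult_right_mono order_trans)
    also have "\<dots> = sqrt \<bar>K\<bar> * sqrt (sq v)" by (simp add: real_sqrt_mult)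
    finally have "J v \<ge> (sqrt (sq v))\<^sup>2 - 2 * (sqrt \<bar>K\<bar> * sqrt (sq v))"
      unfolding J_def using sq_nonneg[OF that] by simp
    moreover have "(sqrt (sq v) - sqrt \<bar>K\<bar>)\<^sup>2 \<ge> 0" by simp
    ultimately show ?thesis by (simp add: power2_diff mult.assoc mult.commute[of "sqrt \<bar>K\<bar>"])
  qed
  define m where "m = Inf (J ` V)"
  have bd: "bdd_below (J ` V)" by (rule bdd_belowI2) (rule Jlow)
  have m_le: "m \<le> J v" if "v \<in> V" for v
    unfolding m_def by (rule cInf_lower) (use that bd in auto)
  have "\<exists>v\<in>V. J v < m + 1 / real (Suc n)" for n
  proof -
    have "Inf (J ` V) < m + 1 / real (Suc n)" by (simp add: m_def)
    then show ?thesis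
      using cInf_lessD[of "J ` V"] zero_mem by blast
  qed
  then obtain s where s: "\<And>n. s n \<in> V" "\<And>n. J (s n) < m + 1 / real (Suc n)" by metis
  \<comment> \<open>The linear terms cancel between \<open>u\<close>, \<open>v\<close> and their
    midpoint, leaving the parallelogram identity; since \<open>J\<close> at the midpoint is at least
    \<open>m\<close>, the sequence is Cauchy.\<close>
  have Jhalf: "sq (\<lambda>x. u x - v x) = 2 * J u + 2 * J v - 4 * J (\<lambda>x. (1/2) * (u x + 1 * v x))"
    if "u \<in> V" "v \<in> V" for u v
  proof -
    have w: "(\<lambda>x. u x + 1 * v x) \<in> V" using comb_mem[OF that] .
    have "F (\<lambda>x. (1/2) * (u x + 1 * v x)) = (1/2) * F (\<lambda>x. u x + 1 * v x)"
      using lin[OF zero_mem w, of "1/2"] lin[OF zero_mem zero_mem, of 1] by simp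
    also have "F (\<lambda>x. u x + 1 * v x) = F u + 1 * F v" by (rule lin[OF that])
    finally have "Re (F (\<lambda>x. (1/2) * (u x + 1 * v x))) = Re ((1/2) * (F u + 1 * F v))" by (rule arg_cong)
    also have "\<dots> = (Re (F u) + Re (F v)) / 2" by simp
    finally have 1: "Re (F (\<lambda>x. (1/2) * (u x + 1 * v x))) = (Re (F u) + Re (F v)) / 2" .
    have 2: "sq (\<lambda>x. (1/2) * (u x + 1 * v x)) = sq (\<lambda>x. u x + 1 * v x) / 4"
      by (simp only: sq_scale[OF w]) (simp add: power2_eq_square norm_divide)
    have 3: "J (\<lambda>x. (1/2) * (u x + 1 * v x)) = sq (\<lambda>x. u x + 1 * v x) / 4 - Re (F u) - Re (F v)"
      unfolding J_def 1 2 by (simp add: field_simps)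
    show ?thesis
      unfolding 3 using sq_comb[OF that, of 1] sq_comb[OF that, of "-1"] by (simp add: J_def field_simps)
  qed
  have "\<exists>N. \<forall>i\<ge>N. \<forall>j\<ge>N. sq (\<lambda>x. s i x - s j x) < e" if "e > 0" for e
  proof -
    have "e / 4 > 0" using that by simp
    from nat_approx_posE[OF this] obtain N where N: "1 / real (Suc N) < e / 4" .
    have "sq (\<lambda>x. s i x - s j x) < e" if ij: "i \<ge> N" "j \<ge> N" for i j
    proof -
      have "1 / real (Suc i) \<le> 1 / real (Suc N)" "1 / real (Suc j) \<le> 1 / real (Suc N)"
        using ij by (auto simp: frac_le)
      moreover have "m \<le> J (\<lambda>x. (1/2) * (s i x + 1 * s j x))"
        by (intro m_le scale_mem comb_mem s)
      ultimately show ?thesis using Jhalf[OF s(1) s(1), of i j] s(2)[of i] s(2)[of j] N by linarith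
    qed
    then show ?thesis by blast
  qed
  from complete[OF s(1) this] obtain u where u: "u \<in> V" "(\<lambda>n. sq (\<lambda>x. s n x - u x)) \<longlonglongrightarrow> 0" by blast
  have "F w = ip w u" if w: "w \<in> V" for w
  proof -
    \<comment> \<open>Almost minimality of \<open>s n\<close> compared with
      \<open>s n + c w\<close>, passed to the limit; after cancellation only
      \<open>ip w (s n)\<close> has to converge.\<close>
    have ge: "2 * Re (c * (ip w u - F w)) + (cmod c)\<^sup>2 * sq w \<ge> 0" for c
    proof -
      have 1: "2 * Re (c * (ip w (s n) - F w)) + (cmod c)\<^sup>2 * sq w \<ge> - (1 / real (Suc n))" for n
        using m_le[OF comb_mem[OF s(1)[of n] w, of c]] s(2)[of n]
        unfolding J_def by (simp add: sq_comb lin s w algebra_simps)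
      have 2: "(\<lambda>n. 2 * Re (c * (ip w (s n) - F w)) + (cmod c)\<^sup>2 * sq w)
            \<longlonglongrightarrow> 2 * Re (c * (ip w u - F w)) + (cmod c)\<^sup>2 * sq w"
        by (intro tendsto_intros tendsto_ip_right s u w)
      have 3: "(\<lambda>n. - (1 / real (Suc n))) \<longlonglongrightarrow> 0"
        using tendsto_minus[OF LIMSEQ_Suc[OF lim_1_over_n]] by simp
      show ?thesis by (rule LIMSEQ_le[OF 3 2]) (use 1 in blast)
    qed
    define d where "d = ip w u - F w"
    \<comment> \<open>The added 1 keeps \<open>t\<close> meaningful when \<open>sq w = 0\<close>,
      and \<open>t * sq w < 1\<close> leaves the quadratic term too small to compensate the linear
      one.\<close>
    define t where "t = 1 / (sq w + 1)"
    have tpos: "t > 0" "t * sq w < 1" unfolding t_def using sq_nonneg[OF w] by (auto simp: field_simps)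
    define c where "c = - complex_of_real t * cnj d"
    have 1: "c * d = complex_of_real (- t * (cmod d)\<^sup>2)"
      unfolding c_def by (simp only: complex_norm_square of_real_mult of_real_minus) (simp add: mult_ac)
    have 2: "(cmod c)\<^sup>2 = t\<^sup>2 * (cmod d)\<^sup>2" unfolding c_def by (simp add: norm_mult power_mult_distrib)
    have "0 \<le> 2 * (- t * (cmod d)\<^sup>2) + t\<^sup>2 * (cmod d)\<^sup>2 * sq w"
      using ge[of c] unfolding d_def[symmetric] 1 2 by simp
    also have "\<dots> = t * (cmod d)\<^sup>2 * (t * sq w - 2)" by (simp add: algebra_simps power2_eq_square)
    finally have "0 \<le> t * (cmod d)\<^sup>2 * (t * sq w - 2)" .
    then have "(cmod d)\<^sup>2 \<le> 0" using tpos
      by (smt (verit) mult_pos_neg mult_pos_pos)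
    then show ?thesis by (simp add: d_def)
  qed
  then show ?thesis using u(1) by blast
qed

end

section \<open>Closed forms and their operators\<close>

text \<open>One application of Bolzano-Weierstrass per index; finiteness of \<open>W\<close> lets
  the extractions be nested without a diagonal argument.\<close>

lemma bounded_family_convergent_subseq:
  fixes f :: "nat \<Rightarrow> 'b \<Rightarrow> complex"
  assumes "finite W" "\<And>n w. w \<in> W \<Longrightarrow> cmod (f n w) \<le> B w"
  shows "\<exists>r::nat\<Rightarrow>nat. strict_mono r \<and> (\<forall>w\<in>W. convergent (\<lambda>n. f (r n) w))"
  using assms
proof (induction W rule: finite_induct)
  case empty
  show ?case by (rule exI[of _ id]) (auto simp: strict_mono_def)
next
  case (insert w W)
  then obtain r :: "nat \<Rightarrow> nat" where r: "strict_mono r" "\<And>w. w \<in> W \<Longrightarrow> convergent (\<lambda>n. f (r n) w)"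
    by auto
  have "bounded (range (\<lambda>n. f (r n) w))"
    using insert.prems by (auto simp: bounded_iff)
  from bounded_imp_convergent_subsequence[OF this] obtain l q where
    q: "strict_mono q" "((\<lambda>n. f (r n) w) \<circ> q) \<longlonglongrightarrow> l" by blast
  have "convergent (\<lambda>n. f (r (q n)) v)" if "v \<in> insert w W" for v
  proof (cases "v = w")
    case True
    then show ?thesis using q(2) by (auto simp: convergent_def o_def)
  next
    case False
    then have "convergent (\<lambda>n. f (r n) v)" using that r(2) by simp
    then show ?thesis using q(1) LIMSEQ_subseq_LIMSEQ[of "\<lambda>n. f (r n) v" _ q]
      by (auto simp: convergent_def o_def)
  qed
  then show ?case using strict_mono_o[OF r(1) q(1)] by (intro exI[of _ "r \<circ> q"]) (auto simp: o_def)
qed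

text \<open>Closedness of the form is expressed as completeness of \<open>V\<close> for the form
  norm of \<open>a + ip\<close>; this makes Riesz representation available on
  \<open>V\<close>.\<close>

locale closed_form =
  L: semi_hilbert L ip + A: semi_inner V a + Q: semi_hilbert V "\<lambda>u v. a u v + ip u v"
  for L :: "('a \<Rightarrow> complex) set" and ip :: "('a \<Rightarrow> complex) \<Rightarrow> ('a \<Rightarrow> complex) \<Rightarrow> complex"
    and V :: "('a \<Rightarrow> complex) set" and a :: "('a \<Rightarrow> complex) \<Rightarrow> ('a \<Rightarrow> complex) \<Rightarrow> complex" +
  assumes sub: "V \<subseteq> L"
begin

lemma V_L: "u \<in> V \<Longrightarrow> u \<in> L"
  using sub by blast

lemma Q_sq: "Q.sq u = A.sq u + L.sq u"
  by (simp add: A.sq_def L.sq_def Q.sq_def)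

lemma L_le_Q: "u \<in> V \<Longrightarrow> L.sq u \<le> Q.sq u"
  using A.sq_nonneg by (simp add: Q_sq)

lemma A_le_Q: "u \<in> V \<Longrightarrow> A.sq u \<le> Q.sq u"
  using L.sq_nonneg V_L by (simp add: Q_sq)

lemma Q_tendsto:
  assumes "\<And>n. s n \<in> V" "u \<in> V" "(\<lambda>n. Q.sq (\<lambda>x. s n x - u x)) \<longlonglongrightarrow> 0"
  shows "(\<lambda>n. A.sq (\<lambda>x. s n x - u x)) \<longlonglongrightarrow> 0" "(\<lambda>n. L.sq (\<lambda>x. s n x - u x)) \<longlonglongrightarrow> 0"
proof -
  have d: "(\<lambda>x. s n x - u x) \<in> V" for n by (rule A.diff_mem[OF assms(1,2)])
  show "(\<lambda>n. A.sq (\<lambda>x. s n x - u x)) \<longlonglongrightarrow> 0"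
    by (rule tendsto_sandwich[OF _ _ tendsto_const assms(3)]) (simp_all add: A.sq_nonneg[OF d] A_le_Q[OF d])
  show "(\<lambda>n. L.sq (\<lambda>x. s n x - u x)) \<longlonglongrightarrow> 0"
    by (rule tendsto_sandwich[OF _ _ tendsto_const assms(3)]) (simp_all add: L.sq_nonneg[OF V_L[OF d]] L_le_Q[OF d])
qed

definition op :: "(('a \<Rightarrow> complex) \<times> ('a \<Rightarrow> complex)) set" where
  "op = {(u, f). u \<in> V \<and> f \<in> L \<and> (\<forall>v\<in>V. a u v = ip f v)}"

text \<open>The counterpart of \<open>resolvent_set\<close>: almost everywhere equality becomes a
  vanishing seminorm and the norm bound is squared, so no measure theory enters the abstract
  part.\<close>

definition resolvent :: "complex \<Rightarrow> bool" where
  "resolvent z \<longleftrightarrow>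
     (\<forall>f\<in>L. \<exists>(u, g)\<in>op. L.sq (\<lambda>x. (g x - z * u x) - f x) = 0) \<and>
     (\<exists>C. \<forall>(u, g)\<in>op. L.sq u \<le> C * L.sq (\<lambda>x. g x - z * u x))"

definition eigvec :: "real \<Rightarrow> ('a \<Rightarrow> complex) \<Rightarrow> bool" where
  "eigvec r u \<longleftrightarrow> u \<in> V \<and> (\<forall>v\<in>V. a u v = complex_of_real r * ip u v)"

lemma op_shift_mem: "(u, g) \<in> op \<Longrightarrow> (\<lambda>x. g x - z * u x) \<in> L"
  using L.comb_mem[of g u "-z"] V_L by (auto simp: op_def)

lemma op_shift_ip:
  assumes "(u, g) \<in> op" "v \<in> V"
  shows "ip (\<lambda>x. g x - z * u x) v = a u v - z * ip u v"
  using L.ip_comb[of g u v "-z"] assms V_L by (auto simp: op_def)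

lemma eigvec_sq: "eigvec r u \<Longrightarrow> A.sq u = r * L.sq u"
  by (auto simp: eigvec_def A.sq_def L.sq_def)

lemma eigvec_ip_sq: "eigvec r u \<Longrightarrow> v \<in> V \<Longrightarrow> ip u v = 0 \<Longrightarrow> a u v = 0"
  by (simp add: eigvec_def)

lemma eigvec_orthogonal:
  assumes "eigvec r u" "eigvec s v" "r \<noteq> s"
  shows "ip u v = 0"
proof -
  have uv: "u \<in> V" "v \<in> V" using assms by (auto simp: eigvec_def)
  have "complex_of_real r * ip u v = a u v" using assms uv by (auto simp: eigvec_def)
  also have "\<dots> = cnj (a v u)" using A.ip_cnj[OF uv(2,1)] .
  also have "\<dots> = complex_of_real s * cnj (ip v u)" using assms uv by (auto simp: eigvec_def)
  also have "cnj (ip v u) = ip u v" using L.ip_cnj[of v u] uv V_L by simp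
  finally show ?thesis using assms(3) by simp
qed

lemma eigvec_comb:
  assumes "eigvec r u" "eigvec r v"
  shows "eigvec r (\<lambda>x. u x + c * v x)"
  using assms A.comb_mem A.ip_comb[of u v _ c] L.ip_comb[of u v _ c] V_L
  by (auto simp: eigvec_def algebra_simps)

lemma eigvec_scale:
  assumes "eigvec r v"
  shows "eigvec r (\<lambda>x. c * v x)"
  using assms A.scale_mem A.ip_scale[of v _ c] L.ip_scale[of v _ c] V_L
  by (auto simp: eigvec_def algebra_simps)

lemma eigvec_sum:
  assumes "\<And>w. w \<in> B \<Longrightarrow> eigvec r w"
  shows "eigvec r (\<lambda>x. \<Sum>w\<in>B. c w * w x)"
  using assms
proof (induction B rule: infinite_finite_induct)
  case (insert w B)
  then show ?case using eigvec_comb[of r "\<lambda>x. \<Sum>w\<in>B. c w * w x" w "c w"] by (simp add: add.commute)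
qed (auto simp: eigvec_def A.zero_mem A.ip_zero L.ip_zero V_L)

subsection \<open>The resolvent at \<open>-1\<close>\<close>

text \<open>Pairing with \<open>f\<close> is a bounded functional for the form norm, which dominates
  the norm of \<open>L\<close>; Riesz then solves (A + 1) u = f weakly.\<close>

lemma R_ex:
  assumes f: "f \<in> L"
  shows "\<exists>u. u \<in> V \<and> (\<forall>v\<in>V. a u v + ip u v = ip f v)"
proof -
  have "\<exists>u\<in>V. \<forall>v\<in>V. ip v f = a v u + ip v u"
  proof (rule Q.riesz)
    show "ip (\<lambda>x. u x + c * v x) f = ip u f + c * ip v f" if "u \<in> V" "v \<in> V" for u v c
      using L.ip_comb that V_L f by blast
    show "(cmod (ip v f))\<^sup>2 \<le> L.sq f * Q.sq v" if "v \<in> V" for v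
      using L.cauchy_schwarz[OF f V_L[OF that]] mult_left_mono[OF L_le_Q[OF that] L.sq_nonneg[OF f]]
      by linarith
  qed
  then obtain u where u: "u \<in> V" "\<And>v. v \<in> V \<Longrightarrow> ip v f = a v u + ip v u" by blast
  have "a u v + ip u v = ip f v" if v: "v \<in> V" for v
    using u(2)[OF v] A.ip_cnj[OF v u(1)] L.ip_cnj[OF V_L[OF v] V_L[OF u(1)]] L.ip_cnj[OF V_L[OF v] f] by simp
  then show ?thesis using u by blast
qed

text \<open>A choice among representatives, hence linear only up to null vectors. This is why
  \<open>R_comb\<close> speaks about pairings and is derived from the symmetry
  \<open>R_sym\<close>.\<close>

definition R :: "('a \<Rightarrow> complex) \<Rightarrow> 'a \<Rightarrow> complex" where
  "R f = (SOME u. u \<in> V \<and> (\<forall>v\<in>V. a u v + ip u v = ip f v))"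

lemma R_mem: "f \<in> L \<Longrightarrow> R f \<in> V"
  using someI_ex[OF R_ex] unfolding R_def by blast

lemma R_eq: "f \<in> L \<Longrightarrow> v \<in> V \<Longrightarrow> a (R f) v + ip (R f) v = ip f v"
  using someI_ex[OF R_ex] unfolding R_def by blast

lemma R_mem_L: "f \<in> L \<Longrightarrow> R f \<in> L"
  using R_mem V_L by blast

lemma R_op:
  assumes f: "f \<in> L"
  shows "(R f, \<lambda>x. f x - R f x) \<in> op"
proof -
  have "a (R f) v = ip (\<lambda>x. f x - R f x) v" if v: "v \<in> V" for v
    unfolding L.ip_diff[OF f R_mem_L[OF f] V_L[OF v]] using R_eq[OF f v] by (metis add_diff_cancel_right')
  then show ?thesis using R_mem[OF f] L.diff_mem[OF f R_mem_L[OF f]] by (simp add: op_def)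
qed

lemma R_sym:
  assumes "f \<in> L" "g \<in> L"
  shows "ip (R f) g = ip f (R g)"
proof -
  have "ip f (R g) = a (R f) (R g) + ip (R f) (R g)" using R_eq R_mem assms by simp
  also have "\<dots> = cnj (a (R g) (R f) + ip (R g) (R f))"
    using A.ip_cnj[of "R g" "R f"] L.ip_cnj[of "R g" "R f"] R_mem R_mem_L assms by simp
  also have "\<dots> = cnj (ip g (R f))" using R_eq R_mem assms by simp
  also have "\<dots> = ip (R f) g" using L.ip_cnj[of g "R f"] R_mem_L assms by simp
  finally show ?thesis ..
qed

lemma R_comb:
  assumes "f \<in> L" "g \<in> L" "k \<in> L"
  shows "ip (R (\<lambda>x. f x + c * g x)) k = ip (R f) k + c * ip (R g) k"
  using assms by (simp add: R_sym L.comb_mem L.ip_comb R_mem_L)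

text \<open>Testing the equation for \<open>R f\<close> with \<open>R f\<close> itself bounds its
  form norm, and with it \<open>L.sq (R f)\<close>, by \<open>ip f (R f)\<close>.\<close>

lemma R_bound:
  assumes f: "f \<in> L"
  shows "L.sq (R f) \<le> L.sq f"
proof -
  have "L.sq (R f) \<le> Q.sq (R f)" using L_le_Q R_mem f by blast
  also have "\<dots> = Re (ip f (R f))" using R_eq[OF f R_mem[OF f]] by (simp add: Q.sq_def)
  also have "\<dots> \<le> cmod (ip f (R f))" by (rule complex_Re_le_cmod)
  also have "\<dots> \<le> sqrt (L.sq f) * sqrt (L.sq (R f))" by (rule L.cauchy_schwarz_sqrt[OF f R_mem_L[OF f]])
  finally have "sqrt (L.sq (R f)) * sqrt (L.sq (R f)) \<le> sqrt (L.sq f) * sqrt (L.sq (R f))"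
    using L.sq_nonneg[OF R_mem_L[OF f]] by simp
  then show ?thesis
    using L.sq_nonneg[OF f] L.sq_nonneg[OF R_mem_L[OF f]]
    by (metis mult_right_le_imp_le real_sqrt_gt_0_iff real_sqrt_le_iff less_eq_real_def)
qed

text \<open>With \<open>R = (A + 1)\<^sup>-\<^sup>1\<close>, solving \<open>(A - z) u = f\<close> amounts to \<open>h - (1 + z) R h = f\<close>, \<open>u = R h\<close>.
  The adjoint \<open>S = 1 - (1 + cnj z) R\<close> is bounded below, so \<open>ip (S h) (S k)\<close> is an equivalent inner
  product, and if \<open>k\<close> represents \<open>f\<close> in it then \<open>h = S k\<close> is the solution.\<close>

theorem resolventI:
  assumes c: "c > 0"
    and lower: "\<And>u g. (u, g) \<in> op \<Longrightarrow> c * L.sq u \<le> L.sq (\<lambda>x. g x - z * u x)"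
    and lower': "\<And>u g. (u, g) \<in> op \<Longrightarrow> c * L.sq u \<le> L.sq (\<lambda>x. g x - cnj z * u x)"
  shows "resolvent z"
proof -
  define \<zeta> where "\<zeta> = 1 + cnj z"
  define S where "S h = (\<lambda>x. h x - \<zeta> * R h x)" for h
  have S_mem: "S h \<in> L" if "h \<in> L" for h
    using L.comb_mem[OF that R_mem_L[OF that], of "-\<zeta>"] by (simp add: S_def)
  have S_ip: "ip (S h) k = ip h k - \<zeta> * ip (R h) k" if "h \<in> L" "k \<in> L" for h k
    using L.ip_comb[OF that(1) R_mem_L[OF that(1)] that(2), of "-\<zeta>"] by (simp add: S_def)
  have S_comb: "ip (S (\<lambda>x. f x + b * g x)) k = ip (S f) k + b * ip (S g) k"
    if "f \<in> L" "g \<in> L" "k \<in> L" for f g k b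
    using that by (simp add: S_ip L.comb_mem R_comb L.ip_comb algebra_simps)
  define ipS where "ipS h k = ip (S h) (S k)" for h k
  interpret T: semi_inner L ipS
  proof
    show "ipS (\<lambda>x. u x + c * v x) w = ipS u w + c * ipS v w" if "u \<in> L" "v \<in> L" "w \<in> L" for u v w c
      unfolding ipS_def by (rule S_comb) (use that S_mem in auto)
    show "ipS v u = cnj (ipS u v)" if "u \<in> L" "v \<in> L" for u v
      unfolding ipS_def using L.ip_cnj[of "S u" "S v"] that S_mem by auto
  qed (auto simp: L.zero_mem L.comb_mem ipS_def L.ip_nonneg S_mem)
  have T_sq: "T.sq h = L.sq (S h)" for h by (simp add: T.sq_def L.sq_def ipS_def)
  define K where "K = 2 + 2 * (cmod \<zeta>)\<^sup>2 / c"
  have K: "K > 0" unfolding K_def using c by (simp add: add_pos_nonneg)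
  \<comment> \<open>\<open>lower'\<close> applied to the pair \<open>(R h, h - R h)\<close> bounds
    \<open>R h\<close> by \<open>S h\<close>, and h = S h + \<zeta> R h then bounds
    \<open>h\<close>; \<open>K\<close> records the constant.\<close>
  have low: "L.sq h \<le> K * L.sq (S h)" if h: "h \<in> L" for h
  proof -
    have "c * L.sq (R h) \<le> L.sq (\<lambda>x. (h x - R h x) - cnj z * R h x)"
      by (rule lower'[OF R_op[OF h]])
    also have "(\<lambda>x. (h x - R h x) - cnj z * R h x) = S h" by (auto simp: S_def \<zeta>_def algebra_simps)
    finally have 1: "L.sq (R h) \<le> L.sq (S h) / c" using c by (simp add: field_simps)
    have "L.sq h = L.sq (\<lambda>x. S h x + \<zeta> * R h x)" by (simp add: S_def)
    also have "\<dots> \<le> 2 * L.sq (S h) + 2 * (cmod \<zeta>)\<^sup>2 * L.sq (R h)"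
      by (rule L.sq_add_le) (auto simp: h S_mem R_mem_L)
    also have "\<dots> \<le> 2 * L.sq (S h) + 2 * (cmod \<zeta>)\<^sup>2 * (L.sq (S h) / c)"
      using 1 by (intro add_left_mono mult_left_mono) auto
    finally show ?thesis by (simp add: K_def algebra_simps)
  qed
  have up: "T.sq h \<le> (2 + 2 * (cmod \<zeta>)\<^sup>2) * L.sq h" if h: "h \<in> L" for h
  proof -
    have "T.sq h \<le> 2 * L.sq h + 2 * (cmod (-\<zeta>))\<^sup>2 * L.sq (R h)"
      using L.sq_add_le[OF h R_mem_L[OF h], of "-\<zeta>"] unfolding T_sq by (simp add: S_def)
    also have "\<dots> \<le> 2 * L.sq h + 2 * (cmod (-\<zeta>))\<^sup>2 * L.sq h"
      using R_bound[OF h] by (intro add_left_mono mult_left_mono) auto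
    finally show ?thesis by (simp add: algebra_simps)
  qed
  interpret T: semi_hilbert L ipS
  proof
    fix s :: "nat \<Rightarrow> 'a \<Rightarrow> complex"
    assume s: "\<And>n. s n \<in> L"
      and cau: "\<And>e. e > 0 \<Longrightarrow> \<exists>N. \<forall>m\<ge>N. \<forall>n\<ge>N. T.sq (\<lambda>x. s m x - s n x) < e"
    have "\<exists>N. \<forall>m\<ge>N. \<forall>n\<ge>N. L.sq (\<lambda>x. s m x - s n x) < e" if "e > 0" for e
    proof -
      have "e / K > 0" using that K by simp
      from cau[OF this] obtain N where N: "\<And>m n. m \<ge> N \<Longrightarrow> n \<ge> N \<Longrightarrow> T.sq (\<lambda>x. s m x - s n x) < e / K"
        by blast
      have "L.sq (\<lambda>x. s m x - s n x) < e" if "m \<ge> N" "n \<ge> N" for m n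
        using N[OF that] low[OF L.diff_mem[OF s[of m] s[of n]]] K
        unfolding T_sq by (simp add: field_simps)
      then show ?thesis by blast
    qed
    from L.complete[OF s this] obtain u where u: "u \<in> L" "(\<lambda>n. L.sq (\<lambda>x. s n x - u x)) \<longlonglongrightarrow> 0" by blast
    have "(\<lambda>n. T.sq (\<lambda>x. s n x - u x)) \<longlonglongrightarrow> 0"
    proof (rule tendsto_sandwich[of "\<lambda>_. 0"])
      show "(\<lambda>n. (2 + 2 * (cmod \<zeta>)\<^sup>2) * L.sq (\<lambda>x. s n x - u x)) \<longlonglongrightarrow> 0"
        using tendsto_mult_right_zero[OF u(2)] by simp
      show "\<forall>\<^sub>F n in sequentially. T.sq (\<lambda>x. s n x - u x) \<le> (2 + 2 * (cmod \<zeta>)\<^sup>2) * L.sq (\<lambda>x. s n x - u x)"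
        using up[OF L.diff_mem[OF s u(1)]] by simp
      show "\<forall>\<^sub>F n in sequentially. 0 \<le> T.sq (\<lambda>x. s n x - u x)"
        using T.sq_nonneg[OF L.diff_mem[OF s u(1)]] by simp
    qed simp
    then show "\<exists>u\<in>L. (\<lambda>n. T.sq (\<lambda>x. s n x - u x)) \<longlonglongrightarrow> 0" using u by blast
  qed
  have surj: "\<exists>(u, g)\<in>op. L.sq (\<lambda>x. (g x - z * u x) - f x) = 0" if f: "f \<in> L" for f
  proof -
    have "\<exists>k\<in>L. \<forall>v\<in>L. ip v f = ipS v k"
    proof (rule T.riesz)
      show "ip (\<lambda>x. u x + c * v x) f = ip u f + c * ip v f" if "u \<in> L" "v \<in> L" for u v c
        using L.ip_comb that f by blast
      show "(cmod (ip v f))\<^sup>2 \<le> L.sq f * K * T.sq v" if "v \<in> L" for v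
        using L.cauchy_schwarz[OF f that] mult_left_mono[OF low[OF that] L.sq_nonneg[OF f]]
        unfolding T_sq by (simp add: mult.assoc)
    qed
    then obtain k where k: "k \<in> L" "\<And>v. v \<in> L \<Longrightarrow> ip v f = ip (S v) (S k)" unfolding ipS_def by blast
    define h where "h = S k"
    have h: "h \<in> L" unfolding h_def using S_mem k(1) .
    \<comment> \<open>The residual of the candidate \<open>R h\<close>. Moving \<open>R\<close>
      across in \<open>ip d d\<close> produces the adjoint \<open>S\<close> acting on
      \<open>d\<close>, and \<open>ip (S d) h = ip d f\<close> by the choice of \<open>k\<close>, so
      the residual is null.\<close>
    define d where "d = (\<lambda>x. ((h x - R h x) - z * R h x) - f x)"
    have Th: "(\<lambda>x. h x + (- (1 + z)) * R h x) \<in> L" by (rule L.comb_mem[OF h R_mem_L[OF h]])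
    have deq: "d = (\<lambda>x. (h x + (- (1 + z)) * R h x) - f x)" by (auto simp: d_def algebra_simps)
    have d: "d \<in> L" unfolding deq by (rule L.diff_mem[OF Th f])
    have "ip d d = ip d (\<lambda>x. h x + (- (1 + z)) * R h x) - ip d f"
      using L.ip_diff_right[OF Th f d] unfolding deq[symmetric] .
    also have "ip d (\<lambda>x. h x + (- (1 + z)) * R h x) = ip d h - \<zeta> * ip d (R h)"
      unfolding L.ip_comb_right[OF h R_mem_L[OF h] d] by (simp add: \<zeta>_def algebra_simps)
    also have "ip d (R h) = ip (R d) h" using R_sym[OF d h] by simp
    also have "ip d h - \<zeta> * ip (R d) h = ip (S d) h" using S_ip[OF d h] by simp
    also have "ip (S d) h = ip d f" using k(2)[OF d] by (simp add: h_def)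
    finally have "L.sq d = 0" by (simp add: L.sq_def)
    then show ?thesis
      using R_op[OF h] unfolding d_def by (intro bexI[of _ "(R h, \<lambda>x. h x - R h x)"]) auto
  qed
  have "L.sq u \<le> (1 / c) * L.sq (\<lambda>x. g x - z * u x)" if "(u, g) \<in> op" for u g
    using lower[OF that] c by (simp add: field_simps)
  then show ?thesis unfolding resolvent_def using surj by blast
qed

text \<open>The form is real on the diagonal, so pairing g - z u with \<open>u\<close> leaves
  \<open>- (Im z * L.sq u)\<close> as imaginary part; Cauchy-Schwarz does the rest.\<close>

lemma op_shift_lower_nonreal:
  assumes "(u, g) \<in> op"
  shows "(Im z)\<^sup>2 * L.sq u \<le> L.sq (\<lambda>x. g x - z * u x)"
proof (cases "L.sq u = 0")
  case False
  have u: "u \<in> V" "u \<in> L" using assms V_L by (auto simp: op_def)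
  then have pos: "L.sq u > 0" using False L.sq_nonneg by (simp add: less_le)
  have "ip (\<lambda>x. g x - z * u x) u = complex_of_real (A.sq u) - z * complex_of_real (L.sq u)"
    using op_shift_ip[OF assms u(1)] A.ip_self[OF u(1)] L.ip_self[OF u(2)] by simp
  then have "Im (ip (\<lambda>x. g x - z * u x) u) = - (Im z * L.sq u)" by simp
  then have "(Im z * L.sq u)\<^sup>2 = (Im (ip (\<lambda>x. g x - z * u x) u))\<^sup>2" by simp
  also have "\<dots> \<le> (cmod (ip (\<lambda>x. g x - z * u x) u))\<^sup>2"
    using abs_Im_le_cmod[of "ip (\<lambda>x. g x - z * u x) u"] by (simp add: abs_le_square_iff[symmetric])
  also have "\<dots> \<le> L.sq u * L.sq (\<lambda>x. g x - z * u x)"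
    by (rule L.cauchy_schwarz[OF u(2) op_shift_mem[OF assms]])
  finally have "L.sq u * ((Im z)\<^sup>2 * L.sq u) \<le> L.sq u * L.sq (\<lambda>x. g x - z * u x)"
    by (simp add: power2_eq_square mult_ac)
  then show ?thesis using pos by simp
qed (use L.sq_nonneg[OF op_shift_mem[OF assms]] in simp)

lemma resolvent_nonreal: "Im z \<noteq> 0 \<Longrightarrow> resolvent z"
  by (rule resolventI[of "(Im z)\<^sup>2"]) (use op_shift_lower_nonreal[of _ _ z] op_shift_lower_nonreal[of _ _ "cnj z"] in auto)

text \<open>For real \<open>r\<close> the two lower bounds required by \<open>resolventI\<close>
  coincide, so failure of invertibility already produces approximate eigenvectors.\<close>

lemma not_resolvent_approx:
  assumes "\<not> resolvent (complex_of_real r)" "e > 0"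
  shows "\<exists>u g. (u, g) \<in> op \<and> L.sq u = 1 \<and> L.sq (\<lambda>x. g x - complex_of_real r * u x) < e"
proof -
  have "\<exists>u g. (u, g) \<in> op \<and> L.sq (\<lambda>x. g x - complex_of_real r * u x) < e * L.sq u"
    using resolventI[of e "complex_of_real r"] assms by (force simp: not_less)
  then obtain u g where ug: "(u, g) \<in> op" "L.sq (\<lambda>x. g x - complex_of_real r * u x) < e * L.sq u" by blast
  have u: "u \<in> V" "g \<in> L" using ug by (auto simp: op_def)
  have "0 < e * L.sq u" using ug L.sq_nonneg[OF op_shift_mem[OF ug(1)], of "complex_of_real r"] by simp
  then have pos: "L.sq u > 0" using assms(2) by (simp add: zero_less_mult_iff)
  then obtain c where c: "L.sq (\<lambda>x. c * u x) = 1" "(cmod c)\<^sup>2 = 1 / L.sq u"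
    using L.normalize[OF V_L[OF u(1)]] by auto
  have "(\<lambda>x. c * u x, \<lambda>x. c * g x) \<in> op"
    using ug u A.scale_mem L.scale_mem A.ip_scale[OF u(1), of _ c] L.ip_scale[OF u(2), of _ c] V_L
    by (auto simp: op_def)
  moreover have "L.sq (\<lambda>x. c * g x - complex_of_real r * (c * u x)) < e"
    using L.sq_scale[OF op_shift_mem[OF ug(1), of "complex_of_real r"], of c] c(2) pos ug(2)
    by (simp add: algebra_simps divide_less_eq)
  ultimately show ?thesis using c(1) by blast
qed

text \<open>A Weyl criterion in the dual of the form norm: \<open>u\<close> is only taken from the
  form domain. If the resolvent existed, the residual of \<open>u\<close> could be tested with the
  solution \<open>v\<close> of (A - r) v = u, where it equals \<open>L.sq u\<close>, although
  \<open>Q.sq v\<close> is bounded by a fixed multiple of \<open>L.sq u\<close>.\<close>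

lemma not_resolvent_weyl:
  assumes ex: "\<And>e. e > 0 \<Longrightarrow> \<exists>u\<in>V. L.sq u > 0 \<and>
      (\<forall>v\<in>V. (cmod (a u v - complex_of_real r * ip u v))\<^sup>2 \<le> e * L.sq u * Q.sq v)"
  shows "\<not> resolvent (complex_of_real r)"
proof
  assume res: "resolvent (complex_of_real r)"
  then obtain C where C: "\<And>u g. (u, g) \<in> op \<Longrightarrow> L.sq u \<le> C * L.sq (\<lambda>x. g x - complex_of_real r * u x)"
    unfolding resolvent_def by blast
  \<comment> \<open>The constant in the bound of \<open>Q.sq v\<close> by \<open>L.sq u\<close>
    below; \<open>e = 1 / (2 * D)\<close> then leaves a square bounded by half of itself.\<close>
  define D where "D = \<bar>C\<bar> + (1 + \<bar>C\<bar> + \<bar>r\<bar> * \<bar>C\<bar>)"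
  have D: "D > 0" unfolding D_def by (simp add: add_pos_nonneg add_nonneg_pos)
  define e where "e = 1 / (2 * D)"
  have e: "e > 0" using D by (simp add: e_def)
  obtain u where u: "u \<in> V" "L.sq u > 0"
    "\<And>v. v \<in> V \<Longrightarrow> (cmod (a u v - complex_of_real r * ip u v))\<^sup>2 \<le> e * L.sq u * Q.sq v"
    using ex[OF e] by blast
  have uL: "u \<in> L" using u V_L by blast
  obtain v g where v: "(v, g) \<in> op" "L.sq (\<lambda>x. (g x - complex_of_real r * v x) - u x) = 0"
    using res uL unfolding resolvent_def by blast
  have vV: "v \<in> V" "v \<in> L" using v V_L by (auto simp: op_def)
  define h where "h = (\<lambda>x. g x - complex_of_real r * v x)"
  have h: "h \<in> L" unfolding h_def by (rule op_shift_mem[OF v(1)])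
  have hu0: "L.sq (\<lambda>x. h x - u x) = 0" using v(2) by (simp add: h_def)
  \<comment> \<open>\<open>h\<close> and \<open>u\<close> agree up to a null vector only, so they
    are exchanged inside inner products and seminorms.\<close>
  have hip: "ip h w = ip u w" if "w \<in> L" for w
    using L.cauchy_schwarz_sqrt[OF L.diff_mem[OF h uL] that] L.ip_diff[OF h uL that] hu0 by simp
  have hsq: "L.sq h = L.sq u"
    using hip[OF h] hip[OF uL] L.ip_cnj[OF h uL] by (simp add: L.sq_def)
  have nv: "L.sq v \<le> \<bar>C\<bar> * L.sq u"
    using C[OF v(1)] unfolding h_def[symmetric] hsq
    using abs_ge_self[of C] u(2) by (meson mult_right_mono less_imp_le order_trans)
  have "a v v - complex_of_real r * ip v v = ip h v" unfolding h_def using op_shift_ip[OF v(1) vV(1)] by simp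
  then have "A.sq v = r * L.sq v + Re (ip h v)"
    by (metis A.sq_def L.sq_def L.ip_self[OF vV(2)] A.ip_self[OF vV(1)] Re_complex_of_real
        add.commute diff_add_cancel minus_complex.simps(1) of_real_mult)
  also have "Re (ip h v) \<le> sqrt (L.sq u) * sqrt (L.sq v)"
    using L.cauchy_schwarz_sqrt[OF h vV(2)] complex_Re_le_cmod[of "ip h v"] by (simp add: hsq)
  also have "sqrt (L.sq u) * sqrt (L.sq v) \<le> L.sq u + L.sq v"
  proof -
    have "0 \<le> (sqrt (L.sq u) - sqrt (L.sq v))\<^sup>2" by simp
    then have "2 * (sqrt (L.sq u) * sqrt (L.sq v)) \<le> L.sq u + L.sq v"
      using L.sq_nonneg[OF uL] L.sq_nonneg[OF vV(2)] by (simp add: power2_diff)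
    moreover have "0 \<le> sqrt (L.sq u) * sqrt (L.sq v)" using L.sq_nonneg uL vV by simp
    ultimately show ?thesis by linarith
  qed
  finally have "A.sq v \<le> \<bar>r\<bar> * L.sq v + L.sq u + L.sq v"
    using mult_right_mono[OF abs_ge_self[of r] L.sq_nonneg[OF vV(2)]] by linarith
  then have "Q.sq v \<le> \<bar>r\<bar> * L.sq v + L.sq u + L.sq v + L.sq v" by (simp add: Q_sq)
  also have "\<dots> \<le> \<bar>r\<bar> * (\<bar>C\<bar> * L.sq u) + L.sq u + \<bar>C\<bar> * L.sq u + \<bar>C\<bar> * L.sq u"
    using nv by (intro add_mono mult_left_mono) auto
  also have "\<dots> = D * L.sq u" by (simp add: D_def algebra_simps)
  finally have Qv: "Q.sq v \<le> D * L.sq u" .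
  have "cnj (a u v - complex_of_real r * ip u v) = a v v * 0 + (a v u - complex_of_real r * ip v u)"
    using A.ip_cnj[OF u(1) vV(1)] L.ip_cnj[OF uL vV(2)] by simp
  also have "\<dots> = ip h u" unfolding h_def using op_shift_ip[OF v(1) u(1)] by simp
  also have "\<dots> = complex_of_real (L.sq u)" using hip[OF uL] L.ip_self[OF uL] by simp
  finally have "cmod (a u v - complex_of_real r * ip u v) = L.sq u"
    by (metis complex_mod_cnj norm_of_real abs_of_pos u(2))
  then have "(L.sq u)\<^sup>2 \<le> e * L.sq u * Q.sq v" using u(3)[OF vV(1)] by simp
  also have "\<dots> \<le> e * L.sq u * (D * L.sq u)" using Qv e u(2) by (intro mult_left_mono) auto
  also have "\<dots> = (L.sq u)\<^sup>2 / 2" using D by (simp add: e_def power2_eq_square)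
  finally show False using u(2) by simp
qed

subsection \<open>Coercivity up to finite rank\<close>

text \<open>A Garding inequality modulo finite rank: apart from finitely many inner products, the
  form minus \<open>r\<close> controls the full form norm. It encodes that \<open>r\<close> lies
  below the essential spectrum.\<close>

definition garding :: "real \<Rightarrow> bool" where
  "garding r \<longleftrightarrow> (\<exists>W c C. finite W \<and> W \<subseteq> L \<and> c > 0 \<and>
     (\<forall>u\<in>V. c * Q.sq u \<le> A.sq u - r * L.sq u + C * (\<Sum>w\<in>W. (cmod (ip u w))\<^sup>2)))"

text \<open>On a bounded sequence the finitely many pairings converge along a subsequence, so on
  differences the finite-rank term drops below any \<open>e\<close>.\<close>

lemma garding_subseq:
  assumes "garding r" and s: "\<And>n::nat. s n \<in> V" and K: "\<And>n. L.sq (s n) \<le> K"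
  shows "\<exists>(q :: nat \<Rightarrow> nat) c. strict_mono q \<and> c > 0 \<and>
    (\<forall>e>0. \<exists>N. \<forall>m\<ge>N. \<forall>n\<ge>N. c * Q.sq (\<lambda>x. s (q m) x - s (q n) x) \<le>
       A.sq (\<lambda>x. s (q m) x - s (q n) x) - r * L.sq (\<lambda>x. s (q m) x - s (q n) x) + e)"
proof -
  from assms(1) obtain W c C where W: "finite W" "W \<subseteq> L" "c > 0"
    and g: "\<And>u. u \<in> V \<Longrightarrow> c * Q.sq u \<le> A.sq u - r * L.sq u + C * (\<Sum>w\<in>W. (cmod (ip u w))\<^sup>2)"
    unfolding garding_def by blast
  have "cmod (ip (s n) w) \<le> sqrt K * sqrt (L.sq w)" if "w \<in> W" for n w
  proof -
    have "cmod (ip (s n) w) \<le> sqrt (L.sq (s n)) * sqrt (L.sq w)"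
      by (rule L.cauchy_schwarz_sqrt) (use s V_L W(2) that in auto)
    also have "\<dots> \<le> sqrt K * sqrt (L.sq w)"
      using K[of n] L.sq_nonneg[of w] W(2) that by (intro mult_right_mono) auto
    finally show ?thesis .
  qed
  from bounded_family_convergent_subseq[of W "\<lambda>n w. ip (s n) w" "\<lambda>w. sqrt K * sqrt (L.sq w)", OF W(1) this]
  obtain q :: "nat \<Rightarrow> nat" where
    q: "strict_mono q" "\<And>w. w \<in> W \<Longrightarrow> convergent (\<lambda>n. ip (s (q n)) w)" by blast
  have "\<exists>N. \<forall>m\<ge>N. \<forall>n\<ge>N. c * Q.sq (\<lambda>x. s (q m) x - s (q n) x) \<le>
       A.sq (\<lambda>x. s (q m) x - s (q n) x) - r * L.sq (\<lambda>x. s (q m) x - s (q n) x) + e" if e: "e > 0" for e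
  proof -
    \<comment> \<open>Chosen so that \<open>card W + 1\<close> terms of size \<delta>^2, times |C| +
      1, give \<open>e\<close>; the added ones exclude division by zero.\<close>
    define \<delta> where "\<delta> = sqrt (e / ((\<bar>C\<bar> + 1) * real (card W + 1)))"
    have \<delta>: "\<delta> > 0" unfolding \<delta>_def using e by simp
    have "\<exists>N. \<forall>m\<ge>N. \<forall>n\<ge>N. cmod (ip (s (q m)) w - ip (s (q n)) w) < \<delta>" if "w \<in> W" for w
      using CauchyD[OF convergent_Cauchy[OF q(2)[OF that]] \<delta>] .
    then have "\<forall>w\<in>W. \<exists>N. \<forall>m\<ge>N. \<forall>n\<ge>N. cmod (ip (s (q m)) w - ip (s (q n)) w) < \<delta>" by blast
    from bchoice[OF this] obtain N
      where N: "\<forall>w\<in>W. \<forall>m\<ge>N w. \<forall>n\<ge>N w. cmod (ip (s (q m)) w - ip (s (q n)) w) < \<delta>" ..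
    \<comment> \<open>The sum of the thresholds \<open>N w\<close> is a common threshold, and it
      makes sense for empty \<open>W\<close> as well.\<close>
    have "c * Q.sq (\<lambda>x. s (q m) x - s (q n) x) \<le>
       A.sq (\<lambda>x. s (q m) x - s (q n) x) - r * L.sq (\<lambda>x. s (q m) x - s (q n) x) + e"
      if mn: "m \<ge> (\<Sum>w\<in>W. N w)" "n \<ge> (\<Sum>w\<in>W. N w)" for m n
    proof -
      let ?d = "\<lambda>x. s (q m) x - s (q n) x"
      have "(\<Sum>w\<in>W. (cmod (ip ?d w))\<^sup>2) \<le> (\<Sum>w\<in>W. \<delta>\<^sup>2)"
      proof (rule sum_mono)
        fix w assume w: "w \<in> W"
        have "N w \<le> (\<Sum>w\<in>W. N w)" using W(1) w by (simp add: member_le_sum)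
        then have "cmod (ip (s (q m)) w - ip (s (q n)) w) < \<delta>" using N w mn by (meson order_trans)
        moreover have "ip ?d w = ip (s (q m)) w - ip (s (q n)) w"
          using L.ip_diff[of "s (q m)" "s (q n)" w] s V_L W(2) w by blast
        ultimately show "(cmod (ip ?d w))\<^sup>2 \<le> \<delta>\<^sup>2" by (simp add: power_mono)
      qed
      also have "\<dots> \<le> real (card W + 1) * \<delta>\<^sup>2" by (simp add: mult_right_mono)
      also have "\<dots> = e / (\<bar>C\<bar> + 1)" unfolding \<delta>_def using e by simp
      finally have 1: "(\<Sum>w\<in>W. (cmod (ip ?d w))\<^sup>2) \<le> e / (\<bar>C\<bar> + 1)" .
      have "C * (\<Sum>w\<in>W. (cmod (ip ?d w))\<^sup>2) \<le> \<bar>C\<bar> * (e / (\<bar>C\<bar> + 1))"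
        by (rule mult_mono) (use 1 in \<open>auto intro: sum_nonneg\<close>)
      also have "\<dots> \<le> e" using e by (simp add: field_simps)
      finally show ?thesis using g[OF A.diff_mem[OF s[of "q m"] s[of "q n"]]] by linarith
    qed
    then show ?thesis by blast
  qed
  then show ?thesis using q(1) W(3) by blast
qed

text \<open>The residuals are small functionals on the form domain and differences of the sequence
  are bounded there, so the form minus \<open>r\<close> is small on differences. Coercivity makes
  the subsequence Cauchy in the form norm, and the residuals pass to the limit.\<close>

theorem approx_eigvec:
  assumes gar: "garding r" and s: "\<And>n::nat. s n \<in> V" "\<And>n. L.sq (s n) = 1"
    and K: "\<And>n. Q.sq (s n) \<le> K"
    and app: "\<And>n v. v \<in> V \<Longrightarrow> (cmod (a (s n) v - complex_of_real r * ip (s n) v))\<^sup>2 \<le> e n * Q.sq v"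
    and e: "e \<longlonglongrightarrow> 0"
  shows "\<exists>u. eigvec r u \<and> L.sq u = 1"
proof -
  have K1: "L.sq (s n) \<le> 1" for n using s(2)[of n] by simp
  obtain q :: "nat \<Rightarrow> nat" and c where q: "strict_mono q" "c > 0" and
    sub: "\<And>\<epsilon>. \<epsilon> > 0 \<Longrightarrow> \<exists>N. \<forall>m\<ge>N. \<forall>n\<ge>N. c * Q.sq (\<lambda>x. s (q m) x - s (q n) x) \<le>
       A.sq (\<lambda>x. s (q m) x - s (q n) x) - r * L.sq (\<lambda>x. s (q m) x - s (q n) x) + \<epsilon>"
    using garding_subseq[where s = s, OF gar s(1) K1] by blast
  define b where "b u v = a u v - complex_of_real r * ip u v" for u v
  have eq: "(\<lambda>n. e (q n)) \<longlonglongrightarrow> 0" using LIMSEQ_subseq_LIMSEQ[OF e q(1)] by (simp add: o_def)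
  have e_nn: "0 \<le> e n" for n
  proof -
    have "0 \<le> e n * Q.sq (s n)" using app[OF s(1), of n n] by (meson order_trans zero_le_power2)
    moreover have "Q.sq (s n) > 0" using L_le_Q[OF s(1)[of n]] s(2)[of n] by simp
    ultimately show ?thesis by (simp add: zero_le_mult_iff)
  qed
  have "\<exists>N. \<forall>m\<ge>N. \<forall>n\<ge>N. Q.sq (\<lambda>x. s (q m) x - s (q n) x) < \<epsilon>" if \<epsilon>: "\<epsilon> > 0" for \<epsilon>
  proof -
    \<comment> \<open>Two residuals and the slack of the coercivity estimate cost 3 \<eta>, which
      stays below c \<epsilon> = 4 \<eta>.\<close>
    define \<eta> where "\<eta> = c * \<epsilon> / 4"
    have \<eta>: "\<eta> > 0" using \<epsilon> q by (simp add: \<eta>_def)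
    obtain N1 where N1: "\<And>m n. m \<ge> N1 \<Longrightarrow> n \<ge> N1 \<Longrightarrow> c * Q.sq (\<lambda>x. s (q m) x - s (q n) x) \<le>
       A.sq (\<lambda>x. s (q m) x - s (q n) x) - r * L.sq (\<lambda>x. s (q m) x - s (q n) x) + \<eta>"
      using sub[OF \<eta>] by blast
    have "(\<lambda>n. sqrt (e (q n)) * sqrt (4 * K)) \<longlonglongrightarrow> sqrt 0 * sqrt (4 * K)"
      by (intro tendsto_intros eq)
    then have "(\<lambda>n. sqrt (e (q n)) * sqrt (4 * K)) \<longlonglongrightarrow> 0" by simp
    then have "\<forall>\<^sub>F n in sequentially. sqrt (e (q n)) * sqrt (4 * K) < \<eta>"
      using \<eta> by (simp add: order_tendstoD(2))
    then obtain N2 where N2: "\<And>n. n \<ge> N2 \<Longrightarrow> sqrt (e (q n)) * sqrt (4 * K) < \<eta>"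
      by (auto simp: eventually_sequentially)
    have "Q.sq (\<lambda>x. s (q m) x - s (q n) x) < \<epsilon>" if mn: "m \<ge> max N1 N2" "n \<ge> max N1 N2" for m n
    proof -
      define d where "d = (\<lambda>x. s (q m) x - s (q n) x)"
      have d: "d \<in> V" unfolding d_def by (rule A.diff_mem[OF s(1) s(1)])
      have Qd: "Q.sq d \<le> 4 * K"
        using Q.parallelogram[OF s(1)[of "q m"] s(1)[of "q n"]] K[of "q m"] K[of "q n"] by (simp add: d_def)
      have bd: "cmod (b (s (q k)) d) < \<eta>" if "k \<ge> N2" for k
      proof -
        have "(cmod (b (s (q k)) d))\<^sup>2 \<le> e (q k) * (4 * K)"
          using app[OF d, of "q k"] mult_left_mono[OF Qd e_nn[of "q k"]] unfolding b_def by linarith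
        then have "cmod (b (s (q k)) d) \<le> sqrt (e (q k)) * sqrt (4 * K)"
          by (metis real_le_rsqrt real_sqrt_mult)
        then show ?thesis using N2[OF that] by linarith
      qed
      have ad: "a d d = a (s (q m)) d - a (s (q n)) d"
        using A.ip_diff[OF s(1)[of "q m"] s(1)[of "q n"] d] unfolding d_def[symmetric] .
      have id: "ip d d = ip (s (q m)) d - ip (s (q n)) d"
        using L.ip_diff[OF V_L[OF s(1)[of "q m"]] V_L[OF s(1)[of "q n"]] V_L[OF d]]
        unfolding d_def[symmetric] .
      have "b d d = b (s (q m)) d - b (s (q n)) d"
        unfolding b_def ad id by (simp add: algebra_simps)
      then have "cmod (b d d) \<le> cmod (b (s (q m)) d) + cmod (b (s (q n)) d)"
        using norm_triangle_ineq4[of "b (s (q m)) d" "b (s (q n)) d"] by simp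
      also have "\<dots> < \<eta> + \<eta>" using bd[of m] bd[of n] mn by simp
      finally have "Re (b d d) < 2 * \<eta>" using complex_Re_le_cmod[of "b d d"] by simp
      moreover have "Re (b d d) = A.sq d - r * L.sq d" by (simp add: b_def A.sq_def L.sq_def)
      moreover have "c * Q.sq d \<le> A.sq d - r * L.sq d + \<eta>"
        using N1[of m n] mn unfolding d_def by simp
      moreover have "4 * \<eta> = c * \<epsilon>" "0 < c * \<epsilon>" using \<epsilon> q(2) by (simp_all add: \<eta>_def)
      ultimately have "c * Q.sq d < c * \<epsilon>" by linarith
      then show ?thesis using q(2) unfolding d_def by simp
    qed
    then show ?thesis by blast
  qed
  from Q.complete[OF s(1) this] obtain u where
    u: "u \<in> V" "(\<lambda>n. Q.sq (\<lambda>x. s (q n) x - u x)) \<longlonglongrightarrow> 0" by blast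
  have sL: "s (q n) \<in> L" for n using s V_L by blast
  have Au: "(\<lambda>n. A.sq (\<lambda>x. s (q n) x - u x)) \<longlonglongrightarrow> 0"
    and Lu: "(\<lambda>n. L.sq (\<lambda>x. s (q n) x - u x)) \<longlonglongrightarrow> 0"
    using Q_tendsto[of "\<lambda>n. s (q n)" u] s(1) u by auto
  have "(\<lambda>n. L.sq (s (q n))) \<longlonglongrightarrow> L.sq u" by (rule L.tendsto_sq[OF sL V_L[OF u(1)] Lu])
  then have "L.sq u = 1" unfolding s(2) using LIMSEQ_unique tendsto_const by blast
  moreover have "a u v = complex_of_real r * ip u v" if v: "v \<in> V" for v
  proof -
    have "(\<lambda>n. b (s (q n)) v) \<longlonglongrightarrow> b u v"
      unfolding b_def by (intro tendsto_intros A.tendsto_ip L.tendsto_ip sL V_L s u v Au Lu)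
    then have 1: "(\<lambda>n. (cmod (b (s (q n)) v))\<^sup>2) \<longlonglongrightarrow> (cmod (b u v))\<^sup>2" by (intro tendsto_intros)
    have 2: "(\<lambda>n. e (q n) * Q.sq v) \<longlonglongrightarrow> 0" using tendsto_mult_left_zero[OF eq] by simp
    have "(cmod (b u v))\<^sup>2 \<le> 0"
      by (rule LIMSEQ_le[OF 1 2]) (use app[OF v] in \<open>auto simp: b_def\<close>)
    then show ?thesis by (simp add: b_def)
  qed
  ultimately show ?thesis using u(1) by (auto simp: eigvec_def)
qed

text \<open>A residual that is small in \<open>L\<close> is small against the form norm too, so the
  vectors of \<open>not_resolvent_approx\<close> yield a genuine eigenvector.\<close>

lemma garding_not_resolvent_eigvec:
  assumes gar: "garding r" and nres: "\<not> resolvent (complex_of_real r)"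
  shows "\<exists>u. eigvec r u \<and> L.sq u = 1"
proof -
  have "\<exists>u g. (u, g) \<in> op \<and> L.sq u = 1 \<and> L.sq (\<lambda>x. g x - complex_of_real r * u x) < 1 / real (Suc n)" for n
    by (rule not_resolvent_approx[OF nres]) simp
  then obtain s g where sg: "\<And>n. (s n, g n) \<in> op" "\<And>n. L.sq (s n) = 1"
    "\<And>n. L.sq (\<lambda>x. g n x - complex_of_real r * s n x) < 1 / real (Suc n)" by metis
  have s: "s n \<in> V" for n using sg(1)[of n] by (auto simp: op_def)
  have est: "(cmod (a (s n) v - complex_of_real r * ip (s n) v))\<^sup>2 \<le> 1 / real (Suc n) * L.sq v" if v: "v \<in> V" for n v
  proof -
    have "(cmod (a (s n) v - complex_of_real r * ip (s n) v))\<^sup>2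
        = (cmod (ip (\<lambda>x. g n x - complex_of_real r * s n x) v))\<^sup>2"
      using op_shift_ip[OF sg(1) v] by simp
    also have "\<dots> \<le> L.sq v * L.sq (\<lambda>x. g n x - complex_of_real r * s n x)"
      by (rule L.cauchy_schwarz[OF V_L[OF v] op_shift_mem[OF sg(1)]])
    also have "\<dots> \<le> L.sq v * (1 / real (Suc n))"
      using sg(3)[of n] L.sq_nonneg[OF V_L[OF v]] by (intro mult_left_mono) auto
    finally show ?thesis by (simp add: mult.commute)
  qed
  show ?thesis
  proof (rule approx_eigvec[OF gar s sg(2)])
    \<comment> \<open>Testing the residual with \<open>s n\<close> itself bounds
      \<open>A.sq (s n)\<close> by r + 1; the unit \<open>L.sq\<close> adds 1.\<close>
    show "Q.sq (s n) \<le> \<bar>r\<bar> + 2" for n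
    proof -
      have "(cmod (a (s n) (s n) - complex_of_real r * ip (s n) (s n)))\<^sup>2 \<le> 1 / real (Suc n)"
        using est[OF s, of n n] sg(2)[of n] by simp
      also have "\<dots> \<le> 1\<^sup>2" by simp
      finally have "cmod (a (s n) (s n) - complex_of_real r * ip (s n) (s n)) \<le> 1"
        by (rule power2_le_imp_le) simp
      then have "Re (a (s n) (s n) - complex_of_real r * ip (s n) (s n)) \<le> 1"
        using complex_Re_le_cmod order_trans by blast
      then have "A.sq (s n) - r * L.sq (s n) \<le> 1" by (simp add: A.sq_def L.sq_def)
      then show ?thesis using sg(2)[of n] by (simp add: Q_sq)
    qed
    show "(cmod (a (s n) v - complex_of_real r * ip (s n) v))\<^sup>2 \<le> 1 / real (Suc n) * Q.sq v" if "v \<in> V" for n v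
      using est[OF that, of n] L_le_Q[OF that] by (smt (verit) mult_left_mono zero_le_divide_1_iff of_nat_0_le_iff)
    show "(\<lambda>n. 1 / real (Suc n)) \<longlonglongrightarrow> 0" by (rule LIMSEQ_Suc[OF lim_1_over_n])
  qed
qed

text \<open>The difference of two members has \<open>L.sq\<close> equal to 2 while the form minus
  \<open>r\<close> is nonpositive on it, so coercivity with slack \<open>c\<close> would give 2 c
  \<le> c.\<close>

lemma no_infinite_orthonormal:
  assumes gar: "garding r" and s: "\<And>n::nat. s n \<in> V" "\<And>n. L.sq (s n) = 1" "\<And>n. A.sq (s n) \<le> r"
    and orth: "\<And>m n. m \<noteq> n \<Longrightarrow> ip (s m) (s n) = 0" "\<And>m n. m \<noteq> n \<Longrightarrow> a (s m) (s n) = 0"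
  shows False
proof -
  have K1: "L.sq (s n) \<le> 1" for n using s(2)[of n] by simp
  obtain q :: "nat \<Rightarrow> nat" and c where q: "strict_mono q" "c > 0" and
    sub: "\<And>\<epsilon>. \<epsilon> > 0 \<Longrightarrow> \<exists>N. \<forall>m\<ge>N. \<forall>n\<ge>N. c * Q.sq (\<lambda>x. s (q m) x - s (q n) x) \<le>
       A.sq (\<lambda>x. s (q m) x - s (q n) x) - r * L.sq (\<lambda>x. s (q m) x - s (q n) x) + \<epsilon>"
    using garding_subseq[where s = s, OF gar s(1) K1] by blast
  obtain N where N: "\<And>m n. m \<ge> N \<Longrightarrow> n \<ge> N \<Longrightarrow> c * Q.sq (\<lambda>x. s (q m) x - s (q n) x) \<le>
       A.sq (\<lambda>x. s (q m) x - s (q n) x) - r * L.sq (\<lambda>x. s (q m) x - s (q n) x) + c"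
    using sub[OF q(2)] by blast
  define m n where "m = q N" and "n = q (Suc N)"
  have mn: "m \<noteq> n" unfolding m_def n_def using q(1) by (metis n_not_Suc_n strict_mono_eq)
  let ?d = "\<lambda>x. s m x - s n x"
  have 1: "L.sq ?d = 2"
    using L.sq_comb[OF V_L[OF s(1)[of m]] V_L[OF s(1)[of n]], of "-1"] orth(1)[of n m] mn s(2) by simp
  have 2: "A.sq ?d \<le> 2 * r"
    using A.sq_comb[OF s(1)[of m] s(1)[of n], of "-1"] orth(2)[of n m] mn s(3)[of m] s(3)[of n] by simp
  have "c * Q.sq ?d \<le> c" using N[of N "Suc N"] 1 2 unfolding m_def[symmetric] n_def[symmetric] by simp
  moreover have "Q.sq ?d \<ge> 2" using L_le_Q[OF A.diff_mem[OF s(1)[of m] s(1)[of n]]] 1 by simp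
  ultimately show False using q(2) by simp
qed

lemma eigvec_normalize:
  assumes "eigvec r u" "L.sq u \<noteq> 0"
  shows "\<exists>c. eigvec r (\<lambda>x. c * u x) \<and> L.sq (\<lambda>x. c * u x) = 1"
proof -
  have "u \<in> L" using assms V_L by (auto simp: eigvec_def)
  then show ?thesis using L.normalize[OF _ assms(2)] eigvec_scale[OF assms(1)] by metis
qed

text \<open>Infinitely many eigenvalues up to \<open>r\<close> would give eigenvectors orthonormal
  in \<open>L\<close> and orthogonal for the form, with energies at most \<open>r\<close>.\<close>

lemma finite_eigenvalues:
  assumes gar: "garding r"
  shows "finite {t. t \<le> r \<and> (\<exists>u. eigvec t u \<and> L.sq u \<noteq> 0)}"
proof (rule ccontr)
  assume "infinite {t. t \<le> r \<and> (\<exists>u. eigvec t u \<and> L.sq u \<noteq> 0)}"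
  then obtain t :: "nat \<Rightarrow> real" where t: "inj t" "range t \<subseteq> {t. t \<le> r \<and> (\<exists>u. eigvec t u \<and> L.sq u \<noteq> 0)}"
    using infinite_countable_subset by blast
  have "\<exists>u. eigvec (t n) u \<and> L.sq u = 1" for n
    using t(2) eigvec_normalize by blast
  then obtain s where s: "\<And>n. eigvec (t n) (s n)" "\<And>n. L.sq (s n) = 1" by metis
  have sV: "s n \<in> V" for n using s(1) by (auto simp: eigvec_def)
  have o: "ip (s m) (s n) = 0" if "m \<noteq> n" for m n
    by (rule eigvec_orthogonal[OF s(1) s(1)]) (use that t(1) in \<open>auto simp: inj_def\<close>)
  show False
  proof (rule no_infinite_orthonormal[OF gar sV s(2) _ o])
    show "A.sq (s n) \<le> r" for n using eigvec_sq[OF s(1)[of n]] s(2)[of n] t(2) by auto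
    show "a (s m) (s n) = 0" if "m \<noteq> n" for m n using eigvec_ip_sq[OF s(1) sV o[OF that]] .
  qed auto
qed

text \<open>If no finite family spans the eigenspace, Gram-Schmidt never stops and yields an
  infinite orthonormal sequence of eigenvectors.\<close>

lemma finite_dim_eigenspace:
  assumes gar: "garding r" and t: "t \<le> r"
  shows "\<exists>B. finite B \<and> (\<forall>w\<in>B. eigvec t w) \<and>
    (\<forall>u. eigvec t u \<longrightarrow> (\<exists>c. L.sq (\<lambda>x. u x - (\<Sum>w\<in>B. c w * w x)) = 0))"
proof (rule ccontr)
  assume neg: "\<not> ?thesis"
  define P where "P s n u \<longleftrightarrow> eigvec t u \<and> L.sq u = 1 \<and> (\<forall>m<n. ip (s m) u = 0)"
    for s :: "nat \<Rightarrow> 'a \<Rightarrow> complex" and n :: nat and u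
  have "\<exists>s. \<forall>n. P s n (s n)"
  proof (rule dependent_wellorder_choice)
    show "P f n u = P g n u" if "\<And>m. m < n \<Longrightarrow> f m = g m" for f g n u
      using that by (auto simp: P_def)
    fix n :: nat and s assume s: "\<And>m. m < n \<Longrightarrow> P s m (s m)"
    have orth: "ip (s i) (s j) = (if i = j then 1 else 0)" if "i < n" "j < n" for i j
    proof -
      have m: "s i \<in> L" "s j \<in> L" using s that V_L by (auto simp: P_def eigvec_def)
      consider "i = j" | "i < j" | "j < i" by linarith
      then show ?thesis
      proof cases
        case 1
        then show ?thesis using s[OF that(1)] L.ip_self[OF m(1)] by (simp add: P_def)
      next
        case 2
        then show ?thesis using s[OF that(2)] by (simp add: P_def)
      next
        case 3
        then show ?thesis using s[OF that(1)] L.ip_cnj[OF m(2,1)] by (simp add: P_def)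
      qed
    qed
    define B where "B = s ` {..<n}"
    have B: "finite B" "\<And>w. w \<in> B \<Longrightarrow> eigvec t w" using s by (auto simp: B_def P_def)
    \<comment> \<open>Spans are taken over the set \<open>B\<close>, orthogonality over indices;
      injectivity of \<open>s\<close> translates between the two sums.\<close>
    have inj: "inj_on s {..<n}"
    proof (rule inj_onI)
      fix i j assume ij: "i \<in> {..<n}" "j \<in> {..<n}" "s i = s j"
      then show "i = j" using orth[of i j] orth[of i i] by (auto split: if_splits)
    qed
    have "\<not> (\<forall>u. eigvec t u \<longrightarrow> (\<exists>c. L.sq (\<lambda>x. u x - (\<Sum>w\<in>B. c w * w x)) = 0))"
    proof
      assume "\<forall>u. eigvec t u \<longrightarrow> (\<exists>c. L.sq (\<lambda>x. u x - (\<Sum>w\<in>B. c w * w x)) = 0)"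
      with B have "finite B \<and> (\<forall>w\<in>B. eigvec t w) \<and>
        (\<forall>u. eigvec t u \<longrightarrow> (\<exists>c. L.sq (\<lambda>x. u x - (\<Sum>w\<in>B. c w * w x)) = 0))" by simp
      then show False by (rule notE[OF neg exI])
    qed
    then obtain u where u: "eigvec t u" "\<And>c. L.sq (\<lambda>x. u x - (\<Sum>w\<in>B. c w * w x)) \<noteq> 0" by auto
    have uL: "u \<in> L" using u V_L by (auto simp: eigvec_def)
    \<comment> \<open>The orthogonal projection of \<open>u\<close> onto the span found so far;
      \<open>u\<close> lies outside that span, so u - p is not null.\<close>
    define p where "p = (\<lambda>x. \<Sum>w\<in>B. ip u w * w x)"
    have p: "eigvec t p" unfolding p_def by (rule eigvec_sum) (rule B)
    have pL: "p \<in> L" using p V_L by (auto simp: eigvec_def)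
    define v where "v = (\<lambda>x. u x - p x)"
    have v: "eigvec t v" using eigvec_comb[OF u(1) p, of "-1"] by (simp add: v_def)
    have vn: "L.sq v \<noteq> 0" using u(2)[of "ip u"] by (simp add: v_def p_def)
    have vo: "ip v (s m) = 0" if m: "m < n" for m
    proof -
      have mL: "s m \<in> L" using s[OF m] V_L by (auto simp: P_def eigvec_def)
      have "ip p (s m) = (\<Sum>w\<in>B. ip u w * ip w (s m))"
        unfolding p_def by (rule L.ip_sum) (use B V_L mL in \<open>auto simp: eigvec_def\<close>)
      also have "\<dots> = (\<Sum>i<n. ip u (s i) * ip (s i) (s m))"
        unfolding B_def by (simp add: sum.reindex[OF inj])
      also have "\<dots> = (\<Sum>i<n. if i = m then ip u (s i) else 0)"
        by (rule sum.cong) (auto simp: orth m)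
      also have "\<dots> = ip u (s m)" using m by simp
      finally show ?thesis unfolding v_def using L.ip_diff[OF uL pL mL] by simp
    qed
    obtain c where c: "eigvec t (\<lambda>x. c * v x)" "L.sq (\<lambda>x. c * v x) = 1"
      using eigvec_normalize[OF v vn] by blast
    have vL: "v \<in> L" using v V_L by (auto simp: eigvec_def)
    have "ip (s m) (\<lambda>x. c * v x) = 0" if m: "m < n" for m
    proof -
      have mL: "s m \<in> L" using s[OF m] V_L by (auto simp: P_def eigvec_def)
      show ?thesis using L.ip_scale_right[OF vL mL, of c] vo[OF m] L.ip_cnj[OF vL mL] by simp
    qed
    then have "P s n (\<lambda>x. c * v x)" using c by (simp add: P_def)
    then show "\<exists>u. P s n u" by blast
  qed
  then obtain s where "\<forall>n. P s n (s n)" ..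
  then have s: "\<And>n. eigvec t (s n)" "\<And>n. L.sq (s n) = 1" "\<And>m n. m < n \<Longrightarrow> ip (s m) (s n) = 0"
    by (auto simp: P_def)
  have sV: "s n \<in> V" for n using s(1) by (auto simp: eigvec_def)
  have o: "ip (s m) (s n) = 0" if "m \<noteq> n" for m n
  proof (cases "m < n")
    case False
    then have "ip (s n) (s m) = 0" using that s(3) by simp
    then show ?thesis using L.ip_cnj[OF V_L[OF sV[of n]] V_L[OF sV[of m]]] by simp
  qed (rule s(3))
  show False
  proof (rule no_infinite_orthonormal[OF gar sV s(2) _ o])
    show "A.sq (s n) \<le> r" for n using eigvec_sq[OF s(1)[of n]] s(2)[of n] t by auto
    show "a (s m) (s n) = 0" if "m \<noteq> n" for m n using eigvec_ip_sq[OF s(1) sV o[OF that]] .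
  qed auto
qed

end

section \<open>Square integrable functions\<close>

text \<open>The measure is a parameter because the same space serves
  \<open>lebesgue_on \<Omega>\<close> and, for functions of the longitudinal coordinate,
  \<open>lborel\<close> on the line.\<close>

definition L2M :: "'a measure \<Rightarrow> ('a \<Rightarrow> complex) set" where
  "L2M M = {f \<in> borel_measurable M. integrable M (\<lambda>x. (cmod (f x))\<^sup>2)}"

definition ipM :: "'a measure \<Rightarrow> ('a \<Rightarrow> complex) \<Rightarrow> ('a \<Rightarrow> complex) \<Rightarrow> complex" where
  "ipM M f g = (\<integral>x. f x * cnj (g x) \<partial>M)"

lemma L2M_measurable [measurable_dest]: "f \<in> L2M M \<Longrightarrow> f \<in> borel_measurable M"
  by (simp add: L2M_def)

lemma norm_mult_le_sum_squares:
  fixes a b :: complex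
  shows "cmod (a * b) \<le> (cmod a)\<^sup>2 + (cmod b)\<^sup>2"
proof -
  have "0 \<le> (cmod a - cmod b)\<^sup>2" by simp
  then have "2 * (cmod a * cmod b) \<le> (cmod a)\<^sup>2 + (cmod b)\<^sup>2" by (simp add: power2_diff)
  moreover have "0 \<le> cmod a * cmod b" by simp
  ultimately show ?thesis unfolding norm_mult by linarith
qed

lemma L2M_integrable_mult:
  assumes "f \<in> L2M M" "g \<in> L2M M"
  shows "integrable M (\<lambda>x. f x * g x)"
proof (rule Bochner_Integration.integrable_bound)
  show "integrable M (\<lambda>x. (cmod (f x))\<^sup>2 + (cmod (g x))\<^sup>2)" using assms by (simp add: L2M_def)
  show "(\<lambda>x. f x * g x) \<in> borel_measurable M" using assms by (auto simp: L2M_def)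
  show "AE x in M. norm (f x * g x) \<le> norm ((cmod (f x))\<^sup>2 + (cmod (g x))\<^sup>2)"
    using norm_mult_le_sum_squares by (auto simp: abs_of_nonneg)
qed

lemma L2M_cnj: "f \<in> L2M M \<Longrightarrow> (\<lambda>x. cnj (f x)) \<in> L2M M"
  using measurable_compose[of f M borel cnj borel] borel_measurable_continuous_onI[of cnj]
  by (auto simp: L2M_def intro: continuous_intros)

lemma L2M_comb:
  assumes "f \<in> L2M M" "g \<in> L2M M"
  shows "(\<lambda>x. f x + c * g x) \<in> L2M M"
proof -
  have "integrable M (\<lambda>x. (cmod (f x + c * g x))\<^sup>2)"
  proof (rule Bochner_Integration.integrable_bound)
    show "integrable M (\<lambda>x. 2 * (cmod (f x))\<^sup>2 + 2 * (cmod c)\<^sup>2 * (cmod (g x))\<^sup>2)"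
      using assms by (simp add: L2M_def)
    show "(\<lambda>x. (cmod (f x + c * g x))\<^sup>2) \<in> borel_measurable M" using assms by (auto simp: L2M_def)
    have "(cmod (a + c * b))\<^sup>2 \<le> 2 * (cmod a)\<^sup>2 + 2 * (cmod c)\<^sup>2 * (cmod b)\<^sup>2" for a b
    proof -
      have "(cmod (a + c * b))\<^sup>2 \<le> (cmod a + cmod (c * b))\<^sup>2"
        by (intro power_mono norm_triangle_ineq) auto
      also have "\<dots> \<le> 2 * (cmod a)\<^sup>2 + 2 * (cmod (c * b))\<^sup>2"
        using zero_le_power2[of "cmod a - cmod (c * b)"] unfolding power2_sum power2_diff by linarith
      finally show ?thesis by (simp add: norm_mult power_mult_distrib)
    qed
    then show "AE x in M. norm ((cmod (f x + c * g x))\<^sup>2) \<le> norm (2 * (cmod (f x))\<^sup>2 + 2 * (cmod c)\<^sup>2 * (cmod (g x))\<^sup>2)"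
      by auto
  qed
  then show ?thesis using assms by (auto simp: L2M_def)
qed

global_interpretation L2: semi_inner "L2M M" "ipM M" for M :: "'a measure"
proof
  fix u v w :: "'a \<Rightarrow> complex" and c
  show "(\<lambda>x. 0) \<in> L2M M" by (simp add: L2M_def)
  show "u \<in> L2M M \<Longrightarrow> v \<in> L2M M \<Longrightarrow> (\<lambda>x. u x + c * v x) \<in> L2M M" by (rule L2M_comb)
  assume u: "u \<in> L2M M"
  show "0 \<le> Re (ipM M u u)"
    unfolding ipM_def complex_norm_square[symmetric] integral_complex_of_real by simp
  assume v: "v \<in> L2M M"
  have "cnj (ipM M u v) = (\<integral>x. cnj (u x * cnj (v x)) \<partial>M)"
    unfolding ipM_def by (rule Bochner_Integration.integral_cnj[symmetric])
  then show "ipM M v u = cnj (ipM M u v)" by (simp add: ipM_def mult.commute)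
  assume w: "w \<in> L2M M"
  have "integrable M (\<lambda>x. u x * cnj (w x))" "integrable M (\<lambda>x. c * (v x * cnj (w x)))"
    using L2M_integrable_mult[OF u L2M_cnj[OF w]] L2M_integrable_mult[OF v L2M_cnj[OF w]] by auto
  then show "ipM M (\<lambda>x. u x + c * v x) w = ipM M u w + c * ipM M v w"
    unfolding ipM_def by (simp add: ring_distribs mult.assoc)
qed

lemma L2_sq: "L2.sq M u = (\<integral>x. (cmod (u x))\<^sup>2 \<partial>M)"
  unfolding L2.sq_def ipM_def complex_norm_square[symmetric] integral_complex_of_real by simp

lemma L2_sq_eq_0_iff: "u \<in> L2M M \<Longrightarrow> L2.sq M u = 0 \<longleftrightarrow> (AE x in M. u x = 0)"
  unfolding L2_sq by (subst integral_nonneg_eq_0_iff_AE) (auto simp: L2M_def)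

lemma L2_sq_nn: "u \<in> L2M M \<Longrightarrow> ennreal (L2.sq M u) = (\<integral>\<^sup>+x. ennreal ((cmod (u x))\<^sup>2) \<partial>M)"
  unfolding L2_sq by (subst nn_integral_eq_integral) (auto simp: L2M_def)

lemma L2M_nnI:
  assumes "u \<in> borel_measurable M" "(\<integral>\<^sup>+x. ennreal ((cmod (u x))\<^sup>2) \<partial>M) \<le> ennreal B" "B \<ge> 0"
  shows "u \<in> L2M M" "L2.sq M u \<le> B"
proof -
  show u: "u \<in> L2M M"
    using assms by (auto simp: L2M_def integrable_iff_bounded intro: le_less_trans)
  show "L2.sq M u \<le> B" using assms(2,3) L2_sq_nn[OF u] by (metis ennreal_le_iff)
qed

text \<open>Squared distances of order 4^-k survive a weight 2^k with a summable total, so the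
  weighted series is finite almost everywhere, and at such a point the increments decay
  geometrically.\<close>

lemma AE_summable_subseq:
  fixes s :: "nat \<Rightarrow> 'a \<Rightarrow> complex"
  assumes s: "\<And>n. s n \<in> L2M M" and d: "\<And>k. L2.sq M (\<lambda>x. s (Suc k) x - s k x) \<le> (1/4)^k"
  shows "AE x in M. convergent (\<lambda>k. s k x)"
proof -
  define h where "h k x = ennreal (2^k * (cmod (s (Suc k) x - s k x))\<^sup>2)" for k x
  have dm: "(\<lambda>x. s (Suc k) x - s k x) \<in> L2M M" for k using L2.diff_mem s by blast
  have hm: "h k \<in> borel_measurable M" for k
    unfolding h_def using L2M_measurable[OF dm[of k]] by measurable
  have hk: "(\<integral>\<^sup>+x. h k x \<partial>M) \<le> ennreal ((1/2)^k)" for k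
  proof -
    have "(\<integral>\<^sup>+x. h k x \<partial>M) = ennreal (2^k) * (\<integral>\<^sup>+x. ennreal ((cmod (s (Suc k) x - s k x))\<^sup>2) \<partial>M)"
      unfolding h_def using L2M_measurable[OF dm[of k]] by (simp add: ennreal_mult nn_integral_cmult)
    also have "\<dots> = ennreal (2^k * L2.sq M (\<lambda>x. s (Suc k) x - s k x))"
      unfolding L2_sq_nn[OF dm, symmetric] using L2.sq_nonneg[OF dm] by (simp add: ennreal_mult)
    also have "\<dots> \<le> ennreal (2^k * (1/4)^k)"
      using d[of k] by (intro ennreal_leI mult_left_mono) auto
    also have "(2::real)^k * (1/4)^k = (1/2)^k" by (simp add: power_mult_distrib[symmetric])
    finally show ?thesis .
  qed
  have "(\<integral>\<^sup>+x. (\<Sum>k. h k x) \<partial>M) = (\<Sum>k. \<integral>\<^sup>+x. h k x \<partial>M)"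
    by (rule nn_integral_suminf) (rule hm)
  also have "\<dots> \<le> (\<Sum>k. ennreal ((1/2)^k))" by (intro suminf_le hk) auto
  also have "\<dots> = ennreal (\<Sum>k. (1/2)^k)" by (intro suminf_ennreal2) auto
  also have "\<dots> < \<infinity>" by simp
  finally have "AE x in M. (\<Sum>k. h k x) \<noteq> \<infinity>"
    by (intro nn_integral_noteq_infinite) (use hm in auto)
  then show ?thesis
  proof (rule AE_mp, intro AE_I2 impI)
    fix x assume fin: "(\<Sum>k. h k x) \<noteq> \<infinity>"
    then obtain H where H: "H \<ge> 0" "(\<Sum>k. h k x) = ennreal H" by (cases "\<Sum>k. h k x") auto
    have b: "cmod (s (Suc k) x - s k x) \<le> sqrt H * (1 / sqrt 2)^k" for k
    proof -
      have "h k x \<le> ennreal H" unfolding H(2)[symmetric]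
        using sum_le_suminf[of "\<lambda>k. h k x" "{k}"] by simp
      then have "2^k * (cmod (s (Suc k) x - s k x))\<^sup>2 \<le> H" unfolding h_def using H(1) by simp
      then have "(cmod (s (Suc k) x - s k x))\<^sup>2 \<le> H * (1/2)^k" by (simp add: field_simps)
      then have "cmod (s (Suc k) x - s k x) \<le> sqrt (H * (1/2)^k)" by (rule real_le_rsqrt)
      then show ?thesis by (simp add: real_sqrt_mult real_sqrt_power real_sqrt_divide)
    qed
    have "summable (\<lambda>k. sqrt H * (1 / sqrt 2)^k)"
      by (intro summable_mult summable_geometric) simp
    then have "summable (\<lambda>k. s (Suc k) x - s k x)"
      by (rule summable_comparison_test[rotated]) (use b in auto)
    then have "convergent (\<lambda>n. \<Sum>k<n. s (Suc k) x - s k x)" by (simp add: summable_iff_convergent)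
    then have "convergent (\<lambda>n. s n x - s 0 x)" by (simp only: sum_lessThan_telescope[of "\<lambda>n. s n x"])
    then have "convergent (\<lambda>n. (s n x - s 0 x) + s 0 x)" by (rule convergent_add) (rule convergent_const)
    then show "convergent (\<lambda>k. s k x)" by simp
  qed
qed

text \<open>Riesz-Fischer: a fast Cauchy subsequence converges almost everywhere, and Fatou's lemma
  shows that its pointwise limit is also the limit in the seminorm.\<close>

global_interpretation L2: semi_hilbert "L2M M" "ipM M" for M :: "'a measure"
proof
  fix s :: "nat \<Rightarrow> 'a \<Rightarrow> complex"
  assume s: "\<And>n. s n \<in> L2M M"
    and cau: "\<And>e. e > 0 \<Longrightarrow> \<exists>N. \<forall>m\<ge>N. \<forall>n\<ge>N. L2.sq M (\<lambda>x. s m x - s n x) < e"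
  have "\<forall>k. \<exists>N. \<forall>m\<ge>N. \<forall>n\<ge>N. L2.sq M (\<lambda>x. s m x - s n x) < (1/4)^k" using cau by simp
  from choice[OF this] obtain N
    where N': "\<forall>k. \<forall>m\<ge>N k. \<forall>n\<ge>N k. L2.sq M (\<lambda>x. s m x - s n x) < (1/4)^k" ..
  then have N: "L2.sq M (\<lambda>x. s m x - s n x) < (1/4)^k" if "m \<ge> N k" "n \<ge> N k" for k m n
    using that by blast
  \<comment> \<open>A partial sum lies beyond every threshold \<open>N j\<close> with j \<le> k at
    once.\<close>
  define r where "r k = (\<Sum>j\<le>k. N j)" for k
  have r: "N j \<le> r k" if "j \<le> k" for j k
    unfolding r_def using that by (intro member_le_sum) auto
  define f where "f x = lim (\<lambda>k. s (r k) x)" for x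
  have fm: "f \<in> borel_measurable M"
    unfolding f_def by (intro borel_measurable_lim_metric L2M_measurable s)
  have "AE x in M. convergent (\<lambda>k. s (r k) x)"
    using AE_summable_subseq[of "\<lambda>k. s (r k)"] s less_imp_le[OF N[OF r r]] by (simp add: le_Suc_eq)
  then have lim: "AE x in M. (\<lambda>k. s (r k) x) \<longlonglongrightarrow> f x"
    by (auto simp: f_def convergent_LIMSEQ_iff)
  have est: "(\<lambda>x. s n x - f x) \<in> L2M M \<and> L2.sq M (\<lambda>x. s n x - f x) \<le> (1/4)^j" if n: "n \<ge> N j" for n j
  proof -
    have dm: "(\<lambda>x. s n x - s (r k) x) \<in> L2M M" for k using L2.diff_mem s by blast
    have "(\<integral>\<^sup>+x. ennreal ((cmod (s n x - f x))\<^sup>2) \<partial>M)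
        = (\<integral>\<^sup>+x. liminf (\<lambda>k. ennreal ((cmod (s n x - s (r k) x))\<^sup>2)) \<partial>M)"
    proof (rule nn_integral_cong_AE)
      show "AE x in M. ennreal ((cmod (s n x - f x))\<^sup>2) = liminf (\<lambda>k. ennreal ((cmod (s n x - s (r k) x))\<^sup>2))"
        using lim
      proof (rule AE_mp, intro AE_I2 impI)
        fix x assume l: "(\<lambda>k. s (r k) x) \<longlonglongrightarrow> f x"
        have "(\<lambda>k. ennreal ((cmod (s n x - s (r k) x))\<^sup>2)) \<longlonglongrightarrow> ennreal ((cmod (s n x - f x))\<^sup>2)"
          by (intro tendsto_intros tendsto_ennrealI l)
        from lim_imp_Liminf[OF _ this]
        show "ennreal ((cmod (s n x - f x))\<^sup>2) = liminf (\<lambda>k. ennreal ((cmod (s n x - s (r k) x))\<^sup>2))" by simp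
      qed
    qed
    also have "\<dots> \<le> liminf (\<lambda>k. \<integral>\<^sup>+x. ennreal ((cmod (s n x - s (r k) x))\<^sup>2) \<partial>M)"
      by (rule nn_integral_liminf) (use L2M_measurable[OF dm] in measurable)
    also have "\<dots> = liminf (\<lambda>k. ennreal (L2.sq M (\<lambda>x. s n x - s (r k) x)))"
      by (simp add: L2_sq_nn[OF dm])
    also have "\<dots> \<le> liminf (\<lambda>k. ennreal ((1/4)^j))"
    proof (rule Liminf_mono)
      show "\<forall>\<^sub>F k in sequentially. ennreal (L2.sq M (\<lambda>x. s n x - s (r k) x)) \<le> ennreal ((1/4)^j)"
        using eventually_ge_at_top[of j]
        by eventually_elim (use N[OF n r] in \<open>auto intro!: ennreal_leI less_imp_le\<close>)
    qed
    also have "\<dots> = ennreal ((1/4)^j)" by (simp add: Liminf_const)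
    finally have le: "(\<integral>\<^sup>+x. ennreal ((cmod (s n x - f x))\<^sup>2) \<partial>M) \<le> ennreal ((1/4)^j)" .
    have m: "(\<lambda>x. s n x - f x) \<in> borel_measurable M" using fm L2M_measurable[OF s[of n]] by measurable
    have "(1/4)^j \<ge> (0::real)" by simp
    from L2M_nnI[OF m le this] show ?thesis by (rule conjI)
  qed
  have f: "f \<in> L2M M" using L2.diff_mem[OF s[of "N 0"] conjunct1[OF est[OF order_refl, of 0]]] by simp
  have "(\<lambda>n. L2.sq M (\<lambda>x. s n x - f x)) \<longlonglongrightarrow> 0"
  proof (rule LIMSEQ_I)
    fix e :: real assume "e > 0"
    then obtain j where j: "(1/4::real)^j < e" using real_arch_pow_inv[of e "1/4"] by auto
    show "\<exists>no. \<forall>n\<ge>no. norm (L2.sq M (\<lambda>x. s n x - f x) - 0) < e"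
    proof (intro exI[of _ "N j"] allI impI)
      fix n assume "N j \<le> n"
      then have "L2.sq M (\<lambda>x. s n x - f x) \<le> (1/4)^j" using est by blast
      then show "norm (L2.sq M (\<lambda>x. s n x - f x) - 0) < e"
        using j L2.sq_nonneg[OF L2.diff_mem[OF s[of n] f]] by simp
    qed
  qed
  then show "\<exists>u\<in>L2M M. (\<lambda>n. L2.sq M (\<lambda>x. s n x - u x)) \<longlonglongrightarrow> 0" using f by blast
qed

lemma L2_space_eq: "L2_space \<Omega> = L2M (lebesgue_on \<Omega>)"
  by (simp add: L2_space_def L2M_def)

lemma L2_inner_eq: "L2_inner \<Omega> = ipM (lebesgue_on \<Omega>)"
  by (simp add: L2_inner_def ipM_def fun_eq_iff)

lemma L2_norm_eq: "L2_norm \<Omega> u = sqrt (L2.sq (lebesgue_on \<Omega>) u)"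
  by (simp add: L2_norm_def L2_sq)

lemma ipM_cong_AE:
  assumes "u \<in> L2M M" "u' \<in> L2M M" "v \<in> L2M M" "v' \<in> L2M M"
    "AE x in M. u x = u' x" "AE x in M. v x = v' x"
  shows "ipM M u v = ipM M u' v'"
  unfolding ipM_def
proof (rule integral_cong_AE)
  show "(\<lambda>x. u x * cnj (v x)) \<in> borel_measurable M" "(\<lambda>x. u' x * cnj (v' x)) \<in> borel_measurable M"
    using L2M_integrable_mult L2M_cnj assms by (blast intro: borel_measurable_integrable)+
  show "AE x in M. u x * cnj (v x) = u' x * cnj (v' x)" using assms(5,6) by auto
qed

section \<open>Smooth functions\<close>

lemma partial_deriv_eqI: "(f has_derivative f') (at x) \<Longrightarrow> partial_deriv b f x = f' b"
  unfolding partial_deriv_def using frechet_derivative_at by metis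

lemma differentiable_has_derivative:
  "f differentiable at x \<Longrightarrow> (f has_derivative frechet_derivative f (at x)) (at x)"
  using frechet_derivative_works by blast

lemma frechet_derivative_eq_sum_partial:
  fixes f :: "'a::euclidean_space \<Rightarrow> complex"
  assumes "f differentiable at x"
  shows "frechet_derivative f (at x) h = (\<Sum>b\<in>Basis. complex_of_real (h \<bullet> b) * partial_deriv b f x)"
proof -
  interpret bounded_linear "frechet_derivative f (at x)"
    using has_derivative_bounded_linear[OF differentiable_has_derivative[OF assms]] .
  have "frechet_derivative f (at x) h = frechet_derivative f (at x) (\<Sum>b\<in>Basis. (h \<bullet> b) *\<^sub>R b)"
    by (simp add: euclidean_representation)
  also have "\<dots> = (\<Sum>b\<in>Basis. (h \<bullet> b) *\<^sub>R frechet_derivative f (at x) b)"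
    by (simp add: sum scaleR)
  finally show ?thesis by (simp add: partial_deriv_def scaleR_conv_of_real)
qed

lemma C_k_SucD: "C_k (Suc k) f \<Longrightarrow> C_k k f"
proof (induction k arbitrary: f)
  case 0
  then show ?case by (auto intro!: differentiable_imp_continuous_on simp: differentiable_on_def)
next
  case (Suc k)
  then show ?case by simp
qed

lemma C_k_continuous: "C_k k f \<Longrightarrow> continuous_on UNIV f"
  by (cases k) (auto intro!: differentiable_imp_continuous_on simp: differentiable_on_def)

lemma C_k_const: "C_k k (\<lambda>x. c)"
proof (induction k arbitrary: c)
  case (Suc k)
  have "partial_deriv b (\<lambda>x::'a. c) = (\<lambda>x. 0)" for b
    by (rule ext, rule partial_deriv_eqI[where f' = "\<lambda>x. 0"]) simp
  then show ?case using Suc by simp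
qed simp

lemma partial_deriv_add:
  assumes "f differentiable at x" "g differentiable at x"
  shows "partial_deriv b (\<lambda>x. f x + g x) x = partial_deriv b f x + partial_deriv b g x"
  by (subst partial_deriv_eqI[OF has_derivative_add[OF assms[THEN differentiable_has_derivative]]])
    (simp add: partial_deriv_def)

lemma partial_deriv_mult:
  assumes "f differentiable at x" "g differentiable at x"
  shows "partial_deriv b (\<lambda>x. f x * g x) x = f x * partial_deriv b g x + partial_deriv b f x * g x"
  by (subst partial_deriv_eqI[OF has_derivative_mult[OF assms[THEN differentiable_has_derivative]]])
    (simp add: partial_deriv_def)

lemma C_k_add: "C_k k f \<Longrightarrow> C_k k g \<Longrightarrow> C_k k (\<lambda>x. f x + g x)"
proof (induction k arbitrary: f g)
  case (Suc k)
  then have d: "f differentiable at x" "g differentiable at x" for x by auto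
  have "partial_deriv b (\<lambda>x. f x + g x) = (\<lambda>x. partial_deriv b f x + partial_deriv b g x)" for b
    using partial_deriv_add[OF d] by blast
  then show ?case using Suc d by auto
qed (auto intro: continuous_intros)

lemma C_k_mult: "C_k k f \<Longrightarrow> C_k k g \<Longrightarrow> C_k k (\<lambda>x. f x * g x)"
proof (induction k arbitrary: f g)
  case (Suc k)
  then have d: "f differentiable at x" "g differentiable at x" for x by auto
  have "partial_deriv b (\<lambda>x. f x * g x) = (\<lambda>x. f x * partial_deriv b g x + partial_deriv b f x * g x)" for b
    using partial_deriv_mult[OF d] by blast
  moreover have "C_k k f" "C_k k g" using C_k_SucD Suc.prems by blast+
  ultimately show ?case using Suc d by (auto intro!: C_k_add)
qed (auto intro: continuous_intros)

lemma C_k_cmult: "C_k k f \<Longrightarrow> C_k k (\<lambda>x. c * f x)"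
  by (intro C_k_mult C_k_const)

lemma C_k_sum: "(\<And>i. i \<in> I \<Longrightarrow> C_k k (f i)) \<Longrightarrow> C_k k (\<lambda>x. \<Sum>i\<in>I. f i x)"
  by (induction I rule: infinite_finite_induct) (auto intro: C_k_const C_k_add)

lemma C_k_prod: "(\<And>i. i \<in> I \<Longrightarrow> C_k k (f i)) \<Longrightarrow> C_k k (\<lambda>x. \<Prod>i\<in>I. f i x)"
  by (induction I rule: infinite_finite_induct) (auto intro: C_k_const C_k_mult)

lemma partial_deriv_cnj:
  assumes "f differentiable at x"
  shows "partial_deriv b (\<lambda>x. cnj (f x)) x = cnj (partial_deriv b f x)"
  by (subst partial_deriv_eqI[OF bounded_linear.has_derivative[OF bounded_linear_cnj differentiable_has_derivative[OF assms]]])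
    (simp add: partial_deriv_def)

lemma differentiable_cnj: "f differentiable at x \<Longrightarrow> (\<lambda>x. cnj (f x)) differentiable at x"
  using bounded_linear.has_derivative[OF bounded_linear_cnj] unfolding differentiable_def by blast

lemma C_k_cnj: "C_k k f \<Longrightarrow> C_k k (\<lambda>x. cnj (f x))"
proof (induction k arbitrary: f)
  case (Suc k)
  then have d: "f differentiable at x" for x by auto
  have "partial_deriv b (\<lambda>x. cnj (f x)) = (\<lambda>x. cnj (partial_deriv b f x))" for b
    using partial_deriv_cnj[OF d] by (intro ext) simp
  then show ?case using Suc differentiable_cnj[OF d] by auto
qed (auto intro: continuous_intros)

lemma has_derivative_affine_comp:
  assumes "f differentiable at (l x + c)" "bounded_linear l"
  shows "((\<lambda>x. f (l x + c)) has_derivative (\<lambda>h. frechet_derivative f (at (l x + c)) (l h))) (at x)"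
proof -
  have "((\<lambda>x. l x + c) has_derivative l) (at x)"
    using has_derivative_add_const[OF bounded_linear_imp_has_derivative[OF assms(2)]] .
  from has_derivative_compose[OF this differentiable_has_derivative[OF assms(1)]]
  show ?thesis .
qed

lemma partial_deriv_affine_comp:
  assumes "f differentiable at (l x + c)" "bounded_linear l"
  shows "partial_deriv b (\<lambda>x. f (l x + c)) x
      = (\<Sum>d\<in>Basis. complex_of_real (l b \<bullet> d) * partial_deriv d f (l x + c))"
  using partial_deriv_eqI[OF has_derivative_affine_comp[OF assms]]
    frechet_derivative_eq_sum_partial[OF assms(1)] by simp

lemma C_k_affine_comp:
  assumes "bounded_linear l"
  shows "C_k k f \<Longrightarrow> C_k k (\<lambda>x. f (l x + c))"
proof (induction k arbitrary: f)
  case 0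
  have "continuous_on UNIV (\<lambda>x. l x + c)"
    by (intro continuous_on_add continuous_on_const bounded_linear.continuous_on[OF assms] continuous_on_id)
  then show ?case
    using 0 continuous_on_compose2[of UNIV f UNIV "\<lambda>x. l x + c"] by simp
next
  case (Suc k)
  then have d: "f differentiable at x" for x by auto
  have "partial_deriv b (\<lambda>x. f (l x + c))
      = (\<lambda>x. \<Sum>d\<in>Basis. complex_of_real (l b \<bullet> d) * partial_deriv d f (l x + c))" for b
    using partial_deriv_affine_comp[OF d assms] by blast
  moreover have "(\<lambda>x. f (l x + c)) differentiable at x" for x
    using has_derivative_affine_comp[OF d assms] unfolding differentiable_def by blast
  ultimately show ?case using Suc by (auto intro!: C_k_sum C_k_cmult)
qed

text \<open>Smoothness is local and the two open sets cover the space. This is extension by zero,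
  needed for the slices of test functions.\<close>

lemma C_k_local:
  assumes "open U" "open W" "U \<union> W = UNIV"
  shows "C_k k f \<Longrightarrow> (\<And>x. x \<in> U \<Longrightarrow> g x = f x) \<Longrightarrow> (\<And>x. x \<in> W \<Longrightarrow> g x = 0) \<Longrightarrow> C_k k g"
proof (induction k arbitrary: f g)
  case 0
  have "continuous (at x) g" for x
  proof (cases "x \<in> U")
    case True
    then have "\<forall>\<^sub>F y in nhds x. f y = g y" using 0 assms(1) by (auto simp: eventually_nhds)
    then show ?thesis using 0 isCont_cong[of f g x] by (simp add: continuous_on_eq_continuous_at)
  next
    case False
    then have "x \<in> W" using assms(3) by auto
    then have "\<forall>\<^sub>F y in nhds x. (\<lambda>_. 0) y = g y" using 0 assms(2) by (auto simp: eventually_nhds)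
    then show ?thesis using isCont_cong[of "\<lambda>_. 0" g x] by simp
  qed
  then show ?case by (simp add: continuous_on_eq_continuous_at)
next
  case (Suc k)
  then have d: "f differentiable at x" for x by auto
  have gU: "(g has_derivative frechet_derivative f (at x)) (at x)" if "x \<in> U" for x
    using has_derivative_transform_within_open[OF differentiable_has_derivative[OF d] assms(1) that] Suc.prems(2)
    by metis
  have gW: "(g has_derivative (\<lambda>_. 0)) (at x)" if "x \<in> W" for x
    using has_derivative_transform_within_open[OF has_derivative_const[of 0] assms(2) that] Suc.prems(3)
    by metis
  have "g differentiable at x" for x
    using gU[of x] gW[of x] assms(3) unfolding differentiable_def by blast
  moreover have "C_k k (partial_deriv b g)" if "b \<in> Basis" for b
  proof (rule Suc.IH)
    show "C_k k (partial_deriv b f)" using Suc.prems that by simp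
    show "partial_deriv b g x = partial_deriv b f x" if "x \<in> U" for x
      using partial_deriv_eqI[OF gU[OF that]] by (simp add: partial_deriv_def)
    show "partial_deriv b g x = 0" if "x \<in> W" for x
      using partial_deriv_eqI[OF gW[OF that]] by simp
  qed
  ultimately show ?case by simp
qed

lemma partial_deriv_vector:
  fixes f :: "real \<Rightarrow> complex"
  assumes "(f has_vector_derivative f') (at x)"
  shows "partial_deriv 1 f x = f'"
  using assms partial_deriv_eqI[of f "\<lambda>h. h *\<^sub>R f'"] unfolding has_vector_derivative_def by simp

subsection \<open>A smooth bump function\<close>

text \<open>The polynomial parameter makes the family closed under differentiation: the derivative
  belongs to t^2 (p(t) - p'(t)), which is the double \<open>pCons 0\<close> in
  \<open>flat_deriv\<close>. Smoothness of all orders then follows from one derivative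
  formula.\<close>

definition flat :: "real poly \<Rightarrow> real \<Rightarrow> real" where
  "flat p x = (if x > 0 then poly p (1 / x) * exp (- (1 / x)) else 0)"

lemma poly_exp_tendsto_0: "((\<lambda>x::real. poly p x * exp (- x)) \<longlongrightarrow> 0) at_top"
proof (induction p)
  case (pCons a p)
  have 1: "((\<lambda>x::real. x ^ n * exp (- x)) \<longlongrightarrow> 0) at_top" for n
    using tendsto_power_div_exp_0[of n] by (simp add: exp_minus divide_inverse)
  have "((\<lambda>x::real. a * (x^0 * exp (- x)) + (\<Sum>i\<le>degree p. coeff p i * (x ^ Suc i * exp (- x)))) \<longlongrightarrow>
      a * 0 + (\<Sum>i\<le>degree p. coeff p i * 0)) at_top"
    by (intro tendsto_intros 1)
  moreover have "a * (x^0 * exp (- x)) + (\<Sum>i\<le>degree p. coeff p i * (x ^ Suc i * exp (- x))) = poly (pCons a p) x * exp (- x)"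
    for x :: real
    by (simp add: poly_altdef[of p] sum_distrib_left sum_distrib_right algebra_simps)
  ultimately show ?case by simp
qed simp

lemma flat_deriv: "(flat p has_real_derivative flat (pCons 0 (pCons 0 (p - pderiv p))) x) (at x)"
proof -
  consider "x > 0" | "x < 0" | "x = 0" by linarith
  then show ?thesis
  proof cases
    case 1
    have "((\<lambda>x. poly p (1 / x) * exp (- (1 / x))) has_real_derivative
        flat (pCons 0 (pCons 0 (p - pderiv p))) x) (at x)"
      using 1 by (auto simp: flat_def intro!: derivative_eq_intros DERIV_chain2[OF poly_DERIV])
        (simp add: field_simps power2_eq_square)
    then show ?thesis
      by (rule has_field_derivative_transform_within_open[of _ _ _ "{0<..}"]) (use 1 in \<open>auto simp: flat_def\<close>)
  next
    case 2
    have "((\<lambda>x. 0) has_real_derivative flat (pCons 0 (pCons 0 (p - pderiv p))) x) (at x)"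
      using 2 by (simp add: flat_def)
    then show ?thesis
      by (rule has_field_derivative_transform_within_open[of _ _ _ "{..<0}"]) (use 2 in \<open>auto simp: flat_def\<close>)
  next
    \<comment> \<open>At the origin the right difference quotient is a member of the same family
      with one more factor 1/h in the polynomial, and it tends to 0.\<close>
    case 3
    have "((\<lambda>h. poly (pCons 0 p) (inverse h) * exp (- (inverse h))) \<longlongrightarrow> 0) (at_right 0)"
      using filterlim_compose[OF poly_exp_tendsto_0 filterlim_inverse_at_top_right, of "pCons 0 p"] by simp
    moreover have "\<forall>\<^sub>F h in at_right 0. poly (pCons 0 p) (inverse h) * exp (- inverse h) = flat p h / h"
      using eventually_at_right_less[of "0::real"]
      by eventually_elim (simp add: flat_def divide_inverse)
    ultimately have "((\<lambda>h. flat p h / h) \<longlongrightarrow> 0) (at_right 0)"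
      by (rule Lim_transform_eventually)
    moreover have "\<forall>\<^sub>F h in at_left 0. 0 = flat p h / h"
      unfolding eventually_at_filter by (rule always_eventually) (simp add: flat_def)
    then have "((\<lambda>h. flat p h / h) \<longlongrightarrow> 0) (at_left 0)"
      by (rule Lim_transform_eventually[OF tendsto_const])
    ultimately have "((\<lambda>h. flat p h / h) \<longlongrightarrow> 0) (at 0)"
      using filterlim_split_at by blast
    then show ?thesis using 3 by (simp add: DERIV_def flat_def)
  qed
qed

lemma flat_C_k: "C_k k (\<lambda>x. complex_of_real (flat p x))"
proof (induction k arbitrary: p)
  case 0
  have "isCont (flat p) x" for x using DERIV_isCont[OF flat_deriv] .
  then show ?case by (auto simp: continuous_on_eq_continuous_at intro!: continuous_intros)
next
  case (Suc k)
  let ?q = "pCons 0 (pCons 0 (p - pderiv p))"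
  have d: "((\<lambda>x. complex_of_real (flat p x)) has_vector_derivative complex_of_real (flat ?q x)) (at x)" for x
    using bounded_linear.has_vector_derivative[OF bounded_linear_of_real flat_deriv[THEN has_real_derivative_iff_has_vector_derivative[THEN iffD1]]] .
  then have "partial_deriv 1 (\<lambda>x. complex_of_real (flat p x)) = (\<lambda>x. complex_of_real (flat ?q x))"
    using partial_deriv_vector by blast
  moreover have "(\<lambda>x. complex_of_real (flat p x)) differentiable at x" for x
    using d unfolding has_vector_derivative_def differentiable_def by blast
  ultimately show ?case using Suc[of ?q] by simp
qed

lemma exp_C_k: "C_k k (\<lambda>x::real. exp (c * complex_of_real x))"
proof (induction k)
  case 0
  show ?case by (auto intro!: continuous_intros)
next
  case (Suc k)
  have d: "((\<lambda>x::real. exp (c * complex_of_real x)) has_vector_derivative c * exp (c * complex_of_real x)) (at x)" for x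
    by (rule has_vector_derivative_real_field[of "\<lambda>z. exp (c * z)"]) (auto intro!: derivative_eq_intros)
  then have "partial_deriv 1 (\<lambda>x. exp (c * complex_of_real x)) = (\<lambda>x::real. c * exp (c * complex_of_real x))"
    using partial_deriv_vector by blast
  moreover have "(\<lambda>x::real. exp (c * complex_of_real x)) differentiable at x" for x
    using d unfolding has_vector_derivative_def differentiable_def by blast
  ultimately show ?case using Suc by (simp add: C_k_cmult)
qed

section \<open>Test functions\<close>

abbreviation test_fun :: "('a::euclidean_space \<Rightarrow> complex) \<Rightarrow> bool" where
  "test_fun \<phi> \<equiv> \<phi> \<in> test_functions UNIV"

lemma test_C_k: "\<phi> \<in> test_functions \<Omega> \<Longrightarrow> C_k k \<phi>"
  by (simp add: test_functions_def)

lemma test_differentiable: "\<phi> \<in> test_functions \<Omega> \<Longrightarrow> \<phi> differentiable at x"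
  using test_C_k[of \<phi> \<Omega> "Suc 0"] by simp

lemma test_continuous: "\<phi> \<in> test_functions \<Omega> \<Longrightarrow> continuous_on UNIV \<phi>"
  using test_C_k C_k_continuous by blast

lemma test_functionsI:
  assumes "\<And>k. C_k k \<phi>" "compact K" "K \<subseteq> \<Omega>" "\<And>x. x \<notin> K \<Longrightarrow> \<phi> x = 0"
  shows "\<phi> \<in> test_functions \<Omega>"
proof -
  have "closure {x. \<phi> x \<noteq> 0} \<subseteq> K"
    by (rule closure_minimal) (use assms compact_imp_closed in auto)
  moreover from this have "compact (closure {x. \<phi> x \<noteq> 0})"
    by (metis assms(2) closed_closure compact_Int_closed inf.absorb_iff2)
  ultimately show ?thesis using assms by (auto simp: test_functions_def)
qed

lemma test_support:
  assumes "\<phi> \<in> test_functions \<Omega>"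
  obtains K where "compact K" "K \<subseteq> \<Omega>" "\<And>x. x \<notin> K \<Longrightarrow> \<phi> x = 0" "\<And>x b. x \<notin> K \<Longrightarrow> partial_deriv b \<phi> x = 0"
proof -
  define K where "K = closure {x. \<phi> x \<noteq> 0}"
  have K: "compact K" "K \<subseteq> \<Omega>" using assms by (auto simp: test_functions_def K_def)
  have z: "\<phi> x = 0" if "x \<notin> K" for x
    using that closure_subset[of "{x. \<phi> x \<noteq> 0}"] unfolding K_def by auto
  have "partial_deriv b \<phi> x = 0" if x: "x \<notin> K" for x b
  proof -
    have "open (- K)" by (simp add: K_def open_Compl)
    have "(\<phi> has_derivative (\<lambda>_. 0)) (at x)"
      by (rule has_derivative_transform_within_open[OF has_derivative_const[of 0] \<open>open (- K)\<close>])
        (use x in \<open>auto simp: z\<close>)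
    from partial_deriv_eqI[OF this] show ?thesis .
  qed
  with K z show ?thesis by (rule that)
qed

lemma test_zero_outside: "\<phi> \<in> test_functions \<Omega> \<Longrightarrow> x \<notin> \<Omega> \<Longrightarrow> \<phi> x = 0"
  by (rule test_support[of \<phi> \<Omega>]) auto

lemma test_partial_zero_outside: "\<phi> \<in> test_functions \<Omega> \<Longrightarrow> x \<notin> \<Omega> \<Longrightarrow> partial_deriv b \<phi> x = 0"
  by (rule test_support[of \<phi> \<Omega>]) auto

lemma test_mono: "\<phi> \<in> test_functions \<Omega> \<Longrightarrow> \<Omega> \<subseteq> \<Omega>' \<Longrightarrow> \<phi> \<in> test_functions \<Omega>'"
  by (auto simp: test_functions_def)

lemma test_UNIV: "\<phi> \<in> test_functions \<Omega> \<Longrightarrow> test_fun \<phi>"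
  using test_mono by blast

lemma test_partial:
  assumes "\<phi> \<in> test_functions \<Omega>" "b \<in> Basis"
  shows "partial_deriv b \<phi> \<in> test_functions \<Omega>"
proof -
  obtain K where K: "compact K" "K \<subseteq> \<Omega>" "\<And>x b. x \<notin> K \<Longrightarrow> partial_deriv b \<phi> x = 0"
    using test_support[OF assms(1)] by metis
  show ?thesis
    by (rule test_functionsI[OF _ K]) (use test_C_k[OF assms(1), of "Suc _"] assms(2) in auto)
qed

lemma test_zero: "(\<lambda>x. 0) \<in> test_functions \<Omega>"
  by (rule test_functionsI[of _ "{}"]) (auto simp: C_k_const)

lemma test_mult:
  assumes "\<phi> \<in> test_functions \<Omega>" "\<And>k. C_k k f"
  shows "(\<lambda>x. f x * \<phi> x) \<in> test_functions \<Omega>"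
proof -
  obtain K where K: "compact K" "K \<subseteq> \<Omega>" "\<And>x. x \<notin> K \<Longrightarrow> \<phi> x = 0"
    using test_support[OF assms(1)] by metis
  show ?thesis
    by (rule test_functionsI[OF _ K(1,2)]) (use assms K(3) test_C_k in \<open>auto intro!: C_k_mult\<close>)
qed

lemma test_comb:
  assumes "\<phi> \<in> test_functions \<Omega>" "\<psi> \<in> test_functions \<Omega>"
  shows "(\<lambda>x. \<phi> x + c * \<psi> x) \<in> test_functions \<Omega>"
proof -
  obtain K where K: "compact K" "K \<subseteq> \<Omega>" "\<And>x. x \<notin> K \<Longrightarrow> \<phi> x = 0"
    using test_support[OF assms(1)] by metis
  obtain K' where K': "compact K'" "K' \<subseteq> \<Omega>" "\<And>x. x \<notin> K' \<Longrightarrow> \<psi> x = 0"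
    using test_support[OF assms(2)] by metis
  show ?thesis
    by (rule test_functionsI[OF _ compact_Un[OF K(1) K'(1)]])
      (use assms K K' test_C_k in \<open>auto intro!: C_k_add C_k_cmult\<close>)
qed

lemma test_cnj:
  assumes "\<phi> \<in> test_functions \<Omega>"
  shows "(\<lambda>x. cnj (\<phi> x)) \<in> test_functions \<Omega>"
proof -
  obtain K where K: "compact K" "K \<subseteq> \<Omega>" "\<And>x. x \<notin> K \<Longrightarrow> \<phi> x = 0"
    using test_support[OF assms(1)] by metis
  show ?thesis
    by (rule test_functionsI[OF _ K(1,2)]) (use assms K(3) test_C_k in \<open>auto intro!: C_k_cnj\<close>)
qed

lemma partial_deriv_comb:
  assumes "\<phi> differentiable at x" "\<psi> differentiable at x"
  shows "partial_deriv b (\<lambda>x. \<phi> x + c * \<psi> x) x = partial_deriv b \<phi> x + c * partial_deriv b \<psi> x"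
proof -
  have "(\<lambda>x. c * \<psi> x) differentiable at x" using assms(2) by (intro differentiable_mult) auto
  moreover have "partial_deriv b (\<lambda>x. c) x = 0"
    by (rule partial_deriv_eqI[where f' = "\<lambda>_. 0"]) simp
  ultimately show ?thesis using assms
    by (simp add: partial_deriv_add partial_deriv_mult)
qed

lemma integrable_continuous_compact_support:
  fixes f :: "'a::euclidean_space \<Rightarrow> 'b::{banach, second_countable_topology}"
  assumes "continuous_on UNIV f" "compact K" "\<And>x. x \<notin> K \<Longrightarrow> f x = 0"
  shows "integrable lborel f"
proof -
  have "integrable lborel (\<lambda>x. indicator K x *\<^sub>R f x)"
    by (rule borel_integrable_compact) (use assms continuous_on_subset[OF assms(1)] in auto)
  also have "(\<lambda>x. indicator K x *\<^sub>R f x) = f"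
    using assms(3) by (auto simp: fun_eq_iff indicator_def)
  finally show ?thesis .
qed

lemma test_borel: "test_fun \<phi> \<Longrightarrow> \<phi> \<in> borel_measurable borel"
  using test_continuous borel_measurable_continuous_onI by blast

lemma test_integrable: "test_fun \<phi> \<Longrightarrow> integrable lborel \<phi>"
  using test_support integrable_continuous_compact_support test_continuous by metis

lemma test_norm_sq_integrable:
  assumes "test_fun \<phi>"
  shows "integrable lborel (\<lambda>x. (cmod (\<phi> x))\<^sup>2)"
proof -
  obtain K where K: "compact K" "\<And>x. x \<notin> K \<Longrightarrow> \<phi> x = 0"
    using test_support[OF assms] by metis
  show ?thesis
    by (rule integrable_continuous_compact_support[OF _ K(1)])
      (use K(2) test_continuous[OF assms] in \<open>auto intro!: continuous_intros\<close>)
qed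

lemma test_bounded:
  assumes "test_fun \<phi>"
  obtains B where "B \<ge> 0" "\<And>x. cmod (\<phi> x) \<le> B"
proof -
  obtain K where K: "compact K" "\<And>x. x \<notin> K \<Longrightarrow> \<phi> x = 0"
    using test_support[OF assms] by metis
  have "bounded (\<phi> ` K)"
    by (intro compact_imp_bounded compact_continuous_image K continuous_on_subset[OF test_continuous[OF assms]]) auto
  then obtain B where B: "\<And>x. x \<in> K \<Longrightarrow> cmod (\<phi> x) \<le> B" by (auto simp: bounded_iff)
  show ?thesis
  proof (rule that[of "max 0 B"])
    show "cmod (\<phi> x) \<le> max 0 B" for x using B[of x] K(2)[of x] by (cases "x \<in> K") auto
  qed simp
qed

text \<open>The definitions integrate over \<open>lebesgue_on\<close>, whereas Fubini, translations
  and changes of variables are applied to \<open>lborel\<close>; this is the passage between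
  them.\<close>

lemma integral_lebesgue_on:
  fixes f :: "'a::euclidean_space \<Rightarrow> 'b::{banach, second_countable_topology}"
  assumes "\<Omega> \<in> sets borel" "f \<in> borel_measurable borel" "\<And>x. x \<notin> \<Omega> \<Longrightarrow> f x = 0"
  shows "(\<integral>x. f x \<partial>lebesgue_on \<Omega>) = (\<integral>x. f x \<partial>lborel)"
proof -
  have "(\<integral>x. f x \<partial>lebesgue_on \<Omega>) = (\<integral>x. indicator \<Omega> x *\<^sub>R f x \<partial>lebesgue)"
    by (rule integral_restrict_space) (use assms in auto)
  also have "(\<lambda>x. indicator \<Omega> x *\<^sub>R f x) = f"
    using assms(3) by (auto simp: fun_eq_iff indicator_def)
  also have "(\<integral>x. f x \<partial>lebesgue) = (\<integral>x. f x \<partial>lborel)"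
    by (rule integral_completion) (use assms in simp)
  finally show ?thesis .
qed

lemma integrable_lebesgue_on:
  fixes f :: "'a::euclidean_space \<Rightarrow> 'b::{banach, second_countable_topology}"
  assumes "\<Omega> \<in> sets borel" "integrable lborel f"
  shows "integrable (lebesgue_on \<Omega>) f"
proof -
  have "integrable lebesgue f" using assms(2) by (simp add: integrable_completion)
  then have "integrable lebesgue (\<lambda>x. indicator \<Omega> x *\<^sub>R f x)"
    by (rule integrable_mult_indicator[rotated]) (use assms in auto)
  then show ?thesis using assms(1) by (subst integrable_restrict_space) auto
qed

subsection \<open>Translations\<close>

lemma lborel_integral_translate:
  fixes f :: "'a::euclidean_space \<Rightarrow> 'b::{banach, second_countable_topology}"
  assumes "f \<in> borel_measurable borel"
  shows "(\<integral>x. f (x + w) \<partial>lborel) = (\<integral>x. f x \<partial>lborel)"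
proof -
  have "(\<integral>x. f x \<partial>lborel) = (\<integral>x. f x \<partial>distr lborel borel ((+) w))" by (simp add: lborel_distr_plus)
  also have "\<dots> = (\<integral>x. f (w + x) \<partial>lborel)" by (rule integral_distr) (use assms in auto)
  finally show ?thesis by (simp add: add.commute)
qed

lemma lborel_nn_integral_translate:
  fixes f :: "'a::euclidean_space \<Rightarrow> ennreal"
  assumes "f \<in> borel_measurable borel"
  shows "(\<integral>\<^sup>+x. f (x + w) \<partial>lborel) = (\<integral>\<^sup>+x. f x \<partial>lborel)"
proof -
  have "(\<integral>\<^sup>+x. f x \<partial>lborel) = (\<integral>\<^sup>+x. f x \<partial>distr lborel borel ((+) w))" by (simp add: lborel_distr_plus)
  also have "\<dots> = (\<integral>\<^sup>+x. f (w + x) \<partial>lborel)" by (rule nn_integral_distr) (use assms in auto)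
  finally show ?thesis by (simp add: add.commute)
qed

text \<open>Cauchy-Schwarz against the constant function on \<open>B\<close>, obtained by
  integrating 2 Re (cnj c g) \<le> |c|^2 / v + v |g|^2, where c is the integral itself and v the
  measure of \<open>B\<close>.\<close>

lemma integral_norm_sq_le:
  fixes g :: "'a::euclidean_space \<Rightarrow> complex"
  assumes B: "B \<in> sets borel" "emeasure lborel B < \<infinity>" "measure lborel B > 0"
    and int: "integrable lborel (\<lambda>x. indicator B x *\<^sub>R g x)" "integrable lborel (\<lambda>x. indicator B x * (cmod (g x))\<^sup>2)"
  shows "(cmod (\<integral>x. indicator B x *\<^sub>R g x \<partial>lborel))\<^sup>2 \<le> measure lborel B * (\<integral>x. indicator B x * (cmod (g x))\<^sup>2 \<partial>lborel)"
proof -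
  define c where "c = (\<integral>x. indicator B x *\<^sub>R g x \<partial>lborel)"
  define v where "v = measure lborel B"
  have v: "v > 0" using B by (simp add: v_def)
  have i1: "integrable lborel (\<lambda>x. indicator B x * ((cmod c)\<^sup>2 / v))"
    using B by (intro integrable_mult_left) (simp add: integrable_indicator_iff)
  have i2: "integrable lborel (\<lambda>x. v * (indicator B x * (cmod (g x))\<^sup>2))"
    using int(2) by simp
  have i3: "integrable lborel (\<lambda>x. cnj c * (indicator B x *\<^sub>R g x))"
    by (rule integrable_mult_right[OF int(1)])
  have "2 * (cmod c)\<^sup>2 = 2 * Re (cnj c * c)"
    by (metis Re_complex_of_real complex_norm_square mult.commute)
  also have "cnj c * c = (\<integral>x. cnj c * (indicator B x *\<^sub>R g x) \<partial>lborel)"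
    by (simp only: integral_mult_right_zero c_def[symmetric])
  also have "2 * Re \<dots> = (\<integral>x. 2 * Re (cnj c * (indicator B x *\<^sub>R g x)) \<partial>lborel)"
    by (simp only: integral_mult_right_zero integral_Re[OF i3])
  also have "\<dots> \<le> (\<integral>x. indicator B x * ((cmod c)\<^sup>2 / v) + v * (indicator B x * (cmod (g x))\<^sup>2) \<partial>lborel)"
  proof (rule integral_mono)
    show "integrable lborel (\<lambda>x. 2 * Re (cnj c * (indicator B x *\<^sub>R g x)))"
      using integrable_Re[OF i3] by simp
    show "integrable lborel (\<lambda>x. indicator B x * ((cmod c)\<^sup>2 / v) + v * (indicator B x * (cmod (g x))\<^sup>2))"
      using i1 i2 by simp
    fix x
    have "Re (cnj c * g x) \<le> cmod c * cmod (g x)"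
      using complex_Re_le_cmod[of "cnj c * g x"] by (simp add: norm_mult)
    moreover have "0 \<le> (cmod c / sqrt v - sqrt v * cmod (g x))\<^sup>2" by simp
    then have "2 * (cmod c * cmod (g x)) \<le> (cmod c)\<^sup>2 / v + v * (cmod (g x))\<^sup>2"
      using v by (simp add: power2_diff power_divide power_mult_distrib)
    ultimately have "2 * Re (cnj c * g x) \<le> (cmod c)\<^sup>2 / v + v * (cmod (g x))\<^sup>2" by linarith
    then show "2 * Re (cnj c * (indicator B x *\<^sub>R g x))
        \<le> indicator B x * ((cmod c)\<^sup>2 / v) + v * (indicator B x * (cmod (g x))\<^sup>2)"
      by (auto simp: indicator_def)
  qed
  also have "\<dots> = v * ((cmod c)\<^sup>2 / v) + v * (\<integral>x. indicator B x * (cmod (g x))\<^sup>2 \<partial>lborel)"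
    using i1 i2 B by (simp add: v_def)
  finally show ?thesis using v unfolding c_def[symmetric] v_def[symmetric] by simp
qed

definition grad_sq :: "('a::euclidean_space \<Rightarrow> complex) \<Rightarrow> 'a \<Rightarrow> real" where
  "grad_sq \<phi> x = (\<Sum>b\<in>Basis. (cmod (partial_deriv b \<phi> x))\<^sup>2)"

lemma grad_sq_nonneg: "0 \<le> grad_sq \<phi> x"
  by (simp add: grad_sq_def sum_nonneg)

lemma grad_sq_integral_nonneg: "0 \<le> (\<integral>x. grad_sq \<phi> x \<partial>lborel)"
  by (rule Bochner_Integration.integral_nonneg) (rule grad_sq_nonneg)

lemma grad_sq_integrable: "test_fun \<phi> \<Longrightarrow> integrable lborel (grad_sq \<phi>)"
  unfolding grad_sq_def
  by (intro Bochner_Integration.integrable_sum test_norm_sq_integrable test_partial)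

lemma grad_sq_continuous: "test_fun \<phi> \<Longrightarrow> continuous_on UNIV (grad_sq \<phi>)"
  unfolding grad_sq_def
  by (intro continuous_intros test_continuous[OF test_partial])

lemma frechet_norm_sq_le:
  assumes "test_fun \<phi>"
  shows "(cmod (frechet_derivative \<phi> (at x) h))\<^sup>2 \<le> (norm h)\<^sup>2 * grad_sq \<phi> x"
proof -
  have "cmod (frechet_derivative \<phi> (at x) h) \<le> (\<Sum>b\<in>Basis. cmod (complex_of_real (h \<bullet> b) * partial_deriv b \<phi> x))"
    unfolding frechet_derivative_eq_sum_partial[OF test_differentiable[OF assms]] by (rule norm_sum)
  also have "\<dots> = (\<Sum>b\<in>Basis. \<bar>h \<bullet> b\<bar> * cmod (partial_deriv b \<phi> x))" by (simp add: norm_mult)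
  finally have "(cmod (frechet_derivative \<phi> (at x) h))\<^sup>2 \<le> (\<Sum>b\<in>Basis. \<bar>h \<bullet> b\<bar> * cmod (partial_deriv b \<phi> x))\<^sup>2"
    by (simp add: power_mono)
  also have "\<dots> \<le> (\<Sum>b\<in>Basis. \<bar>h \<bullet> b\<bar>\<^sup>2) * (\<Sum>b\<in>Basis. (cmod (partial_deriv b \<phi> x))\<^sup>2)"
    by (rule Cauchy_Schwarz_ineq_sum)
  also have "(\<Sum>b\<in>Basis. \<bar>h \<bullet> b\<bar>\<^sup>2) = (norm h)\<^sup>2"
    unfolding power2_norm_eq_inner by (subst euclidean_inner) (simp add: power2_eq_square)
  finally show ?thesis by (simp add: grad_sq_def)
qed

text \<open>The fundamental theorem of calculus on the segment from \<open>x\<close> to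
  \<open>x + w\<close>, then Cauchy-Schwarz in the parameter.\<close>

lemma translation_pointwise:
  assumes "test_fun \<phi>"
  shows "(cmod (\<phi> (x + w) - \<phi> x))\<^sup>2 \<le> (\<integral>t. indicator {0..1} t * ((norm w)\<^sup>2 * grad_sq \<phi> (x + t *\<^sub>R w)) \<partial>lborel)"
proof -
  define g where "g t = frechet_derivative \<phi> (at (x + t *\<^sub>R w)) w" for t
  have geq: "g = (\<lambda>t. \<Sum>b\<in>Basis. complex_of_real (w \<bullet> b) * partial_deriv b \<phi> (x + t *\<^sub>R w))"
    unfolding g_def frechet_derivative_eq_sum_partial[OF test_differentiable[OF assms]] ..
  have gc: "continuous_on UNIV g"
    unfolding geq
    by (intro continuous_intros continuous_on_compose2[OF test_continuous[OF test_partial[OF assms]]]) auto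
  have d: "((\<lambda>t. \<phi> (x + t *\<^sub>R w)) has_vector_derivative g t) (at t within {0..1})" for t
  proof -
    have "((\<lambda>t. x + t *\<^sub>R w) has_derivative (\<lambda>h. h *\<^sub>R w)) (at t within {0..1})"
      by (auto intro!: derivative_eq_intros)
    from has_derivative_compose[OF this differentiable_has_derivative[OF test_differentiable[OF assms]]]
    have "((\<lambda>t. \<phi> (x + t *\<^sub>R w)) has_derivative (\<lambda>h. frechet_derivative \<phi> (at (x + t *\<^sub>R w)) (h *\<^sub>R w))) (at t within {0..1})" .
    moreover have "frechet_derivative \<phi> (at (x + t *\<^sub>R w)) (h *\<^sub>R w) = h *\<^sub>R g t" for h
      unfolding g_def
      by (rule linear_simps(5)[OF has_derivative_bounded_linear[OF differentiable_has_derivative[OF test_differentiable[OF assms]]]])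
    ultimately show ?thesis unfolding has_vector_derivative_def by simp
  qed
  have eq: "(\<integral>t. indicator {0..1} t *\<^sub>R g t \<partial>lborel) = \<phi> (x + w) - \<phi> x"
    using integral_FTC_Icc[of 0 1 "\<lambda>t. \<phi> (x + t *\<^sub>R w)" g] d continuous_on_subset[OF gc] by auto
  have i1: "integrable lborel (\<lambda>t. indicator {0..1} t *\<^sub>R g t)"
    by (intro borel_integrable_compact continuous_on_subset[OF gc]) auto
  have i2: "integrable lborel (\<lambda>t. indicator {0..1} t * (cmod (g t))\<^sup>2)"
    using borel_integrable_compact[of "{0..1::real}" "\<lambda>t. (cmod (g t))\<^sup>2"]
      continuous_on_power[OF continuous_on_norm[OF continuous_on_subset[OF gc subset_UNIV]]] by simp
  have "continuous_on UNIV (\<lambda>t. (norm w)\<^sup>2 * grad_sq \<phi> (x + t *\<^sub>R w))"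
    by (intro continuous_intros continuous_on_compose2[OF grad_sq_continuous[OF assms]]) auto
  then have i3: "integrable lborel (\<lambda>t. indicator {0..1} t * ((norm w)\<^sup>2 * grad_sq \<phi> (x + t *\<^sub>R w)))"
    using borel_integrable_compact[of "{0..1::real}" "\<lambda>t. (norm w)\<^sup>2 * grad_sq \<phi> (x + t *\<^sub>R w)"] continuous_on_subset
    by (auto simp del: continuous_on_mult_const)
  have "(cmod (\<phi> (x + w) - \<phi> x))\<^sup>2 \<le> measure lborel {0..1::real} * (\<integral>t. indicator {0..1} t * (cmod (g t))\<^sup>2 \<partial>lborel)"
    unfolding eq[symmetric] by (rule integral_norm_sq_le) (use i1 i2 in auto)
  also have "\<dots> \<le> (\<integral>t. indicator {0..1} t * ((norm w)\<^sup>2 * grad_sq \<phi> (x + t *\<^sub>R w)) \<partial>lborel)"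
    using frechet_norm_sq_le[OF assms, of _ w] unfolding g_def[symmetric]
    by simp (intro integral_mono i2 i3, auto simp: indicator_def g_def)
  finally show ?thesis .
qed

text \<open>After exchanging the two integrals, translation invariance removes the dependence on
  \<open>t\<close>.\<close>

lemma translation_estimate:
  assumes "test_fun \<phi>"
  shows "(\<integral>\<^sup>+x. ennreal ((cmod (\<phi> (x + w) - \<phi> x))\<^sup>2) \<partial>lborel) \<le> ennreal ((norm w)\<^sup>2 * (\<integral>x. grad_sq \<phi> x \<partial>lborel))"
proof -
  let ?G = "grad_sq \<phi>"
  have Gm [measurable]: "?G \<in> borel_measurable borel"
    by (rule borel_measurable_continuous_onI[OF grad_sq_continuous[OF assms]])
  have "(\<integral>\<^sup>+x. ennreal ((cmod (\<phi> (x + w) - \<phi> x))\<^sup>2) \<partial>lborel)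
      \<le> (\<integral>\<^sup>+x. (\<integral>\<^sup>+t. indicator {0..1} t * ennreal ((norm w)\<^sup>2 * ?G (x + t *\<^sub>R w)) \<partial>lborel) \<partial>lborel)"
  proof (rule nn_integral_mono)
    fix x
    let ?f = "\<lambda>t::real. indicator {0..1} t * ((norm w)\<^sup>2 * ?G (x + t *\<^sub>R w))"
    have "continuous_on {0..1} (\<lambda>t::real. (norm w)\<^sup>2 * ?G (x + t *\<^sub>R w))"
      by (intro continuous_intros continuous_on_compose2[OF grad_sq_continuous[OF assms]]) auto
    then have i: "integrable lborel ?f"
      using borel_integrable_compact[of "{0..1::real}" "\<lambda>t. (norm w)\<^sup>2 * ?G (x + t *\<^sub>R w)"] by simp
    have "ennreal ((cmod (\<phi> (x + w) - \<phi> x))\<^sup>2) \<le> ennreal (\<integral>t. ?f t \<partial>lborel)"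
      by (rule ennreal_leI[OF translation_pointwise[OF assms]])
    also have "\<dots> = (\<integral>\<^sup>+t. ennreal (?f t) \<partial>lborel)"
      by (rule nn_integral_eq_integral[symmetric, OF i]) (auto simp: grad_sq_nonneg)
    also have "\<dots> = (\<integral>\<^sup>+t. indicator {0..1} t * ennreal ((norm w)\<^sup>2 * ?G (x + t *\<^sub>R w)) \<partial>lborel)"
      by (intro nn_integral_cong) (auto simp: indicator_def)
    finally show "ennreal ((cmod (\<phi> (x + w) - \<phi> x))\<^sup>2)
        \<le> (\<integral>\<^sup>+t. indicator {0..1} t * ennreal ((norm w)\<^sup>2 * ?G (x + t *\<^sub>R w)) \<partial>lborel)" .
  qed
  also have "\<dots> = (\<integral>\<^sup>+t. (\<integral>\<^sup>+x. indicator {0..1} t * ennreal ((norm w)\<^sup>2 * ?G (x + t *\<^sub>R w)) \<partial>lborel) \<partial>lborel)"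
    by (rule lborel_pair.Fubini') measurable
  also have "\<dots> = (\<integral>\<^sup>+t. indicator {0..1} t * (\<integral>\<^sup>+x. ennreal ((norm w)\<^sup>2 * ?G x) \<partial>lborel) \<partial>(lborel :: real measure))"
    by (simp add: nn_integral_cmult lborel_nn_integral_translate[of "\<lambda>x. ennreal ((norm w)\<^sup>2 * ?G x)"])
  also have "\<dots> = (\<integral>\<^sup>+x. ennreal ((norm w)\<^sup>2 * ?G x) \<partial>lborel)"
    by (simp add: nn_integral_multc)
  also have "\<dots> = ennreal (\<integral>x. (norm w)\<^sup>2 * ?G x \<partial>lborel)"
    by (rule nn_integral_eq_integral) (use grad_sq_integrable[OF assms] in \<open>auto simp: grad_sq_nonneg\<close>)
  finally show ?thesis by simp
qed


subsection \<open>Quantitative Rellich compactness\<close>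

text \<open>Comparison of \<open>\<phi>\<close> with its averages over balls of radius \<open>r\<close> centred at a finite net.\<close>

theorem rellich:
  fixes K :: "'a::euclidean_space set"
  assumes K: "bounded K" "K \<in> sets borel" and e: "e > 0"
  shows "\<exists>(X :: 'a set) r C. finite X \<and> r > 0 \<and> C \<ge> 0 \<and> (\<forall>\<phi>. test_fun \<phi> \<longrightarrow>
    (\<integral>x. indicator K x * (cmod (\<phi> x))\<^sup>2 \<partial>lborel)
      \<le> e * (\<integral>x. grad_sq \<phi> x \<partial>lborel) + C * (\<Sum>y\<in>X. (cmod (\<integral>x. indicator (ball y r) x *\<^sub>R \<phi> x \<partial>lborel))\<^sup>2))"
proof -
  \<comment> \<open>The factor of r^2 that comes out at the end: 2 / v from the pointwise bound,
    times the volume 2^DIM v of the doubled ball, times (2 r)^2 from the translation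
    estimate.\<close>
  define d where "d = 8 * (2::real) ^ DIM('a)"
  have d: "d > 0" by (simp add: d_def)
  define r where "r = sqrt (e / d)"
  have r: "r > 0" "d * r\<^sup>2 = e" using e d by (auto simp: r_def)
  define v where "v = measure lborel (ball (0::'a) r)"
  have vy: "measure lborel (ball y r) = v" for y :: 'a
    unfolding v_def using content_ball_conv_unit_ball[of r y] content_ball_conv_unit_ball[of r "0::'a"] r(1) by simp
  have v: "v > 0" unfolding v_def using content_ball_pos[OF r(1)] by simp
  have v2: "measure lborel (ball (0::'a) (2 * r)) = 2 ^ DIM('a) * v"
    unfolding v_def using content_ball_conv_unit_ball[of "2 * r" "0::'a"] content_ball_conv_unit_ball[of r "0::'a"] r(1)
    by (simp add: power_mult_distrib)
  have "compact (closure K)" using K(1) by simp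
  then have "\<forall>e>0. \<exists>X. finite X \<and> closure K \<subseteq> (\<Union>x\<in>X. ball x e)"
    unfolding compact_eq_totally_bounded by (rule conjunct2)
  then obtain X where X': "finite X" "closure K \<subseteq> (\<Union>x\<in>X. ball x r)" using r(1) by meson
  have X: "finite X" "K \<subseteq> (\<Union>x\<in>X. ball x r)" using X' closure_subset[of K] by auto
  have Kfin: "emeasure lborel K < \<infinity>" using K(1) by (rule emeasure_bounded_finite)
  define C where "C = 2 * measure lborel K / v\<^sup>2"
  have C: "C \<ge> 0" by (simp add: C_def)
  have "(\<integral>x. indicator K x * (cmod (\<phi> x))\<^sup>2 \<partial>lborel)
      \<le> e * (\<integral>x. grad_sq \<phi> x \<partial>lborel) + C * (\<Sum>y\<in>X. (cmod (\<integral>x. indicator (ball y r) x *\<^sub>R \<phi> x \<partial>lborel))\<^sup>2)"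
    if t: "test_fun \<phi>" for \<phi>
  proof -
    let ?m = "\<lambda>y. (\<integral>x. indicator (ball y r) x *\<^sub>R \<phi> x \<partial>lborel)"
    let ?S = "\<Sum>y\<in>X. (cmod (?m y))\<^sup>2"
    have S: "0 \<le> ?S" by (simp add: sum_nonneg)
    have [measurable]: "ball y s \<in> sets borel" for y :: 'a and s by simp
    have phm [measurable]: "\<phi> \<in> borel_measurable borel" by (rule test_borel[OF t])
    \<comment> \<open>The squared oscillation around \<open>x\<close>. The radius is 2 r because two
      points of one ball of radius r differ by less than that.\<close>
    define F where "F x = (\<integral>\<^sup>+w. indicator (ball 0 (2 * r)) w * ennreal ((cmod (\<phi> (x + w) - \<phi> x))\<^sup>2) \<partial>lborel)" for x
    have Fm [measurable]: "F \<in> borel_measurable borel" unfolding F_def by measurable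
    \<comment> \<open>The deviation of \<phi> at \<open>x\<close> from its mean over a ball
      containing \<open>x\<close> is the mean of the differences, so its square is at most the mean
      of their squares.\<close>
    have avg: "ennreal ((cmod (\<phi> x - ?m y / v))\<^sup>2) \<le> ennreal (1 / v) * F x" if xy: "x \<in> ball y r" for x y
    proof -
      let ?g = "\<lambda>z. \<phi> x - \<phi> z"
      have gc: "continuous_on UNIV ?g" using test_continuous[OF t] by (intro continuous_intros)
      have cb: "integrable lborel (\<lambda>z. indicator (ball y r) z *\<^sub>R h z)" if "continuous_on UNIV h" for h :: "'a \<Rightarrow> 'b::{banach,second_countable_topology}"
      proof -
        have "integrable lborel (\<lambda>z. indicator (ball y r) z *\<^sub>R (indicator (cball y r) z *\<^sub>R h z))"
          by (intro integrable_mult_indicator borel_integrable_compact continuous_on_subset[OF that]) auto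
        also have "(\<lambda>z. indicator (ball y r) z *\<^sub>R (indicator (cball y r) z *\<^sub>R h z)) = (\<lambda>z. indicator (ball y r) z *\<^sub>R h z)"
          by (auto simp: fun_eq_iff indicator_def)
        finally show ?thesis .
      qed
      have i1: "integrable lborel (\<lambda>z. indicator (ball y r) z *\<^sub>R ?g z)" by (rule cb[OF gc])
      have i2: "integrable lborel (\<lambda>z. indicator (ball y r) z * (cmod (?g z))\<^sup>2)"
        using cb[of "\<lambda>z. (cmod (?g z))\<^sup>2"] gc continuous_on_power[OF continuous_on_norm[OF gc]] by simp
      have "(\<integral>z. indicator (ball y r) z *\<^sub>R ?g z \<partial>lborel) = (\<integral>z. indicator (ball y r) z *\<^sub>R \<phi> x \<partial>lborel) - ?m y"
        using cb[OF continuous_on_const, of "\<phi> x"] cb[OF test_continuous[OF t]]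
        by (simp add: scaleR_diff_right)
      also have "(\<integral>z. indicator (ball y r) z *\<^sub>R \<phi> x \<partial>lborel) = v *\<^sub>R \<phi> x"
        using integral_scaleR_left[of "\<phi> x" lborel "indicator (ball y r) :: 'a \<Rightarrow> real"]
          emeasure_lborel_ball_finite[of y r] by (simp add: vy)
      finally have eq: "(\<integral>z. indicator (ball y r) z *\<^sub>R ?g z \<partial>lborel) = v *\<^sub>R \<phi> x - ?m y" .
      have "(cmod (\<integral>z. indicator (ball y r) z *\<^sub>R ?g z \<partial>lborel))\<^sup>2
          \<le> measure lborel (ball y r) * (\<integral>z. indicator (ball y r) z * (cmod (?g z))\<^sup>2 \<partial>lborel)"
        by (rule integral_norm_sq_le) (use i1 i2 vy v emeasure_lborel_ball_finite in auto)
      then have "(cmod (v *\<^sub>R \<phi> x - ?m y))\<^sup>2 \<le> v * (\<integral>z. indicator (ball y r) z * (cmod (?g z))\<^sup>2 \<partial>lborel)"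
        unfolding eq vy .
      moreover have "cmod (v *\<^sub>R \<phi> x - ?m y) = v * cmod (\<phi> x - ?m y / v)"
      proof -
        have "v *\<^sub>R \<phi> x - ?m y = complex_of_real v * (\<phi> x - ?m y / v)"
          using v by (simp add: scaleR_conv_of_real right_diff_distrib)
        then show ?thesis using v by (simp add: norm_mult)
      qed
      ultimately have "v * (v * (cmod (\<phi> x - ?m y / v))\<^sup>2) \<le> v * (\<integral>z. indicator (ball y r) z * (cmod (?g z))\<^sup>2 \<partial>lborel)"
        by (simp add: power_mult_distrib power2_eq_square mult_ac)
      then have "v * (cmod (\<phi> x - ?m y / v))\<^sup>2 \<le> (\<integral>z. indicator (ball y r) z * (cmod (?g z))\<^sup>2 \<partial>lborel)"
        using v by (simp only: mult_le_cancel_left_pos)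
      then have "(cmod (\<phi> x - ?m y / v))\<^sup>2 \<le> (1 / v) * (\<integral>z. indicator (ball y r) z * (cmod (?g z))\<^sup>2 \<partial>lborel)"
        using v by (simp add: field_simps)
      then have "ennreal ((cmod (\<phi> x - ?m y / v))\<^sup>2) \<le> ennreal ((1 / v) * (\<integral>z. indicator (ball y r) z * (cmod (?g z))\<^sup>2 \<partial>lborel))"
        by (rule ennreal_leI)
      also have "\<dots> = ennreal (1 / v) * ennreal (\<integral>z. indicator (ball y r) z * (cmod (?g z))\<^sup>2 \<partial>lborel)"
        using v by (intro ennreal_mult) (auto intro!: integral_nonneg)
      also have "ennreal (\<integral>z. indicator (ball y r) z * (cmod (?g z))\<^sup>2 \<partial>lborel)
          = (\<integral>\<^sup>+z. ennreal (indicator (ball y r) z * (cmod (?g z))\<^sup>2) \<partial>lborel)"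
        by (rule nn_integral_eq_integral[symmetric, OF i2]) auto
      also have "\<dots> = (\<integral>\<^sup>+w. ennreal (indicator (ball y r) (w + x) * (cmod (?g (w + x)))\<^sup>2) \<partial>lborel)"
        by (rule lborel_nn_integral_translate[symmetric]) measurable
      also have "\<dots> \<le> F x"
        unfolding F_def
      proof (rule nn_integral_mono)
        fix w :: 'a
        have "w \<in> ball 0 (2 * r)" if "w + x \<in> ball y r"
        proof -
          have "norm w = dist (w + x) x" by (simp add: dist_norm)
          also have "\<dots> \<le> dist (w + x) y + dist y x" by (rule dist_triangle)
          also have "\<dots> < r + r" using that xy by (intro add_strict_mono) (auto simp: dist_commute)
          finally show ?thesis by simp
        qed
        then show "ennreal (indicator (ball y r) (w + x) * (cmod (?g (w + x)))\<^sup>2)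
            \<le> indicator (ball 0 (2 * r)) w * ennreal ((cmod (\<phi> (x + w) - \<phi> x))\<^sup>2)"
          by (auto simp: indicator_def norm_minus_commute add.commute)
      qed
      finally show ?thesis by (simp add: mult_left_mono)
    qed
    have pt: "ennreal (indicator K x * (cmod (\<phi> x))\<^sup>2) \<le> ennreal (2 / v) * F x + ennreal (2 / v\<^sup>2 * ?S) * indicator K x" for x
    proof (cases "x \<in> K")
      case True
      then obtain y where y: "y \<in> X" "x \<in> ball y r" using X(2) by blast
      let ?a = "\<phi> x - ?m y / v"
      have "(cmod (\<phi> x))\<^sup>2 \<le> (cmod ?a + cmod (?m y / v))\<^sup>2"
        by (intro power_mono) (use norm_triangle_ineq[of ?a "?m y / v"] in auto)
      also have "\<dots> \<le> 2 * (cmod ?a)\<^sup>2 + 2 * (cmod (?m y / v))\<^sup>2"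
        using zero_le_power2[of "cmod ?a - cmod (?m y / v)"] unfolding power2_sum power2_diff by linarith
      also have "(cmod (?m y / v))\<^sup>2 = (cmod (?m y))\<^sup>2 / v\<^sup>2" by (simp add: norm_divide power_divide)
      also have "2 * ((cmod (?m y))\<^sup>2 / v\<^sup>2) \<le> 2 / v\<^sup>2 * ?S"
        using member_le_sum[of y X "\<lambda>y. (cmod (?m y))\<^sup>2"] y(1) X(1) v by (simp add: divide_right_mono)
      finally have "(cmod (\<phi> x))\<^sup>2 \<le> 2 * (cmod ?a)\<^sup>2 + 2 / v\<^sup>2 * ?S" by simp
      then have "ennreal ((cmod (\<phi> x))\<^sup>2) \<le> ennreal (2 * (cmod ?a)\<^sup>2 + 2 / v\<^sup>2 * ?S)" by (rule ennreal_leI)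
      also have "\<dots> = ennreal (2 * (cmod ?a)\<^sup>2) + ennreal (2 / v\<^sup>2 * ?S)" using S by (intro ennreal_plus) auto
      also have "ennreal (2 * (cmod ?a)\<^sup>2) = 2 * ennreal ((cmod ?a)\<^sup>2)" by (simp add: ennreal_mult)
      also have "\<dots> \<le> 2 * (ennreal (1 / v) * F x)" by (intro mult_left_mono avg y) auto
      also have "\<dots> = ennreal (2 / v) * F x"
      proof -
        have "ennreal (2 / v) = ennreal 2 * ennreal (1 / v)"
          using v ennreal_mult[of 2 "1 / v"] by simp
        then show ?thesis by (simp add: mult.assoc)
      qed
      finally show ?thesis using True by (simp add: add_mono)
    qed simp
    have Fint: "(\<integral>\<^sup>+x. F x \<partial>lborel) \<le> ennreal (2 ^ DIM('a) * v * ((2 * r)\<^sup>2 * (\<integral>x. grad_sq \<phi> x \<partial>lborel)))"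
    proof -
      have G0: "0 \<le> (\<integral>x. grad_sq \<phi> x \<partial>lborel)" by (rule grad_sq_integral_nonneg)
      have "(\<integral>\<^sup>+x. F x \<partial>lborel) = (\<integral>\<^sup>+w. (\<integral>\<^sup>+x. indicator (ball 0 (2 * r)) w * ennreal ((cmod (\<phi> (x + w) - \<phi> x))\<^sup>2) \<partial>lborel) \<partial>lborel)"
        unfolding F_def by (rule lborel_pair.Fubini') measurable
      also have "\<dots> = (\<integral>\<^sup>+w. indicator (ball 0 (2 * r)) w * (\<integral>\<^sup>+x. ennreal ((cmod (\<phi> (x + w) - \<phi> x))\<^sup>2) \<partial>lborel) \<partial>lborel)"
        by (intro nn_integral_cong nn_integral_cmult) measurable
      also have "\<dots> \<le> (\<integral>\<^sup>+w. indicator (ball (0::'a) (2 * r)) w * ennreal ((2 * r)\<^sup>2 * (\<integral>x. grad_sq \<phi> x \<partial>lborel)) \<partial>lborel)"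
      proof (rule nn_integral_mono)
        fix w :: 'a
        show "indicator (ball 0 (2 * r)) w * (\<integral>\<^sup>+x. ennreal ((cmod (\<phi> (x + w) - \<phi> x))\<^sup>2) \<partial>lborel)
            \<le> indicator (ball 0 (2 * r)) w * ennreal ((2 * r)\<^sup>2 * (\<integral>x. grad_sq \<phi> x \<partial>lborel))"
        proof (cases "w \<in> ball 0 (2 * r)")
          case True
          then have "(norm w)\<^sup>2 \<le> (2 * r)\<^sup>2" by (intro power_mono) auto
          then have "ennreal ((norm w)\<^sup>2 * (\<integral>x. grad_sq \<phi> x \<partial>lborel)) \<le> ennreal ((2 * r)\<^sup>2 * (\<integral>x. grad_sq \<phi> x \<partial>lborel))"
            by (intro ennreal_leI mult_right_mono G0)
          then show ?thesis using translation_estimate[OF t, of w] True by simp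
        qed simp
      qed
      also have "\<dots> = emeasure lborel (ball (0::'a) (2 * r)) * ennreal ((2 * r)\<^sup>2 * (\<integral>x. grad_sq \<phi> x \<partial>lborel))"
        by (subst nn_integral_multc) auto
      also have "emeasure lborel (ball (0::'a) (2 * r)) = ennreal (2 ^ DIM('a) * v)"
        unfolding v2[symmetric] by (rule emeasure_eq_ennreal_measure) (use emeasure_lborel_ball_finite[of "0::'a" "2 * r"] in auto)
      also have "ennreal (2 ^ DIM('a) * v) * ennreal ((2 * r)\<^sup>2 * (\<integral>x. grad_sq \<phi> x \<partial>lborel))
          = ennreal (2 ^ DIM('a) * v * ((2 * r)\<^sup>2 * (\<integral>x. grad_sq \<phi> x \<partial>lborel)))"
        using v G0 by (intro ennreal_mult[symmetric]) auto
      finally show ?thesis .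
    qed
    have G0: "0 \<le> (\<integral>x. grad_sq \<phi> x \<partial>lborel)" by (rule grad_sq_integral_nonneg)
    have "integrable lborel (\<lambda>x. indicator K x *\<^sub>R (cmod (\<phi> x))\<^sup>2)"
      by (rule integrable_mult_indicator) (use K test_norm_sq_integrable[OF t] in auto)
    then have iK: "integrable lborel (\<lambda>x. indicator K x * (cmod (\<phi> x))\<^sup>2)" by simp
    have "ennreal (\<integral>x. indicator K x * (cmod (\<phi> x))\<^sup>2 \<partial>lborel) = (\<integral>\<^sup>+x. ennreal (indicator K x * (cmod (\<phi> x))\<^sup>2) \<partial>lborel)"
      by (rule nn_integral_eq_integral[symmetric, OF iK]) auto
    also have "\<dots> \<le> (\<integral>\<^sup>+x. ennreal (2 / v) * F x + ennreal (2 / v\<^sup>2 * ?S) * indicator K x \<partial>lborel)"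
      by (rule nn_integral_mono) (rule pt)
    also have "\<dots> = ennreal (2 / v) * (\<integral>\<^sup>+x. F x \<partial>lborel) + ennreal (2 / v\<^sup>2 * ?S) * emeasure lborel K"
      using K(2) by (simp add: nn_integral_add nn_integral_cmult)
    also have "emeasure lborel K = ennreal (measure lborel K)"
      by (rule emeasure_eq_ennreal_measure) (use Kfin in auto)
    also have "ennreal (2 / v\<^sup>2 * ?S) * ennreal (measure lborel K) = ennreal (C * ?S)"
      using S by (subst ennreal_mult[symmetric]) (auto simp: C_def mult_ac)
    also have "ennreal (2 / v) * (\<integral>\<^sup>+x. F x \<partial>lborel) \<le> ennreal (2 / v) * ennreal (2 ^ DIM('a) * v * ((2 * r)\<^sup>2 * (\<integral>x. grad_sq \<phi> x \<partial>lborel)))"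
      by (rule mult_left_mono[OF Fint]) simp
    also have "\<dots> = ennreal (2 / v * (2 ^ DIM('a) * v * ((2 * r)\<^sup>2 * (\<integral>x. grad_sq \<phi> x \<partial>lborel))))"
      using v G0 by (intro ennreal_mult[symmetric]) auto
    also have "2 / v * (2 ^ DIM('a) * v * ((2 * r)\<^sup>2 * (\<integral>x. grad_sq \<phi> x \<partial>lborel))) = (d * r\<^sup>2) * (\<integral>x. grad_sq \<phi> x \<partial>lborel)"
      using v by (simp add: d_def power_mult_distrib)
    also have "\<dots> = e * (\<integral>x. grad_sq \<phi> x \<partial>lborel)" by (simp only: r(2))
    finally have "ennreal (\<integral>x. indicator K x * (cmod (\<phi> x))\<^sup>2 \<partial>lborel)
        \<le> ennreal (e * (\<integral>x. grad_sq \<phi> x \<partial>lborel)) + ennreal (C * ?S)" by simp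
    also have "\<dots> = ennreal (e * (\<integral>x. grad_sq \<phi> x \<partial>lborel) + C * ?S)"
      using e G0 C S by (intro ennreal_plus[symmetric]) auto
    finally show ?thesis using e G0 C S by (subst (asm) ennreal_le_iff) auto
  qed
  then show ?thesis using X(1) r(1) C by blast
qed

subsection \<open>Integration by parts\<close>

lemma test_lipschitz:
  assumes t: "test_fun \<phi>"
  obtains B where "B \<ge> 0" "\<And>x y. cmod (\<phi> x - \<phi> y) \<le> B * norm (x - y)"
proof -
  have "\<exists>B. \<forall>b\<in>Basis. \<forall>x. cmod (partial_deriv b \<phi> x) \<le> B b"
  proof (rule bchoice, rule ballI)
    fix b :: 'a assume "b \<in> Basis"
    from test_bounded[OF test_partial[OF t this]] show "\<exists>B. \<forall>x. cmod (partial_deriv b \<phi> x) \<le> B" by metis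
  qed
  then obtain B where B: "\<And>b x. b \<in> Basis \<Longrightarrow> cmod (partial_deriv b \<phi> x) \<le> B b" by blast
  have "cmod (frechet_derivative \<phi> (at x) h) \<le> (\<Sum>b\<in>Basis. B b) * norm h" for x h
  proof -
    have "cmod (frechet_derivative \<phi> (at x) h) \<le> (\<Sum>b\<in>Basis. cmod (complex_of_real (h \<bullet> b) * partial_deriv b \<phi> x))"
      unfolding frechet_derivative_eq_sum_partial[OF test_differentiable[OF t]] by (rule norm_sum)
    also have "\<dots> \<le> (\<Sum>b\<in>Basis. norm h * B b)"
      unfolding norm_mult by (intro sum_mono mult_mono B) (auto simp: Basis_le_norm)
    finally show ?thesis by (simp add: sum_distrib_left mult.commute)
  qed
  then have on: "onorm (frechet_derivative \<phi> (at x)) \<le> (\<Sum>b\<in>Basis. B b)" for x by (intro onorm_le) auto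
  have "cmod (\<phi> x - \<phi> y) \<le> (\<Sum>b\<in>Basis. B b) * norm (x - y)" for x y
    using differentiable_bound[of UNIV \<phi> "\<lambda>x. frechet_derivative \<phi> (at x)" "\<Sum>b\<in>Basis. B b" x y]
      differentiable_has_derivative[OF test_differentiable[OF t]] on by auto
  moreover have "0 \<le> (\<Sum>b\<in>Basis. B b)" by (intro sum_nonneg) (use B norm_ge_zero order_trans in blast)
  ultimately show ?thesis using that by blast
qed

text \<open>Difference quotients have integral zero by translation invariance, and the Lipschitz
  bound dominates them in the passage to the limit.\<close>

lemma integral_partial_test:
  assumes t: "test_fun \<phi>" and b: "b \<in> Basis"
  shows "(\<integral>x. partial_deriv b \<phi> x \<partial>lborel) = 0"
proof -
  define h where "h n = 1 / real (Suc n)" for n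
  have h: "h n > 0" "h n \<le> 1" for n by (auto simp: h_def)
  have h0: "h \<longlonglongrightarrow> 0" unfolding h_def by (rule LIMSEQ_Suc[OF lim_1_over_n])
  define s where "s n x = (1 / h n) *\<^sub>R (\<phi> (x + h n *\<^sub>R b) - \<phi> x)" for n x
  obtain L where L: "L \<ge> 0" "\<And>x y. cmod (\<phi> x - \<phi> y) \<le> L * norm (x - y)" using test_lipschitz[OF t] by metis
  obtain K where K: "compact K" "\<And>x. x \<notin> K \<Longrightarrow> \<phi> x = 0" using test_support[OF t] by metis
  from compact_imp_bounded[OF K(1)] obtain R where R: "\<And>x. x \<in> K \<Longrightarrow> norm x \<le> R" by (auto simp: bounded_iff)
  have phm [measurable]: "\<phi> \<in> borel_measurable borel" by (rule test_borel[OF t])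
  have pm [measurable]: "partial_deriv b \<phi> \<in> borel_measurable borel" by (rule test_borel[OF test_partial[OF t b]])
  have "(\<lambda>n. \<integral>x. s n x \<partial>lborel) \<longlonglongrightarrow> (\<integral>x. partial_deriv b \<phi> x \<partial>lborel)"
  proof (rule integral_dominated_convergence)
    \<comment> \<open>The steps \<open>h n\<close> are at most 1, so all difference quotients vanish
      outside the ball of radius R + 1.\<close>
    show "integrable lborel (\<lambda>x. indicator (cball (0::'a) (R + 1)) x * L)"
      using emeasure_lborel_cball_finite[of "0::'a" "R + 1"]
      by (intro integrable_mult_left) (simp add: integrable_indicator_iff)
    show "AE x in lborel. (\<lambda>n. s n x) \<longlonglongrightarrow> partial_deriv b \<phi> x"
    proof (rule AE_I2)
      fix x
      let ?D = "frechet_derivative \<phi> (at x)"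
      have D: "((\<lambda>y. (1 / norm (y - x)) *\<^sub>R (\<phi> y - (\<phi> x + ?D (y - x)))) \<longlongrightarrow> 0) (at x)"
        using differentiable_has_derivative[OF test_differentiable[OF t]] unfolding has_derivative_at2 by blast
      have lin: "bounded_linear ?D"
        using has_derivative_bounded_linear[OF differentiable_has_derivative[OF test_differentiable[OF t]]] .
      have "filterlim (\<lambda>n. x + h n *\<^sub>R b) (at x) sequentially"
      proof (rule filterlim_atI)
        have "(\<lambda>n. x + h n *\<^sub>R b) \<longlonglongrightarrow> x + 0 *\<^sub>R b" by (intro tendsto_intros h0)
        then show "(\<lambda>n. x + h n *\<^sub>R b) \<longlonglongrightarrow> x" by simp
        show "\<forall>\<^sub>F n in sequentially. x + h n *\<^sub>R b \<noteq> x"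
          using h(1) b by (auto simp: less_le intro!: always_eventually)
      qed
      from filterlim_compose[OF D this]
      have "(\<lambda>n. (1 / norm (h n *\<^sub>R b)) *\<^sub>R (\<phi> (x + h n *\<^sub>R b) - (\<phi> x + ?D (h n *\<^sub>R b)))) \<longlonglongrightarrow> 0" by simp
      moreover have "(1 / norm (h n *\<^sub>R b)) *\<^sub>R (\<phi> (x + h n *\<^sub>R b) - (\<phi> x + ?D (h n *\<^sub>R b))) = s n x - partial_deriv b \<phi> x" for n
        using h(1)[of n] b by (simp add: s_def linear_simps(5)[OF lin] partial_deriv_def algebra_simps)
      ultimately show "(\<lambda>n. s n x) \<longlonglongrightarrow> partial_deriv b \<phi> x" by (simp add: LIM_zero_iff)
    qed
    show "AE x in lborel. norm (s n x) \<le> indicator (cball 0 (R + 1)) x * L" for n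
    proof (rule AE_I2)
      fix x
      show "norm (s n x) \<le> indicator (cball 0 (R + 1)) x * L"
      proof (cases "x \<in> cball 0 (R + 1)")
        case True
        have "cmod (\<phi> (x + h n *\<^sub>R b) - \<phi> x) \<le> L * h n"
          using L(2)[of "x + h n *\<^sub>R b" x] h(1)[of n] b by simp
        then show ?thesis using True h(1)[of n] unfolding s_def norm_scaleR by (simp add: field_simps)
      next
        case False
        then have x: "norm x > R + 1" by simp
        have "norm x \<le> norm (x + h n *\<^sub>R b) + norm (h n *\<^sub>R b)"
          using norm_triangle_ineq4[of "x + h n *\<^sub>R b" "h n *\<^sub>R b"] by simp
        then have "norm (x + h n *\<^sub>R b) > R" using x h[of n] b by simp
        then have "\<phi> (x + h n *\<^sub>R b) = 0" "\<phi> x = 0" using K(2) R x by force+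
        then show ?thesis using False by (simp add: s_def)
      qed
    qed
  qed (auto simp: s_def)
  moreover have "(\<integral>x. s n x \<partial>lborel) = 0" for n
  proof -
    have i: "integrable lborel \<phi>" by (rule test_integrable[OF t])
    have "integrable lborel (\<lambda>x. \<phi> (h n *\<^sub>R b + x))"
      using i integrable_distr_eq[of "(+) (h n *\<^sub>R b)" lborel borel \<phi>] by (simp add: lborel_distr_plus)
    then have "integrable lborel (\<lambda>x. \<phi> (x + h n *\<^sub>R b))" by (simp add: add.commute)
    then show ?thesis unfolding s_def using i lborel_integral_translate[OF phm, of "h n *\<^sub>R b"] by simp
  qed
  ultimately have "(\<lambda>n::nat. 0::complex) \<longlonglongrightarrow> (\<integral>x. partial_deriv b \<phi> x \<partial>lborel)" by simp
  then show ?thesis by (simp add: LIMSEQ_const_iff)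
qed

lemma integration_by_parts:
  assumes t: "test_fun \<phi>" "\<And>k. C_k k f" and b: "b \<in> Basis"
  shows "(\<integral>x. f x * partial_deriv b \<phi> x \<partial>lborel) = - (\<integral>x. partial_deriv b f x * \<phi> x \<partial>lborel)"
proof -
  have d: "f differentiable at x" "\<phi> differentiable at x" for x
    using t(2)[of "Suc 0"] test_differentiable[OF t(1)] by auto
  have Cp: "C_k k (partial_deriv b f)" for k using t(2)[of "Suc k"] b by simp
  have 1: "integrable lborel (\<lambda>x. f x * partial_deriv b \<phi> x)"
    by (rule test_integrable[OF test_mult[OF test_partial[OF t(1) b] t(2)]])
  have 2: "integrable lborel (\<lambda>x. partial_deriv b f x * \<phi> x)"
    by (rule test_integrable[OF test_mult[OF t(1) Cp]])
  have "0 = (\<integral>x. partial_deriv b (\<lambda>x. f x * \<phi> x) x \<partial>lborel)"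
    by (rule integral_partial_test[OF test_mult[OF t] b, symmetric])
  also have "\<dots> = (\<integral>x. f x * partial_deriv b \<phi> x + partial_deriv b f x * \<phi> x \<partial>lborel)"
    by (simp add: partial_deriv_mult d)
  also have "\<dots> = (\<integral>x. f x * partial_deriv b \<phi> x \<partial>lborel) + (\<integral>x. partial_deriv b f x * \<phi> x \<partial>lborel)"
    using 1 2 by simp
  finally show ?thesis by (simp add: eq_neg_iff_add_eq_0)
qed

subsection \<open>The fundamental lemma of the calculus of variations\<close>

text \<open>The factor \<open>Suc n\<close> sharpens the profile: exp (-1 / (n t)) tends to 1 for t
  > 0, so the bumps tend to the indicator of the open box while staying bounded by 1.\<close>

definition bump :: "'a::euclidean_space \<Rightarrow> 'a \<Rightarrow> nat \<Rightarrow> 'a \<Rightarrow> complex" where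
  "bump a b n x = (\<Prod>i\<in>Basis. complex_of_real (flat 1 (real (Suc n) * (x \<bullet> i - a \<bullet> i))) *
     complex_of_real (flat 1 (real (Suc n) * (b \<bullet> i - x \<bullet> i))))"

lemma flat_1: "flat 1 x = (if x > 0 then exp (- (1 / x)) else 0)"
  by (simp add: flat_def)

lemma flat_1_range: "0 \<le> flat 1 x" "flat 1 x \<le> 1"
  by (auto simp: flat_1)

lemma bump_C_k: "C_k k (bump a b n)"
proof -
  have "C_k k (\<lambda>x. complex_of_real (flat 1 (real (Suc n) * (x \<bullet> i - a \<bullet> i))))" for i
    using C_k_affine_comp[OF bounded_linear_const_mult[OF bounded_linear_inner_left[of i], of "real (Suc n)"] flat_C_k[of k 1],
        of "- real (Suc n) * (a \<bullet> i)"] by (simp add: algebra_simps)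
  moreover have "C_k k (\<lambda>x. complex_of_real (flat 1 (real (Suc n) * (b \<bullet> i - x \<bullet> i))))" for i
    using C_k_affine_comp[OF bounded_linear_const_mult[OF bounded_linear_inner_left[of i], of "- real (Suc n)"] flat_C_k[of k 1],
        of "real (Suc n) * (b \<bullet> i)"] by (simp add: algebra_simps)
  ultimately show ?thesis unfolding bump_def by (intro C_k_prod C_k_mult)
qed

lemma bump_outside:
  assumes "x \<notin> box a b"
  shows "bump a b n x = 0"
proof -
  obtain i where i: "i \<in> Basis" "\<not> (a \<bullet> i < x \<bullet> i) \<or> \<not> (x \<bullet> i < b \<bullet> i)"
    using assms by (auto simp: mem_box)
  have "real (Suc n) * (x \<bullet> i - a \<bullet> i) \<le> 0 \<or> real (Suc n) * (b \<bullet> i - x \<bullet> i) \<le> 0"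
    using i(2) by (auto simp: mult_le_0_iff)
  then have "complex_of_real (flat 1 (real (Suc n) * (x \<bullet> i - a \<bullet> i))) *
     complex_of_real (flat 1 (real (Suc n) * (b \<bullet> i - x \<bullet> i))) = 0"
    by (auto simp: flat_1)
  then show ?thesis unfolding bump_def using i(1) by (intro prod_zero) auto
qed

lemma bump_nonzero: "x \<in> box a b \<Longrightarrow> bump a b n x \<noteq> 0"
  by (auto simp: bump_def mem_box flat_1 prod_zero_iff)

lemma bump_test: "cbox a b \<subseteq> \<Omega> \<Longrightarrow> bump a b n \<in> test_functions \<Omega>"
  by (rule test_functionsI[OF bump_C_k compact_cbox])
    (use bump_outside[of _ a b] box_subset_cbox[of a b] in blast)+

lemma bump_le_1: "cmod (bump a b n x) \<le> 1"
proof -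
  have "cmod (bump a b n x) = (\<Prod>i\<in>Basis. \<bar>flat 1 (real (Suc n) * (x \<bullet> i - a \<bullet> i))\<bar> * \<bar>flat 1 (real (Suc n) * (b \<bullet> i - x \<bullet> i))\<bar>)"
    unfolding bump_def by (simp add: prod_norm[symmetric] norm_mult)
  also have "\<dots> \<le> 1"
    by (intro prod_le_1 conjI mult_le_one) (use flat_1_range in auto)
  finally show ?thesis .
qed

lemma flat_1_tendsto: "t > 0 \<Longrightarrow> (\<lambda>n. flat 1 (real (Suc n) * t)) \<longlonglongrightarrow> 1"
proof -
  assume t: "t > 0"
  have "(\<lambda>n. exp (- (1 / real (Suc n) * (1 / t)))) \<longlonglongrightarrow> exp (- (0 * (1 / t)))"
    by (intro tendsto_intros LIMSEQ_Suc[OF lim_1_over_n])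
  then show ?thesis using t by (simp add: flat_1)
qed

lemma bump_tendsto:
  fixes x :: "'a::euclidean_space"
  shows "(\<lambda>n. bump a b n x) \<longlonglongrightarrow> indicator (box a b) x"
proof (cases "x \<in> box a b")
  case True
  have "(\<lambda>n. bump a b n x) \<longlonglongrightarrow> (\<Prod>i\<in>(Basis::'a set). complex_of_real 1 * complex_of_real 1)"
    unfolding bump_def
    by (intro tendsto_prod tendsto_mult tendsto_of_real flat_1_tendsto) (use True in \<open>auto simp: mem_box\<close>)
  then show ?thesis using True by simp
qed (simp add: bump_outside)

text \<open>Positive and negative parts are densities of finite measures that agree on the
  intersection-stable generator of open boxes, hence everywhere; so the densities agree almost
  everywhere.\<close>

lemma AE_zero_if_box_integrals_zero:
  fixes F :: "'a::euclidean_space \<Rightarrow> real"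
  assumes F: "integrable lborel F"
    and z: "\<And>a b. (\<integral>x. indicator (box a b) x * F x \<partial>lborel) = 0"
  shows "AE x in lborel. F x = 0"
proof -
  have Fm [measurable]: "F \<in> borel_measurable borel" using F by auto
  define p n where "p x = max 0 (F x)" and "n x = max 0 (- F x)" for x
  have pm [measurable]: "p \<in> borel_measurable borel" "n \<in> borel_measurable borel" unfolding p_def n_def by measurable
  have int: "integrable lborel p" "integrable lborel n" unfolding p_def n_def using F by auto
  have Fpn: "F x = p x - n x" for x by (auto simp: p_def n_def)
  have em: "emeasure (density lborel q) X = ennreal (\<integral>x. indicator X x * q x \<partial>lborel)"
    if "integrable lborel q" "\<And>x. 0 \<le> q x" "X \<in> sets borel" for q :: "'a \<Rightarrow> real" and X
  proof -
    have "emeasure (density lborel q) X = (\<integral>\<^sup>+x. ennreal (q x) * indicator X x \<partial>lborel)"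
      by (rule emeasure_density) (use that in auto)
    also have "\<dots> = (\<integral>\<^sup>+x. ennreal (indicator X x * q x) \<partial>lborel)"
      by (intro nn_integral_cong) (auto simp: indicator_def)
    also have "\<dots> = ennreal (\<integral>x. indicator X x * q x \<partial>lborel)"
      by (rule nn_integral_eq_integral) (use that integrable_mult_indicator[of X lborel q] in auto)
    finally show ?thesis .
  qed
  have "density lborel p = density lborel n"
  proof (rule measure_eqI_generator_eq[where E = "range (\<lambda>(a, b). box a b :: 'a set)" and \<Omega> = UNIV
        and A = "\<lambda>i. box (- (real i *\<^sub>R One)) (real i *\<^sub>R One)"])
    show "Int_stable (range (\<lambda>(a, b). box a b :: 'a set))"
      by (auto simp: Int_stable_def box_Int_box)
    show "sets (density lborel p) = sigma_sets UNIV (range (\<lambda>(a, b). box a b :: 'a set))"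
      "sets (density lborel n) = sigma_sets UNIV (range (\<lambda>(a, b). box a b :: 'a set))"
      by (simp_all add: borel_eq_box)
    show "(\<Union>i. box (- (real i *\<^sub>R One)) (real i *\<^sub>R One)) = (UNIV :: 'a set)"
      using UN_box_eq_UNIV .
    show "emeasure (density lborel p) X = emeasure (density lborel n) X" if "X \<in> range (\<lambda>(a, b). box a b :: 'a set)" for X
    proof -
      from that obtain ab where "X = (\<lambda>(a, b). box a b) ab" by blast
      then obtain a b where X: "X = box a b" by (cases ab) auto
      have "integrable lborel (\<lambda>x. indicator X x * p x)" "integrable lborel (\<lambda>x. indicator X x * n x)"
        using integrable_mult_indicator[of X lborel p] integrable_mult_indicator[of X lborel n] int X by auto
      moreover have "0 = (\<integral>x. indicator X x * p x - indicator X x * n x \<partial>lborel)"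
        using z[of a b] unfolding X Fpn by (simp add: right_diff_distrib)
      ultimately have "(\<integral>x. indicator X x * p x \<partial>lborel) = (\<integral>x. indicator X x * n x \<partial>lborel)" by simp
      then show ?thesis using em[OF int(1), of X] em[OF int(2), of X] X by (simp add: p_def n_def)
    qed
    show "emeasure (density lborel p) (box (- (real i *\<^sub>R One)) (real i *\<^sub>R One)) \<noteq> \<infinity>" for i
      using em[OF int(1)] by (simp add: p_def)
  qed auto
  then have "AE x in lborel. ennreal (p x) = ennreal (n x)"
    by (subst (asm) finite_density_unique) (use nn_integral_eq_integral[OF int(1)] in \<open>auto simp: p_def\<close>)
  then show ?thesis by (rule AE_mp, intro AE_I2) (auto simp: p_def n_def max_def split: if_splits)
qed

lemma AE_zero_if_box_integrals_zero_complex: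
  fixes F :: "'a::euclidean_space \<Rightarrow> complex"
  assumes F: "integrable lebesgue F"
    and z: "\<And>a b. (\<integral>x. indicator (box a b) x *\<^sub>R F x \<partial>lebesgue) = 0"
  shows "AE x in lebesgue. F x = 0"
proof -
  have main: "AE x in lebesgue. G x = 0"
    if G: "integrable lebesgue G" "\<And>a b. (\<integral>x. indicator (box a b) x * G x \<partial>lebesgue) = 0" for G :: "'a \<Rightarrow> real"
  proof -
    \<comment> \<open>Passage to \<open>lborel\<close> requires a Borel function; a Lebesgue
      measurable one agrees almost everywhere with such a \<open>G'\<close>.\<close>
    obtain G' where G': "G' \<in> borel_measurable lborel" "AE x in lborel. G x = G' x"
      using completion_ex_borel_measurable_real[of G lborel] G(1) by auto
    have ae: "AE x in lebesgue. G x = G' x" using G'(2) by (rule AE_completion)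
    have Gm: "G \<in> borel_measurable lebesgue" "G' \<in> borel_measurable lebesgue"
      using borel_measurable_integrable[OF G(1)] measurable_completion[OF G'(1)] by simp_all
    have "integrable lebesgue G'"
      using G(1) by (rule integrable_cong_AE_imp) (use Gm ae in auto)
    then have "integrable lborel G'" using G'(1) by (simp add: integrable_completion)
    moreover have "(\<integral>x. indicator (box a b) x * G' x \<partial>lborel) = 0" for a b
    proof -
      have "(\<integral>x. indicator (box a b) x * G' x \<partial>lborel) = (\<integral>x. indicator (box a b) x * G' x \<partial>lebesgue)"
        by (rule integral_completion[symmetric]) (use G'(1) in measurable)
      also have "\<dots> = (\<integral>x. indicator (box a b) x * G x \<partial>lebesgue)"
        by (rule integral_cong_AE) (use Gm ae in \<open>auto intro!: borel_measurable_times borel_measurable_indicator\<close>)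
      finally show ?thesis using G(2) by simp
    qed
    ultimately have "AE x in lborel. G' x = 0" by (rule AE_zero_if_box_integrals_zero)
    then have "AE x in lebesgue. G' x = 0" by (rule AE_completion)
    then show ?thesis using ae by auto
  qed
  have i: "integrable lebesgue (\<lambda>x. indicator (box a b) x *\<^sub>R F x)" for a b
    by (rule integrable_mult_indicator) (use F in auto)
  have "AE x in lebesgue. Re (F x) = 0"
    using integral_Re[OF i] z by (intro main integrable_Re F) simp
  moreover have "AE x in lebesgue. Im (F x) = 0"
    using integral_Im[OF i] z by (intro main integrable_Im F) simp
  ultimately show ?thesis by eventually_elim (simp add: complex_eq_iff)
qed

lemma indicator_L2M:
  assumes "B \<in> sets borel" "bounded B" "\<Omega> \<in> sets borel"
  shows "(\<lambda>x. indicator B x) \<in> L2M (lebesgue_on \<Omega>)"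
proof -
  have "integrable lborel (\<lambda>x. indicator B x :: real)"
    using assms emeasure_bounded_finite[OF assms(2)] by (simp add: integrable_indicator_iff)
  then have "integrable (lebesgue_on \<Omega>) (\<lambda>x. indicator B x :: real)"
    by (rule integrable_lebesgue_on[OF assms(3)])
  moreover have "(\<lambda>x. (cmod (indicator B x))\<^sup>2) = (\<lambda>x. indicator B x :: real)"
    by (auto simp: indicator_def fun_eq_iff)
  moreover have "(\<lambda>x. indicator B x :: complex) \<in> borel_measurable (lebesgue_on \<Omega>)"
    by (intro measurable_restrict_space1 measurable_completion) (use assms(1) in simp)
  ultimately show ?thesis by (simp add: L2M_def)
qed

lemma test_L2M:
  assumes "\<phi> \<in> test_functions \<Omega>'" "\<Omega> \<in> sets borel"
  shows "\<phi> \<in> L2M (lebesgue_on \<Omega>)"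
proof -
  have t: "test_fun \<phi>" by (rule test_UNIV[OF assms(1)])
  have "\<phi> \<in> borel_measurable (lebesgue_on \<Omega>)"
    by (intro measurable_restrict_space1 measurable_completion) (use test_borel[OF t] in simp)
  then show ?thesis
    using integrable_lebesgue_on[OF assms(2) test_norm_sq_integrable[OF t]] by (simp add: L2M_def)
qed

text \<open>Bumps supported in \<Omega> converge to indicators of boxes, so the integrals of
  \<open>g\<close> over boxes inside \<Omega> vanish. Square integrability gives integrability only
  on bounded pieces, so the argument runs box by box over a countable cover of \<Omega>.\<close>

theorem fundamental_lemma:
  fixes g :: "'a::euclidean_space \<Rightarrow> complex"
  assumes O: "open \<Omega>" and g: "g \<in> L2M (lebesgue_on \<Omega>)"
    and z: "\<And>\<phi>. \<phi> \<in> test_functions \<Omega> \<Longrightarrow> (\<integral>x. g x * \<phi> x \<partial>lebesgue_on \<Omega>) = 0"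
  shows "AE x in lebesgue_on \<Omega>. g x = 0"
proof -
  have Ob: "\<Omega> \<in> sets borel" using O by simp
  have Ol: "\<Omega> \<in> sets lebesgue" using Ob by simp
  have box0: "(\<integral>x. indicator (box a b) x *\<^sub>R g x \<partial>lebesgue_on \<Omega>) = 0" if ab: "cbox a b \<subseteq> \<Omega>" for a b
  proof -
    have "(\<lambda>n. \<integral>x. g x * bump a b n x \<partial>lebesgue_on \<Omega>) \<longlonglongrightarrow> (\<integral>x. g x * indicator (box a b) x \<partial>lebesgue_on \<Omega>)"
    proof (rule integral_dominated_convergence)
      have "integrable (lebesgue_on \<Omega>) (\<lambda>x. g x * indicator (box a b) x)"
        by (rule L2M_integrable_mult[OF g indicator_L2M]) (use Ob in auto)
      then show "integrable (lebesgue_on \<Omega>) (\<lambda>x. cmod (g x * indicator (box a b) x))" by (rule integrable_norm)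
      show "(\<lambda>x. g x * indicator (box a b) x) \<in> borel_measurable (lebesgue_on \<Omega>)"
        by (rule borel_measurable_integrable[OF L2M_integrable_mult[OF g indicator_L2M]]) (use Ob in auto)
      show "(\<lambda>x. g x * bump a b n x) \<in> borel_measurable (lebesgue_on \<Omega>)" for n
        by (rule borel_measurable_integrable[OF L2M_integrable_mult[OF g test_L2M[OF bump_test[OF ab] Ob]]])
      show "AE x in lebesgue_on \<Omega>. (\<lambda>n. g x * bump a b n x) \<longlonglongrightarrow> g x * indicator (box a b) x"
        by (intro AE_I2 tendsto_intros bump_tendsto)
      show "AE x in lebesgue_on \<Omega>. norm (g x * bump a b n x) \<le> cmod (g x * indicator (box a b) x)" for n
      proof (rule AE_I2)
        fix x
        show "norm (g x * bump a b n x) \<le> cmod (g x * indicator (box a b) x)"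
          using bump_outside[of x a b n] mult_left_mono[OF bump_le_1[of a b n x], of "cmod (g x)"]
          by (cases "x \<in> box a b") (auto simp: norm_mult)
      qed
    qed
    then have "(\<lambda>n. 0) \<longlonglongrightarrow> (\<integral>x. g x * indicator (box a b) x \<partial>lebesgue_on \<Omega>)"
      using z[OF bump_test[OF ab]] by simp
    then have "(\<integral>x. g x * indicator (box a b) x \<partial>lebesgue_on \<Omega>) = 0" by (simp add: LIMSEQ_const_iff)
    moreover have "(\<lambda>x. indicator (box a b) x *\<^sub>R g x) = (\<lambda>x. g x * indicator (box a b) x)"
      by (auto simp: indicator_def fun_eq_iff)
    ultimately show ?thesis by simp
  qed
  have "AE x in lebesgue. x \<in> cbox c d \<longrightarrow> g x = 0" if cd: "cbox c d \<subseteq> \<Omega>" for c d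
  proof -
    define F where "F x = indicator \<Omega> x *\<^sub>R (indicator (box c d) x *\<^sub>R g x)" for x
    have eqi: "(\<lambda>x. indicator (box c d) x *\<^sub>R g x) = (\<lambda>x. g x * indicator (box c d) x)"
      by (auto simp: indicator_def fun_eq_iff)
    have "integrable (lebesgue_on \<Omega>) (\<lambda>x. indicator (box c d) x *\<^sub>R g x)"
      unfolding eqi by (rule L2M_integrable_mult[OF g indicator_L2M]) (use Ob in auto)
    then have Fi: "integrable lebesgue F"
      unfolding F_def using Ol by (subst (asm) integrable_restrict_space) auto
    have "(\<integral>x. indicator (box a b) x *\<^sub>R F x \<partial>lebesgue) = 0" for a b
    proof -
      \<comment> \<open>\<open>box0\<close> is known only inside \<Omega>; an arbitrary box met with
        \<open>box c d\<close> is again a box to which it applies.\<close>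
      obtain a' b' where ab': "box a b \<inter> box c d = box a' b'" "cbox a' b' \<subseteq> cbox c d"
      proof (rule that)
        let ?a = "\<Sum>i\<in>Basis. max (a\<bullet>i) (c\<bullet>i) *\<^sub>R i" and ?b = "\<Sum>i\<in>Basis. min (b\<bullet>i) (d\<bullet>i) *\<^sub>R i"
        show "box a b \<inter> box c d = box ?a ?b" by (rule box_Int_box)
        show "cbox ?a ?b \<subseteq> cbox c d" by (auto simp: mem_box)
      qed
      have "(\<lambda>x. indicator (box a b) x *\<^sub>R F x) = (\<lambda>x. indicator \<Omega> x *\<^sub>R (indicator (box a' b') x *\<^sub>R g x))"
        unfolding F_def ab'(1)[symmetric] by (auto simp: indicator_def fun_eq_iff)
      then have "(\<integral>x. indicator (box a b) x *\<^sub>R F x \<partial>lebesgue) = (\<integral>x. indicator (box a' b') x *\<^sub>R g x \<partial>lebesgue_on \<Omega>)"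
        using Ol by (simp add: integral_restrict_space)
      also have "\<dots> = 0" by (rule box0) (use ab'(2) cd in blast)
      finally show ?thesis .
    qed
    from AE_zero_if_box_integrals_zero_complex[OF Fi this] have 1: "AE x in lebesgue. F x = 0" .
    have "cbox c d - box c d \<in> null_sets lebesgue"
      using negligible_interval(1) negligible_iff_null_sets negligible_frontier_interval by metis
    then have "AE x in lebesgue. x \<notin> cbox c d - box c d" by (rule AE_not_in)
    with 1 show ?thesis by eventually_elim (use cd box_subset_cbox[of c d] in \<open>auto simp: F_def indicator_def split: if_splits\<close>)
  qed
  moreover obtain D where D: "countable D" "\<And>X. X \<in> D \<Longrightarrow> X \<subseteq> \<Omega> \<and> (\<exists>a b. X = cbox a b)" "\<Union>D = \<Omega>"
    using open_countable_Union_open_cbox[OF O] by (metis Pow_iff subsetD)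
  ultimately have "AE x in lebesgue. \<forall>X\<in>D. x \<in> X \<longrightarrow> g x = 0"
    by (subst AE_ball_countable) blast+
  then have "AE x in lebesgue. x \<in> \<Omega> \<longrightarrow> g x = 0" by eventually_elim (use D(3) in blast)
  then show ?thesis using Ol by (subst AE_restrict_space_iff) auto
qed


section \<open>Weak derivatives and \<open>H\<^sup>1\<^sub>0\<close>\<close>

text \<open>Weak derivatives are defined by bilinear integrals; conjugating the test function
  rewrites them with the sesquilinear \<open>ipM\<close>, whose linearity and continuity are at
  hand.\<close>

lemma has_weak_partial_alt:
  assumes "u \<in> L2M (lebesgue_on \<Omega>)" "g \<in> L2M (lebesgue_on \<Omega>)"
  shows "has_weak_partial \<Omega> b u g \<longleftrightarrow> (\<forall>\<phi>\<in>test_functions \<Omega>.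
    ipM (lebesgue_on \<Omega>) u (\<lambda>x. cnj (partial_deriv b \<phi> x)) = - ipM (lebesgue_on \<Omega>) g (\<lambda>x. cnj (\<phi> x)))"
  by (simp add: has_weak_partial_def ipM_def)

text \<open>Makes the choice in \<open>weak_partial\<close> harmless: the difference of two
  candidates is orthogonal to all test functions.\<close>

lemma weak_partial_unique:
  assumes O: "open \<Omega>" and g: "g \<in> L2M (lebesgue_on \<Omega>)" "g' \<in> L2M (lebesgue_on \<Omega>)"
    and w: "has_weak_partial \<Omega> b u g" "has_weak_partial \<Omega> b u g'"
  shows "AE x in lebesgue_on \<Omega>. g x = g' x"
proof -
  have "AE x in lebesgue_on \<Omega>. g x - g' x = 0"
  proof (rule fundamental_lemma[OF O L2.diff_mem[OF g]])
    fix \<phi> assume t: "\<phi> \<in> test_functions \<Omega>"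
    have p: "\<phi> \<in> L2M (lebesgue_on \<Omega>)" by (rule test_L2M[OF t]) (use O in simp)
    have "(\<integral>x. g x * \<phi> x \<partial>lebesgue_on \<Omega>) = (\<integral>x. g' x * \<phi> x \<partial>lebesgue_on \<Omega>)"
      using w t by (simp add: has_weak_partial_def)
    then show "(\<integral>x. (g x - g' x) * \<phi> x \<partial>lebesgue_on \<Omega>) = 0"
      using L2M_integrable_mult[OF g(1) p] L2M_integrable_mult[OF g(2) p] by (simp add: left_diff_distrib)
  qed
  then show ?thesis by eventually_elim simp
qed

locale open_domain =
  fixes \<Omega> :: "'a::euclidean_space set"
  assumes O: "open \<Omega>"
begin

abbreviation "LO \<equiv> L2M (lebesgue_on \<Omega>)"
abbreviation "ip \<equiv> ipM (lebesgue_on \<Omega>)"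
abbreviation "nsq \<equiv> L2.sq (lebesgue_on \<Omega>)"
abbreviation "D \<equiv> weak_partial \<Omega>"
abbreviation "test \<equiv> test_functions \<Omega>"
abbreviation "H10 \<equiv> H10_space \<Omega>"

lemma Ob: "\<Omega> \<in> sets borel"
  using O by simp

lemma test_LO: "\<phi> \<in> test_functions \<Omega>' \<Longrightarrow> \<phi> \<in> LO"
  using test_L2M Ob by blast

lemma H1_D:
  assumes "u \<in> H1_space \<Omega>" "b \<in> Basis"
  shows "D b u \<in> LO" "has_weak_partial \<Omega> b u (D b u)"
proof -
  have "\<exists>g. g \<in> L2_space \<Omega> \<and> has_weak_partial \<Omega> b u g" using assms by (auto simp: H1_space_def)
  from someI_ex[OF this] show "D b u \<in> LO" "has_weak_partial \<Omega> b u (D b u)"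
    unfolding weak_partial_def L2_space_eq by blast+
qed

lemma H1_LO: "u \<in> H1_space \<Omega> \<Longrightarrow> u \<in> LO"
  by (simp add: H1_space_def L2_space_eq)

lemma H1I:
  assumes "u \<in> LO" "\<And>b. b \<in> Basis \<Longrightarrow> g b \<in> LO" "\<And>b. b \<in> Basis \<Longrightarrow> has_weak_partial \<Omega> b u (g b)"
  shows "u \<in> H1_space \<Omega>"
  using assms by (auto simp: H1_space_def L2_space_eq)

lemma D_eqI:
  assumes "u \<in> H1_space \<Omega>" "b \<in> Basis" "g \<in> LO" "has_weak_partial \<Omega> b u g"
  shows "AE x in lebesgue_on \<Omega>. D b u x = g x"
  by (rule weak_partial_unique[OF O H1_D(1) _ H1_D(2)]) (use assms in auto)

lemma weak_partial_comb:
  assumes "u \<in> LO" "v \<in> LO" "g \<in> LO" "h \<in> LO" "b \<in> Basis"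
    "has_weak_partial \<Omega> b u g" "has_weak_partial \<Omega> b v h"
  shows "has_weak_partial \<Omega> b (\<lambda>x. u x + c * v x) (\<lambda>x. g x + c * h x)"
proof -
  have "ip (\<lambda>x. u x + c * v x) (\<lambda>x. cnj (partial_deriv b \<phi> x)) = - ip (\<lambda>x. g x + c * h x) (\<lambda>x. cnj (\<phi> x))"
    if t: "\<phi> \<in> test" for \<phi>
  proof -
    have 1: "(\<lambda>x. cnj (partial_deriv b \<phi> x)) \<in> LO" "(\<lambda>x. cnj (\<phi> x)) \<in> LO"
      using test_cnj test_partial t assms(5) test_LO by blast+
    have "ip u (\<lambda>x. cnj (partial_deriv b \<phi> x)) = - ip g (\<lambda>x. cnj (\<phi> x))"
      "ip v (\<lambda>x. cnj (partial_deriv b \<phi> x)) = - ip h (\<lambda>x. cnj (\<phi> x))"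
      using assms t by (auto simp: has_weak_partial_alt)
    then show ?thesis by (simp add: L2.ip_comb assms 1)
  qed
  then show ?thesis using assms by (simp add: has_weak_partial_alt L2.comb_mem)
qed

lemma H1_comb:
  assumes "u \<in> H1_space \<Omega>" "v \<in> H1_space \<Omega>"
  shows "(\<lambda>x. u x + c * v x) \<in> H1_space \<Omega>"
    "b \<in> Basis \<Longrightarrow> AE x in lebesgue_on \<Omega>. D b (\<lambda>x. u x + c * v x) x = D b u x + c * D b v x"
proof -
  have w: "has_weak_partial \<Omega> b (\<lambda>x. u x + c * v x) (\<lambda>x. D b u x + c * D b v x)" if "b \<in> Basis" for b
    by (rule weak_partial_comb) (use H1_D H1_LO assms that in auto)
  have m: "(\<lambda>x. D b u x + c * D b v x) \<in> LO" if "b \<in> Basis" for b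
    by (rule L2.comb_mem) (use H1_D assms that in auto)
  show *: "(\<lambda>x. u x + c * v x) \<in> H1_space \<Omega>"
    by (rule H1I[OF L2.comb_mem[OF H1_LO[OF assms(1)] H1_LO[OF assms(2)]] m w])
  show "AE x in lebesgue_on \<Omega>. D b (\<lambda>x. u x + c * v x) x = D b u x + c * D b v x" if "b \<in> Basis"
    by (rule D_eqI[OF * that m[OF that] w[OF that]])
qed

text \<open>One weight per basis vector lets the same form cover both problems: all weights 1 for
  the gradient form, \<open>trans_weight\<close> for T(\<beta>).\<close>

definition wform :: "('a \<Rightarrow> real) \<Rightarrow> ('a \<Rightarrow> complex) \<Rightarrow> ('a \<Rightarrow> complex) \<Rightarrow> complex" where
  "wform c u v = (\<Sum>b\<in>Basis. complex_of_real (c b) * ip (D b u) (D b v))"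

lemma wform_semi_inner:
  assumes c: "\<And>b. b \<in> Basis \<Longrightarrow> 0 \<le> c b"
    and V: "V \<subseteq> H1_space \<Omega>" "(\<lambda>x. 0) \<in> V" "\<And>u v k. u \<in> V \<Longrightarrow> v \<in> V \<Longrightarrow> (\<lambda>x. u x + k * v x) \<in> V"
  shows "semi_inner V (wform c)"
proof
  fix u v w :: "'a \<Rightarrow> complex" and k
  show "(\<lambda>x. 0) \<in> V" by (rule V)
  show "u \<in> V \<Longrightarrow> v \<in> V \<Longrightarrow> (\<lambda>x. u x + k * v x) \<in> V" by (rule V)
  assume u: "u \<in> V"
  then have u1: "u \<in> H1_space \<Omega>" using V by blast
  show "0 \<le> Re (wform c u u)"
    using c L2.ip_nonneg[OF H1_D(1)[OF u1]] by (auto simp: wform_def intro!: sum_nonneg)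
  assume v: "v \<in> V"
  then have v1: "v \<in> H1_space \<Omega>" using V by blast
  have "ip (D b v) (D b u) = cnj (ip (D b u) (D b v))" if "b \<in> Basis" for b
    by (rule L2.ip_cnj) (use H1_D u1 v1 that in auto)
  then show "wform c v u = cnj (wform c u v)" by (simp add: wform_def)
  assume w: "w \<in> V"
  then have w1: "w \<in> H1_space \<Omega>" using V by blast
  have "ip (D b (\<lambda>x. u x + k * v x)) (D b w) = ip (D b u) (D b w) + k * ip (D b v) (D b w)" if b: "b \<in> Basis" for b
  proof -
    have "ip (D b (\<lambda>x. u x + k * v x)) (D b w) = ip (\<lambda>x. D b u x + k * D b v x) (D b w)"
      by (rule ipM_cong_AE[OF H1_D(1)[OF H1_comb(1)[OF u1 v1] b] L2.comb_mem[OF H1_D(1)[OF u1 b] H1_D(1)[OF v1 b]]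
        H1_D(1)[OF w1 b] H1_D(1)[OF w1 b] H1_comb(2)[OF u1 v1 b] AE_I2[OF refl]])
    then show ?thesis by (simp add: L2.ip_comb H1_D(1) u1 v1 w1 b)
  qed
  then show "wform c (\<lambda>x. u x + k * v x) w = wform c u w + k * wform c v w"
    by (simp add: wform_def sum.distrib sum_distrib_left algebra_simps)
qed

lemma test_H1:
  assumes t: "\<phi> \<in> test"
  shows "\<phi> \<in> H1_space \<Omega>"
    "b \<in> Basis \<Longrightarrow> AE x in lebesgue_on \<Omega>. D b \<phi> x = partial_deriv b \<phi> x"
proof -
  have w: "has_weak_partial \<Omega> b \<phi> (partial_deriv b \<phi>)" if b: "b \<in> Basis" for b
  proof -
    have "(\<integral>x. \<phi> x * partial_deriv b \<psi> x \<partial>lebesgue_on \<Omega>) = - (\<integral>x. partial_deriv b \<phi> x * \<psi> x \<partial>lebesgue_on \<Omega>)"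
      if s: "\<psi> \<in> test" for \<psi>
    proof -
      have bm: "\<phi> \<in> borel_measurable borel" "partial_deriv b \<phi> \<in> borel_measurable borel"
          "\<psi> \<in> borel_measurable borel" "partial_deriv b \<psi> \<in> borel_measurable borel"
        by (rule test_borel[OF test_UNIV], rule t test_partial[OF t b] s test_partial[OF s b])+
      have "(\<integral>x. \<phi> x * partial_deriv b \<psi> x \<partial>lebesgue_on \<Omega>) = (\<integral>x. \<phi> x * partial_deriv b \<psi> x \<partial>lborel)"
        by (rule integral_lebesgue_on[OF Ob])
          (use test_zero_outside[OF t] in \<open>simp_all add: borel_measurable_times[OF bm(1) bm(4)]\<close>)
      moreover have "(\<integral>x. partial_deriv b \<phi> x * \<psi> x \<partial>lebesgue_on \<Omega>) = (\<integral>x. partial_deriv b \<phi> x * \<psi> x \<partial>lborel)"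
        by (rule integral_lebesgue_on[OF Ob])
          (use test_zero_outside[OF s] in \<open>simp_all add: borel_measurable_times[OF bm(2) bm(3)]\<close>)
      ultimately show ?thesis
        using integration_by_parts[OF test_UNIV[OF s] test_C_k[OF t] b] by simp
    qed
    then show ?thesis by (simp add: has_weak_partial_def)
  qed
  have m: "partial_deriv b \<phi> \<in> LO" if "b \<in> Basis" for b by (rule test_LO[OF test_partial[OF t that]])
  show *: "\<phi> \<in> H1_space \<Omega>"
    by (rule H1I[OF test_LO[OF t] m w])
  show "AE x in lebesgue_on \<Omega>. D b \<phi> x = partial_deriv b \<phi> x" if "b \<in> Basis"
    by (rule D_eqI[OF * that m[OF that] w[OF that]])
qed

interpretation H1: semi_inner "H1_space \<Omega>" "wform (\<lambda>_. 1)"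
  by (rule wform_semi_inner[OF _ order_refl test_H1(1)[OF test_zero] H1_comb(1)]) simp_all

lemma wform_sq: "Re (wform c u u) = (\<Sum>b\<in>Basis. c b * nsq (D b u))"
  by (simp add: wform_def L2.sq_def)

lemma form_sum_semi_inner:
  assumes V: "semi_inner V (wform c)" "V \<subseteq> LO"
  shows "semi_inner V (\<lambda>u v. wform c u v + ip u v)"
proof -
  have "0 \<le> Re (wform c u u + complex_of_real 1 * ip u u)" if "u \<in> V" for u
    using semi_inner.ip_nonneg[OF V(1) that] L2.ip_nonneg[of u] V(2) that by auto
  from semi_inner_add[OF V(1) L2.semi_inner_axioms V(2) this] show ?thesis by simp
qed

interpretation H1Q: semi_inner "H1_space \<Omega>" "\<lambda>u v. wform (\<lambda>_. 1) u v + ip u v"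
  by (rule form_sum_semi_inner[OF H1.semi_inner_axioms]) (use H1_LO in blast)

lemma H1Q_sq: "H1Q.sq u = (\<Sum>b\<in>Basis. nsq (D b u)) + nsq u"
  by (simp add: H1Q.sq_def wform_sq) (simp add: L2.sq_def)

lemma H1_norm_eq:
  assumes u: "u \<in> H1_space \<Omega>"
  shows "H1_norm \<Omega> u = sqrt (H1Q.sq u)"
  unfolding H1_norm_def L2_norm_eq H1Q_sq
  by (simp add: L2.sq_nonneg[OF H1_LO[OF u]] L2.sq_nonneg[OF H1_D(1)[OF u]] add.commute)

lemma H10_H1: "u \<in> H10 \<Longrightarrow> u \<in> H1_space \<Omega>"
  by (simp add: H10_space_def)

lemma H10_LO: "u \<in> H10 \<Longrightarrow> u \<in> LO"
  using H10_H1 H1_LO by blast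

lemma H10_iff:
  "u \<in> H10 \<longleftrightarrow> u \<in> H1_space \<Omega> \<and> (\<forall>e>0. \<exists>\<phi>\<in>test. sqrt (H1Q.sq (\<lambda>x. u x - \<phi> x)) < e)"
proof -
  have "H1_norm \<Omega> (\<lambda>x. u x - \<phi> x) = sqrt (H1Q.sq (\<lambda>x. u x - \<phi> x))" if "u \<in> H1_space \<Omega>" "\<phi> \<in> test" for \<phi>
    by (rule H1_norm_eq[OF H1.diff_mem[OF that(1) test_H1(1)[OF that(2)]]])
  then show ?thesis by (simp add: H10_space_def cong: conj_cong bex_cong)
qed

lemma H1Q_zero: "H1Q.sq (\<lambda>x. 0) = 0"
  using H1Q.ip_zero[OF H1.zero_mem] by (simp add: H1Q.sq_def)

lemma test_H10: "\<phi> \<in> test \<Longrightarrow> \<phi> \<in> H10"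
  unfolding H10_iff by (auto intro!: bexI[of _ \<phi>] test_H1(1) simp: H1Q_zero)

lemma H10_comb:
  assumes u: "u \<in> H10" and v: "v \<in> H10"
  shows "(\<lambda>x. u x + k * v x) \<in> H10"
proof -
  have u1: "u \<in> H1_space \<Omega>" "v \<in> H1_space \<Omega>" using u v H10_H1 by auto
  have "\<exists>\<phi>\<in>test. sqrt (H1Q.sq (\<lambda>x. (u x + k * v x) - \<phi> x)) < e" if e: "e > 0" for e
  proof -
    define \<delta> where "\<delta> = e / (1 + cmod k)"
    have k: "1 + cmod k > 0" using norm_ge_zero[of k] by linarith
    then have \<delta>: "\<delta> > 0" using e by (simp add: \<delta>_def)
    obtain \<phi> where p: "\<phi> \<in> test" "sqrt (H1Q.sq (\<lambda>x. u x - \<phi> x)) < \<delta>" using u \<delta> H10_iff by blast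
    obtain \<psi> where q: "\<psi> \<in> test" "sqrt (H1Q.sq (\<lambda>x. v x - \<psi> x)) < \<delta>" using v \<delta> H10_iff by blast
    have d: "(\<lambda>x. u x - \<phi> x) \<in> H1_space \<Omega>" "(\<lambda>x. v x - \<psi> x) \<in> H1_space \<Omega>"
      by (rule H1.diff_mem[OF u1(1) test_H1(1)[OF p(1)]], rule H1.diff_mem[OF u1(2) test_H1(1)[OF q(1)]])
    have "(\<lambda>x. (u x + k * v x) - (\<phi> x + k * \<psi> x)) = (\<lambda>x. (u x - \<phi> x) + k * (v x - \<psi> x))"
      by (auto simp: algebra_simps)
    then have "sqrt (H1Q.sq (\<lambda>x. (u x + k * v x) - (\<phi> x + k * \<psi> x)))
        \<le> sqrt (H1Q.sq (\<lambda>x. u x - \<phi> x)) + sqrt (H1Q.sq (\<lambda>x. k * (v x - \<psi> x)))"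
      using H1Q.triangle[OF d(1) H1.scale_mem[OF d(2), of k]] by simp
    also have "sqrt (H1Q.sq (\<lambda>x. k * (v x - \<psi> x))) = cmod k * sqrt (H1Q.sq (\<lambda>x. v x - \<psi> x))"
      using H1Q.sq_scale[OF d(2), of k] by (simp add: real_sqrt_mult)
    also have "sqrt (H1Q.sq (\<lambda>x. u x - \<phi> x)) + \<dots> < \<delta> + cmod k * \<delta>"
      using p(2) q(2) by (intro add_less_le_mono mult_left_mono) auto
    also have "\<dots> = \<delta> * (1 + cmod k)" by (simp add: algebra_simps)
    also have "\<dots> = e" using k by (simp add: \<delta>_def)
    finally show ?thesis by (rule bexI[OF _ test_comb[OF p(1) q(1)]])
  qed
  then show ?thesis unfolding H10_iff using H1_comb(1)[OF u1] by blast
qed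

lemma H10_zero: "(\<lambda>x. 0) \<in> H10"
  using test_H10[OF test_zero] .

text \<open>The functions and each of their weak derivatives converge separately in the L2 seminorm;
  the identity defining the weak derivative survives the limit, and so does approximability by test
  functions.\<close>

lemma H10_complete:
  assumes s: "\<And>n. s n \<in> H10"
    and cau: "\<And>e. e > 0 \<Longrightarrow> \<exists>N. \<forall>m\<ge>N. \<forall>n\<ge>N. H1Q.sq (\<lambda>x. s m x - s n x) < e"
  shows "\<exists>u\<in>H10. (\<lambda>n. H1Q.sq (\<lambda>x. s n x - u x)) \<longlonglongrightarrow> 0"
proof -
  have s1: "s n \<in> H1_space \<Omega>" "s n \<in> LO" for n using s H10_H1 H10_LO by auto
  have ds: "AE x in lebesgue_on \<Omega>. D b (\<lambda>x. s m x - s n x) x = D b (s m) x - D b (s n) x" if "b \<in> Basis" for b m n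
    using H1_comb(2)[OF s1(1) s1(1) that, of m "-1" n] by simp
  have nD: "nsq (D b (\<lambda>x. s m x - s n x)) = nsq (\<lambda>x. D b (s m) x - D b (s n) x)" if b: "b \<in> Basis" for b m n
    unfolding L2.sq_def
    by (rule arg_cong[where f = Re], rule ipM_cong_AE[OF _ _ _ _ ds[OF b] ds[OF b]])
      (rule H1_D(1)[OF H1.diff_mem[OF s1(1) s1(1)] b] L2.diff_mem[OF H1_D(1)[OF s1(1) b] H1_D(1)[OF s1(1) b]])+
  have sq0: "0 \<le> nsq (D b (\<lambda>x. s m x - s n x))" if "b \<in> Basis" for b m n
    by (rule L2.sq_nonneg[OF H1_D(1)[OF H1.diff_mem[OF s1(1) s1(1)] that]])
  have "\<exists>N. \<forall>m\<ge>N. \<forall>n\<ge>N. nsq (\<lambda>x. s m x - s n x) < e" if e: "e > 0" for e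
  proof -
    obtain N where N: "\<And>m n. m \<ge> N \<Longrightarrow> n \<ge> N \<Longrightarrow> H1Q.sq (\<lambda>x. s m x - s n x) < e" using cau[OF e] by blast
    have "nsq (\<lambda>x. s m x - s n x) < e" if "m \<ge> N" "n \<ge> N" for m n
      using N[OF that] sum_nonneg[of Basis "\<lambda>b. nsq (D b (\<lambda>x. s m x - s n x))", OF sq0] unfolding H1Q_sq by linarith
    then show ?thesis by blast
  qed
  from L2.complete[OF s1(2) this] obtain u where
    u: "u \<in> LO" "(\<lambda>n. nsq (\<lambda>x. s n x - u x)) \<longlonglongrightarrow> 0" by blast
  have "\<exists>g. g \<in> LO \<and> (\<lambda>n. nsq (\<lambda>x. D b (s n) x - g x)) \<longlonglongrightarrow> 0" if b: "b \<in> Basis" for b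
  proof -
    have "\<exists>N. \<forall>m\<ge>N. \<forall>n\<ge>N. nsq (\<lambda>x. D b (s m) x - D b (s n) x) < e" if e: "e > 0" for e
    proof -
      obtain N where N: "\<And>m n. m \<ge> N \<Longrightarrow> n \<ge> N \<Longrightarrow> H1Q.sq (\<lambda>x. s m x - s n x) < e" using cau[OF e] by blast
      have "nsq (\<lambda>x. D b (s m) x - D b (s n) x) < e" if "m \<ge> N" "n \<ge> N" for m n
      proof -
        have "nsq (D b (\<lambda>x. s m x - s n x)) \<le> (\<Sum>b\<in>Basis. nsq (D b (\<lambda>x. s m x - s n x)))"
          by (rule member_le_sum) (use b sq0 in auto)
        also have "\<dots> \<le> H1Q.sq (\<lambda>x. s m x - s n x)"
          unfolding H1Q_sq using L2.sq_nonneg[OF L2.diff_mem[OF s1(2)[of m] s1(2)[of n]]] by simp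
        finally show ?thesis using N[OF that] nD[OF b] by simp
      qed
      then show ?thesis by blast
    qed
    from L2.complete[OF H1_D(1)[OF s1(1) b] this] show ?thesis by blast
  qed
  then obtain g where g: "\<And>b. b \<in> Basis \<Longrightarrow> g b \<in> LO"
    "\<And>b. b \<in> Basis \<Longrightarrow> (\<lambda>n. nsq (\<lambda>x. D b (s n) x - g b x)) \<longlonglongrightarrow> 0" by metis
  have w: "has_weak_partial \<Omega> b u (g b)" if b: "b \<in> Basis" for b
    unfolding has_weak_partial_alt[OF u(1) g(1)[OF b]]
  proof
    fix \<phi> assume t: "\<phi> \<in> test"
    have m: "(\<lambda>x. cnj (partial_deriv b \<phi> x)) \<in> LO" "(\<lambda>x. cnj (\<phi> x)) \<in> LO"
      using test_cnj test_partial t b test_LO by blast+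
    have "ip (s n) (\<lambda>x. cnj (partial_deriv b \<phi> x)) = - ip (D b (s n)) (\<lambda>x. cnj (\<phi> x))" for n
      using H1_D(2)[OF s1(1) b, of n] t unfolding has_weak_partial_alt[OF s1(2) H1_D(1)[OF s1(1) b]] by blast
    moreover have "(\<lambda>n. ip (s n) (\<lambda>x. cnj (partial_deriv b \<phi> x))) \<longlonglongrightarrow> ip u (\<lambda>x. cnj (partial_deriv b \<phi> x))"
      by (rule L2.tendsto_ip[OF s1(2) u(1) m(1) u(2)])
    moreover have "(\<lambda>n. - ip (D b (s n)) (\<lambda>x. cnj (\<phi> x))) \<longlonglongrightarrow> - ip (g b) (\<lambda>x. cnj (\<phi> x))"
      by (intro tendsto_minus L2.tendsto_ip[OF H1_D(1)[OF s1(1) b] g(1)[OF b] m(2) g(2)[OF b]])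
    ultimately show "ip u (\<lambda>x. cnj (partial_deriv b \<phi> x)) = - ip (g b) (\<lambda>x. cnj (\<phi> x))"
      by (simp add: LIMSEQ_unique)
  qed
  have u1: "u \<in> H1_space \<Omega>" by (rule H1I[OF u(1) g(1) w])
  have Dg: "nsq (D b (\<lambda>x. s n x - u x)) = nsq (\<lambda>x. D b (s n) x - g b x)" if b: "b \<in> Basis" for b n
  proof -
    have "AE x in lebesgue_on \<Omega>. D b (\<lambda>x. s n x - u x) x = D b (s n) x - D b u x"
      using H1_comb(2)[OF s1(1) u1 b, of n "-1"] by simp
    then have "AE x in lebesgue_on \<Omega>. D b (\<lambda>x. s n x - u x) x = D b (s n) x - g b x"
      using D_eqI[OF u1 b g(1)[OF b] w[OF b]] by eventually_elim simp
    then show ?thesis unfolding L2.sq_def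
      by (intro arg_cong[where f = Re] ipM_cong_AE)
        (rule H1_D(1)[OF H1.diff_mem[OF s1(1) u1] b] L2.diff_mem[OF H1_D(1)[OF s1(1) b] g(1)[OF b]] | assumption)+
  qed
  have lim: "(\<lambda>n. H1Q.sq (\<lambda>x. s n x - u x)) \<longlonglongrightarrow> 0"
  proof -
    have "(\<lambda>n. (\<Sum>b\<in>Basis. nsq (\<lambda>x. D b (s n) x - g b x)) + nsq (\<lambda>x. s n x - u x)) \<longlonglongrightarrow> (\<Sum>b\<in>(Basis::'a set). 0) + 0"
      by (intro tendsto_add tendsto_sum g u)
    then show ?thesis by (simp add: H1Q_sq Dg)
  qed
  have "\<exists>\<phi>\<in>test. sqrt (H1Q.sq (\<lambda>x. u x - \<phi> x)) < e" if e: "e > 0" for e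
  proof -
    have "(\<lambda>n. sqrt (H1Q.sq (\<lambda>x. s n x - u x))) \<longlonglongrightarrow> 0" using tendsto_real_sqrt[OF lim] by simp
    then have "\<forall>\<^sub>F n in sequentially. sqrt (H1Q.sq (\<lambda>x. s n x - u x)) < e / 2"
      by (rule order_tendstoD) (use e in simp)
    then obtain n where n: "sqrt (H1Q.sq (\<lambda>x. s n x - u x)) < e / 2" by (auto simp: eventually_sequentially)
    obtain \<phi> where p: "\<phi> \<in> test" "sqrt (H1Q.sq (\<lambda>x. s n x - \<phi> x)) < e / 2"
      using s[of n] e unfolding H10_iff by (meson half_gt_zero)
    have "sqrt (H1Q.sq (\<lambda>x. u x - \<phi> x)) \<le> sqrt (H1Q.sq (\<lambda>x. u x - s n x)) + sqrt (H1Q.sq (\<lambda>x. s n x - \<phi> x))"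
      by (rule H1Q.triangle_diff[OF u1 s1(1) test_H1(1)[OF p(1)]])
    also have "\<dots> < e" using n p(2) H1Q.sq_minus_commute[OF u1 s1(1)[of n]] by simp
    finally show ?thesis using p(1) by blast
  qed
  then have "u \<in> H10" unfolding H10_iff using u1 by blast
  then show ?thesis using lim by blast
qed

text \<open>Completeness does not depend on the weights, since the form norms are equivalent.\<close>

theorem closed_form_H10:
  assumes c: "\<And>b. b \<in> Basis \<Longrightarrow> 1 \<le> c b"
  shows "closed_form LO ip H10 (wform c)"
proof -
  have c0: "0 \<le> c b" if "b \<in> Basis" for b using c[OF that] by simp
  interpret A: semi_inner H10 "wform c"
    by (rule wform_semi_inner[OF c0 _ H10_zero H10_comb]) (auto intro: H10_H1)
  interpret Q: semi_inner H10 "\<lambda>u v. wform c u v + ip u v"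
    by (rule form_sum_semi_inner[OF A.semi_inner_axioms]) (use H10_LO in blast)
  have Qsq: "Q.sq u = (\<Sum>b\<in>Basis. c b * nsq (D b u)) + nsq u" for u
    by (simp add: Q.sq_def wform_sq) (simp add: L2.sq_def)
  define M where "M = (\<Sum>b\<in>Basis. c b)"
  have cM: "c b \<le> M" if "b \<in> Basis" for b
    unfolding M_def by (rule member_le_sum) (use that c0 in auto)
  have M1: "1 \<le> M" using cM[OF SOME_Basis] c[OF SOME_Basis] by linarith
  have low: "H1Q.sq u \<le> Q.sq u" if "u \<in> H10" for u
  proof -
    have "(\<Sum>b\<in>Basis. nsq (D b u)) \<le> (\<Sum>b\<in>Basis. c b * nsq (D b u))"
    proof (rule sum_mono)
      fix b :: 'a assume b: "b \<in> Basis"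
      show "nsq (D b u) \<le> c b * nsq (D b u)"
        using mult_right_mono[OF c[OF b] L2.sq_nonneg[OF H1_D(1)[OF H10_H1[OF that] b]]] by simp
    qed
    then show ?thesis unfolding Qsq H1Q_sq by simp
  qed
  have up: "Q.sq u \<le> M * H1Q.sq u" if "u \<in> H10" for u
  proof -
    have "(\<Sum>b\<in>Basis. c b * nsq (D b u)) \<le> (\<Sum>b\<in>Basis. M * nsq (D b u))"
      by (intro sum_mono mult_right_mono cM L2.sq_nonneg[OF H1_D(1)[OF H10_H1[OF that]]]) auto
    moreover have "nsq u \<le> M * nsq u" using mult_right_mono[OF M1 L2.sq_nonneg[OF H10_LO[OF that]]] by simp
    ultimately show ?thesis unfolding Qsq H1Q_sq by (simp add: sum_distrib_left[symmetric] distrib_left)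
  qed
  interpret Q: semi_hilbert H10 "\<lambda>u v. wform c u v + ip u v"
  proof
    fix s :: "nat \<Rightarrow> 'a \<Rightarrow> complex"
    assume s: "\<And>n. s n \<in> H10"
      and cau: "\<And>e. e > 0 \<Longrightarrow> \<exists>N. \<forall>m\<ge>N. \<forall>n\<ge>N. Q.sq (\<lambda>x. s m x - s n x) < e"
    have "\<exists>N. \<forall>m\<ge>N. \<forall>n\<ge>N. H1Q.sq (\<lambda>x. s m x - s n x) < e" if e: "e > 0" for e
    proof -
      obtain N where N: "\<And>m n. m \<ge> N \<Longrightarrow> n \<ge> N \<Longrightarrow> Q.sq (\<lambda>x. s m x - s n x) < e" using cau[OF e] by blast
      have "H1Q.sq (\<lambda>x. s m x - s n x) < e" if "m \<ge> N" "n \<ge> N" for m n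
        using N[OF that] low[OF A.diff_mem[OF s[of m] s[of n]]] by linarith
      then show ?thesis by blast
    qed
    from H10_complete[OF s this] obtain u where
      u: "u \<in> H10" "(\<lambda>n. H1Q.sq (\<lambda>x. s n x - u x)) \<longlonglongrightarrow> 0" by blast
    have "(\<lambda>n. Q.sq (\<lambda>x. s n x - u x)) \<longlonglongrightarrow> 0"
    proof (rule tendsto_sandwich[of "\<lambda>_. 0"])
      show "(\<lambda>n. M * H1Q.sq (\<lambda>x. s n x - u x)) \<longlonglongrightarrow> 0" using tendsto_mult_right_zero[OF u(2)] by simp
      show "\<forall>\<^sub>F n in sequentially. Q.sq (\<lambda>x. s n x - u x) \<le> M * H1Q.sq (\<lambda>x. s n x - u x)"
        using up[OF A.diff_mem[OF s u(1)]] by simp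
      show "\<forall>\<^sub>F n in sequentially. 0 \<le> Q.sq (\<lambda>x. s n x - u x)"
        using Q.sq_nonneg[OF A.diff_mem[OF s u(1)]] by simp
    qed simp
    then show "\<exists>u\<in>H10. (\<lambda>n. Q.sq (\<lambda>x. s n x - u x)) \<longlonglongrightarrow> 0" using u(1) by blast
  qed
  show ?thesis by unfold_locales (use H10_LO in blast)
qed

end

text \<open>Weights of at least 1 make the form dominate the plain Dirichlet integral, the quantity
  in Rellich's estimate.\<close>

locale weighted_domain = open_domain \<Omega> for \<Omega> :: "'a::euclidean_space set" +
  fixes c :: "'a \<Rightarrow> real"
  assumes c1: "\<And>b. b \<in> Basis \<Longrightarrow> 1 \<le> c b"
begin

sublocale F: closed_form "L2M (lebesgue_on \<Omega>)" "ipM (lebesgue_on \<Omega>)" "H10_space \<Omega>" "wform c"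
  by (rule closed_form_H10) (rule c1)

lemma A_sq: "F.A.sq u = (\<Sum>b\<in>Basis. c b * nsq (D b u))"
  by (simp add: F.A.sq_def wform_sq)

text \<open>Membership gives approximation in \<open>H1_norm\<close>; the square of the form norm is
  at most the square of that norm times the sum of the weights.\<close>

lemma H10_dense:
  assumes u: "u \<in> H10"
  shows "\<exists>\<phi>. (\<forall>n::nat. \<phi> n \<in> test) \<and> (\<lambda>n. F.Q.sq (\<lambda>x. \<phi> n x - u x)) \<longlonglongrightarrow> 0"
proof -
  define M where "M = (\<Sum>b\<in>Basis. c b)"
  have c0: "0 \<le> c b" if "b \<in> Basis" for b using c1[OF that] by simp
  have cM: "c b \<le> M" if "b \<in> Basis" for b
    unfolding M_def by (rule member_le_sum) (use that c0 in auto)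
  have M1: "1 \<le> M" using cM[OF SOME_Basis] c1[OF SOME_Basis] by linarith
  have up: "F.Q.sq v \<le> M * (H1_norm \<Omega> v)\<^sup>2" if v: "v \<in> H10" for v
  proof -
    have nn: "0 \<le> nsq v" "\<And>b. b \<in> Basis \<Longrightarrow> 0 \<le> nsq (D b v)"
      using L2.sq_nonneg[OF H10_LO[OF v]] L2.sq_nonneg[OF H1_D(1)[OF H10_H1[OF v]]] by auto
    have "(H1_norm \<Omega> v)\<^sup>2 = nsq v + (\<Sum>b\<in>Basis. nsq (D b v))"
      unfolding H1_norm_def L2_norm_eq using nn by (simp add: sum_nonneg)
    moreover have "(\<Sum>b\<in>Basis. c b * nsq (D b v)) \<le> (\<Sum>b\<in>Basis. M * nsq (D b v))"
      by (intro sum_mono mult_right_mono cM nn)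
    moreover have "nsq v \<le> M * nsq v" using mult_right_mono[OF M1 nn(1)] by simp
    ultimately show ?thesis unfolding F.Q_sq A_sq by (simp add: sum_distrib_left[symmetric] distrib_left)
  qed
  have "\<exists>\<phi>\<in>test. H1_norm \<Omega> (\<lambda>x. u x - \<phi> x) < 1 / real (Suc n)" for n
    using u unfolding H10_space_def by simp
  then obtain \<phi> where p: "\<And>n. \<phi> n \<in> test" "\<And>n. H1_norm \<Omega> (\<lambda>x. u x - \<phi> n x) < 1 / real (Suc n)" by metis
  have ph: "\<phi> n \<in> H10" for n by (rule test_H10[OF p(1)])
  have nn: "0 \<le> H1_norm \<Omega> v" for v
  proof -
    have "0 \<le> (L2_norm \<Omega> v)\<^sup>2 + (\<Sum>b\<in>Basis. (L2_norm \<Omega> (D b v))\<^sup>2)" by (simp add: sum_nonneg)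
    then show ?thesis by (simp add: H1_norm_def)
  qed
  have "(\<lambda>n. F.Q.sq (\<lambda>x. \<phi> n x - u x)) \<longlonglongrightarrow> 0"
  proof (rule tendsto_sandwich[of "\<lambda>_. 0"])
    show "\<forall>\<^sub>F n in sequentially. 0 \<le> F.Q.sq (\<lambda>x. \<phi> n x - u x)"
      using F.Q.sq_nonneg[OF F.A.diff_mem[OF ph u]] by simp
    have "F.Q.sq (\<lambda>x. \<phi> n x - u x) \<le> M * (1 / real (Suc n))\<^sup>2" for n
    proof -
      have "F.Q.sq (\<lambda>x. \<phi> n x - u x) = F.Q.sq (\<lambda>x. u x - \<phi> n x)"
        by (rule F.Q.sq_minus_commute[OF ph u])
      also have "\<dots> \<le> M * (H1_norm \<Omega> (\<lambda>x. u x - \<phi> n x))\<^sup>2" by (rule up[OF F.A.diff_mem[OF u ph]])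
      also have "\<dots> \<le> M * (1 / real (Suc n))\<^sup>2"
        using M1 nn p(2)[of n] by (intro mult_left_mono power_mono) auto
      finally show ?thesis .
    qed
    then show "\<forall>\<^sub>F n in sequentially. F.Q.sq (\<lambda>x. \<phi> n x - u x) \<le> M * (1 / real (Suc n))\<^sup>2" by simp
    have "(\<lambda>n. M * (1 / real (Suc n))\<^sup>2) \<longlonglongrightarrow> M * 0\<^sup>2" by (intro tendsto_intros LIMSEQ_Suc[OF lim_1_over_n])
    then show "(\<lambda>n. M * (1 / real (Suc n))\<^sup>2) \<longlonglongrightarrow> 0" by simp
  qed simp
  then show ?thesis using p(1) by blast
qed

lemma test_ip: "\<phi> \<in> test \<Longrightarrow> \<psi> \<in> test \<Longrightarrow> ip \<phi> \<psi> = (\<integral>x. \<phi> x * cnj (\<psi> x) \<partial>lborel)"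
  unfolding ipM_def
  by (rule integral_lebesgue_on[OF Ob])
    (simp_all add: test_zero_outside borel_measurable_times[OF test_borel[OF test_UNIV] test_borel[OF test_UNIV[OF test_cnj]]])

lemma test_nsq: "\<phi> \<in> test \<Longrightarrow> nsq \<phi> = (\<integral>x. (cmod (\<phi> x))\<^sup>2 \<partial>lborel)"
  unfolding L2_sq
  by (rule integral_lebesgue_on[OF Ob])
    (simp_all add: test_zero_outside borel_measurable_integrable[OF test_norm_sq_integrable[OF test_UNIV], simplified])

lemma test_wform:
  assumes "\<phi> \<in> test" "\<psi> \<in> test"
  shows "wform c \<phi> \<psi> = (\<Sum>b\<in>Basis. complex_of_real (c b) * (\<integral>x. partial_deriv b \<phi> x * cnj (partial_deriv b \<psi> x) \<partial>lborel))"
proof -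
  have "ip (D b \<phi>) (D b \<psi>) = (\<integral>x. partial_deriv b \<phi> x * cnj (partial_deriv b \<psi> x) \<partial>lborel)" if b: "b \<in> Basis" for b
  proof -
    have "ip (D b \<phi>) (D b \<psi>) = ip (partial_deriv b \<phi>) (partial_deriv b \<psi>)"
      by (rule ipM_cong_AE[OF H1_D(1)[OF test_H1(1)[OF assms(1)] b] test_LO[OF test_partial[OF assms(1) b]]
          H1_D(1)[OF test_H1(1)[OF assms(2)] b] test_LO[OF test_partial[OF assms(2) b]]
          test_H1(2)[OF assms(1) b] test_H1(2)[OF assms(2) b]])
    then show ?thesis using test_ip[OF test_partial[OF assms(1) b] test_partial[OF assms(2) b]] by simp
  qed
  then show ?thesis by (simp add: wform_def)
qed

lemma test_A_sq:
  assumes "\<phi> \<in> test"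
  shows "F.A.sq \<phi> = (\<Sum>b\<in>Basis. c b * (\<integral>x. (cmod (partial_deriv b \<phi> x))\<^sup>2 \<partial>lborel))"
proof -
  have "(\<integral>x. partial_deriv b \<phi> x * cnj (partial_deriv b \<phi> x) \<partial>lborel)
      = complex_of_real (\<integral>x. (cmod (partial_deriv b \<phi> x))\<^sup>2 \<partial>lborel)" for b
    unfolding complex_norm_square[symmetric] integral_complex_of_real ..
  then show ?thesis unfolding F.A.sq_def test_wform[OF assms assms] by simp
qed

lemma grad_sq_le_A_sq:
  assumes "\<phi> \<in> test"
  shows "(\<integral>x. grad_sq \<phi> x \<partial>lborel) \<le> F.A.sq \<phi>"
proof -
  have i: "integrable lborel (\<lambda>x. (cmod (partial_deriv b \<phi> x))\<^sup>2)" if "b \<in> Basis" for b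
    by (rule test_norm_sq_integrable[OF test_UNIV[OF test_partial[OF assms that]]])
  have "(\<integral>x. grad_sq \<phi> x \<partial>lborel) = (\<Sum>b\<in>Basis. (\<integral>x. (cmod (partial_deriv b \<phi> x))\<^sup>2 \<partial>lborel))"
    unfolding grad_sq_def by (rule Bochner_Integration.integral_sum) (rule i)
  also have "\<dots> \<le> (\<Sum>b\<in>Basis. c b * (\<integral>x. (cmod (partial_deriv b \<phi> x))\<^sup>2 \<partial>lborel))"
  proof (rule sum_mono)
    fix b :: 'a assume b: "b \<in> Basis"
    have "0 \<le> (\<integral>x. (cmod (partial_deriv b \<phi> x))\<^sup>2 \<partial>lborel)" by (rule Bochner_Integration.integral_nonneg) simp
    from mult_right_mono[OF c1[OF b] this]
    show "(\<integral>x. (cmod (partial_deriv b \<phi> x))\<^sup>2 \<partial>lborel) \<le> c b * (\<integral>x. (cmod (partial_deriv b \<phi> x))\<^sup>2 \<partial>lborel)" by simp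
  qed
  finally show ?thesis by (simp add: test_A_sq[OF assms])
qed

text \<open>Both sides are continuous in \<open>v\<close> for the form norm, so a residual need only
  be tested with test functions. The case \<open>K = 0\<close> serves eigenvectors.\<close>

lemma form_bound_dense:
  assumes u: "u \<in> H10" and le: "\<And>\<phi>. \<phi> \<in> test \<Longrightarrow> (cmod (wform c u \<phi> - complex_of_real r * ip u \<phi>))\<^sup>2 \<le> K * F.Q.sq \<phi>"
    and v: "v \<in> H10"
  shows "(cmod (wform c u v - complex_of_real r * ip u v))\<^sup>2 \<le> K * F.Q.sq v"
proof -
  obtain \<phi> where p: "\<And>n::nat. \<phi> n \<in> test" "(\<lambda>n. F.Q.sq (\<lambda>x. \<phi> n x - v x)) \<longlonglongrightarrow> 0"
    using H10_dense[OF v] by blast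
  have ph: "\<phi> n \<in> H10" for n by (rule test_H10[OF p(1)])
  note lims = F.Q_tendsto[OF ph v p(2)]
  have "(\<lambda>n. (cmod (wform c u (\<phi> n) - complex_of_real r * ip u (\<phi> n)))\<^sup>2)
      \<longlonglongrightarrow> (cmod (wform c u v - complex_of_real r * ip u v))\<^sup>2"
    by (intro tendsto_intros F.A.tendsto_ip_right[OF ph v u lims(1)] L2.tendsto_ip_right[OF H10_LO[OF ph] H10_LO[OF v] H10_LO[OF u] lims(2)])
  moreover have "(\<lambda>n. K * F.Q.sq (\<phi> n)) \<longlonglongrightarrow> K * F.Q.sq v"
    by (intro tendsto_intros F.Q.tendsto_sq[OF ph v p(2)])
  ultimately show ?thesis by (rule LIMSEQ_le) (use le p(1) in blast)
qed

lemma eigvec_test: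
  assumes "u \<in> H10" "\<And>\<phi>. \<phi> \<in> test \<Longrightarrow> wform c u \<phi> = complex_of_real r * ip u \<phi>"
  shows "F.eigvec r u"
  using form_bound_dense[OF assms(1), where K = 0 and r = r] assms by (auto simp: F.eigvec_def)

lemma test_ball_ip:
  assumes "\<phi> \<in> test"
  shows "ip \<phi> (\<lambda>x. indicator (ball y s) x) = (\<integral>x. indicator (ball y s) x *\<^sub>R \<phi> x \<partial>lborel)"
proof -
  have "ip \<phi> (\<lambda>x. indicator (ball y s) x) = (\<integral>x. \<phi> x * cnj (indicator (ball y s) x) \<partial>lborel)"
    unfolding ipM_def
  proof (rule integral_lebesgue_on[OF Ob])
    have [measurable]: "\<phi> \<in> borel_measurable borel" "ball y s \<in> sets borel" using test_borel[OF test_UNIV[OF assms]] by auto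
    have "(\<lambda>x. \<phi> x * cnj (indicator (ball y s) x)) = (\<lambda>x. \<phi> x * indicator (ball y s) x)"
      by (auto simp: indicator_def fun_eq_iff)
    then show "(\<lambda>x. \<phi> x * cnj (indicator (ball y s) x)) \<in> borel_measurable borel" by simp
  qed (simp add: test_zero_outside[OF assms])
  also have "(\<lambda>x. \<phi> x * cnj (indicator (ball y s) x)) = (\<lambda>x. indicator (ball y s) x *\<^sub>R \<phi> x)"
    by (auto simp: indicator_def fun_eq_iff)
  finally show ?thesis .
qed

text \<open>What the form fails to control is only the mass in a bounded set, and Rellich trades it
  for a small part of the gradient plus inner products with the indicators of finitely many
  balls.\<close>

theorem garding_criterion:
  assumes K: "bounded K" "K \<in> sets borel" and d: "\<delta> > 0" "\<mu> > 0" "\<kappa> \<ge> 0"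
    and low: "\<And>\<phi>. \<phi> \<in> test \<Longrightarrow>
      \<delta> * F.A.sq \<phi> + \<mu> * nsq \<phi> \<le> F.A.sq \<phi> - r * nsq \<phi> + \<kappa> * (\<integral>x. indicator K x * (cmod (\<phi> x))\<^sup>2 \<partial>lborel)"
  shows "F.garding r"
proof -
  \<comment> \<open>Makes \<kappa> \<epsilon> \<le> \<delta> / 2, so that half of the reserve
    \<delta> remains; the added 1 covers \<kappa> = 0.\<close>
  define \<epsilon> where "\<epsilon> = \<delta> / (2 * (\<kappa> + 1))"
  have e: "\<epsilon> > 0" "\<kappa> * \<epsilon> \<le> \<delta> / 2" using d by (auto simp: \<epsilon>_def field_simps)
  obtain X :: "'a set" and s C where X: "finite X" "s > 0" "C \<ge> 0"
    and rel: "\<And>\<phi>. test_fun \<phi> \<Longrightarrow> (\<integral>x. indicator K x * (cmod (\<phi> x))\<^sup>2 \<partial>lborel)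
      \<le> \<epsilon> * (\<integral>x. grad_sq \<phi> x \<partial>lborel) + C * (\<Sum>y\<in>X. (cmod (\<integral>x. indicator (ball y s) x *\<^sub>R \<phi> x \<partial>lborel))\<^sup>2)"
    using rellich[OF K e(1)] by blast
  define w where "w y = (\<lambda>x. indicator (ball y s) x :: complex)" for y :: 'a
  define W where "W = w ` X"
  define k where "k = min (\<delta> / 2) \<mu>"
  have k: "k > 0" "k \<le> \<delta> / 2" "k \<le> \<mu>" using d by (auto simp: k_def)
  have W: "finite W" "W \<subseteq> LO"
    unfolding W_def w_def using X(1) indicator_L2M[OF _ bounded_ball Ob] by auto
  \<comment> \<open>Different centres might give the same function in \<open>W\<close>; the factor
    \<open>card X\<close> settles this without injectivity.\<close>
  have SX: "(\<Sum>y\<in>X. (cmod (ip u (w y)))\<^sup>2) \<le> real (card X) * (\<Sum>v\<in>W. (cmod (ip u v))\<^sup>2)" for u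
  proof (rule sum_bounded_above)
    fix y assume "y \<in> X"
    then have "w y \<in> W" by (simp add: W_def)
    then show "(cmod (ip u (w y)))\<^sup>2 \<le> (\<Sum>v\<in>W. (cmod (ip u v))\<^sup>2)" by (intro member_le_sum W(1)) auto
  qed
  let ?C = "\<kappa> * C * real (card X)"
  have tst: "k * F.Q.sq \<phi> \<le> F.A.sq \<phi> - r * nsq \<phi> + ?C * (\<Sum>v\<in>W. (cmod (ip \<phi> v))\<^sup>2)" if t: "\<phi> \<in> test" for \<phi>
  proof -
    let ?n = "nsq \<phi>" and ?a = "F.A.sq \<phi>"
    have nn: "0 \<le> ?n" "0 \<le> ?a" using L2.sq_nonneg[OF test_LO[OF t]] F.A.sq_nonneg[OF test_H10[OF t]] by auto
    have "(\<integral>x. indicator K x * (cmod (\<phi> x))\<^sup>2 \<partial>lborel)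
        \<le> \<epsilon> * (\<integral>x. grad_sq \<phi> x \<partial>lborel) + C * (\<Sum>y\<in>X. (cmod (ip \<phi> (w y)))\<^sup>2)"
      using rel[OF test_UNIV[OF t]] unfolding w_def test_ball_ip[OF t] .
    also have "\<dots> \<le> \<epsilon> * ?a + C * (real (card X) * (\<Sum>v\<in>W. (cmod (ip \<phi> v))\<^sup>2))"
      using e X(3) by (intro add_mono mult_left_mono grad_sq_le_A_sq[OF t] SX) auto
    finally have "\<kappa> * (\<integral>x. indicator K x * (cmod (\<phi> x))\<^sup>2 \<partial>lborel)
        \<le> \<kappa> * (\<epsilon> * ?a + C * (real (card X) * (\<Sum>v\<in>W. (cmod (ip \<phi> v))\<^sup>2)))"
      using d(3) by (rule mult_left_mono)
    also have "\<dots> = (\<kappa> * \<epsilon>) * ?a + ?C * (\<Sum>v\<in>W. (cmod (ip \<phi> v))\<^sup>2)" by (simp add: algebra_simps)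
    also have "\<dots> \<le> (\<delta> / 2) * ?a + ?C * (\<Sum>v\<in>W. (cmod (ip \<phi> v))\<^sup>2)"
      by (intro add_right_mono mult_right_mono e nn)
    finally have 1: "\<kappa> * (\<integral>x. indicator K x * (cmod (\<phi> x))\<^sup>2 \<partial>lborel)
        \<le> (\<delta> / 2) * ?a + ?C * (\<Sum>v\<in>W. (cmod (ip \<phi> v))\<^sup>2)" .
    have 2: "k * ?a \<le> (\<delta> / 2) * ?a" "k * ?n \<le> \<mu> * ?n" by (rule mult_right_mono[OF k(2) nn(2)], rule mult_right_mono[OF k(3) nn(1)])
    have 3: "\<delta> * ?a = (\<delta> / 2) * ?a + (\<delta> / 2) * ?a" by simp
    show ?thesis unfolding F.Q_sq distrib_left using low[OF t] 1 2 3 by linarith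
  qed
  have "k * F.Q.sq u \<le> F.A.sq u - r * nsq u + ?C * (\<Sum>v\<in>W. (cmod (ip u v))\<^sup>2)" if u: "u \<in> H10" for u
  proof -
    obtain \<phi> where p: "\<And>n::nat. \<phi> n \<in> test" "(\<lambda>n. F.Q.sq (\<lambda>x. \<phi> n x - u x)) \<longlonglongrightarrow> 0"
      using H10_dense[OF u] by blast
    have ph: "\<phi> n \<in> H10" for n by (rule test_H10[OF p(1)])
    note lims = F.Q_tendsto[OF ph u p(2)]
    have ipl: "(\<lambda>n. ip (\<phi> n) v) \<longlonglongrightarrow> ip u v" if "v \<in> W" for v
      by (rule L2.tendsto_ip[OF H10_LO[OF ph] H10_LO[OF u] _ lims(2)]) (use that W(2) in blast)
    have 1: "(\<lambda>n. k * F.Q.sq (\<phi> n)) \<longlonglongrightarrow> k * F.Q.sq u"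
      by (intro tendsto_intros F.Q.tendsto_sq[OF ph u p(2)])
    have 2: "(\<lambda>n. F.A.sq (\<phi> n) - r * nsq (\<phi> n) + ?C * (\<Sum>v\<in>W. (cmod (ip (\<phi> n) v))\<^sup>2))
        \<longlonglongrightarrow> F.A.sq u - r * nsq u + ?C * (\<Sum>v\<in>W. (cmod (ip u v))\<^sup>2)"
      by (intro tendsto_intros ipl F.A.tendsto_sq[OF ph u lims(1)] L2.tendsto_sq[OF H10_LO[OF ph] H10_LO[OF u] lims(2)])
    show ?thesis by (rule LIMSEQ_le[OF 1 2]) (use tst p(1) in blast)
  qed
  then show ?thesis unfolding F.garding_def using W k(1) by blast
qed

end

section \<open>The essential spectrum of the Dirichlet Laplacian\<close>

locale dirichlet_domain = weighted_domain \<Omega> "\<lambda>_. 1" for \<Omega> :: "'a::euclidean_space set"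
begin

lemma dirichlet_laplacian_op: "dirichlet_laplacian \<Omega> = F.op"
proof -
  have "gradient_form \<Omega> u v = wform (\<lambda>_. 1) u v" for u v
    by (simp add: gradient_form_def wform_def L2_inner_eq)
  then show ?thesis
    by (simp add: dirichlet_laplacian_def form_operator_def F.op_def L2_space_eq L2_inner_eq)
qed

lemma resolvent_set_iff: "z \<in> resolvent_set \<Omega> (dirichlet_laplacian \<Omega>) \<longleftrightarrow> F.resolvent z"
proof -
  have 1: "(AE x in lebesgue_on \<Omega>. g x - z * u x = f x) \<longleftrightarrow> nsq (\<lambda>x. (g x - z * u x) - f x) = 0"
    if "(u, g) \<in> F.op" "f \<in> LO" for u g f
    unfolding L2_sq_eq_0_iff[OF L2.diff_mem[OF F.op_shift_mem[OF that(1)] that(2)]] by simp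
  have 2: "(\<exists>C. \<forall>(u, g)\<in>F.op. L2_norm \<Omega> u \<le> C * L2_norm \<Omega> (\<lambda>x. g x - z * u x))
      \<longleftrightarrow> (\<exists>C. \<forall>(u, g)\<in>F.op. nsq u \<le> C * nsq (\<lambda>x. g x - z * u x))"
  proof
    assume "\<exists>C. \<forall>(u, g)\<in>F.op. L2_norm \<Omega> u \<le> C * L2_norm \<Omega> (\<lambda>x. g x - z * u x)"
    then obtain C where C: "\<And>u g. (u, g) \<in> F.op \<Longrightarrow> L2_norm \<Omega> u \<le> C * L2_norm \<Omega> (\<lambda>x. g x - z * u x)" by blast
    have "nsq u \<le> C\<^sup>2 * nsq (\<lambda>x. g x - z * u x)" if ug: "(u, g) \<in> F.op" for u g
    proof -
      have u: "u \<in> LO" using ug H10_LO by (auto simp: F.op_def)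
      have "(sqrt (nsq u))\<^sup>2 \<le> (C * sqrt (nsq (\<lambda>x. g x - z * u x)))\<^sup>2"
        using C[OF ug] L2.sq_nonneg[OF u] unfolding L2_norm_eq by (intro power_mono) auto
      then show ?thesis
        using L2.sq_nonneg[OF u] L2.sq_nonneg[OF F.op_shift_mem[OF ug]] by (simp add: power_mult_distrib)
    qed
    then show "\<exists>C. \<forall>(u, g)\<in>F.op. nsq u \<le> C * nsq (\<lambda>x. g x - z * u x)" by blast
  next
    assume "\<exists>C. \<forall>(u, g)\<in>F.op. nsq u \<le> C * nsq (\<lambda>x. g x - z * u x)"
    then obtain C where C: "\<And>u g. (u, g) \<in> F.op \<Longrightarrow> nsq u \<le> C * nsq (\<lambda>x. g x - z * u x)" by blast
    \<comment> \<open>The real \<open>sqrt\<close> is odd, hence multiplicative for all signs, so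
      this is valid whatever the sign of \<open>C\<close>.\<close>
    have "L2_norm \<Omega> u \<le> sqrt C * L2_norm \<Omega> (\<lambda>x. g x - z * u x)" if ug: "(u, g) \<in> F.op" for u g
      using real_sqrt_le_mono[OF C[OF ug]] unfolding L2_norm_eq by (simp add: real_sqrt_mult)
    then show "\<exists>C. \<forall>(u, g)\<in>F.op. L2_norm \<Omega> u \<le> C * L2_norm \<Omega> (\<lambda>x. g x - z * u x)" by blast
  qed
  have 3: "(\<forall>f\<in>LO. \<exists>(u, g)\<in>F.op. AE x in lebesgue_on \<Omega>. g x - z * u x = f x)
      \<longleftrightarrow> (\<forall>f\<in>LO. \<exists>(u, g)\<in>F.op. nsq (\<lambda>x. (g x - z * u x) - f x) = 0)"
    by (intro ball_cong refl bex_cong) (use 1 in auto)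
  show ?thesis
    unfolding resolvent_set_def F.resolvent_def dirichlet_laplacian_op L2_space_eq mem_Collect_eq 2 3 ..
qed

lemma eigenspace_iff:
  "u \<in> eigenspace \<Omega> (dirichlet_laplacian \<Omega>) (complex_of_real r) \<longleftrightarrow> F.eigvec r u"
proof
  assume "u \<in> eigenspace \<Omega> (dirichlet_laplacian \<Omega>) (complex_of_real r)"
  then obtain g where g: "(u, g) \<in> F.op" "AE x in lebesgue_on \<Omega>. g x = complex_of_real r * u x"
    by (auto simp: eigenspace_def dirichlet_laplacian_op)
  have u: "u \<in> H10" "g \<in> LO" using g by (auto simp: F.op_def)
  have "ip g v = complex_of_real r * ip u v" if v: "v \<in> H10" for v
  proof -
    have "ip g v = ip (\<lambda>x. complex_of_real r * u x) v"
      by (rule ipM_cong_AE[OF u(2) L2.scale_mem[OF H10_LO[OF u(1)]] H10_LO[OF v] H10_LO[OF v] g(2)]) simp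
    then show ?thesis using L2.ip_scale[OF H10_LO[OF u(1)] H10_LO[OF v]] by simp
  qed
  then show "F.eigvec r u" using g(1) by (auto simp: F.op_def F.eigvec_def)
next
  assume e: "F.eigvec r u"
  then have u: "u \<in> H10" by (simp add: F.eigvec_def)
  have "(u, \<lambda>x. complex_of_real r * u x) \<in> F.op"
    using e L2.scale_mem[OF H10_LO[OF u]] L2.ip_scale[OF H10_LO[OF u] H10_LO] by (auto simp: F.eigvec_def F.op_def)
  then show "u \<in> eigenspace \<Omega> (dirichlet_laplacian \<Omega>) (complex_of_real r)"
    unfolding eigenspace_def dirichlet_laplacian_op by auto
qed

text \<open>No point of \<open>[E, \<infinity>)\<close> is isolated in the spectrum, so membership in the spectrum suffices there;
  below \<open>E\<close> the spectrum is discrete by the coercivity up to finite rank.\<close>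

theorem essential_spectrum_eqI:
  assumes below: "\<And>r. r < E \<Longrightarrow> F.garding r"
    and above: "\<And>r. r \<ge> E \<Longrightarrow> \<not> F.resolvent (complex_of_real r)"
  shows "essential_spectrum \<Omega> (dirichlet_laplacian \<Omega>) = complex_of_real ` {E..}"
proof -
  let ?A = "dirichlet_laplacian \<Omega>"
  have spec: "z \<in> spectrum \<Omega> ?A \<longleftrightarrow> \<not> F.resolvent z" for z
    by (simp add: spectrum_def resolvent_set_iff)
  show ?thesis
  proof (intro equalityI subsetI)
    fix z assume z: "z \<in> essential_spectrum \<Omega> ?A"
    then have nres: "\<not> F.resolvent z" by (simp add: essential_spectrum_def spec)
    then have "Im z = 0" using F.resolvent_nonreal by blast
    then have zr: "z = complex_of_real (Re z)" by (simp add: complex_eq_iff)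
    define r where "r = Re z"
    have zr: "z = complex_of_real r" using zr by (simp add: r_def)
    have "r \<ge> E"
    proof (rule ccontr)
      assume "\<not> r \<ge> E"
      then have rE: "r < E" by simp
      \<comment> \<open>Room above \<open>r\<close>, still below \<open>E\<close>: finiteness up to
        \<open>t\<close> isolates \<open>r\<close> from both sides.\<close>
      define t where "t = (r + E) / 2"
      have t: "r < t" "t < E" using rE by (auto simp: t_def)
      define P where "P = {s. s \<le> t \<and> (\<exists>u. F.eigvec s u \<and> nsq u \<noteq> 0)}"
      have P: "finite P" unfolding P_def by (rule F.finite_eigenvalues[OF below[OF t(2)]])
      have inP: "s \<in> P" if "\<not> F.resolvent (complex_of_real s)" "s \<le> t" for s
      proof -
        have "s < E" using that t by simp
        from F.garding_not_resolvent_eigvec[OF below[OF this] that(1)]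
        obtain u where "F.eigvec s u" "nsq u = 1" by blast
        then show ?thesis using that(2) by (force simp: P_def)
      qed
      obtain u where u: "F.eigvec r u" "nsq u = 1"
        using F.garding_not_resolvent_eigvec[OF below[OF rE]] nres zr by blast
      have "u \<in> LO" using u H10_LO by (simp add: F.eigvec_def)
      from L2_sq_eq_0_iff[OF this] have "\<not> (AE x in lebesgue_on \<Omega>. u x = 0)" using u(2) by simp
      then have ev: "is_eigenvalue \<Omega> ?A z"
        unfolding is_eigenvalue_def zr using u(1) eigenspace_iff by blast
      have fm: "finite_multiplicity \<Omega> ?A z"
      proof -
        obtain B where B: "finite B" "\<And>w. w \<in> B \<Longrightarrow> F.eigvec r w"
          "\<And>u. F.eigvec r u \<Longrightarrow> \<exists>c. nsq (\<lambda>x. u x - (\<Sum>w\<in>B. c w * w x)) = 0"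
          using F.finite_dim_eigenspace[OF below[OF rE] order_refl] by blast
        have vs: "\<exists>c. AE x in lebesgue_on \<Omega>. v x = (\<Sum>w\<in>B. c w * w x)" if v: "F.eigvec r v" for v
        proof -
          obtain c where c: "nsq (\<lambda>x. v x - (\<Sum>w\<in>B. c w * w x)) = 0" using B(3)[OF v] by blast
          have m: "(\<lambda>x. v x - (\<Sum>w\<in>B. c w * w x)) \<in> LO"
          proof (rule L2.diff_mem[OF _ L2.sum_mem])
            show "v \<in> LO" using v H10_LO by (simp add: F.eigvec_def)
            show "w \<in> LO" if "w \<in> B" for w using B(2)[OF that] H10_LO by (simp add: F.eigvec_def)
          qed
          from c have "AE x in lebesgue_on \<Omega>. v x - (\<Sum>w\<in>B. c w * w x) = 0" unfolding L2_sq_eq_0_iff[OF m] .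
          then show ?thesis by auto
        qed
        show ?thesis
          unfolding finite_multiplicity_def zr
        proof (intro exI[of _ B] conjI ballI B(1) subsetI)
          show "w \<in> eigenspace \<Omega> ?A (complex_of_real r)" if "w \<in> B" for w
            using B(2)[OF that] eigenspace_iff by blast
          show "\<exists>c. AE x in lebesgue_on \<Omega>. v x = (\<Sum>w\<in>B. c w * w x)"
            if "v \<in> eigenspace \<Omega> ?A (complex_of_real r)" for v
            using that vs eigenspace_iff by blast
        qed
      qed
      \<comment> \<open>A half plane containing \<open>r\<close>, with the other finitely many
        eigenvalues removed; nonreal points are resolvent points anyway.\<close>
      define T where "T = {z. Re z < t} - complex_of_real ` (P - {r})"
      have "open T"
        unfolding T_def by (intro open_Diff open_halfspace_Re_lt finite_imp_closed finite_imageI finite_Diff P)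
      moreover have "T \<inter> spectrum \<Omega> ?A = {z}"
      proof (intro equalityI subsetI)
        fix y assume "y \<in> T \<inter> spectrum \<Omega> ?A"
        then have y: "y \<in> T" "y \<in> spectrum \<Omega> ?A" by (rule IntD1, rule IntD2)
        have ny: "\<not> F.resolvent y" using y(2) spec by blast
        then have "Im y = 0" using F.resolvent_nonreal by blast
        then obtain s where yr: "y = complex_of_real s" using complex_is_Real_iff Reals_cases by metis
        have s: "s < t" "y \<notin> complex_of_real ` (P - {r})" using y(1) unfolding T_def yr by auto
        have "s \<in> P" using inP[of s] ny yr s(1) by simp
        then have "s = r" using s(2) yr by blast
        then show "y \<in> {z}" using yr zr by simp
      next
        fix y assume "y \<in> {z}"
        then have y: "y = complex_of_real r" using zr by simp
        have "y \<in> T" unfolding T_def y using t(1) by auto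
        moreover have "y \<in> spectrum \<Omega> ?A" using nres spec y zr by blast
        ultimately show "y \<in> T \<inter> spectrum \<Omega> ?A" by (rule IntI)
      qed
      ultimately have "z isolated_in spectrum \<Omega> ?A"
        unfolding isolated_in_def using nres spec by blast
      then show False using z ev fm unfolding essential_spectrum_def by blast
    qed
    then show "z \<in> complex_of_real ` {E..}" using zr by auto
  next
    fix z assume "z \<in> complex_of_real ` {E..}"
    then obtain r where r: "z = complex_of_real r" "r \<ge> E" by auto
    have "\<not> z isolated_in spectrum \<Omega> ?A"
    proof
      assume "z isolated_in spectrum \<Omega> ?A"
      then obtain T where T: "open T" "T \<inter> spectrum \<Omega> ?A = {z}" unfolding isolated_in_def by blast
      then have "z \<in> T" by blast
      then obtain e where e: "e > 0" "ball z e \<subseteq> T" using T(1) open_contains_ball by blast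
      let ?y = "complex_of_real (r + e / 2)"
      have "?y = z + complex_of_real (e / 2)" using r by simp
      then have "dist z ?y = e / 2" using e(1) by (simp add: dist_norm norm_minus_commute)
      then have "?y \<in> T" using e by auto
      moreover have "?y \<in> spectrum \<Omega> ?A" using above[of "r + e / 2"] r(2) e(1) by (simp add: spec)
      ultimately have "?y = z" using T(2) by blast
      then show False using r(1) e(1) by simp
    qed
    then show "z \<in> essential_spectrum \<Omega> ?A"
      using above[OF r(2)] r(1) by (simp add: essential_spectrum_def spec)
  qed
qed

end

section \<open>The transverse operator\<close>

definition trans_weight :: "real \<Rightarrow> real \<times> real \<Rightarrow> real" where
  "trans_weight \<beta> b = (if b = (0, 1) then 1 + \<beta>\<^sup>2 else 1)"

lemma Basis_plane_eq: "(Basis :: (real \<times> real) set) = {(1, 0), (0, 1)}"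
  by (auto simp: Basis_prod_def)

lemma sum_Basis_plane: "(\<Sum>b\<in>(Basis :: (real \<times> real) set). f b) = f (1, 0) + f (0, 1)"
  unfolding Basis_plane_eq by (subst sum.insert) auto

lemma Basis_plane: "(1, 0) \<in> (Basis :: (real \<times> real) set)" "(0, 1) \<in> (Basis :: (real \<times> real) set)"
  by (simp_all add: Basis_prod_def)

locale cross_section = weighted_domain S "trans_weight \<beta>" for S :: "(real \<times> real) set" and \<beta> :: real +
  assumes bounded: "bounded S" and nonempty: "S \<noteq> {}"
begin

lemma test_wform_plane:
  assumes "\<phi> \<in> test" "\<psi> \<in> test"
  shows "wform (trans_weight \<beta>) \<phi> \<psi> = (\<integral>y. partial_deriv (1, 0) \<phi> y * cnj (partial_deriv (1, 0) \<psi> y) \<partial>lborel)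
    + complex_of_real (1 + \<beta>\<^sup>2) * (\<integral>y. partial_deriv (0, 1) \<phi> y * cnj (partial_deriv (0, 1) \<psi> y) \<partial>lborel)"
  unfolding test_wform[OF assms] sum_Basis_plane by (simp add: trans_weight_def)

lemma test_A_sq_plane:
  assumes "\<phi> \<in> test"
  shows "F.A.sq \<phi> = (\<integral>y. (cmod (partial_deriv (1, 0) \<phi> y))\<^sup>2 \<partial>lborel)
    + (1 + \<beta>\<^sup>2) * (\<integral>y. (cmod (partial_deriv (0, 1) \<phi> y))\<^sup>2 \<partial>lborel)"
  unfolding test_A_sq[OF assms] sum_Basis_plane by (simp add: trans_weight_def)

text \<open>The definition of the weak derivative, with a derivative of \<phi> as test function,
  performs the integration by parts. The conjugate appears because the distributional pairing is
  bilinear and the form sesquilinear.\<close>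

lemma transverse_weak_form:
  assumes u: "u \<in> H10" and t: "\<phi> \<in> test"
  shows "(\<integral>y. u y * transverse_expression \<beta> \<phi> y \<partial>lebesgue_on S) = wform (trans_weight \<beta>) u (\<lambda>y. cnj (\<phi> y))"
proof -
  have tc: "(\<lambda>y. cnj (\<phi> y)) \<in> test" by (rule test_cnj[OF t])
  have 1: "ip (D b u) (D b (\<lambda>y. cnj (\<phi> y))) = - (\<integral>y. u y * partial_deriv b (partial_deriv b \<phi>) y \<partial>lebesgue_on S)"
    if b: "b \<in> Basis" for b
  proof -
    have cn: "partial_deriv b (\<lambda>y. cnj (\<phi> y)) = (\<lambda>y. cnj (partial_deriv b \<phi> y))"
      using partial_deriv_cnj[OF test_differentiable[OF t]] by blast
    have "ip (D b u) (D b (\<lambda>y. cnj (\<phi> y))) = ip (D b u) (\<lambda>y. cnj (partial_deriv b \<phi> y))"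
      by (rule ipM_cong_AE[OF H1_D(1)[OF H10_H1[OF u] b] H1_D(1)[OF H10_H1[OF u] b]
          H1_D(1)[OF test_H1(1)[OF tc] b] test_LO[OF test_cnj[OF test_partial[OF t b]]] AE_I2[OF refl]
          test_H1(2)[OF tc b, unfolded cn]])
    also have "\<dots> = (\<integral>y. D b u y * partial_deriv b \<phi> y \<partial>lebesgue_on S)" by (simp add: ipM_def)
    also have "\<dots> = - (\<integral>y. u y * partial_deriv b (partial_deriv b \<phi>) y \<partial>lebesgue_on S)"
      using H1_D(2)[OF H10_H1[OF u] b] test_partial[OF t b] unfolding has_weak_partial_def by simp
    finally show ?thesis .
  qed
  have i: "integrable (lebesgue_on S) (\<lambda>y. u y * partial_deriv b (partial_deriv b \<phi>) y)" if b: "b \<in> Basis" for b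
    by (rule L2M_integrable_mult[OF H10_LO[OF u] test_LO[OF test_partial[OF test_partial[OF t b] b]]])
  have "(\<lambda>y. u y * transverse_expression \<beta> \<phi> y) = (\<lambda>y. - (u y * partial_deriv (1, 0) (partial_deriv (1, 0) \<phi>) y)
      - complex_of_real (1 + \<beta>\<^sup>2) * (u y * partial_deriv (0, 1) (partial_deriv (0, 1) \<phi>) y))"
    unfolding transverse_expression_def by (rule ext) (simp add: algebra_simps)
  then have "(\<integral>y. u y * transverse_expression \<beta> \<phi> y \<partial>lebesgue_on S)
      = - (\<integral>y. u y * partial_deriv (1, 0) (partial_deriv (1, 0) \<phi>) y \<partial>lebesgue_on S)
        - complex_of_real (1 + \<beta>\<^sup>2) * (\<integral>y. u y * partial_deriv (0, 1) (partial_deriv (0, 1) \<phi>) y \<partial>lebesgue_on S)"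
    using i[OF Basis_plane(1)] i[OF Basis_plane(2)] by simp
  also have "\<dots> = wform (trans_weight \<beta>) u (\<lambda>y. cnj (\<phi> y))"
    unfolding wform_def sum_Basis_plane 1[OF Basis_plane(1)] 1[OF Basis_plane(2)] by (simp add: trans_weight_def)
  finally show ?thesis .
qed

text \<open>The distributional equation is the form equation restricted to test functions, and these
  are dense in the form domain.\<close>

lemma transverse_eigenspace_iff:
  "u \<in> eigenspace S (transverse_operator \<beta> S) (complex_of_real r) \<longleftrightarrow> F.eigvec r u"
proof
  assume "u \<in> eigenspace S (transverse_operator \<beta> S) (complex_of_real r)"
  then obtain g where g: "(u, g) \<in> transverse_operator \<beta> S" "AE y in lebesgue_on S. g y = complex_of_real r * u y"
    by (auto simp: eigenspace_def)
  have u: "u \<in> H10" and gL: "g \<in> LO"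
    and ex: "\<And>\<phi>. \<phi> \<in> test \<Longrightarrow> (\<integral>y. u y * transverse_expression \<beta> \<phi> y \<partial>lebesgue_on S) = (\<integral>y. g y * \<phi> y \<partial>lebesgue_on S)"
    using g(1) by (auto simp: transverse_operator_def L2_space_eq)
  show "F.eigvec r u"
  proof (rule eigvec_test[OF u])
    fix \<phi> assume t: "\<phi> \<in> test"
    have tc: "(\<lambda>y. cnj (\<phi> y)) \<in> test" by (rule test_cnj[OF t])
    have "wform (trans_weight \<beta>) u \<phi> = (\<integral>y. g y * cnj (\<phi> y) \<partial>lebesgue_on S)"
      using transverse_weak_form[OF u tc] ex[OF tc] by simp
    also have "\<dots> = ip g \<phi>" by (simp add: ipM_def)
    also have "\<dots> = ip (\<lambda>y. complex_of_real r * u y) \<phi>"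
      by (rule ipM_cong_AE[OF gL L2.scale_mem[OF H10_LO[OF u]] test_LO[OF t] test_LO[OF t] g(2)]) simp
    also have "\<dots> = complex_of_real r * ip u \<phi>" by (rule L2.ip_scale[OF H10_LO[OF u] test_LO[OF t]])
    finally show "wform (trans_weight \<beta>) u \<phi> = complex_of_real r * ip u \<phi>" .
  qed
next
  assume e: "F.eigvec r u"
  then have u: "u \<in> H10" by (simp add: F.eigvec_def)
  have "(\<integral>y. u y * transverse_expression \<beta> \<phi> y \<partial>lebesgue_on S) = (\<integral>y. complex_of_real r * u y * \<phi> y \<partial>lebesgue_on S)"
    if t: "\<phi> \<in> test" for \<phi>
  proof -
    have "wform (trans_weight \<beta>) u (\<lambda>y. cnj (\<phi> y)) = complex_of_real r * ip u (\<lambda>y. cnj (\<phi> y))"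
      using e test_H10[OF test_cnj[OF t]] by (simp add: F.eigvec_def)
    also have "\<dots> = ip (\<lambda>y. complex_of_real r * u y) (\<lambda>y. cnj (\<phi> y))"
      by (rule L2.ip_scale[OF H10_LO[OF u] test_LO[OF test_cnj[OF t]], symmetric])
    finally show ?thesis using transverse_weak_form[OF u t] by (simp add: ipM_def)
  qed
  then have "(u, \<lambda>y. complex_of_real r * u y) \<in> transverse_operator \<beta> S"
    unfolding transverse_operator_def L2_space_eq using u L2.scale_mem[OF H10_LO[OF u]] by simp
  then show "u \<in> eigenspace S (transverse_operator \<beta> S) (complex_of_real r)"
    unfolding eigenspace_def by auto
qed

lemma transverse_is_eigenvalue_iff:
  "is_eigenvalue S (transverse_operator \<beta> S) (complex_of_real r) \<longleftrightarrow> (\<exists>u. F.eigvec r u \<and> nsq u \<noteq> 0)"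
proof -
  have "(AE y in lebesgue_on S. u y = 0) \<longleftrightarrow> nsq u = 0" if "F.eigvec r u" for u
    using L2_sq_eq_0_iff[of u] H10_LO that by (simp add: F.eigvec_def)
  then show ?thesis unfolding is_eigenvalue_def using transverse_eigenspace_iff by blast
qed

text \<open>\<open>S\<close> is bounded, so the whole mass may sit in the remainder term that
  Rellich absorbs: every real number lies below the essential spectrum of T(\<beta>).\<close>

lemma garding_all: "F.garding r"
proof (rule garding_criterion[OF bounded Ob, of "1/2" "1/2" "\<bar>r\<bar> + 1/2"])
  fix \<phi> assume t: "\<phi> \<in> test"
  have "(\<integral>x. indicator S x * (cmod (\<phi> x))\<^sup>2 \<partial>lborel) = nsq \<phi>"
    unfolding test_nsq[OF t] using test_zero_outside[OF t]
    by (intro Bochner_Integration.integral_cong) (auto simp: indicator_def)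
  moreover have "r * nsq \<phi> \<le> \<bar>r\<bar> * nsq \<phi>"
    using L2.sq_nonneg[OF test_LO[OF t]] by (intro mult_right_mono) auto
  moreover have "0 \<le> F.A.sq \<phi>" by (rule F.A.sq_nonneg[OF test_H10[OF t]])
  ultimately show "1/2 * F.A.sq \<phi> + 1/2 * nsq \<phi>
      \<le> F.A.sq \<phi> - r * nsq \<phi> + (\<bar>r\<bar> + 1/2) * (\<integral>x. indicator S x * (cmod (\<phi> x))\<^sup>2 \<partial>lborel)"
    by (simp add: distrib_right)
qed auto

text \<open>Keeps the set of Rayleigh quotients nonempty, so that its infimum is meaningful.\<close>

lemma exists_unit_test: "\<exists>\<phi>\<in>test. nsq \<phi> = 1"
proof -
  obtain y where y: "y \<in> S" using nonempty by blast
  obtain a b where ab: "y \<in> box a b" "cbox a b \<subseteq> S"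
    using open_contains_cbox[OF O y] by metis
  define \<phi> where "\<phi> = bump a b 0"
  have t: "\<phi> \<in> test" unfolding \<phi>_def by (rule bump_test[OF ab(2)])
  have "nsq \<phi> \<noteq> 0"
  proof
    assume "nsq \<phi> = 0"
    then have "AE x in lebesgue_on S. \<phi> x = 0" unfolding L2_sq_eq_0_iff[OF test_LO[OF t]] .
    then have "AE x in lebesgue. x \<in> S \<longrightarrow> \<phi> x = 0" using Ob by (subst (asm) AE_restrict_space_iff) auto
    then have "AE x in lebesgue. x \<notin> box a b"
      by eventually_elim (use bump_nonzero[of _ a b 0] ab(2) box_subset_cbox[of a b] in \<open>auto simp: \<phi>_def\<close>)
    then have "box a b \<in> null_sets lebesgue" by (subst (asm) AE_iff_null_sets[symmetric]) auto
    then have "negligible (box a b)" by (simp add: negligible_iff_null_sets)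
    then show False using open_not_negligible[OF open_box] ab(1) by blast
  qed
  then obtain k where "nsq (\<lambda>x. k * \<phi> x) = 1" by (rule L2.normalize[OF test_LO[OF t]])
  moreover have "(\<lambda>x. k * \<phi> x) \<in> test" by (rule test_mult[OF t C_k_const])
  ultimately show ?thesis by blast
qed

text \<open>The infimum of the Rayleigh quotient. All estimates use this variational value;
  \<open>first_eigenvalue_eq\<close> identifies it with the lowest eigenvalue.\<close>

definition E1 :: real where
  "E1 = Inf (F.A.sq ` {u \<in> H10. nsq u = 1})"

lemma E1_bdd: "bdd_below (F.A.sq ` {u \<in> H10. nsq u = 1})"
  by (rule bdd_belowI2[of _ 0]) (auto intro: F.A.sq_nonneg)

lemma E1_nonempty: "F.A.sq ` {u \<in> H10. nsq u = 1} \<noteq> {}"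
  using exists_unit_test test_H10 by blast

lemma E1_nonneg: "0 \<le> E1"
  unfolding E1_def by (rule cInf_greatest[OF E1_nonempty]) (auto intro: F.A.sq_nonneg)

lemma E1_le:
  assumes u: "u \<in> H10"
  shows "E1 * nsq u \<le> F.A.sq u"
proof (cases "nsq u = 0")
  case False
  then have pos: "nsq u > 0" using L2.sq_nonneg[OF H10_LO[OF u]] by simp
  obtain k where k: "nsq (\<lambda>x. k * u x) = 1" "(cmod k)\<^sup>2 = 1 / nsq u"
    by (rule L2.normalize[OF H10_LO[OF u] False])
  then have "E1 \<le> F.A.sq (\<lambda>x. k * u x)"
    unfolding E1_def using F.A.scale_mem[OF u] by (intro cInf_lower[OF _ E1_bdd]) auto
  also have "\<dots> = F.A.sq u / nsq u" using F.A.sq_scale[OF u] k(2) by simp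
  finally show ?thesis using pos by (simp add: field_simps)
qed (use F.A.sq_nonneg[OF u] in simp)

lemma shifted_form: "semi_inner H10 (\<lambda>u v. wform (trans_weight \<beta>) u v - complex_of_real E1 * ip u v)"
proof -
  have "semi_inner H10 (\<lambda>u v. wform (trans_weight \<beta>) u v + complex_of_real (- E1) * ip u v)"
  proof (rule semi_inner_add[OF F.A.semi_inner_axioms L2.semi_inner_axioms])
    show "0 \<le> Re (wform (trans_weight \<beta>) u u + complex_of_real (- E1) * ip u u)" if "u \<in> H10" for u
      using E1_le[OF that] by (simp add: F.A.sq_def L2.sq_def)
  qed (use H10_LO in blast)
  then show ?thesis by simp
qed

text \<open>The form minus \<open>E1\<close> is nonnegative and hence satisfies Cauchy-Schwarz. A
  near-minimiser therefore has a small residual against the whole form domain, whatever its second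
  derivatives do.\<close>

lemma shifted_cauchy_schwarz:
  assumes u: "u \<in> H10" and v: "v \<in> H10"
  shows "(cmod (wform (trans_weight \<beta>) u v - complex_of_real E1 * ip u v))\<^sup>2 \<le> (F.A.sq u - E1 * nsq u) * F.A.sq v"
proof -
  interpret B: semi_inner H10 "\<lambda>u v. wform (trans_weight \<beta>) u v - complex_of_real E1 * ip u v"
    by (rule shifted_form)
  have Bsq: "B.sq w = F.A.sq w - E1 * nsq w" for w by (simp add: B.sq_def F.A.sq_def L2.sq_def)
  have "(cmod (wform (trans_weight \<beta>) u v - complex_of_real E1 * ip u v))\<^sup>2 \<le> B.sq v * B.sq u"
    by (rule B.cauchy_schwarz[OF v u])
  also have "\<dots> \<le> F.A.sq v * B.sq u"
    using E1_nonneg L2.sq_nonneg[OF H10_LO[OF v]] by (intro mult_right_mono B.sq_nonneg[OF u]) (simp add: Bsq)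
  finally show ?thesis unfolding Bsq by (simp add: mult.commute)
qed

text \<open>A minimising sequence consists of approximate eigenvectors by
  \<open>shifted_cauchy_schwarz\<close>; coercivity up to finite rank supplies the
  compactness.\<close>

lemma E1_attained: "\<exists>u. F.eigvec E1 u \<and> nsq u = 1"
proof -
  have "\<exists>u\<in>H10. nsq u = 1 \<and> F.A.sq u < E1 + 1 / real (Suc n)" for n
  proof -
    have "Inf (F.A.sq ` {u \<in> H10. nsq u = 1}) < E1 + 1 / real (Suc n)" unfolding E1_def by simp
    from cInf_lessD[OF E1_nonempty this] show ?thesis by blast
  qed
  then obtain s where s: "\<And>n. s n \<in> H10" "\<And>n. nsq (s n) = 1" "\<And>n. F.A.sq (s n) < E1 + 1 / real (Suc n)"
    by metis
  show ?thesis
  proof (rule F.approx_eigvec[where s = s and K = "E1 + 2" and e = "\<lambda>n. 1 / real (Suc n)", OF garding_all s(1,2)])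
    show "F.Q.sq (s n) \<le> E1 + 2" for n
    proof -
      have "1 / real (Suc n) \<le> 1" by simp
      then show ?thesis using s(2,3)[of n] unfolding F.Q_sq by linarith
    qed
    show "(cmod (wform (trans_weight \<beta>) (s n) v - complex_of_real E1 * ip (s n) v))\<^sup>2 \<le> 1 / real (Suc n) * F.Q.sq v"
      if v: "v \<in> H10" for n v
    proof -
      have "(cmod (wform (trans_weight \<beta>) (s n) v - complex_of_real E1 * ip (s n) v))\<^sup>2
          \<le> (F.A.sq (s n) - E1 * nsq (s n)) * F.A.sq v" by (rule shifted_cauchy_schwarz[OF s(1) v])
      also have "\<dots> \<le> 1 / real (Suc n) * F.Q.sq v"
        using s(2,3)[of n] F.A.sq_nonneg[OF v] F.A_le_Q[OF v] E1_le[OF s(1)[of n]] by (intro mult_mono) auto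
      finally show ?thesis .
    qed
    show "(\<lambda>n. 1 / real (Suc n)) \<longlonglongrightarrow> 0" by (rule LIMSEQ_Suc[OF lim_1_over_n])
  qed
qed

text \<open>\<open>LEAST\<close> over the reals has the expected value because the infimum is
  attained.\<close>

theorem first_eigenvalue_eq: "first_eigenvalue S (transverse_operator \<beta> S) = E1"
  unfolding first_eigenvalue_def
proof (rule Least_equality)
  show "is_eigenvalue S (transverse_operator \<beta> S) (complex_of_real E1)"
    using E1_attained unfolding transverse_is_eigenvalue_iff by force
next
  fix r assume "is_eigenvalue S (transverse_operator \<beta> S) (complex_of_real r)"
  then obtain u where u: "F.eigvec r u" "nsq u \<noteq> 0" unfolding transverse_is_eigenvalue_iff by blast
  have uH: "u \<in> H10" using u by (simp add: F.eigvec_def)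
  have "nsq u > 0" using u(2) L2.sq_nonneg[OF H10_LO[OF uH]] by simp
  moreover have "E1 * nsq u \<le> r * nsq u" using E1_le[OF uH] F.eigvec_sq[OF u(1)] by simp
  ultimately show "E1 \<le> r" by simp
qed

text \<open>The minimiser is replaced by a test function, so that its product with a smooth wave is
  a test function of the waveguide.\<close>

lemma E1_approx:
  assumes e: "e > 0"
  shows "\<exists>\<phi>\<in>test. nsq \<phi> > 0 \<and> F.A.sq \<phi> - E1 * nsq \<phi> \<le> e * nsq \<phi>"
proof -
  obtain u where u: "F.eigvec E1 u" "nsq u = 1" using E1_attained by blast
  have uH: "u \<in> H10" using u by (simp add: F.eigvec_def)
  obtain \<phi> where p: "\<And>n::nat. \<phi> n \<in> test" "(\<lambda>n. F.Q.sq (\<lambda>x. \<phi> n x - u x)) \<longlonglongrightarrow> 0"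
    using H10_dense[OF uH] by blast
  have ph: "\<phi> n \<in> H10" for n by (rule test_H10[OF p(1)])
  note lims = F.Q_tendsto[OF ph uH p(2)]
  have n: "(\<lambda>n. nsq (\<phi> n)) \<longlonglongrightarrow> 1"
    using L2.tendsto_sq[OF H10_LO[OF ph] H10_LO[OF uH] lims(2)] u(2) by simp
  have "(\<lambda>n. F.A.sq (\<phi> n) - E1 * nsq (\<phi> n) - e * nsq (\<phi> n)) \<longlonglongrightarrow> F.A.sq u - E1 * nsq u - e * nsq u"
    by (intro tendsto_intros F.A.tendsto_sq[OF ph uH lims(1)] L2.tendsto_sq[OF H10_LO[OF ph] H10_LO[OF uH] lims(2)])
  then have "(\<lambda>n. F.A.sq (\<phi> n) - E1 * nsq (\<phi> n) - e * nsq (\<phi> n)) \<longlonglongrightarrow> - e"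
    using F.eigvec_sq[OF u(1)] u(2) by simp
  then have "\<forall>\<^sub>F n in sequentially. F.A.sq (\<phi> n) - E1 * nsq (\<phi> n) - e * nsq (\<phi> n) < 0"
    by (rule order_tendstoD) (use e in simp)
  moreover have "\<forall>\<^sub>F n in sequentially. nsq (\<phi> n) > 0" using n by (rule order_tendstoD) simp
  ultimately have "\<forall>\<^sub>F n in sequentially. nsq (\<phi> n) > 0 \<and> F.A.sq (\<phi> n) - E1 * nsq (\<phi> n) \<le> e * nsq (\<phi> n)"
    by eventually_elim simp
  then obtain n where "nsq (\<phi> n) > 0 \<and> F.A.sq (\<phi> n) - E1 * nsq (\<phi> n) \<le> e * nsq (\<phi> n)"
    by (auto simp: eventually_sequentially)
  then show ?thesis using p(1) by blast
qed

end

section \<open>The waveguide\<close>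

subsection \<open>Volume preserving shears\<close>

lemma distr_lborel_pairI:
  fixes T :: "'a::euclidean_space \<times> 'b::euclidean_space \<Rightarrow> 'a \<times> 'b"
  assumes T [measurable]: "T \<in> borel_measurable borel"
    and inv: "\<And>A. A \<in> sets borel \<Longrightarrow> (\<integral>\<^sup>+p. indicator A (T p) \<partial>lborel) = (\<integral>\<^sup>+p. indicator A p \<partial>lborel)"
  shows "distr lborel borel T = lborel"
proof (rule measure_eqI)
  fix A assume "A \<in> sets (distr lborel borel T)"
  then have A [measurable]: "A \<in> sets borel" by simp
  have "emeasure (distr lborel borel T) A = (\<integral>\<^sup>+p. indicator A p \<partial>distr lborel borel T)" by simp
  also have "\<dots> = (\<integral>\<^sup>+p. indicator A (T p) \<partial>lborel)" by (rule nn_integral_distr) auto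
  also have "\<dots> = emeasure lborel A" using inv[OF A] by simp
  finally show "emeasure (distr lborel borel T) A = emeasure lborel A" .
qed simp

lemma nn_integral_lborel_pair_fst:
  fixes f :: "'a::euclidean_space \<times> 'b::euclidean_space \<Rightarrow> ennreal"
  assumes "f \<in> borel_measurable borel"
  shows "(\<integral>\<^sup>+p. f p \<partial>lborel) = (\<integral>\<^sup>+x. \<integral>\<^sup>+y. f (x, y) \<partial>lborel \<partial>lborel)"
proof -
  have "f \<in> borel_measurable (lborel \<Otimes>\<^sub>M lborel)" unfolding lborel_prod using assms by simp
  from lborel.nn_integral_fst[OF this] show ?thesis unfolding lborel_prod by simp
qed

lemma nn_integral_lborel_pair_snd:
  fixes f :: "'a::euclidean_space \<times> 'b::euclidean_space \<Rightarrow> ennreal"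
  assumes "f \<in> borel_measurable borel"
  shows "(\<integral>\<^sup>+p. f p \<partial>lborel) = (\<integral>\<^sup>+y. \<integral>\<^sup>+x. f (x, y) \<partial>lborel \<partial>lborel)"
proof -
  have "(\<lambda>(x, y). f (x, y)) \<in> borel_measurable (lborel \<Otimes>\<^sub>M lborel)" unfolding lborel_prod using assms by simp
  from lborel_pair.nn_integral_snd[OF this] show ?thesis unfolding lborel_prod by simp
qed

text \<open>In each fibre the shear is a translation, which preserves Lebesgue measure; Tonelli
  assembles the fibres.\<close>

lemma distr_shear_fst:
  fixes g :: "'b::euclidean_space \<Rightarrow> 'a::euclidean_space"
  assumes g: "continuous_on UNIV g"
  shows "distr lborel borel (\<lambda>p. (fst p + g (snd p), snd p)) = lborel"
proof (rule distr_lborel_pairI)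
  show m: "(\<lambda>p. (fst p + g (snd p), snd p)) \<in> borel_measurable borel"
    by (intro borel_measurable_continuous_onI continuous_intros continuous_on_compose2[OF g]) auto
  fix A :: "('a \<times> 'b) set" assume A: "A \<in> sets borel"
  have im: "(\<lambda>p. indicator A p :: ennreal) \<in> borel_measurable borel" using A by simp
  have "(\<integral>\<^sup>+p. indicator A (fst p + g (snd p), snd p) \<partial>lborel)
      = (\<integral>\<^sup>+y. \<integral>\<^sup>+x. indicator A (x + g y, y) \<partial>lborel \<partial>lborel)"
    by (subst nn_integral_lborel_pair_snd) (use measurable_compose[OF m im] in simp_all)
  also have "\<dots> = (\<integral>\<^sup>+y. \<integral>\<^sup>+x. indicator A (x, y) \<partial>lborel \<partial>lborel)"
  proof (rule nn_integral_cong)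
    fix y :: 'b
    have "(\<lambda>x :: 'a. (x, y)) \<in> borel_measurable borel" by (intro borel_measurable_continuous_onI continuous_intros)
    from measurable_compose[OF this im]
    show "(\<integral>\<^sup>+x. indicator A (x + g y, y) \<partial>lborel) = (\<integral>\<^sup>+x. indicator A (x, y) \<partial>(lborel :: 'a measure))"
      by (rule lborel_nn_integral_translate)
  qed
  also have "\<dots> = (\<integral>\<^sup>+p. indicator A p \<partial>lborel)" by (rule nn_integral_lborel_pair_snd[OF im, symmetric])
  finally show "(\<integral>\<^sup>+p. indicator A (fst p + g (snd p), snd p) \<partial>lborel) = (\<integral>\<^sup>+p. indicator A p \<partial>lborel)" .
qed

lemma distr_shear_snd:
  fixes g :: "'a::euclidean_space \<Rightarrow> 'b::euclidean_space"
  assumes g: "continuous_on UNIV g"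
  shows "distr lborel borel (\<lambda>p. (fst p, snd p + g (fst p))) = lborel"
proof (rule distr_lborel_pairI)
  show m: "(\<lambda>p. (fst p, snd p + g (fst p))) \<in> borel_measurable borel"
    by (intro borel_measurable_continuous_onI continuous_intros continuous_on_compose2[OF g]) auto
  fix A :: "('a \<times> 'b) set" assume A: "A \<in> sets borel"
  have im: "(\<lambda>p. indicator A p :: ennreal) \<in> borel_measurable borel" using A by simp
  have "(\<integral>\<^sup>+p. indicator A (fst p, snd p + g (fst p)) \<partial>lborel)
      = (\<integral>\<^sup>+x. \<integral>\<^sup>+y. indicator A (x, y + g x) \<partial>lborel \<partial>lborel)"
    by (subst nn_integral_lborel_pair_fst) (use measurable_compose[OF m im] in simp_all)
  also have "\<dots> = (\<integral>\<^sup>+x. \<integral>\<^sup>+y. indicator A (x, y) \<partial>lborel \<partial>lborel)"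
  proof (rule nn_integral_cong)
    fix x :: 'a
    have "(\<lambda>y :: 'b. (x, y)) \<in> borel_measurable borel" by (intro borel_measurable_continuous_onI continuous_intros)
    from measurable_compose[OF this im]
    show "(\<integral>\<^sup>+y. indicator A (x, y + g x) \<partial>lborel) = (\<integral>\<^sup>+y. indicator A (x, y) \<partial>(lborel :: 'b measure))"
      by (rule lborel_nn_integral_translate)
  qed
  also have "\<dots> = (\<integral>\<^sup>+p. indicator A p \<partial>lborel)" by (rule nn_integral_lborel_pair_fst[OF im, symmetric])
  finally show "(\<integral>\<^sup>+p. indicator A (fst p, snd p + g (fst p)) \<partial>lborel) = (\<integral>\<^sup>+p. indicator A p \<partial>lborel)" .
qed

lemma distr_reflect_fst:
  fixes \<sigma> :: real
  assumes \<sigma>: "\<sigma> * \<sigma> = 1"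
  shows "distr lborel borel (\<lambda>p :: real \<times> 'b::euclidean_space. (\<sigma> * fst p, snd p)) = lborel"
proof (rule distr_lborel_pairI)
  show m: "(\<lambda>p :: real \<times> 'b. (\<sigma> * fst p, snd p)) \<in> borel_measurable borel"
    by (intro borel_measurable_continuous_onI continuous_intros)
  fix A :: "(real \<times> 'b) set" assume A: "A \<in> sets borel"
  have im: "(\<lambda>p. indicator A p :: ennreal) \<in> borel_measurable borel" using A by simp
  have s: "\<sigma> \<noteq> 0" "\<bar>\<sigma>\<bar> = 1" using \<sigma> by (auto simp: abs_if square_eq_1_iff)
  have "(\<integral>\<^sup>+p. indicator A (\<sigma> * fst p, snd p) \<partial>(lborel :: (real \<times> 'b) measure))
      = (\<integral>\<^sup>+y. \<integral>\<^sup>+x. indicator A (\<sigma> * x, y) \<partial>lborel \<partial>lborel)"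
    by (subst nn_integral_lborel_pair_snd) (use measurable_compose[OF m im] in simp_all)
  also have "\<dots> = (\<integral>\<^sup>+y. \<integral>\<^sup>+x. indicator A (x, y) \<partial>lborel \<partial>lborel)"
  proof (rule nn_integral_cong)
    fix y :: 'b
    have "(\<lambda>x::real. (x, y)) \<in> borel_measurable borel" by (intro borel_measurable_continuous_onI continuous_intros)
    from nn_integral_real_affine[OF measurable_compose[OF this im] s(1), of 0]
    show "(\<integral>\<^sup>+x. indicator A (\<sigma> * x, y) \<partial>lborel) = (\<integral>\<^sup>+x. indicator A (x, y) \<partial>lborel)" by (simp add: s(2))
  qed
  also have "\<dots> = (\<integral>\<^sup>+p. indicator A p \<partial>lborel)" by (rule nn_integral_lborel_pair_snd[OF im, symmetric])
  finally show "(\<integral>\<^sup>+p. indicator A (\<sigma> * fst p, snd p) \<partial>(lborel :: (real \<times> 'b) measure)) = (\<integral>\<^sup>+p. indicator A p \<partial>lborel)" .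
qed

text \<open>Orthogonal coordinates along the half \<open>\<sigma> x > 0\<close> of the tube: \<open>s\<close> runs in the direction
  \<open>(\<sigma>, 0, \<beta>)\<close>, and the point with coordinates \<open>(s, y)\<close> has transverse coordinate \<open>y\<close>, that is
  \<open>z - \<beta> \<sigma> x = y\<^sub>2\<close>. The planes of constant \<open>s\<close> are orthogonal to that direction.\<close>

definition tube :: "real \<Rightarrow> real \<Rightarrow> real \<times> real \<times> real \<Rightarrow> real \<times> real \<times> real" where
  "tube \<beta> \<sigma> q = (\<sigma> * (fst q - \<beta> / (1 + \<beta>\<^sup>2) * snd (snd q)), fst (snd q), \<beta> * fst q + 1 / (1 + \<beta>\<^sup>2) * snd (snd q))"

text \<open>The inverse of \<open>tube\<close>. For \<sigma> = 1 or -1 the first component is the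
  coefficient of the orthogonal projection onto (\<sigma>, 0, \<beta>), a vector of squared length 1
  + \<beta>^2.\<close>

definition untube :: "real \<Rightarrow> real \<Rightarrow> real \<times> real \<times> real \<Rightarrow> real \<times> real \<times> real" where
  "untube \<beta> \<sigma> p = (1 / (1 + \<beta>\<^sup>2) * (\<sigma> * fst p + \<beta> * snd (snd p)), fst (snd p), snd (snd p) - \<beta> * \<sigma> * fst p)"

lemma one_plus_sq_pos: "0 < 1 + (b::real)\<^sup>2"
  by (simp add: add_pos_nonneg)

lemma sign_cases:
  fixes \<sigma> :: real
  assumes "\<sigma> * \<sigma> = 1"
  shows "\<sigma> = 1 \<or> \<sigma> = -1"
  using square_eq_1_iff[of \<sigma>] assms by simp

lemma untube_tube:
  assumes "\<sigma> * \<sigma> = 1"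
  shows "untube \<beta> \<sigma> (tube \<beta> \<sigma> q) = q"
proof -
  define k where "k = 1 / (1 + \<beta>\<^sup>2)"
  have k: "k * (1 + \<beta>\<^sup>2) = 1" "\<beta> / (1 + \<beta>\<^sup>2) = \<beta> * k" using one_plus_sq_pos[of \<beta>] by (simp_all add: k_def)
  obtain s y1 y2 where q: "q = (s, y1, y2)" by (cases q) auto
  have s: "\<sigma> * (\<sigma> * t) = t" for t using assms by (metis mult.assoc mult_1)
  have "k * (s - \<beta> * k * y2 + \<beta> * (\<beta> * s + k * y2)) = s * (k * (1 + \<beta>\<^sup>2))"
    by (simp add: algebra_simps power2_eq_square)
  moreover have "\<beta> * s + k * y2 - \<beta> * (s - \<beta> * k * y2) = y2 * (k * (1 + \<beta>\<^sup>2))"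
    by (simp add: algebra_simps power2_eq_square)
  ultimately show ?thesis
    unfolding q tube_def untube_def k_def[symmetric] k(2) by (simp add: s mult.assoc k(1)[unfolded mult.assoc])
qed

lemma tube_untube:
  assumes "\<sigma> * \<sigma> = 1"
  shows "tube \<beta> \<sigma> (untube \<beta> \<sigma> p) = p"
proof -
  define k where "k = 1 / (1 + \<beta>\<^sup>2)"
  have k: "k * (1 + \<beta>\<^sup>2) = 1" "\<beta> / (1 + \<beta>\<^sup>2) = \<beta> * k" using one_plus_sq_pos[of \<beta>] by (simp_all add: k_def)
  obtain x y z where p: "p = (x, y, z)" by (cases p) auto
  have "k * (\<sigma> * x + \<beta> * z) - \<beta> * k * (z - \<beta> * \<sigma> * x) = \<sigma> * x * (k * (1 + \<beta>\<^sup>2))"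
    by (simp add: algebra_simps power2_eq_square)
  then have 1: "k * (\<sigma> * x + \<beta> * z) - \<beta> * k * (z - \<beta> * \<sigma> * x) = \<sigma> * x" by (simp add: k)
  have "\<beta> * (k * (\<sigma> * x + \<beta> * z)) + k * (z - \<beta> * \<sigma> * x) = z * (k * (1 + \<beta>\<^sup>2))"
    by (simp add: algebra_simps power2_eq_square)
  then have 2: "\<beta> * (k * (\<sigma> * x + \<beta> * z)) + k * (z - \<beta> * \<sigma> * x) = z" by (simp add: k)
  have "\<sigma> * (\<sigma> * x) = x" using assms by (metis mult.assoc mult_1)
  then show ?thesis
    unfolding p tube_def untube_def k_def[symmetric] k(2) fst_conv snd_conv 1 2 by simp
qed

lemma tube_continuous: "continuous_on UNIV (tube \<beta> \<sigma>)"
  unfolding tube_def by (intro continuous_intros)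

lemma untube_continuous: "continuous_on UNIV (untube \<beta> \<sigma>)"
  unfolding untube_def by (intro continuous_intros)

lemma tube_measurable [measurable]: "tube \<beta> \<sigma> \<in> borel_measurable borel"
  by (rule borel_measurable_continuous_onI[OF tube_continuous])

lemma untube_measurable [measurable]: "untube \<beta> \<sigma> \<in> borel_measurable borel"
  by (rule borel_measurable_continuous_onI[OF untube_continuous])

text \<open>The map factors into two shears and at most one reflection, each preserving volume; no
  determinant is computed.\<close>

lemma distr_tube:
  assumes \<sigma>: "\<sigma> * \<sigma> = 1"
  shows "distr lborel borel (tube \<beta> \<sigma>) = lborel"
proof -
  define T1 :: "real \<times> real \<times> real \<Rightarrow> real \<times> real \<times> real" where
    "T1 p = (fst p + - \<beta> / (1 + \<beta>\<^sup>2) * snd (snd p), snd p)" for p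
  define T2 :: "real \<times> real \<times> real \<Rightarrow> real \<times> real \<times> real" where
    "T2 p = (fst p, snd p + (0, \<beta> * fst p))" for p
  define T3 :: "real \<times> real \<times> real \<Rightarrow> real \<times> real \<times> real" where
    "T3 p = (\<sigma> * fst p, snd p)" for p
  have m [measurable]: "T1 \<in> borel_measurable borel" "T2 \<in> borel_measurable borel" "T3 \<in> borel_measurable borel"
    unfolding T1_def T2_def T3_def by (intro borel_measurable_continuous_onI continuous_intros)+
  have d1: "distr lborel borel T1 = lborel"
    unfolding T1_def by (rule distr_shear_fst[of "\<lambda>y. - \<beta> / (1 + \<beta>\<^sup>2) * snd y"]) (intro continuous_intros)
  have d2: "distr lborel borel T2 = lborel"
    unfolding T2_def by (rule distr_shear_snd[of "\<lambda>x. (0, \<beta> * x)"]) (intro continuous_intros)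
  have d3: "distr lborel borel T3 = lborel" unfolding T3_def by (rule distr_reflect_fst[OF \<sigma>])
  have n: "1 + \<beta>\<^sup>2 \<noteq> 0" using one_plus_sq_pos[of \<beta>] by simp
  have "tube \<beta> \<sigma> = T3 \<circ> (T2 \<circ> T1)"
  proof
    fix q :: "real \<times> real \<times> real"
    obtain s y1 y2 where q: "q = (s, y1, y2)" by (cases q) auto
    have "y2 + \<beta> * (s + - \<beta> / (1 + \<beta>\<^sup>2) * y2) = \<beta> * s + 1 / (1 + \<beta>\<^sup>2) * y2"
      using n by (simp add: field_simps power2_eq_square)
    then show "tube \<beta> \<sigma> q = (T3 \<circ> (T2 \<circ> T1)) q"
      unfolding q by (simp add: T1_def T2_def T3_def tube_def)
  qed
  then have "distr lborel borel (tube \<beta> \<sigma>) = distr (distr (distr lborel borel T1) borel T2) borel T3"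
    by (simp add: distr_distr comp_assoc)
  then show ?thesis by (simp add: d1 d2 d3)
qed

lemma integral_tube:
  fixes f :: "real \<times> real \<times> real \<Rightarrow> 'b::{banach, second_countable_topology}"
  assumes \<sigma>: "\<sigma> * \<sigma> = 1" and f: "integrable lborel f"
  shows "integrable lborel (\<lambda>q. f (tube \<beta> \<sigma> q))" "(\<integral>q. f (tube \<beta> \<sigma> q) \<partial>lborel) = (\<integral>p. f p \<partial>lborel)"
proof -
  have fm: "f \<in> borel_measurable borel" using f by auto
  have "integrable (distr lborel borel (tube \<beta> \<sigma>)) f" unfolding distr_tube[OF \<sigma>] by (rule f)
  then show "integrable lborel (\<lambda>q. f (tube \<beta> \<sigma> q))" by (subst (asm) integrable_distr_eq) (use fm in auto)
  have "(\<integral>p. f p \<partial>lborel) = (\<integral>p. f p \<partial>distr lborel borel (tube \<beta> \<sigma>))" unfolding distr_tube[OF \<sigma>] ..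
  also have "\<dots> = (\<integral>q. f (tube \<beta> \<sigma> q) \<partial>lborel)" by (rule integral_distr) (use fm in auto)
  finally show "(\<integral>q. f (tube \<beta> \<sigma> q) \<partial>lborel) = (\<integral>p. f p \<partial>lborel)" by simp
qed

lemma lborel_fubini:
  fixes f :: "'a::euclidean_space \<times> 'b::euclidean_space \<Rightarrow> 'c::{banach, second_countable_topology}"
  assumes "integrable lborel f"
  shows "integrable lborel (\<lambda>x. \<integral>y. f (x, y) \<partial>lborel)" "(\<integral>x. \<integral>y. f (x, y) \<partial>lborel \<partial>lborel) = (\<integral>p. f p \<partial>lborel)"
proof -
  have "integrable (lborel \<Otimes>\<^sub>M lborel) f" unfolding lborel_prod by (rule assms)
  from lborel_pair.integrable_fst'[OF this] lborel_pair.integral_fst'[OF this]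
  show "integrable lborel (\<lambda>x. \<integral>y. f (x, y) \<partial>lborel)" "(\<integral>x. \<integral>y. f (x, y) \<partial>lborel \<partial>lborel) = (\<integral>p. f p \<partial>lborel)"
    unfolding lborel_prod by auto
qed

lemma partial_deriv_local:
  assumes "open U" "x \<in> U" "\<And>y. y \<in> U \<Longrightarrow> g y = f y" "f differentiable at x"
  shows "partial_deriv b g x = partial_deriv b f x"
proof -
  have "(g has_derivative frechet_derivative f (at x)) (at x)"
    by (rule has_derivative_transform_within_open[OF differentiable_has_derivative[OF assms(4)] assms(1,2)])
      (use assms(3) in simp)
  from partial_deriv_eqI[OF this] show ?thesis by (simp add: partial_deriv_def)
qed

lemma Basis_space: "(Basis :: (real \<times> real \<times> real) set) = {(1, 0, 0), (0, 1, 0), (0, 0, 1)}"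
  by (auto simp: Basis_prod_def zero_prod_def)

lemma sum_Basis_space:
  "(\<Sum>b\<in>(Basis :: (real \<times> real \<times> real) set). f b) = f (1, 0, 0) + f (0, 1, 0) + f (0, 0, 1)"
  unfolding Basis_space by (simp add: add.assoc)

lemma Basis_space_mem:
  "(1, 0, 0) \<in> (Basis :: (real \<times> real \<times> real) set)" "(0, 1, 0) \<in> (Basis :: (real \<times> real \<times> real) set)"
  "(0, 0, 1) \<in> (Basis :: (real \<times> real \<times> real) set)"
  unfolding Basis_space by auto

abbreviation dx :: "(real \<times> real \<times> real \<Rightarrow> complex) \<Rightarrow> real \<times> real \<times> real \<Rightarrow> complex" where "dx \<equiv> partial_deriv (1, 0, 0)"
abbreviation dy :: "(real \<times> real \<times> real \<Rightarrow> complex) \<Rightarrow> real \<times> real \<times> real \<Rightarrow> complex" where "dy \<equiv> partial_deriv (0, 1, 0)"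
abbreviation dz :: "(real \<times> real \<times> real \<Rightarrow> complex) \<Rightarrow> real \<times> real \<times> real \<Rightarrow> complex" where "dz \<equiv> partial_deriv (0, 0, 1)"

text \<open>\<open>dn\<close> is the derivative with respect to \<open>y\<^sub>2\<close> in the coordinates \<open>(s, y)\<close>.\<close>

definition dn :: "real \<Rightarrow> real \<Rightarrow> (real \<times> real \<times> real \<Rightarrow> complex) \<Rightarrow> real \<times> real \<times> real \<Rightarrow> complex" where
  "dn \<beta> \<sigma> v p = complex_of_real (1 / (1 + \<beta>\<^sup>2)) * (dz v p - complex_of_real (\<beta> * \<sigma>) * dx v p)"

locale waveguide =
  fixes S :: "(real \<times> real) set" and \<beta> :: real
  assumes open_S: "open S" and bounded_S: "bounded S" and nonempty_S: "S \<noteq> {}" and beta_pos: "\<beta> > 0"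
begin

abbreviation "\<Omega> \<equiv> broken_sheared_waveguide \<beta> S"

lemma mem_Omega: "(x, y, z) \<in> \<Omega> \<longleftrightarrow> (y, z - \<beta> * \<bar>x\<bar>) \<in> S"
proof
  assume "(x, y, z) \<in> \<Omega>"
  then show "(y, z - \<beta> * \<bar>x\<bar>) \<in> S"
    by (auto simp: broken_sheared_waveguide_def shear_map_def bent_curve_def)
next
  assume "(y, z - \<beta> * \<bar>x\<bar>) \<in> S"
  then have "(x, y, z - \<beta> * \<bar>x\<bar>) \<in> UNIV \<times> S" by simp
  moreover have "(x, y, z) = shear_map \<beta> (x, y, z - \<beta> * \<bar>x\<bar>)" by (simp add: shear_map_def bent_curve_def)
  ultimately show "(x, y, z) \<in> \<Omega>" unfolding broken_sheared_waveguide_def by blast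
qed

lemma open_Omega: "open \<Omega>"
proof -
  have "\<Omega> = (\<lambda>p. (fst (snd p), snd (snd p) - \<beta> * \<bar>fst p\<bar>)) -` S"
    by (auto simp: mem_Omega)
  moreover have "open ((\<lambda>p::real \<times> real \<times> real. (fst (snd p), snd (snd p) - \<beta> * \<bar>fst p\<bar>)) -` S)"
    by (intro open_vimage open_S continuous_intros)
  ultimately show ?thesis by simp
qed

end

sublocale waveguide \<subseteq> C: cross_section S \<beta>
  by unfold_locales (use open_S bounded_S nonempty_S in \<open>auto simp: trans_weight_def\<close>)

sublocale waveguide \<subseteq> W: dirichlet_domain "broken_sheared_waveguide \<beta> S"
  by unfold_locales (auto simp: open_Omega)

section \<open>The region far out on one branch\<close>

context waveguide
begin

definition height :: real where
  "height = (SOME R. R \<ge> 0 \<and> (\<forall>y\<in>S. \<bar>snd y\<bar> \<le> R \<and> \<bar>fst y\<bar> \<le> R))"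

lemma height: "height \<ge> 0" "y \<in> S \<Longrightarrow> \<bar>snd y\<bar> \<le> height" "y \<in> S \<Longrightarrow> \<bar>fst y\<bar> \<le> height"
proof -
  obtain R where R: "\<And>y. y \<in> S \<Longrightarrow> norm y \<le> R" using bounded_S by (auto simp: bounded_iff)
  have "\<exists>R. R \<ge> 0 \<and> (\<forall>y\<in>S. \<bar>snd y\<bar> \<le> R \<and> \<bar>fst y\<bar> \<le> R)"
  proof (intro exI[of _ "max 0 R"] conjI ballI)
    fix y assume "y \<in> S"
    then show "\<bar>snd y\<bar> \<le> max 0 R" "\<bar>fst y\<bar> \<le> max 0 R"
      using R[of y] norm_snd_le[of "snd y" "fst y"] norm_fst_le[of "fst y" "snd y"] by auto
  qed simp
  from someI_ex[OF this] show "height \<ge> 0" "y \<in> S \<Longrightarrow> \<bar>snd y\<bar> \<le> height" "y \<in> S \<Longrightarrow> \<bar>fst y\<bar> \<le> height"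
    unfolding height_def by blast+
qed

text \<open>On the plane at \<open>s\<close> one has \<sigma> x = s - \<beta> / (1 + \<beta>^2) y2,
  and |y2| is at most \<open>height\<close> over \<open>S\<close>; from \<open>cut\<close> on, the
  slice stays strictly on one side of the kink.\<close>

definition cut :: real where
  "cut = \<beta> / (1 + \<beta>\<^sup>2) * height + 1"

lemma slope: "0 \<le> \<beta> / (1 + \<beta>\<^sup>2)"
  using beta_pos one_plus_sq_pos[of \<beta>] by simp

lemma tube_sign_pos:
  assumes "\<sigma> * \<sigma> = 1" "s \<ge> cut" "y \<in> S"
  shows "\<sigma> * fst (tube \<beta> \<sigma> (s, y)) > 0"
proof -
  have "\<beta> / (1 + \<beta>\<^sup>2) * snd y \<le> \<beta> / (1 + \<beta>\<^sup>2) * height"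
    using height(2)[OF assms(3)] by (intro mult_left_mono slope) simp
  then have "s - \<beta> / (1 + \<beta>\<^sup>2) * snd y > 0" using assms(2) by (simp add: cut_def)
  moreover have "\<sigma> * fst (tube \<beta> \<sigma> (s, y)) = s - \<beta> / (1 + \<beta>\<^sup>2) * snd y"
    using assms(1) by (simp add: tube_def mult.assoc[symmetric])
  ultimately show ?thesis by simp
qed

lemma abs_sigma:
  fixes \<sigma> x :: real
  assumes "\<sigma> * \<sigma> = 1" "\<sigma> * x \<ge> 0"
  shows "\<bar>x\<bar> = \<sigma> * x"
proof -
  from sign_cases[OF assms(1)] show ?thesis using assms(2) by auto
qed

lemma tube_mem_Omega_iff:
  assumes \<sigma>: "\<sigma> * \<sigma> = 1" and x: "\<sigma> * fst (tube \<beta> \<sigma> (s, y)) \<ge> 0"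
  shows "tube \<beta> \<sigma> (s, y) \<in> \<Omega> \<longleftrightarrow> y \<in> S"
proof -
  let ?p = "tube \<beta> \<sigma> (s, y)"
  have "?p \<in> \<Omega> \<longleftrightarrow> (fst (snd ?p), snd (snd ?p) - \<beta> * (\<sigma> * fst ?p)) \<in> S"
    using mem_Omega[of "fst ?p" "fst (snd ?p)" "snd (snd ?p)"] abs_sigma[OF \<sigma> x] by simp
  also have "(fst (snd ?p), snd (snd ?p) - \<beta> * (\<sigma> * fst ?p)) = snd (untube \<beta> \<sigma> ?p)"
    by (simp add: untube_def mult.assoc)
  also have "\<dots> = y" by (simp add: untube_tube[OF \<sigma>])
  finally show ?thesis .
qed

subsection \<open>Slices\<close>

text \<open>Values off \<open>S\<close> are set to zero because the full plane may run into the
  other branch of the waveguide, where \<open>v\<close> need not vanish.\<close>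

definition slice :: "real \<Rightarrow> (real \<times> real \<times> real \<Rightarrow> complex) \<Rightarrow> real \<Rightarrow> real \<times> real \<Rightarrow> complex" where
  "slice \<sigma> v s y = (if y \<in> S then v (tube \<beta> \<sigma> (s, y)) else 0)"

lemma tube_affine: "tube \<beta> \<sigma> (s, y) = tube \<beta> \<sigma> (0, y) + tube \<beta> \<sigma> (s, 0)"
  by (simp add: tube_def algebra_simps)

lemma bounded_linear_tube: "bounded_linear (\<lambda>y. tube \<beta> \<sigma> (0, y))"
proof -
  have "linear (\<lambda>y. tube \<beta> \<sigma> (0, y))"
    by (rule linearI) (auto simp: tube_def algebra_simps add_divide_distrib)
  then show ?thesis by (rule linear_conv_bounded_linear[THEN iffD1])
qed

text \<open>Compact support of \<open>v\<close> inside \<Omega> keeps the support of the slice away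
  from the boundary of \<open>S\<close>, so the cut-off costs no smoothness.\<close>

lemma slice_test:
  assumes \<sigma>: "\<sigma> * \<sigma> = 1" and v: "v \<in> W.test" and s: "s \<ge> cut"
  shows "slice \<sigma> v s \<in> C.test"
proof -
  obtain K where K: "compact K" "K \<subseteq> \<Omega>" "\<And>x. x \<notin> K \<Longrightarrow> v x = 0" using test_support[OF v] by metis
  define f where "f y = v (tube \<beta> \<sigma> (0, y) + tube \<beta> \<sigma> (s, 0))" for y
  have fC: "C_k k f" for k unfolding f_def by (rule C_k_affine_comp[OF bounded_linear_tube test_C_k[OF v]])
  \<comment> \<open>Restricting to the closed half \<sigma> x \<ge> 0 discards the other branch; on
    this half, points of \<open>K\<close> lie over \<open>S\<close>.\<close>
  define K' where "K' = (\<lambda>y. tube \<beta> \<sigma> (s, y)) -` K \<inter> (\<lambda>y. \<sigma> * fst (tube \<beta> \<sigma> (s, y))) -` {0..}"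
  have cont: "continuous_on UNIV (\<lambda>y. tube \<beta> \<sigma> (s, y))"
    unfolding tube_def by (intro continuous_intros)
  have "closed K'"
    unfolding K'_def
    by (intro closed_Int closed_vimage cont compact_imp_closed K continuous_intros closed_atLeast)
  have K'S: "K' \<subseteq> S"
  proof
    fix y assume "y \<in> K'"
    then have "tube \<beta> \<sigma> (s, y) \<in> K" "0 \<le> \<sigma> * fst (tube \<beta> \<sigma> (s, y))" by (simp_all add: K'_def)
    then show "y \<in> S" using tube_mem_Omega_iff[OF \<sigma>] K(2) by blast
  qed
  have comp: "compact K'"
    using \<open>closed K'\<close> bounded_subset[OF bounded_S K'S] by (simp add: compact_eq_bounded_closed)
  have z: "slice \<sigma> v s y = 0" if "y \<notin> K'" for y
  proof (cases "y \<in> S")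
    case True
    have "tube \<beta> \<sigma> (s, y) \<notin> K" using that less_imp_le[OF tube_sign_pos[OF \<sigma> s True]] by (simp add: K'_def)
    then show ?thesis using K(3) by (simp add: slice_def)
  qed (simp add: slice_def)
  show ?thesis
  proof (rule test_functionsI[OF _ comp K'S z])
    show "C_k k (slice \<sigma> v s)" for k
    proof (rule C_k_local[OF open_S _ _ fC])
      show "open (- K')" using \<open>closed K'\<close> by (rule open_Compl)
      show "S \<union> - K' = UNIV" using K'S by blast
      show "slice \<sigma> v s x = f x" if "x \<in> S" for x
        using that tube_affine[of \<sigma> s x] by (simp add: slice_def f_def)
      show "slice \<sigma> v s x = 0" if "x \<in> - K'" for x using z that by simp
    qed
  qed
qed

lemma slice_partial:
  assumes \<sigma>: "\<sigma> * \<sigma> = 1" and v: "v \<in> W.test" and s: "s \<ge> cut" and y: "y \<in> S"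
  shows "partial_deriv (1, 0) (slice \<sigma> v s) y = dy v (tube \<beta> \<sigma> (s, y))"
    "partial_deriv (0, 1) (slice \<sigma> v s) y = dn \<beta> \<sigma> v (tube \<beta> \<sigma> (s, y))"
proof -
  define f where "f y = v (tube \<beta> \<sigma> (0, y) + tube \<beta> \<sigma> (s, 0))" for y
  have fC: "C_k k f" for k unfolding f_def by (rule C_k_affine_comp[OF bounded_linear_tube test_C_k[OF v]])
  have fd: "f differentiable at y" using fC[of "Suc 0"] unfolding C_k.simps by blast
  have eq: "partial_deriv b (slice \<sigma> v s) y = partial_deriv b f y" for b
  proof (rule partial_deriv_local[OF open_S y _ fd])
    show "slice \<sigma> v s w = f w" if "w \<in> S" for w
      using that tube_affine[of \<sigma> s w] by (simp add: slice_def f_def)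
  qed
  have pf: "partial_deriv b f y = complex_of_real (tube \<beta> \<sigma> (0, b) \<bullet> (1, 0, 0)) * dx v (tube \<beta> \<sigma> (s, y))
     + complex_of_real (tube \<beta> \<sigma> (0, b) \<bullet> (0, 1, 0)) * dy v (tube \<beta> \<sigma> (s, y))
     + complex_of_real (tube \<beta> \<sigma> (0, b) \<bullet> (0, 0, 1)) * dz v (tube \<beta> \<sigma> (s, y))" for b
    unfolding f_def partial_deriv_affine_comp[OF test_differentiable[OF v] bounded_linear_tube] sum_Basis_space
    by (simp only: tube_affine[of \<sigma> s y, symmetric])
  show "partial_deriv (1, 0) (slice \<sigma> v s) y = dy v (tube \<beta> \<sigma> (s, y))"
    unfolding eq pf by (simp add: tube_def)
  show "partial_deriv (0, 1) (slice \<sigma> v s) y = dn \<beta> \<sigma> v (tube \<beta> \<sigma> (s, y))"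
    unfolding eq pf dn_def by (simp add: tube_def algebra_simps)
qed

end

section \<open>Energy along the cutting planes, and coercivity below the threshold\<close>

context waveguide
begin

lemma dn_test:
  assumes v: "v \<in> W.test"
  shows "dn \<beta> \<sigma> v \<in> W.test"
proof -
  have eq: "dn \<beta> \<sigma> v = (\<lambda>p. complex_of_real (1 / (1 + \<beta>\<^sup>2)) * (dz v p + (- complex_of_real (\<beta> * \<sigma>)) * dx v p))"
    by (rule ext) (simp add: dn_def)
  show ?thesis unfolding eq
    by (intro test_mult[OF test_comb C_k_const] test_partial v Basis_space_mem)
qed

text \<open>The squared gradient along the plane: \<open>dn\<close> differentiates along a vector of
  length 1 / sqrt(1 + \<beta>^2), and the weight makes up for it.\<close>

definition trans_sq :: "real \<Rightarrow> (real \<times> real \<times> real \<Rightarrow> complex) \<Rightarrow> real \<times> real \<times> real \<Rightarrow> real" where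
  "trans_sq \<sigma> v p = (cmod (dy v p))\<^sup>2 + (1 + \<beta>\<^sup>2) * (cmod (dn \<beta> \<sigma> v p))\<^sup>2"

lemma trans_sq_integrable: "v \<in> W.test \<Longrightarrow> integrable lborel (trans_sq \<sigma> v)"
  unfolding trans_sq_def
  by (intro Bochner_Integration.integrable_add integrable_mult_right test_norm_sq_integrable
      test_UNIV[OF dn_test] test_UNIV[OF test_partial[OF _ Basis_space_mem(2)]])

text \<open>Only the derivative along the branch is discarded: dz - \<beta> \<sigma> dx is sqrt(1 +
  \<beta>^2) times a derivative in a unit direction, estimated by Cauchy-Schwarz for the
  \<open>x\<close> and \<open>z\<close> derivatives.\<close>

lemma trans_sq_le_grad_sq:
  assumes \<sigma>: "\<sigma> * \<sigma> = 1"
  shows "trans_sq \<sigma> v p \<le> grad_sq v p"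
proof -
  let ?X = "cmod (dx v p)" and ?Z = "cmod (dz v p)"
  have n: "1 + \<beta>\<^sup>2 > 0" by (rule one_plus_sq_pos)
  have ab: "\<bar>\<sigma>\<bar> = 1" using sign_cases[OF \<sigma>] by auto
  have "cmod (dz v p - complex_of_real (\<beta> * \<sigma>) * dx v p) \<le> ?Z + \<bar>\<beta>\<bar> * ?X"
    using norm_triangle_ineq4[of "dz v p" "complex_of_real (\<beta> * \<sigma>) * dx v p"] ab
    by (simp add: norm_mult abs_mult)
  then have "(cmod (dz v p - complex_of_real (\<beta> * \<sigma>) * dx v p))\<^sup>2 \<le> (?Z + \<bar>\<beta>\<bar> * ?X)\<^sup>2"
    by (simp add: power_mono)
  also have "\<dots> \<le> (1 + \<beta>\<^sup>2) * (?X\<^sup>2 + ?Z\<^sup>2)"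
  proof -
    have "0 \<le> (\<bar>\<beta>\<bar> * ?Z - ?X)\<^sup>2" by simp
    then show ?thesis by (simp add: power2_sum power2_diff power_mult_distrib algebra_simps)
  qed
  finally have "(cmod (dz v p - complex_of_real (\<beta> * \<sigma>) * dx v p))\<^sup>2 / (1 + \<beta>\<^sup>2) \<le> ?X\<^sup>2 + ?Z\<^sup>2"
    using n by (simp add: divide_le_eq mult.commute)
  moreover have "(1 + \<beta>\<^sup>2) * (cmod (dn \<beta> \<sigma> v p))\<^sup>2 = (cmod (dz v p - complex_of_real (\<beta> * \<sigma>) * dx v p))\<^sup>2 / (1 + \<beta>\<^sup>2)"
  proof -
    have "(cmod (dn \<beta> \<sigma> v p))\<^sup>2 = (1 / (1 + \<beta>\<^sup>2))\<^sup>2 * (cmod (dz v p - complex_of_real (\<beta> * \<sigma>) * dx v p))\<^sup>2"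
      unfolding dn_def norm_mult norm_of_real power_mult_distrib by simp
    then show ?thesis using n by (simp add: power2_eq_square)
  qed
  ultimately show ?thesis
    unfolding trans_sq_def grad_sq_def sum_Basis_space by simp
qed

definition outer :: "real \<Rightarrow> (real \<times> real \<times> real) set" where
  "outer \<sigma> = {p. cut \<le> fst (untube \<beta> \<sigma> p) \<and> snd (untube \<beta> \<sigma> p) \<in> S}"

lemma outer_borel [measurable]: "outer \<sigma> \<in> sets borel"
proof -
  have "outer \<sigma> = untube \<beta> \<sigma> -` ({cut..} \<times> S)" by (auto simp: outer_def mem_Times_iff)
  moreover have "{cut..} \<times> S \<in> sets borel"
    by (rule borel_Times) (use C.Ob in auto)
  then have "untube \<beta> \<sigma> -` ({cut..} \<times> S) \<inter> space borel \<in> sets borel"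
    by (rule measurable_sets[OF untube_measurable])
  ultimately show ?thesis by simp
qed

lemma outer_sign:
  assumes \<sigma>: "\<sigma> * \<sigma> = 1" and p: "p \<in> outer \<sigma>"
  shows "\<sigma> * fst p > 0"
proof -
  have "\<sigma> * fst (tube \<beta> \<sigma> (fst (untube \<beta> \<sigma> p), snd (untube \<beta> \<sigma> p))) > 0"
    by (rule tube_sign_pos[OF \<sigma>]) (use p in \<open>auto simp: outer_def\<close>)
  then show ?thesis by (simp add: tube_untube[OF \<sigma>])
qed

lemma outer_disjoint: "outer 1 \<inter> outer (-1) = {}"
  using outer_sign[of 1] outer_sign[of "-1"] by fastforce

lemma indicator_outer_tube:
  assumes "\<sigma> * \<sigma> = 1"
  shows "indicator (outer \<sigma>) (tube \<beta> \<sigma> (s, y)) = (indicator {cut..} s * indicator S y :: real)"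
  using untube_tube[OF assms, of \<beta> "(s, y)"] by (auto simp: outer_def indicator_def)

lemma integral_outer:
  fixes f :: "real \<times> real \<times> real \<Rightarrow> real"
  assumes \<sigma>: "\<sigma> * \<sigma> = 1" and f: "integrable lborel f"
  shows "integrable lborel (\<lambda>s. indicator {cut..} s * (\<integral>y. indicator S y * f (tube \<beta> \<sigma> (s, y)) \<partial>lborel))"
    "(\<integral>s. indicator {cut..} s * (\<integral>y. indicator S y * f (tube \<beta> \<sigma> (s, y)) \<partial>lborel) \<partial>lborel)
      = (\<integral>p. indicator (outer \<sigma>) p * f p \<partial>lborel)"
proof -
  have i: "integrable lborel (\<lambda>p. indicator (outer \<sigma>) p * f p)"
    using integrable_mult_indicator[of "outer \<sigma>" lborel f] f by simp
  note t = integral_tube[OF \<sigma> i, where \<beta> = \<beta>]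
  have "(\<integral>y. indicator (outer \<sigma>) (tube \<beta> \<sigma> (s, y)) * f (tube \<beta> \<sigma> (s, y)) \<partial>lborel)
      = indicator {cut..} s * (\<integral>y. indicator S y * f (tube \<beta> \<sigma> (s, y)) \<partial>lborel)" for s
    unfolding indicator_outer_tube[OF \<sigma>] by (simp add: mult.assoc)
  with lborel_fubini[OF t(1)] t(2)
  show "integrable lborel (\<lambda>s. indicator {cut..} s * (\<integral>y. indicator S y * f (tube \<beta> \<sigma> (s, y)) \<partial>lborel))"
    "(\<integral>s. indicator {cut..} s * (\<integral>y. indicator S y * f (tube \<beta> \<sigma> (s, y)) \<partial>lborel) \<partial>lborel)
      = (\<integral>p. indicator (outer \<sigma>) p * f p \<partial>lborel)"
    by simp_all
qed

lemma slice_nsq: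
  assumes "\<sigma> * \<sigma> = 1" "v \<in> W.test" "s \<ge> cut"
  shows "C.nsq (slice \<sigma> v s) = (\<integral>y. indicator S y * (cmod (v (tube \<beta> \<sigma> (s, y))))\<^sup>2 \<partial>lborel)"
  unfolding C.test_nsq[OF slice_test[OF assms]]
  by (intro Bochner_Integration.integral_cong) (auto simp: slice_def)

lemma slice_A_sq:
  assumes "\<sigma> * \<sigma> = 1" "v \<in> W.test" "s \<ge> cut"
  shows "C.F.A.sq (slice \<sigma> v s) = (\<integral>y. indicator S y * trans_sq \<sigma> v (tube \<beta> \<sigma> (s, y)) \<partial>lborel)"
proof -
  let ?w = "slice \<sigma> v s"
  have t: "?w \<in> C.test" by (rule slice_test[OF assms])
  have i: "integrable lborel (\<lambda>y. (cmod (partial_deriv b ?w y))\<^sup>2)" if "b \<in> Basis" for b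
    by (rule test_norm_sq_integrable[OF test_UNIV[OF test_partial[OF t that]]])
  have "C.F.A.sq ?w = (\<integral>y. (cmod (partial_deriv (1, 0) ?w y))\<^sup>2 + (1 + \<beta>\<^sup>2) * (cmod (partial_deriv (0, 1) ?w y))\<^sup>2 \<partial>lborel)"
    unfolding C.test_A_sq_plane[OF t] using i[OF Basis_plane(1)] i[OF Basis_plane(2)] by simp
  also have "\<dots> = (\<integral>y. indicator S y * trans_sq \<sigma> v (tube \<beta> \<sigma> (s, y)) \<partial>lborel)"
  proof (rule Bochner_Integration.integral_cong[OF refl])
    fix y
    show "(cmod (partial_deriv (1, 0) ?w y))\<^sup>2 + (1 + \<beta>\<^sup>2) * (cmod (partial_deriv (0, 1) ?w y))\<^sup>2
        = indicator S y * trans_sq \<sigma> v (tube \<beta> \<sigma> (s, y))"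
      using slice_partial[OF assms, of y] test_partial_zero_outside[OF t, of y]
      by (cases "y \<in> S") (simp_all add: trans_sq_def)
  qed
  finally show ?thesis .
qed

lemma integral_outer_trans_sq:
  assumes \<sigma>: "\<sigma> * \<sigma> = 1" and v: "v \<in> W.test"
  shows "integrable lborel (\<lambda>s. indicator {cut..} s * C.F.A.sq (slice \<sigma> v s))"
    "(\<integral>s. indicator {cut..} s * C.F.A.sq (slice \<sigma> v s) \<partial>lborel) = (\<integral>p. indicator (outer \<sigma>) p * trans_sq \<sigma> v p \<partial>lborel)"
proof -
  have "(\<lambda>s. indicator {cut..} s * C.F.A.sq (slice \<sigma> v s))
      = (\<lambda>s. indicator {cut..} s * (\<integral>y. indicator S y * trans_sq \<sigma> v (tube \<beta> \<sigma> (s, y)) \<partial>lborel))"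
    using slice_A_sq[OF \<sigma> v] by (auto simp: indicator_def fun_eq_iff)
  then show "integrable lborel (\<lambda>s. indicator {cut..} s * C.F.A.sq (slice \<sigma> v s))"
    "(\<integral>s. indicator {cut..} s * C.F.A.sq (slice \<sigma> v s) \<partial>lborel) = (\<integral>p. indicator (outer \<sigma>) p * trans_sq \<sigma> v p \<partial>lborel)"
    using integral_outer[OF \<sigma> trans_sq_integrable[OF v, of \<sigma>]] by simp_all
qed

lemma outer_trans_sq_le:
  assumes \<sigma>: "\<sigma> * \<sigma> = 1" and v: "v \<in> W.test"
  shows "(\<integral>p. indicator (outer \<sigma>) p * trans_sq \<sigma> v p \<partial>lborel) \<le> (\<integral>p. indicator (outer \<sigma>) p * grad_sq v p \<partial>lborel)"
proof (rule integral_mono)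
  show "integrable lborel (\<lambda>p. indicator (outer \<sigma>) p * trans_sq \<sigma> v p)"
    using integrable_mult_indicator[of "outer \<sigma>" lborel "trans_sq \<sigma> v"] trans_sq_integrable[OF v] by simp
  show "integrable lborel (\<lambda>p. indicator (outer \<sigma>) p * grad_sq v p)"
    using integrable_mult_indicator[of "outer \<sigma>" lborel "grad_sq v"] grad_sq_integrable[OF test_UNIV[OF v]] by simp
qed (simp add: mult_left_mono trans_sq_le_grad_sq[OF \<sigma>])

text \<open>Neumann bracketing loses nothing: on each plane of constant \<open>s \<ge> cut\<close> the slice is a test
  function of the cross section.\<close>

lemma neumann_bound:
  assumes \<sigma>: "\<sigma> * \<sigma> = 1" and v: "v \<in> W.test"
  shows "C.E1 * (\<integral>p. indicator (outer \<sigma>) p * (cmod (v p))\<^sup>2 \<partial>lborel) \<le> (\<integral>p. indicator (outer \<sigma>) p * grad_sq v p \<partial>lborel)"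
proof -
  note n = integral_outer[OF \<sigma> test_norm_sq_integrable[OF test_UNIV[OF v]]]
  have "C.E1 * (\<integral>p. indicator (outer \<sigma>) p * (cmod (v p))\<^sup>2 \<partial>lborel)
      = (\<integral>s. C.E1 * (indicator {cut..} s * (\<integral>y. indicator S y * (cmod (v (tube \<beta> \<sigma> (s, y))))\<^sup>2 \<partial>lborel)) \<partial>lborel)"
    unfolding n(2)[symmetric] by simp
  also have "\<dots> \<le> (\<integral>s. indicator {cut..} s * C.F.A.sq (slice \<sigma> v s) \<partial>lborel)"
  proof (rule integral_mono[OF integrable_mult_right[OF n(1)] integral_outer_trans_sq(1)[OF \<sigma> v]])
    fix s
    show "C.E1 * (indicator {cut..} s * (\<integral>y. indicator S y * (cmod (v (tube \<beta> \<sigma> (s, y))))\<^sup>2 \<partial>lborel))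
        \<le> indicator {cut..} s * C.F.A.sq (slice \<sigma> v s)"
      using slice_nsq[OF \<sigma> v, of s] C.E1_le[OF C.test_H10[OF slice_test[OF \<sigma> v, of s]]]
      by (cases "s \<ge> cut") simp_all
  qed
  also have "\<dots> \<le> (\<integral>p. indicator (outer \<sigma>) p * grad_sq v p \<partial>lborel)"
    unfolding integral_outer_trans_sq(2)[OF \<sigma> v] by (rule outer_trans_sq_le[OF \<sigma> v])
  finally show ?thesis .
qed

definition middle :: "(real \<times> real \<times> real) set" where
  "middle = \<Omega> - outer 1 - outer (-1)"

lemma middle_borel: "middle \<in> sets borel"
  unfolding middle_def using W.Ob by simp

text \<open>A point outside the outer part of its own branch has s < \<open>cut\<close>, and s
  differs from |x| by at most \<beta> / (1 + \<beta>^2) \<open>height\<close>; this bounds |x| and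
  then |z|.\<close>

lemma middle_bounded: "bounded middle"
proof -
  let ?a = "\<beta> / (1 + \<beta>\<^sup>2)"
  define X where "X = cut + ?a * height"
  have "norm p \<le> X + (height + (height + \<beta> * X))" if p: "p \<in> middle" for p
  proof -
    obtain x y z where pe: "p = (x, y, z)" by (cases p) auto
    \<comment> \<open>The branch is selected by the sign of \<open>x\<close>, so that \<sigma> x =
      |x|.\<close>
    define \<sigma> :: real where "\<sigma> = (if x \<ge> 0 then 1 else -1)"
    have \<sigma>: "\<sigma> * \<sigma> = 1" "\<sigma> * x = \<bar>x\<bar>" by (auto simp: \<sigma>_def)
    have S: "(y, z - \<beta> * \<bar>x\<bar>) \<in> S" using p mem_Omega by (simp add: middle_def pe)
    have nin: "p \<notin> outer \<sigma>" using p by (auto simp: middle_def \<sigma>_def)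
    define w where "w = z - \<beta> * \<bar>x\<bar>"
    have h: "\<bar>w\<bar> \<le> height" "\<bar>y\<bar> \<le> height" using height(2)[OF S] height(3)[OF S] by (simp_all add: w_def)
    have sn: "snd (untube \<beta> \<sigma> p) = (y, w)" using \<sigma>(2) by (simp add: untube_def pe w_def mult.assoc)
    have fs: "fst (untube \<beta> \<sigma> p) = \<bar>x\<bar> + ?a * w"
    proof -
      define k where "k = 1 / (1 + \<beta>\<^sup>2)"
      have k: "k * (1 + \<beta>\<^sup>2) = 1" "?a = \<beta> * k" using one_plus_sq_pos[of \<beta>] by (simp_all add: k_def)
      have "k * (\<bar>x\<bar> + \<beta> * z) = \<bar>x\<bar> * (k * (1 + \<beta>\<^sup>2)) + \<beta> * k * w"
        by (simp add: w_def algebra_simps power2_eq_square)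
      then show ?thesis using \<sigma>(2) by (simp add: untube_def pe k_def[symmetric] k)
    qed
    have "fst (untube \<beta> \<sigma> p) < cut"
      using nin S unfolding outer_def by (simp add: sn w_def)
    moreover have "\<bar>?a * w\<bar> \<le> ?a * height"
      using mult_left_mono[OF h(1) slope] slope by (simp only: abs_mult abs_of_nonneg)
    ultimately have x: "\<bar>x\<bar> \<le> X" unfolding fs X_def by linarith
    have "\<bar>z\<bar> \<le> \<bar>w\<bar> + \<beta> * \<bar>x\<bar>"
      using abs_triangle_ineq[of w "\<beta> * \<bar>x\<bar>"] beta_pos by (simp add: w_def abs_mult)
    also have "\<dots> \<le> height + \<beta> * X" using h(1) x beta_pos by (intro add_mono mult_left_mono) auto
    finally have z: "\<bar>z\<bar> \<le> height + \<beta> * X" .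
    have "norm p \<le> \<bar>x\<bar> + (\<bar>y\<bar> + \<bar>z\<bar>)"
      unfolding pe using norm_Pair_le[of x "(y, z)"] norm_Pair_le[of y z] by simp
    then show ?thesis using x h(2) z by linarith
  qed
  then show ?thesis unfolding bounded_iff by blast
qed

text \<open>The two outer bounds give \<open>C.E1\<close> times the mass outside
  \<open>middle\<close>, and the mass inside is the remainder that \<open>garding_criterion\<close>
  allows. A fraction \<delta> of the energy is held back for the gradient, which lowers the
  threshold to (1 - \<delta>) E1, still above \<open>r\<close>.\<close>

theorem garding_below:
  assumes r: "r < C.E1"
  shows "W.F.garding r"
proof -
  \<comment> \<open>The bound 1/2 keeps 1 - \<delta> positive; the other one yields \<delta> E1 < E1
    - r. The denominator contains E1 + 1 because E1 is only known to be nonnegative.\<close>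
  define \<delta> where "\<delta> = min (1/2) ((C.E1 - r) / (2 * (C.E1 + 1)))"
  have E: "0 \<le> C.E1" by (rule C.E1_nonneg)
  have "0 < (C.E1 - r) / (2 * (C.E1 + 1))" using r E by simp
  then have d: "0 < \<delta>" by (simp add: \<delta>_def)
  have d': "\<delta> \<le> 1/2" unfolding \<delta>_def by (rule min.cobounded1)
  have d3: "\<delta> \<le> (C.E1 - r) / (2 * (C.E1 + 1))" unfolding \<delta>_def by (rule min.cobounded2)
  have "\<delta> * C.E1 \<le> \<delta> * (C.E1 + 1)" using d by simp
  also have "\<dots> \<le> (C.E1 - r) / (2 * (C.E1 + 1)) * (C.E1 + 1)" using d3 E by (intro mult_right_mono) auto
  also have "\<dots> = (C.E1 - r) / 2" using E by (simp add: field_simps)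
  finally have dE: "\<delta> * C.E1 < C.E1 - r" using r by simp
  show ?thesis
  proof (rule W.garding_criterion[OF middle_bounded middle_borel, of \<delta> "(1 - \<delta>) * C.E1 - r" "(1 - \<delta>) * C.E1"])
    show "0 < \<delta>" by (rule d)
    show "0 < (1 - \<delta>) * C.E1 - r" using dE by (simp add: left_diff_distrib)
    show "0 \<le> (1 - \<delta>) * C.E1" using d' E by simp
    fix v assume v: "v \<in> W.test"
    let ?n = "\<lambda>A. (\<integral>p. indicator A p * (cmod (v p))\<^sup>2 \<partial>lborel)"
    let ?g = "\<lambda>A. (\<integral>p. indicator A p * grad_sq v p \<partial>lborel)"
    have vi: "integrable lborel (\<lambda>p. (cmod (v p))\<^sup>2)" by (rule test_norm_sq_integrable[OF test_UNIV[OF v]])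
    have gi: "integrable lborel (grad_sq v)" by (rule grad_sq_integrable[OF test_UNIV[OF v]])
    have ni: "integrable lborel (\<lambda>p. indicator A p * (cmod (v p))\<^sup>2)" if "A \<in> sets borel" for A
      using integrable_mult_indicator[of A lborel "\<lambda>p. (cmod (v p))\<^sup>2"] vi that by simp
    have gA: "integrable lborel (\<lambda>p. indicator A p * grad_sq v p)" if "A \<in> sets borel" for A
      using integrable_mult_indicator[of A lborel "grad_sq v"] gi that by simp
    have "W.nsq v = (\<integral>p. indicator middle p * (cmod (v p))\<^sup>2 + (indicator (outer 1) p * (cmod (v p))\<^sup>2
        + indicator (outer (-1)) p * (cmod (v p))\<^sup>2) \<partial>lborel)"
      unfolding W.test_nsq[OF v]
    proof (rule Bochner_Integration.integral_cong[OF refl])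
      fix p
      show "(cmod (v p))\<^sup>2 = indicator middle p * (cmod (v p))\<^sup>2 + (indicator (outer 1) p * (cmod (v p))\<^sup>2
        + indicator (outer (-1)) p * (cmod (v p))\<^sup>2)"
        using test_zero_outside[OF v, of p] outer_disjoint by (auto simp: middle_def indicator_def)
    qed
    also have "\<dots> = ?n middle + (?n (outer 1) + ?n (outer (-1)))"
      using ni[OF middle_borel] ni[OF outer_borel] by simp
    finally have n: "W.nsq v = ?n middle + (?n (outer 1) + ?n (outer (-1)))" .
    have "?g (outer 1) + ?g (outer (-1)) = (\<integral>p. indicator (outer 1) p * grad_sq v p + indicator (outer (-1)) p * grad_sq v p \<partial>lborel)"
      using gA[OF outer_borel] by simp
    also have "\<dots> \<le> (\<integral>p. grad_sq v p \<partial>lborel)"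
    proof (rule integral_mono[OF _ gi])
      show "integrable lborel (\<lambda>p. indicator (outer 1) p * grad_sq v p + indicator (outer (-1)) p * grad_sq v p)"
        using gA[OF outer_borel] by simp
      show "indicator (outer 1) p * grad_sq v p + indicator (outer (-1)) p * grad_sq v p \<le> grad_sq v p" for p
        using outer_disjoint grad_sq_nonneg[of v p] by (auto simp: indicator_def)
    qed
    also have "\<dots> \<le> W.F.A.sq v" by (rule W.grad_sq_le_A_sq[OF v])
    finally have "C.E1 * (?n (outer 1) + ?n (outer (-1))) \<le> W.F.A.sq v"
      using neumann_bound[of 1, OF _ v] neumann_bound[of "-1", OF _ v] by (simp add: distrib_left)
    then have le: "C.E1 * (W.nsq v - ?n middle) \<le> W.F.A.sq v" unfolding n by simp
    have "(1 - \<delta>) * (C.E1 * (W.nsq v - ?n middle)) \<le> (1 - \<delta>) * W.F.A.sq v"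
      by (rule mult_left_mono[OF le]) (use d' in simp)
    then show "\<delta> * W.F.A.sq v + ((1 - \<delta>) * C.E1 - r) * W.nsq v
        \<le> W.F.A.sq v - r * W.nsq v + (1 - \<delta>) * C.E1 * ?n middle"
      by (simp add: algebra_simps)
  qed
qed

end

subsection \<open>Approximate eigenfunctions\<close>

lemma partial_deriv_real_scale:
  fixes f :: "real \<Rightarrow> complex"
  assumes "\<And>k. C_k k f"
  shows "partial_deriv 1 (\<lambda>s. f (a * s + b)) = (\<lambda>s. complex_of_real a * partial_deriv 1 f (a * s + b))"
proof
  fix s
  have "f differentiable at (a * s + b)" using assms[of "Suc 0"] unfolding C_k.simps by blast
  from partial_deriv_affine_comp[OF this bounded_linear_mult_right]
  show "partial_deriv 1 (\<lambda>s. f (a * s + b)) s = complex_of_real a * partial_deriv 1 f (a * s + b)" by simp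
qed

lemma partial_deriv_exp_real:
  "partial_deriv 1 (\<lambda>s::real. exp (c * complex_of_real s)) = (\<lambda>s. c * exp (c * complex_of_real s))"
proof
  fix s :: real
  have "((\<lambda>x::real. exp (c * complex_of_real x)) has_vector_derivative c * exp (c * complex_of_real s)) (at s)"
    by (rule has_vector_derivative_real_field[of "\<lambda>z. exp (c * z)"]) (auto intro!: derivative_eq_intros)
  then show "partial_deriv 1 (\<lambda>s::real. exp (c * complex_of_real s)) s = c * exp (c * complex_of_real s)"
    by (rule partial_deriv_vector)
qed

text \<open>A slowly modulated plane wave: stretching a fixed bump by the factor \<open>N\<close> makes
  \<open>g'' + k\<^sup>2 g\<close> of relative size \<open>1 / N\<close>.\<close>

lemma modulated_wave:
  fixes k t e :: real
  assumes e: "e > 0"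
  shows "\<exists>(g :: real \<Rightarrow> complex) b. (\<forall>n. C_k n g) \<and> (\<forall>s. s \<notin> {t..b} \<longrightarrow> g s = 0) \<and>
    0 < (\<integral>s. (cmod (g s))\<^sup>2 \<partial>lborel) \<and>
    (\<integral>s. (cmod (partial_deriv 1 (partial_deriv 1 g) s + (complex_of_real k)\<^sup>2 * g s))\<^sup>2 \<partial>lborel)
      \<le> e * (\<integral>s. (cmod (g s))\<^sup>2 \<partial>lborel)"
proof -
  define \<eta> :: "real \<Rightarrow> complex" where "\<eta> = bump 0 1 0"
  let ?d = "partial_deriv (1::real)"
  have chi: "\<eta> \<in> test_functions {0..1}" unfolding \<eta>_def by (rule bump_test) (simp add: cbox_interval)
  have chiC: "C_k n \<eta>" for n by (rule test_C_k[OF chi])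
  have chi1: "?d \<eta> \<in> test_functions {0..1}" by (rule test_partial[OF chi]) simp
  have chi2: "?d (?d \<eta>) \<in> test_functions {0..1}" by (rule test_partial[OF chi1]) simp
  define ik where "ik = \<i> * complex_of_real k"
  define w where "w s = ?d (?d \<eta>) s" for s
  \<comment> \<open>Dominates what remains once the exponential has cancelled k^2: 2 i k times the
    first derivative of the envelope plus its second derivative, up to powers of 1/n.\<close>
  define M where "M s = cmod (?d (?d \<eta>) s) + 2 * \<bar>k\<bar> * cmod (?d \<eta> s)" for s
  define I where "I = (\<integral>s. (cmod (\<eta> s))\<^sup>2 \<partial>lborel)"
  define J where "J = (\<integral>s. (M s)\<^sup>2 \<partial>lborel)"
  have Mi: "integrable lborel (\<lambda>s. (M s)\<^sup>2)"
  proof (rule integrable_continuous_compact_support[of _ "{0..1}"])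
    show "continuous_on UNIV (\<lambda>s. (M s)\<^sup>2)"
      unfolding M_def by (intro continuous_intros test_continuous[OF chi1] test_continuous[OF chi2])
    show "(M s)\<^sup>2 = 0" if "s \<notin> {0..1}" for s
      using test_zero_outside[OF chi1 that] test_zero_outside[OF chi2 that] by (simp add: M_def)
  qed simp
  have J0: "0 \<le> J" unfolding J_def by (rule Bochner_Integration.integral_nonneg) simp
  have Ii: "integrable lborel (\<lambda>s. (cmod (\<eta> s))\<^sup>2)" by (rule test_norm_sq_integrable[OF test_UNIV[OF chi]])
  have I: "I > 0"
  proof (rule ccontr)
    assume "\<not> I > 0"
    moreover have "0 \<le> I" unfolding I_def by (rule Bochner_Integration.integral_nonneg) simp
    ultimately have "I = 0" by simp
    then have "AE s in lborel. (cmod (\<eta> s))\<^sup>2 = 0"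
      unfolding I_def using Ii by (subst (asm) integral_nonneg_eq_0_iff_AE) auto
    then have "AE s in lborel. s \<notin> box 0 (1::real)"
      by eventually_elim (use bump_nonzero[of _ 0 "1::real" 0] in \<open>auto simp: \<eta>_def\<close>)
    then have "box 0 (1::real) \<in> null_sets lborel" by (subst (asm) AE_iff_null_sets[symmetric]) auto
    then show False by (simp add: null_sets_def box_real)
  qed
  \<comment> \<open>The error integral will be at most J / n and that of the wave n I, so J < n e I
    and n > 1 suffice.\<close>
  obtain N :: nat where N: "real N > max 1 (J / (e * I))" using reals_Archimedean2 by blast
  define n where "n = real N"
  have n: "n > 1" "J < n * (e * I)" using N e I by (auto simp: n_def divide_less_eq)
  \<comment> \<open>Carries the interval from t to t + n onto the unit interval that supports the
    bump.\<close>
  define c where "c s = 1 / n * s + - t / n" for s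
  define f where "f s = \<eta> (c s)" for s
  define E where "E s = exp (ik * complex_of_real s)" for s
  define g where "g s = f s * E s" for s
  have fC: "C_k m f" for m
    unfolding f_def c_def by (rule C_k_affine_comp[OF bounded_linear_mult_right chiC])
  have EC: "C_k m E" for m unfolding E_def by (rule exp_C_k)
  have gC: "C_k m g" for m unfolding g_def by (rule C_k_mult[OF fC EC])
  have diff: "h differentiable at s" if "\<And>m. C_k m h" for h :: "real \<Rightarrow> complex" and s
    using that[of "Suc 0"] unfolding C_k.simps by blast
  have E1: "?d E = (\<lambda>s. ik * E s)" unfolding E_def by (rule partial_deriv_exp_real)
  have f1: "?d f = (\<lambda>s. complex_of_real (1 / n) * ?d \<eta> (c s))"
    unfolding f_def c_def by (rule partial_deriv_real_scale[OF chiC])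
  define f1' where "f1' s = ?d \<eta> (c s)" for s
  have f1C: "C_k m f1'" for m
    unfolding f1'_def c_def by (rule C_k_affine_comp[OF bounded_linear_mult_right test_C_k[OF chi1]])
  have f2: "?d f1' = (\<lambda>s. complex_of_real (1 / n) * w (c s))"
    unfolding f1'_def c_def w_def by (rule partial_deriv_real_scale[OF test_C_k[OF chi1]])
  have g1: "?d g = (\<lambda>s. ik * g s + complex_of_real (1 / n) * (f1' s * E s))"
  proof
    fix s
    have "?d g s = f s * ?d E s + ?d f s * E s"
      unfolding g_def by (rule partial_deriv_mult[OF diff[OF fC] diff[OF EC]])
    then show "?d g s = ik * g s + complex_of_real (1 / n) * (f1' s * E s)"
      unfolding E1 f1 by (simp add: g_def f1'_def)
  qed
  have g2: "?d (?d g) s = ik * ?d g s + complex_of_real (1 / n) * (f1' s * (ik * E s) + complex_of_real (1 / n) * w (c s) * E s)" for s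
  proof -
    have C1: "C_k m (\<lambda>s. ik * g s)" "C_k m (\<lambda>s. f1' s * E s)" "C_k m (\<lambda>s. f1' s * E s)" for m
      by (intro C_k_cmult C_k_mult gC f1C EC)+
    have z: "partial_deriv 1 (\<lambda>s::real. a) s = 0" for a :: complex
      by (rule partial_deriv_eqI[where f' = "\<lambda>_. 0"]) simp
    have "?d (?d g) s = ?d (\<lambda>s. ik * g s) s + complex_of_real (1 / n) * ?d (\<lambda>s. f1' s * E s) s"
      unfolding g1 by (rule partial_deriv_comb[OF diff[OF C1(1)] diff[OF C1(2)]])
    also have "?d (\<lambda>s. ik * g s) s = ik * ?d g s"
      using partial_deriv_mult[OF diff[OF C_k_const, of ik s] diff[OF gC, of s], of 1] z by simp
    also have "?d (\<lambda>s. f1' s * E s) s = f1' s * ?d E s + ?d f1' s * E s"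
      by (rule partial_deriv_mult[OF diff[OF f1C] diff[OF EC]])
    finally show ?thesis unfolding E1 f2 .
  qed
  \<comment> \<open>The second derivative of the exponential cancels k^2; every surviving term has
    differentiated the envelope and carries a factor 1/n.\<close>
  have h: "?d (?d g) s + (complex_of_real k)\<^sup>2 * g s
      = (complex_of_real (1 / n) * (2 * ik * f1' s) + complex_of_real (1 / n) * (complex_of_real (1 / n) * w (c s))) * E s" for s
  proof -
    have "ik * ik = - (complex_of_real k)\<^sup>2" by (simp add: ik_def power2_eq_square complex_eq_iff)
    moreover have "ik * (ik * g s) = (ik * ik) * g s" by simp
    ultimately have i2: "ik * (ik * g s) = - ((complex_of_real k)\<^sup>2 * g s)" by simp
    show ?thesis unfolding g2[of s] fun_cong[OF g1, of s] distrib_left i2 by (simp add: algebra_simps)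
  qed
  have E2: "cmod (E s) = 1" for s by (simp add: E_def ik_def norm_exp_eq_Re)
  have hle: "(cmod (?d (?d g) s + (complex_of_real k)\<^sup>2 * g s))\<^sup>2 \<le> (1 / n)\<^sup>2 * (M (c s))\<^sup>2" for s
  proof -
    have "cmod (?d (?d g) s + (complex_of_real k)\<^sup>2 * g s)
        \<le> cmod (complex_of_real (1 / n) * (2 * ik * f1' s)) + cmod (complex_of_real (1 / n) * (complex_of_real (1 / n) * w (c s)))"
      unfolding h norm_mult[of _ "E s"] E2 by (simp add: norm_triangle_ineq)
    also have "\<dots> = 1 / n * (2 * \<bar>k\<bar> * cmod (f1' s)) + 1 / n * (1 / n * cmod (w (c s)))"
      using n(1) by (simp add: norm_mult norm_divide ik_def)
    also have "\<dots> \<le> 1 / n * (2 * \<bar>k\<bar> * cmod (f1' s)) + 1 / n * (1 * cmod (w (c s)))"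
      using n(1) by (intro add_left_mono mult_left_mono mult_right_mono) auto
    also have "\<dots> = 1 / n * M (c s)" by (simp add: M_def f1'_def w_def algebra_simps add_divide_distrib)
    finally have "cmod (?d (?d g) s + (complex_of_real k)\<^sup>2 * g s) \<le> 1 / n * M (c s)" .
    then have "(cmod (?d (?d g) s + (complex_of_real k)\<^sup>2 * g s))\<^sup>2 \<le> (1 / n * M (c s))\<^sup>2" by (simp add: power_mono)
    then show ?thesis by (simp only: power_mult_distrib)
  qed
  have scale: "integrable lborel (\<lambda>s. q (c s)) \<and> (\<integral>s. q (c s) \<partial>lborel) = n * (\<integral>s. q s \<partial>lborel)"
    if q: "integrable lborel q" for q :: "real \<Rightarrow> real"
  proof -
    have nz: "1 / n \<noteq> 0" using n(1) by simp
    have "(\<integral>s. q s \<partial>lborel) = \<bar>1 / n\<bar> *\<^sub>R (\<integral>s. q (- t / n + 1 / n * s) \<partial>lborel)"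
      by (rule lborel_integral_real_affine[OF nz])
    moreover have "integrable lborel (\<lambda>s. q (- t / n + 1 / n * s))"
      by (rule lborel_integrable_real_affine[OF q nz])
    ultimately show ?thesis using n(1) unfolding c_def by (simp add: add.commute)
  qed
  have gsq: "(\<integral>s. (cmod (g s))\<^sup>2 \<partial>lborel) = n * I"
    using scale[OF Ii] unfolding g_def norm_mult E2 f_def I_def by simp
  show ?thesis
  proof (intro exI[of _ g] exI[of _ "t + n"] conjI allI impI)
    show "C_k m g" for m by (rule gC)
    show "g s = 0" if "s \<notin> {t..t + n}" for s
    proof -
      have "c s = (s - t) / n" by (simp add: c_def diff_divide_distrib)
      then have "c s \<notin> {0..1}" using that n(1) by (auto simp: divide_le_eq zero_le_divide_iff)
      from test_zero_outside[OF chi this] show ?thesis by (simp add: g_def f_def)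
    qed
    show "0 < (\<integral>s. (cmod (g s))\<^sup>2 \<partial>lborel)" unfolding gsq using n(1) I by simp
    have "(\<integral>s. (cmod (?d (?d g) s + (complex_of_real k)\<^sup>2 * g s))\<^sup>2 \<partial>lborel) \<le> (\<integral>s. (1 / n)\<^sup>2 * (M (c s))\<^sup>2 \<partial>lborel)"
    proof (rule integral_mono')
      show "integrable lborel (\<lambda>s. (1 / n)\<^sup>2 * (M (c s))\<^sup>2)"
        using conjunct1[OF scale[OF Mi]] by (rule integrable_mult_right)
    qed (use hle in auto)
    also have "\<dots> = (1 / n)\<^sup>2 * (n * J)" using scale[OF Mi] by (simp add: J_def)
    also have "\<dots> = J / n" using n(1) by (simp add: power2_eq_square)
    also have "\<dots> \<le> e * I" using n by (simp add: divide_le_eq mult.commute)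
    also have "\<dots> \<le> n * (e * I)" using n(1) mult_right_mono[of 1 n "e * I"] e I by simp
    finally show "(\<integral>s. (cmod (?d (?d g) s + (complex_of_real k)\<^sup>2 * g s))\<^sup>2 \<partial>lborel)
      \<le> e * (\<integral>s. (cmod (g s))\<^sup>2 \<partial>lborel)" unfolding gsq by (simp add: mult_ac)
  qed
qed

section \<open>Product states on the branch x > 0\<close>

context waveguide
begin

text \<open>A product in the coordinates of the branch \<sigma> = 1, written in Cartesian
  coordinates. For \<open>g\<close> supported beyond \<open>cut\<close> and \<phi> supported in
  \<open>S\<close> it stays away from the kink.\<close>

definition tens :: "(real \<Rightarrow> complex) \<Rightarrow> (real \<times> real \<Rightarrow> complex) \<Rightarrow> real \<times> real \<times> real \<Rightarrow> complex" where
  "tens g \<phi> p = g (fst (untube \<beta> 1 p)) * \<phi> (snd (untube \<beta> 1 p))"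

lemma tens_tube: "tens g \<phi> (tube \<beta> 1 (s, y)) = g s * \<phi> y"
  by (simp add: tens_def untube_tube)

lemma bounded_linear_untube:
  "bounded_linear (\<lambda>p. fst (untube \<beta> 1 p))" "bounded_linear (\<lambda>p. snd (untube \<beta> 1 p))"
proof -
  have "linear (\<lambda>p. fst (untube \<beta> 1 p))" "linear (\<lambda>p. snd (untube \<beta> 1 p))"
    by (rule linearI; auto simp: untube_def algebra_simps add_divide_distrib)+
  then show "bounded_linear (\<lambda>p. fst (untube \<beta> 1 p))" "bounded_linear (\<lambda>p. snd (untube \<beta> 1 p))"
    by (simp_all add: linear_conv_bounded_linear)
qed

lemma tens_C_k:
  assumes "\<And>k. C_k k g" "\<And>k. C_k k \<phi>"
  shows "C_k k (tens g \<phi>)"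
proof -
  have "C_k k (\<lambda>p. g (fst (untube \<beta> 1 p)))"
    using C_k_affine_comp[OF bounded_linear_untube(1) assms(1), of k 0] by simp
  moreover have "C_k k (\<lambda>p. \<phi> (snd (untube \<beta> 1 p)))"
    using C_k_affine_comp[OF bounded_linear_untube(2) assms(2), of k 0] by simp
  moreover have "tens g \<phi> = (\<lambda>p. g (fst (untube \<beta> 1 p)) * \<phi> (snd (untube \<beta> 1 p)))"
    by (rule ext) (simp add: tens_def)
  ultimately show ?thesis by (simp add: C_k_mult)
qed

lemma tens_test:
  assumes g: "\<And>k. C_k k g" "\<And>s. s \<notin> {cut..b} \<Longrightarrow> g s = 0" and p: "\<phi> \<in> C.test"
  shows "tens g \<phi> \<in> W.test"
proof -
  obtain K where K: "compact K" "K \<subseteq> S" "\<And>y. y \<notin> K \<Longrightarrow> \<phi> y = 0" using test_support[OF p] by metis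
  show ?thesis
  proof (rule test_functionsI[OF tens_C_k[OF g(1) test_C_k[OF p]]])
    show "compact (tube \<beta> 1 ` ({cut..b} \<times> K))"
      by (intro compact_continuous_image continuous_on_subset[OF tube_continuous] compact_Times K) auto
    show "tube \<beta> 1 ` ({cut..b} \<times> K) \<subseteq> \<Omega>"
    proof
      fix q assume "q \<in> tube \<beta> 1 ` ({cut..b} \<times> K)"
      then obtain s y where q: "q = tube \<beta> 1 (s, y)" "s \<ge> cut" "y \<in> K" by auto
      then have y: "y \<in> S" using K(2) by blast
      have one: "(1::real) * 1 = 1" by simp
      show "q \<in> \<Omega>"
        unfolding q(1) using tube_mem_Omega_iff[OF one less_imp_le[OF tube_sign_pos[OF one q(2) y]]] y by blast
    qed
    fix q assume q: "q \<notin> tube \<beta> 1 ` ({cut..b} \<times> K)"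
    have "untube \<beta> 1 q \<notin> {cut..b} \<times> K"
    proof
      assume "untube \<beta> 1 q \<in> {cut..b} \<times> K"
      from imageI[OF this, of "tube \<beta> 1"] show False using q by (simp add: tube_untube)
    qed
    then have "fst (untube \<beta> 1 q) \<notin> {cut..b} \<or> snd (untube \<beta> 1 q) \<notin> K" by (auto simp: mem_Times_iff)
    then show "tens g \<phi> q = 0"
      using g(2)[of "fst (untube \<beta> 1 q)"] K(3)[of "snd (untube \<beta> 1 q)"] by (auto simp: tens_def)
  qed
qed

lemma tens_partial:
  assumes g: "\<And>k. C_k k g" and p: "\<And>k. C_k k \<phi>"
  shows "dx (tens g \<phi>) q = complex_of_real (1 / (1 + \<beta>\<^sup>2)) * tens (partial_deriv 1 g) \<phi> q
      - complex_of_real \<beta> * tens g (partial_deriv (0, 1) \<phi>) q"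
    "dy (tens g \<phi>) q = tens g (partial_deriv (1, 0) \<phi>) q"
    "dz (tens g \<phi>) q = complex_of_real (\<beta> / (1 + \<beta>\<^sup>2)) * tens (partial_deriv 1 g) \<phi> q
      + tens g (partial_deriv (0, 1) \<phi>) q"
proof -
  have d: "g differentiable at s" "\<phi> differentiable at y" for s y
    using g[of "Suc 0"] p[of "Suc 0"] unfolding C_k.simps by blast+
  define G where "G = (\<lambda>q. g (fst (untube \<beta> 1 q) + 0))"
  define P where "P = (\<lambda>q. \<phi> (snd (untube \<beta> 1 q) + 0))"
  have eq: "tens g \<phi> = (\<lambda>q. G q * P q)" by (rule ext) (simp add: tens_def G_def P_def)
  have Gd: "G differentiable at q" and Pd: "P differentiable at q"
    unfolding G_def P_def
    using has_derivative_affine_comp[OF d(1) bounded_linear_untube(1)]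
      has_derivative_affine_comp[OF d(2) bounded_linear_untube(2)] unfolding differentiable_def by blast+
  have pG: "partial_deriv b G q = complex_of_real (fst (untube \<beta> 1 b)) * partial_deriv 1 g (fst (untube \<beta> 1 q))" for b
    unfolding G_def partial_deriv_affine_comp[OF d(1) bounded_linear_untube(1)] by simp
  have pP: "partial_deriv b P q = complex_of_real (snd (untube \<beta> 1 b) \<bullet> (1, 0)) * partial_deriv (1, 0) \<phi> (snd (untube \<beta> 1 q))
      + complex_of_real (snd (untube \<beta> 1 b) \<bullet> (0, 1)) * partial_deriv (0, 1) \<phi> (snd (untube \<beta> 1 q))" for b
    unfolding P_def partial_deriv_affine_comp[OF d(2) bounded_linear_untube(2)] sum_Basis_plane by simp
  have main: "partial_deriv b (tens g \<phi>) q = G q * partial_deriv b P q + partial_deriv b G q * P q" for b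
    unfolding eq by (rule partial_deriv_mult[OF Gd Pd])
  have G: "G q = g (fst (untube \<beta> 1 q))" and P: "P q = \<phi> (snd (untube \<beta> 1 q))" by (simp_all add: G_def P_def)
  show "dx (tens g \<phi>) q = complex_of_real (1 / (1 + \<beta>\<^sup>2)) * tens (partial_deriv 1 g) \<phi> q
      - complex_of_real \<beta> * tens g (partial_deriv (0, 1) \<phi>) q"
    unfolding main pG pP G P tens_def by (simp add: untube_def)
  show "dy (tens g \<phi>) q = tens g (partial_deriv (1, 0) \<phi>) q"
    unfolding main pG pP G P tens_def by (simp add: untube_def)
  show "dz (tens g \<phi>) q = complex_of_real (\<beta> / (1 + \<beta>\<^sup>2)) * tens (partial_deriv 1 g) \<phi> q
      + tens g (partial_deriv (0, 1) \<phi>) q"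
    unfolding main pG pP G P tens_def by (simp add: untube_def)
qed

lemma tens_nsq:
  assumes g: "\<And>k. C_k k g" "\<And>s. s \<notin> {cut..b} \<Longrightarrow> g s = 0" and p: "\<phi> \<in> C.test"
  shows "W.nsq (tens g \<phi>) = (\<integral>s. (cmod (g s))\<^sup>2 \<partial>lborel) * C.nsq \<phi>"
proof -
  have t: "tens g \<phi> \<in> W.test" by (rule tens_test[OF g p])
  have one: "(1::real) * 1 = 1" by simp
  have i: "integrable lborel (\<lambda>q. (cmod (tens g \<phi> q))\<^sup>2)" by (rule test_norm_sq_integrable[OF test_UNIV[OF t]])
  have "W.nsq (tens g \<phi>) = (\<integral>s. \<integral>y. (cmod (tens g \<phi> (tube \<beta> 1 (s, y))))\<^sup>2 \<partial>lborel \<partial>lborel)"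
    unfolding W.test_nsq[OF t] lborel_fubini(2)[OF integral_tube(1)[OF one i]] integral_tube(2)[OF one i] ..
  also have "\<dots> = (\<integral>s. (cmod (g s))\<^sup>2 * C.nsq \<phi> \<partial>lborel)"
    unfolding tens_tube C.test_nsq[OF p] by (simp add: norm_mult power_mult_distrib)
  finally show ?thesis by simp
qed

text \<open>The gradient splits orthogonally into the derivative along the branch and those in the
  plane. Integrating the former by parts once gives -g'' / (1 + \<beta>^2), which the k^2 part of
  \<open>r\<close> turns into -h / (1 + \<beta>^2); the latter are left as they are and meet the E1
  part of \<open>r\<close>.\<close>

lemma weyl_identity:
  assumes g: "\<And>k. C_k k g" "\<And>s. s \<notin> {cut..b} \<Longrightarrow> g s = 0" and p: "\<phi> \<in> C.test" and v: "v \<in> W.test"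
    and r: "r = C.E1 + 1 / (1 + \<beta>\<^sup>2) * k\<^sup>2"
    and h: "h = (\<lambda>s. partial_deriv 1 (partial_deriv 1 g) s + (complex_of_real k)\<^sup>2 * g s)"
  shows "W.wform (\<lambda>_. 1) (tens g \<phi>) v - complex_of_real r * W.ip (tens g \<phi>) v
    = - complex_of_real (1 / (1 + \<beta>\<^sup>2)) * W.ip (tens h \<phi>) v
      + (\<integral>q. tens g (partial_deriv (1, 0) \<phi>) q * cnj (dy v q)
          + complex_of_real (1 + \<beta>\<^sup>2) * (tens g (partial_deriv (0, 1) \<phi>) q * cnj (dn \<beta> 1 v q))
          - complex_of_real C.E1 * (tens g \<phi> q * cnj (v q)) \<partial>lborel)"
proof -
  define \<kappa> where "\<kappa> = 1 / (1 + \<beta>\<^sup>2)"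
  have \<kappa>: "\<kappa> * (1 + \<beta>\<^sup>2) = 1" using one_plus_sq_pos[of \<beta>] by (simp add: \<kappa>_def)
  have gp: "\<And>k. C_k k (partial_deriv 1 g)" using g(1)[of "Suc _"] by simp
  have gpp: "\<And>k. C_k k (partial_deriv 1 (partial_deriv 1 g))" using gp[of "Suc _"] by simp
  have gz: "g s = 0 \<and> partial_deriv 1 g s = 0" if "s \<notin> {cut..b}" for s
  proof -
    have "open (- {cut..b})" by (rule open_Compl[OF closed_atLeastAtMost])
    moreover have "s \<in> - {cut..b}" using that by simp
    ultimately have "partial_deriv 1 g s = partial_deriv 1 (\<lambda>_. 0) s"
      by (rule partial_deriv_local) (use g(2) in auto)
    also have "\<dots> = 0" by (rule partial_deriv_eqI[where f' = "\<lambda>_. 0"]) simp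
    finally show ?thesis using g(2)[OF that] by simp
  qed
  have gpz: "partial_deriv 1 g s = 0" if "s \<notin> {cut..b}" for s using gz[OF that] by simp
  have gppz: "partial_deriv 1 (partial_deriv 1 g) s = 0" if "s \<notin> {cut..b}" for s
  proof -
    have "open (- {cut..b})" by (rule open_Compl[OF closed_atLeastAtMost])
    moreover have "s \<in> - {cut..b}" using that by simp
    ultimately have "partial_deriv 1 (partial_deriv 1 g) s = partial_deriv 1 (\<lambda>_. 0) s"
      by (rule partial_deriv_local) (use gpz in auto)
    also have "\<dots> = 0" by (rule partial_deriv_eqI[where f' = "\<lambda>_. 0"]) simp
    finally show ?thesis .
  qed
  note p1 = test_partial[OF p Basis_plane(1)] and p2 = test_partial[OF p Basis_plane(2)]
  have tg: "tens g \<phi> \<in> W.test" by (rule tens_test[OF g p])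
  have tg1: "tens (partial_deriv 1 g) \<phi> \<in> W.test" by (rule tens_test[OF gp gpz p])
  have tg2: "tens (partial_deriv 1 (partial_deriv 1 g)) \<phi> \<in> W.test" by (rule tens_test[OF gpp gppz p])
  have ta: "tens g (partial_deriv (1, 0) \<phi>) \<in> W.test" by (rule tens_test[OF g p1])
  have tb: "tens g (partial_deriv (0, 1) \<phi>) \<in> W.test" by (rule tens_test[OF g p2])
  have vc: "(\<lambda>q. cnj (v q)) \<in> W.test" by (rule test_cnj[OF v])
  have int: "integrable lborel (\<lambda>q. x q * cnj (y q))" if "x \<in> W.test" "y \<in> W.test" for x y
    by (rule test_integrable[OF test_mult[OF test_UNIV[OF test_cnj[OF that(2)]] test_C_k[OF that(1)]]])
  let ?vx = "dx v" and ?vy = "dy v" and ?vz = "dz v"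
  have vx: "?vx \<in> W.test" and vy: "?vy \<in> W.test" and vz: "?vz \<in> W.test"
    by (rule test_partial[OF v], rule Basis_space_mem)+
  have vn: "dn \<beta> 1 v \<in> W.test" by (rule dn_test[OF v])
  let ?w = "tens (partial_deriv 1 g) \<phi>"
  have ibp: "(\<integral>q. ?w q * cnj (partial_deriv b v q) \<partial>lborel) = - (\<integral>q. partial_deriv b ?w q * cnj (v q) \<partial>lborel)"
    if b: "b \<in> Basis" for b
  proof -
    have "partial_deriv b (\<lambda>q. cnj (v q)) = (\<lambda>q. cnj (partial_deriv b v q))"
      using partial_deriv_cnj[OF test_differentiable[OF v]] by blast
    then show ?thesis using integration_by_parts[OF test_UNIV[OF vc] test_C_k[OF tg1] b] by simp
  qed
  have A: "W.wform (\<lambda>_. 1) (tens g \<phi>) v = (\<integral>q. dx (tens g \<phi>) q * cnj (?vx q) + dy (tens g \<phi>) q * cnj (?vy q) + dz (tens g \<phi>) q * cnj (?vz q) \<partial>lborel)"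
    unfolding W.test_wform[OF tg v] sum_Basis_space
    using int[OF test_partial[OF tg Basis_space_mem(1)] vx] int[OF test_partial[OF tg Basis_space_mem(2)] vy]
      int[OF test_partial[OF tg Basis_space_mem(3)] vz] by simp
  \<comment> \<open>The s-derivative of the product pairs only with the derivative of
    \<open>v\<close> along (1, 0, \<beta>), its y2-derivative only with \<open>dn\<close>: this is
    the orthogonality of the two directions.\<close>
  have pt: "dx (tens g \<phi>) q * cnj (?vx q) + dy (tens g \<phi>) q * cnj (?vy q) + dz (tens g \<phi>) q * cnj (?vz q)
      = complex_of_real \<kappa> * (?w q * cnj (?vx q)) + complex_of_real (\<beta> * \<kappa>) * (?w q * cnj (?vz q))
        + (tens g (partial_deriv (1, 0) \<phi>) q * cnj (?vy q)
          + complex_of_real (1 + \<beta>\<^sup>2) * (tens g (partial_deriv (0, 1) \<phi>) q * cnj (dn \<beta> 1 v q)))" for q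
  proof -
    have "complex_of_real (1 + \<beta>\<^sup>2) * complex_of_real \<kappa> = 1"
      using \<kappa> by (metis mult.commute of_real_1 of_real_mult)
    then have dn: "complex_of_real (1 + \<beta>\<^sup>2) * cnj (dn \<beta> 1 v q) = cnj (?vz q) - complex_of_real \<beta> * cnj (?vx q)"
      unfolding dn_def \<kappa>_def[symmetric] by (simp add: mult.assoc[symmetric])
    have bk: "\<beta> / (1 + \<beta>\<^sup>2) = \<beta> * \<kappa>" by (simp add: \<kappa>_def)
    have "complex_of_real (1 + \<beta>\<^sup>2) * (tens g (partial_deriv (0, 1) \<phi>) q * cnj (dn \<beta> 1 v q))
        = tens g (partial_deriv (0, 1) \<phi>) q * (cnj (?vz q) - complex_of_real \<beta> * cnj (?vx q))"
      unfolding dn[symmetric] by (simp only: mult_ac)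
    then show ?thesis
      unfolding tens_partial[OF g(1) test_C_k[OF p]] bk \<kappa>_def[symmetric] by (simp only:) (simp add: algebra_simps)
  qed
  have i1: "integrable lborel (\<lambda>q. ?w q * cnj (?vx q))" "integrable lborel (\<lambda>q. ?w q * cnj (?vz q))"
    by (rule int[OF tg1 vx], rule int[OF tg1 vz])
  have i2: "integrable lborel (\<lambda>q. tens g (partial_deriv (1, 0) \<phi>) q * cnj (?vy q)
      + complex_of_real (1 + \<beta>\<^sup>2) * (tens g (partial_deriv (0, 1) \<phi>) q * cnj (dn \<beta> 1 v q)))"
    using int[OF ta vy] int[OF tb vn] by (intro Bochner_Integration.integrable_add integrable_mult_right)
  have i3: "integrable lborel (\<lambda>q. tens g \<phi> q * cnj (v q))" by (rule int[OF tg v])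
  define T where "T = (\<integral>q. tens g (partial_deriv (1, 0) \<phi>) q * cnj (?vy q)
      + complex_of_real (1 + \<beta>\<^sup>2) * (tens g (partial_deriv (0, 1) \<phi>) q * cnj (dn \<beta> 1 v q)) \<partial>lborel)"
  have B: "W.wform (\<lambda>_. 1) (tens g \<phi>) v = complex_of_real \<kappa> * (\<integral>q. ?w q * cnj (?vx q) \<partial>lborel)
      + complex_of_real (\<beta> * \<kappa>) * (\<integral>q. ?w q * cnj (?vz q) \<partial>lborel) + T"
    unfolding A pt T_def using i1 i2 by (simp only: Bochner_Integration.integral_add integrable_mult_right
      Bochner_Integration.integrable_add integral_mult_right_zero)
  have wi: "integrable lborel (\<lambda>q. dx ?w q * cnj (v q))" "integrable lborel (\<lambda>q. dz ?w q * cnj (v q))"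
    by (rule int[OF test_partial[OF tg1 Basis_space_mem(1)] v], rule int[OF test_partial[OF tg1 Basis_space_mem(3)] v])
  have "complex_of_real \<kappa> * (\<integral>q. ?w q * cnj (?vx q) \<partial>lborel) + complex_of_real (\<beta> * \<kappa>) * (\<integral>q. ?w q * cnj (?vz q) \<partial>lborel)
      = - complex_of_real \<kappa> * ((\<integral>q. dx ?w q * cnj (v q) \<partial>lborel) + complex_of_real \<beta> * (\<integral>q. dz ?w q * cnj (v q) \<partial>lborel))"
    unfolding ibp[OF Basis_space_mem(1)] ibp[OF Basis_space_mem(3)] by (simp add: algebra_simps)
  also have "(\<integral>q. dx ?w q * cnj (v q) \<partial>lborel) + complex_of_real \<beta> * (\<integral>q. dz ?w q * cnj (v q) \<partial>lborel)
      = (\<integral>q. dx ?w q * cnj (v q) + complex_of_real \<beta> * (dz ?w q * cnj (v q)) \<partial>lborel)"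
    using wi by (simp only: Bochner_Integration.integral_add integrable_mult_right integral_mult_right_zero)
  \<comment> \<open>dx + \<beta> dz is the derivative along (1, 0, \<beta>), that is in
    \<open>s\<close>, and it acts on the longitudinal factor alone.\<close>
  also have "(\<lambda>q. dx ?w q * cnj (v q) + complex_of_real \<beta> * (dz ?w q * cnj (v q)))
      = (\<lambda>q. tens (partial_deriv 1 (partial_deriv 1 g)) \<phi> q * cnj (v q))"
  proof
    fix q
    have bk: "\<beta> / (1 + \<beta>\<^sup>2) = \<beta> * \<kappa>" by (simp add: \<kappa>_def)
    have "complex_of_real (\<kappa> * (1 + \<beta>\<^sup>2)) = 1" unfolding \<kappa> by simp
    then have "complex_of_real \<kappa> * X + complex_of_real \<beta> * (complex_of_real (\<beta> * \<kappa>) * X) = X" for X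
      by (metis (no_types, opaque_lifting) distrib_left distrib_right mult.assoc mult.commute mult_1 mult_1_right of_real_mult of_real_add power2_eq_square)
    moreover have "dx ?w q + complex_of_real \<beta> * dz ?w q = complex_of_real \<kappa> * tens (partial_deriv 1 (partial_deriv 1 g)) \<phi> q
        + complex_of_real \<beta> * (complex_of_real (\<beta> * \<kappa>) * tens (partial_deriv 1 (partial_deriv 1 g)) \<phi> q)"
      unfolding tens_partial[OF gp test_C_k[OF p]] bk \<kappa>_def[symmetric] by (simp add: algebra_simps)
    ultimately have "dx ?w q + complex_of_real \<beta> * dz ?w q = tens (partial_deriv 1 (partial_deriv 1 g)) \<phi> q" by simp
    then show "dx ?w q * cnj (v q) + complex_of_real \<beta> * (dz ?w q * cnj (v q))
        = tens (partial_deriv 1 (partial_deriv 1 g)) \<phi> q * cnj (v q)"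
      by (simp add: distrib_right[symmetric] mult.assoc[symmetric])
  qed
  finally have D: "W.wform (\<lambda>_. 1) (tens g \<phi>) v
      = - complex_of_real \<kappa> * (\<integral>q. tens (partial_deriv 1 (partial_deriv 1 g)) \<phi> q * cnj (v q) \<partial>lborel) + T"
    unfolding B by simp
  have hh: "C_k m h" "s \<notin> {cut..b} \<Longrightarrow> h s = 0" for m s
    unfolding h using gpp g gppz by (auto intro!: C_k_add C_k_cmult)
  have th: "tens h \<phi> \<in> W.test" by (rule tens_test[OF hh p])
  have heq: "W.ip (tens h \<phi>) v = (\<integral>q. tens (partial_deriv 1 (partial_deriv 1 g)) \<phi> q * cnj (v q) \<partial>lborel)
      + (complex_of_real k)\<^sup>2 * (\<integral>q. tens g \<phi> q * cnj (v q) \<partial>lborel)"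
  proof -
    have "(\<lambda>q. tens h \<phi> q * cnj (v q)) = (\<lambda>q. tens (partial_deriv 1 (partial_deriv 1 g)) \<phi> q * cnj (v q)
        + (complex_of_real k)\<^sup>2 * (tens g \<phi> q * cnj (v q)))"
      by (rule ext) (simp add: tens_def h algebra_simps)
    then show ?thesis unfolding W.test_ip[OF th v] using int[OF tg2 v] i3 by simp
  qed
  have E: "(\<integral>q. tens g (partial_deriv (1, 0) \<phi>) q * cnj (dy v q)
          + complex_of_real (1 + \<beta>\<^sup>2) * (tens g (partial_deriv (0, 1) \<phi>) q * cnj (dn \<beta> 1 v q))
          - complex_of_real C.E1 * (tens g \<phi> q * cnj (v q)) \<partial>lborel)
      = T - complex_of_real C.E1 * (\<integral>q. tens g \<phi> q * cnj (v q) \<partial>lborel)"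
    unfolding T_def using Bochner_Integration.integral_diff[OF i2 integrable_mult_right[OF i3, of "complex_of_real C.E1"]]
    by (simp only: integral_mult_right_zero)
  show ?thesis
    unfolding E D heq W.test_ip[OF tg v] r \<kappa>_def[symmetric] by (simp add: algebra_simps)
qed

end

section \<open>Size of the transverse residual, and the Weyl criterion above the threshold\<close>

context waveguide
begin

text \<open>On one plane the transverse integrand becomes the form minus \<open>E1\<close> on
  \<open>S\<close>, between \<phi> and a test function, which is what
  \<open>shifted_cauchy_schwarz\<close> estimates.\<close>

lemma slice_pairing:
  assumes p: "\<phi> \<in> C.test" and v: "v \<in> W.test" and s: "s \<ge> cut"
  shows "(\<integral>y. partial_deriv (1, 0) \<phi> y * cnj (dy v (tube \<beta> 1 (s, y)))
      + complex_of_real (1 + \<beta>\<^sup>2) * (partial_deriv (0, 1) \<phi> y * cnj (dn \<beta> 1 v (tube \<beta> 1 (s, y))))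
      - complex_of_real C.E1 * (\<phi> y * cnj (v (tube \<beta> 1 (s, y)))) \<partial>lborel)
    = C.wform (trans_weight \<beta>) \<phi> (slice 1 v s) - complex_of_real C.E1 * C.ip \<phi> (slice 1 v s)"
proof -
  have one: "(1::real) * 1 = 1" by simp
  let ?w = "slice 1 v s"
  have t: "?w \<in> C.test" by (rule slice_test[OF one v s])
  have int: "integrable lborel (\<lambda>q. x q * cnj (y q))" if "x \<in> C.test" "y \<in> C.test" for x y
    by (rule test_integrable[OF test_mult[OF test_UNIV[OF test_cnj[OF that(2)]] test_C_k[OF that(1)]]])
  have "(\<lambda>y. partial_deriv (1, 0) \<phi> y * cnj (dy v (tube \<beta> 1 (s, y)))
      + complex_of_real (1 + \<beta>\<^sup>2) * (partial_deriv (0, 1) \<phi> y * cnj (dn \<beta> 1 v (tube \<beta> 1 (s, y))))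
      - complex_of_real C.E1 * (\<phi> y * cnj (v (tube \<beta> 1 (s, y)))))
    = (\<lambda>y. partial_deriv (1, 0) \<phi> y * cnj (partial_deriv (1, 0) ?w y)
      + complex_of_real (1 + \<beta>\<^sup>2) * (partial_deriv (0, 1) \<phi> y * cnj (partial_deriv (0, 1) ?w y))
      - complex_of_real C.E1 * (\<phi> y * cnj (?w y)))" (is "?l = ?r")
  proof
    fix y
    show "?l y = ?r y"
    proof (cases "y \<in> S")
      case True
      then show ?thesis by (simp only: slice_partial[OF one v s True]) (simp add: slice_def)
    next
      case False
      then show ?thesis using test_zero_outside[OF p False] test_partial_zero_outside[OF p False] by simp
    qed
  qed
  then show ?thesis
    unfolding C.test_wform_plane[OF p t] C.test_ip[OF p t]
    using int[OF test_partial[OF p Basis_plane(1)] test_partial[OF t Basis_plane(1)]]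
      int[OF test_partial[OF p Basis_plane(2)] test_partial[OF t Basis_plane(2)]] int[OF p t]
    by (simp del: of_real_add)
qed

text \<open>Cauchy-Schwarz twice: for the form minus \<open>E1\<close> on each plane, then in
  \<open>s\<close>. The energies of the slices of \<open>v\<close> integrate to at most its
  Dirichlet integral.\<close>

lemma transverse_remainder:
  assumes g: "\<And>k. C_k k g" "\<And>s. s \<notin> {cut..b} \<Longrightarrow> g s = 0" and p: "\<phi> \<in> C.test" and v: "v \<in> W.test"
  shows "(cmod (\<integral>q. tens g (partial_deriv (1, 0) \<phi>) q * cnj (dy v q)
          + complex_of_real (1 + \<beta>\<^sup>2) * (tens g (partial_deriv (0, 1) \<phi>) q * cnj (dn \<beta> 1 v q))
          - complex_of_real C.E1 * (tens g \<phi> q * cnj (v q)) \<partial>lborel))\<^sup>2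
    \<le> (\<integral>s. (cmod (g s))\<^sup>2 \<partial>lborel) * ((C.F.A.sq \<phi> - C.E1 * C.nsq \<phi>) * W.F.A.sq v)"
    (is "(cmod (integral\<^sup>L lborel ?Z))\<^sup>2 \<le> _")
proof -
  have one: "(1::real) * 1 = 1" by simp
  \<comment> \<open>The integrand without the factor \<open>g\<close>: its compact support comes
    from \<open>v\<close>, and this makes its plane integrals integrable in
    \<open>s\<close>.\<close>
  define Y where "Y q = partial_deriv (1, 0) \<phi> (snd q) * cnj (dy v (tube \<beta> 1 q))
      + complex_of_real (1 + \<beta>\<^sup>2) * (partial_deriv (0, 1) \<phi> (snd q) * cnj (dn \<beta> 1 v (tube \<beta> 1 q)))
      - complex_of_real C.E1 * (\<phi> (snd q) * cnj (v (tube \<beta> 1 q)))" for q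
  note p1 = test_partial[OF p Basis_plane(1)] and p2 = test_partial[OF p Basis_plane(2)]
  note vy = test_partial[OF v Basis_space_mem(2)] and vn = dn_test[OF v, of 1]
  have cp: "continuous_on UNIV (\<lambda>q :: real \<times> real \<times> real. x (snd q))" if "x \<in> C.test" for x
    by (rule continuous_on_compose2[OF test_continuous[OF that]]) (auto intro: continuous_intros)
  have ct: "continuous_on UNIV (\<lambda>q. x (tube \<beta> 1 q))" if "x \<in> W.test" for x
    by (rule continuous_on_compose2[OF test_continuous[OF that] tube_continuous]) auto
  have Yi: "integrable lborel Y"
  proof -
    obtain K where K: "compact K" "\<And>q. q \<notin> K \<Longrightarrow> v q = 0" "\<And>q b. q \<notin> K \<Longrightarrow> partial_deriv b v q = 0"
      using test_support[OF v] by metis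
    show ?thesis
    proof (rule integrable_continuous_compact_support)
      show "continuous_on UNIV Y"
        unfolding Y_def by (intro continuous_intros cp ct p p1 p2 v vy vn)
      show "compact (untube \<beta> 1 ` K)"
        by (intro compact_continuous_image continuous_on_subset[OF untube_continuous] K) auto
      fix q assume q: "q \<notin> untube \<beta> 1 ` K"
      have "tube \<beta> 1 q \<notin> K"
      proof
        assume "tube \<beta> 1 q \<in> K"
        from imageI[OF this, of "untube \<beta> 1"] show False using q by (simp add: untube_tube)
      qed
      then show "Y q = 0" using K(2,3) by (simp add: Y_def dn_def)
    qed
  qed
  define G where "G s = (\<integral>y. Y (s, y) \<partial>lborel)" for s
  \<comment> \<open>The identification with a form on \<open>S\<close> is available only for s \<ge>
    \<open>cut\<close>; \<open>g\<close> vanishes below, so the truncation changes nothing under the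
    integral.\<close>
  define F where "F s = indicator {cut..} s *\<^sub>R G s" for s
  have Gi: "integrable lborel G" unfolding G_def by (rule lborel_fubini(1)[OF Yi])
  have Fi: "integrable lborel F" unfolding F_def by (rule integrable_mult_indicator[OF _ Gi]) simp
  have Fle: "(cmod (F s))\<^sup>2 \<le> (C.F.A.sq \<phi> - C.E1 * C.nsq \<phi>) * (indicator {cut..} s * C.F.A.sq (slice 1 v s))" for s
  proof (cases "s \<ge> cut")
    case True
    have "F s = C.wform (trans_weight \<beta>) \<phi> (slice 1 v s) - complex_of_real C.E1 * C.ip \<phi> (slice 1 v s)"
      using slice_pairing[OF p v True] True by (simp add: F_def G_def Y_def)
    then show ?thesis
      using C.shifted_cauchy_schwarz[OF C.test_H10[OF p] C.test_H10[OF slice_test[OF one v True]]] True by simp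
  qed (simp add: F_def)
  have Ai: "integrable lborel (\<lambda>s. (C.F.A.sq \<phi> - C.E1 * C.nsq \<phi>) * (indicator {cut..} s * C.F.A.sq (slice 1 v s)))"
    by (rule integrable_mult_right[OF integral_outer_trans_sq(1)[OF one v]])
  have F2i: "integrable lborel (\<lambda>s. (cmod (F s))\<^sup>2)"
  proof (rule Bochner_Integration.integrable_bound[OF Ai])
    show "(\<lambda>s. (cmod (F s))\<^sup>2) \<in> borel_measurable lborel"
      using borel_measurable_integrable[OF Fi] by measurable
    show "AE s in lborel. norm ((cmod (F s))\<^sup>2) \<le> norm ((C.F.A.sq \<phi> - C.E1 * C.nsq \<phi>) * (indicator {cut..} s * C.F.A.sq (slice 1 v s)))"
    proof (rule AE_I2)
      fix s
      show "norm ((cmod (F s))\<^sup>2) \<le> norm ((C.F.A.sq \<phi> - C.E1 * C.nsq \<phi>) * (indicator {cut..} s * C.F.A.sq (slice 1 v s)))"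
        using Fle[of s] zero_le_power2[of "cmod (F s)"] by (simp only: real_norm_def abs_of_nonneg order_trans[OF _ abs_ge_self])
    qed
  qed
  have FL: "F \<in> L2M lborel" using borel_measurable_integrable[OF Fi] F2i by (simp add: L2M_def)
  have gt: "test_fun g" by (rule test_functionsI[OF g(1) compact_Icc subset_UNIV g(2)])
  have gL: "g \<in> L2M lborel"
    using test_norm_sq_integrable[OF gt] test_borel[OF gt] by (simp add: L2M_def)
  have Zi: "integrable lborel ?Z"
  proof -
    have int: "integrable lborel (\<lambda>q. x q * cnj (y q))" if "x \<in> W.test" "y \<in> W.test" for x y
      by (rule test_integrable[OF test_mult[OF test_UNIV[OF test_cnj[OF that(2)]] test_C_k[OF that(1)]]])
    show ?thesis
      by (intro Bochner_Integration.integrable_diff Bochner_Integration.integrable_add integrable_mult_right int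
          tens_test[OF g] p p1 p2 v vy vn)
  qed
  have "integral\<^sup>L lborel ?Z = (\<integral>s. \<integral>y. ?Z (tube \<beta> 1 (s, y)) \<partial>lborel \<partial>lborel)"
    unfolding lborel_fubini(2)[OF integral_tube(1)[OF one Zi]] integral_tube(2)[OF one Zi] ..
  \<comment> \<open>The double conjugate brings the integral into the shape of
    \<open>ipM\<close>.\<close>
  also have "\<dots> = (\<integral>s. g s * cnj (cnj (F s)) \<partial>lborel)"
  proof (rule Bochner_Integration.integral_cong[OF refl])
    fix s
    have "(\<lambda>y. ?Z (tube \<beta> 1 (s, y))) = (\<lambda>y. g s * Y (s, y))"
      by (rule ext) (simp add: tens_tube Y_def algebra_simps)
    then have "(\<integral>y. ?Z (tube \<beta> 1 (s, y)) \<partial>lborel) = g s * G s"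
      unfolding G_def by simp
    also have "\<dots> = g s * F s" using g(2)[of s] by (cases "s \<ge> cut") (simp_all add: F_def)
    finally show "(\<integral>y. ?Z (tube \<beta> 1 (s, y)) \<partial>lborel) = g s * cnj (cnj (F s))" by simp
  qed
  also have "\<dots> = ipM lborel g (\<lambda>s. cnj (F s))" by (simp add: ipM_def)
  finally have Z: "integral\<^sup>L lborel ?Z = ipM lborel g (\<lambda>s. cnj (F s))" .
  have "(cmod (integral\<^sup>L lborel ?Z))\<^sup>2 \<le> L2.sq lborel (\<lambda>s. cnj (F s)) * L2.sq lborel g"
    unfolding Z by (rule L2.cauchy_schwarz[OF L2M_cnj[OF FL] gL])
  also have "L2.sq lborel (\<lambda>s. cnj (F s)) = (\<integral>s. (cmod (F s))\<^sup>2 \<partial>lborel)" by (simp add: L2_sq)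
  also have "L2.sq lborel g = (\<integral>s. (cmod (g s))\<^sup>2 \<partial>lborel)" by (simp add: L2_sq)
  also have "(\<integral>s. (cmod (F s))\<^sup>2 \<partial>lborel) * (\<integral>s. (cmod (g s))\<^sup>2 \<partial>lborel)
      \<le> ((C.F.A.sq \<phi> - C.E1 * C.nsq \<phi>) * W.F.A.sq v) * (\<integral>s. (cmod (g s))\<^sup>2 \<partial>lborel)"
  proof (rule mult_right_mono)
    have "(\<integral>s. (cmod (F s))\<^sup>2 \<partial>lborel) \<le> (\<integral>s. (C.F.A.sq \<phi> - C.E1 * C.nsq \<phi>) * (indicator {cut..} s * C.F.A.sq (slice 1 v s)) \<partial>lborel)"
      by (rule integral_mono[OF F2i Ai]) (rule Fle)
    also have "\<dots> = (C.F.A.sq \<phi> - C.E1 * C.nsq \<phi>) * (\<integral>q. indicator (outer 1) q * trans_sq 1 v q \<partial>lborel)"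
      by (simp add: integral_outer_trans_sq(2)[OF one v])
    also have "\<dots> \<le> (C.F.A.sq \<phi> - C.E1 * C.nsq \<phi>) * W.F.A.sq v"
    proof (rule mult_left_mono)
      have "(\<integral>q. indicator (outer 1) q * trans_sq 1 v q \<partial>lborel) \<le> (\<integral>q. grad_sq v q \<partial>lborel)"
      proof (rule integral_mono)
        show "integrable lborel (\<lambda>q. indicator (outer 1) q * trans_sq 1 v q)"
          using integrable_mult_indicator[of "outer 1" lborel "trans_sq 1 v"] trans_sq_integrable[OF v] by simp
        show "integrable lborel (grad_sq v)" by (rule grad_sq_integrable[OF test_UNIV[OF v]])
        show "indicator (outer 1) q * trans_sq 1 v q \<le> grad_sq v q" for q
          using trans_sq_le_grad_sq[OF one, of v q] grad_sq_nonneg[of v q] by (simp add: indicator_def)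
      qed
      also have "\<dots> \<le> W.F.A.sq v" by (rule W.grad_sq_le_A_sq[OF v])
      finally show "(\<integral>q. indicator (outer 1) q * trans_sq 1 v q \<partial>lborel) \<le> W.F.A.sq v" .
      show "0 \<le> C.F.A.sq \<phi> - C.E1 * C.nsq \<phi>" using C.E1_le[OF C.test_H10[OF p]] by simp
    qed
    finally show "(\<integral>s. (cmod (F s))\<^sup>2 \<partial>lborel) \<le> (C.F.A.sq \<phi> - C.E1 * C.nsq \<phi>) * W.F.A.sq v" .
  qed simp
  finally show ?thesis by (simp add: mult.commute)
qed

text \<open>The longitudinal residual is controlled by \<open>W.nsq v\<close> and the transverse one
  by \<open>W.F.A.sq v\<close>; together they give exactly the form norm required by
  \<open>not_resolvent_weyl\<close>.\<close>

theorem not_resolvent_above: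
  assumes r: "r \<ge> C.E1"
  shows "\<not> W.F.resolvent (complex_of_real r)"
proof (rule W.F.not_resolvent_weyl)
  fix e :: real assume e: "e > 0"
  \<comment> \<open>Solves r = E1 + k^2 / (1 + \<beta>^2); the root is real because \<open>r\<close>
    is at least E1.\<close>
  define k where "k = sqrt ((r - C.E1) * (1 + \<beta>\<^sup>2))"
  have n: "1 + \<beta>\<^sup>2 > 0" by (rule one_plus_sq_pos)
  have "k\<^sup>2 = (r - C.E1) * (1 + \<beta>\<^sup>2)" unfolding k_def using r n by simp
  then have k: "r = C.E1 + 1 / (1 + \<beta>\<^sup>2) * k\<^sup>2" using n by simp
  \<comment> \<open>Half of \<open>e\<close> for each residual: the factor 2 in |X + Z|^2 \<le> 2
    |X|^2 + 2 |Z|^2 restores \<open>e\<close>.\<close>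
  have e2: "e / 2 > 0" using e by simp
  obtain \<phi> where p: "\<phi> \<in> C.test" "C.nsq \<phi> > 0" "C.F.A.sq \<phi> - C.E1 * C.nsq \<phi> \<le> e / 2 * C.nsq \<phi>"
    using C.E1_approx[OF e2] by blast
  obtain g b where g: "\<And>n. C_k n g" "\<And>s. s \<notin> {cut..b} \<Longrightarrow> g s = 0"
    and gn: "0 < (\<integral>s. (cmod (g s))\<^sup>2 \<partial>lborel)"
      "(\<integral>s. (cmod (partial_deriv 1 (partial_deriv 1 g) s + (complex_of_real k)\<^sup>2 * g s))\<^sup>2 \<partial>lborel)
        \<le> e / 2 * (\<integral>s. (cmod (g s))\<^sup>2 \<partial>lborel)"
    using modulated_wave[OF e2, of cut k] by blast
  define h where "h = (\<lambda>s. partial_deriv 1 (partial_deriv 1 g) s + (complex_of_real k)\<^sup>2 * g s)"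
  have gt: "g \<in> test_functions {cut..b}" by (rule test_functionsI[OF g(1) compact_Icc order_refl g(2)])
  have g2: "partial_deriv 1 (partial_deriv 1 g) \<in> test_functions {cut..b}"
    by (intro test_partial gt) simp_all
  have ht: "h \<in> test_functions {cut..b}" unfolding h_def by (rule test_comb[OF g2 gt])
  have h: "C_k m h" "s \<notin> {cut..b} \<Longrightarrow> h s = 0" for m s
    using test_C_k[OF ht] test_zero_outside[OF ht] by blast+
  let ?u = "tens g \<phi>"
  have ut: "?u \<in> W.test" by (rule tens_test[OF g p(1)])
  have un: "W.nsq ?u = (\<integral>s. (cmod (g s))\<^sup>2 \<partial>lborel) * C.nsq \<phi>" by (rule tens_nsq[OF g p(1)])
  have hn: "W.nsq (tens h \<phi>) \<le> e / 2 * W.nsq ?u"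
  proof -
    have "W.nsq (tens h \<phi>) = (\<integral>s. (cmod (h s))\<^sup>2 \<partial>lborel) * C.nsq \<phi>" by (rule tens_nsq[OF h p(1)])
    also have "\<dots> \<le> (e / 2 * (\<integral>s. (cmod (g s))\<^sup>2 \<partial>lborel)) * C.nsq \<phi>"
      using gn(2) p(2) unfolding h_def by (intro mult_right_mono) auto
    finally show ?thesis unfolding un by (simp add: mult.assoc)
  qed
  show "\<exists>u\<in>W.H10. 0 < W.nsq u \<and> (\<forall>v\<in>W.H10.
      (cmod (W.wform (\<lambda>_. 1) u v - complex_of_real r * W.ip u v))\<^sup>2 \<le> e * W.nsq u * W.F.Q.sq v)"
  proof (intro bexI[of _ ?u] conjI ballI)
    show "?u \<in> W.H10" by (rule W.test_H10[OF ut])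
    show "0 < W.nsq ?u" unfolding un using gn(1) p(2) by simp
    fix v assume vH: "v \<in> W.H10"
    show "(cmod (W.wform (\<lambda>_. 1) ?u v - complex_of_real r * W.ip ?u v))\<^sup>2 \<le> e * W.nsq ?u * W.F.Q.sq v"
    proof (rule W.form_bound_dense[OF W.test_H10[OF ut] _ vH])
      fix v assume v: "v \<in> W.test"
      define X where "X = - complex_of_real (1 / (1 + \<beta>\<^sup>2)) * W.ip (tens h \<phi>) v"
      define Z where "Z = (\<integral>q. tens g (partial_deriv (1, 0) \<phi>) q * cnj (dy v q)
          + complex_of_real (1 + \<beta>\<^sup>2) * (tens g (partial_deriv (0, 1) \<phi>) q * cnj (dn \<beta> 1 v q))
          - complex_of_real C.E1 * (tens g \<phi> q * cnj (v q)) \<partial>lborel)"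
      have eq: "W.wform (\<lambda>_. 1) ?u v - complex_of_real r * W.ip ?u v = X + Z"
        unfolding X_def Z_def by (rule weyl_identity[OF g p(1) v k h_def])
      have vL: "v \<in> W.LO" and hL: "tens h \<phi> \<in> W.LO"
        by (rule W.test_LO[OF v], rule W.test_LO[OF tens_test[OF h p(1)]])
      have nn: "0 \<le> W.nsq v" "0 \<le> W.F.A.sq v" "0 \<le> W.nsq ?u"
        using L2.sq_nonneg[OF vL] W.F.A.sq_nonneg[OF W.test_H10[OF v]] L2.sq_nonneg[OF W.test_LO[OF ut]] by auto
      have "cmod X \<le> cmod (W.ip (tens h \<phi>) v)"
      proof -
        have "\<bar>1 / (1 + \<beta>\<^sup>2)\<bar> \<le> 1" using n by simp
        then show ?thesis unfolding X_def norm_mult norm_minus_cancel norm_of_real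
          by (rule mult_left_le_one_le[OF norm_ge_zero abs_ge_zero])
      qed
      then have "(cmod X)\<^sup>2 \<le> (cmod (W.ip (tens h \<phi>) v))\<^sup>2" by (simp add: power_mono)
      also have "\<dots> \<le> W.nsq v * W.nsq (tens h \<phi>)" by (rule L2.cauchy_schwarz[OF vL hL])
      also have "\<dots> \<le> W.nsq v * (e / 2 * W.nsq ?u)" by (rule mult_left_mono[OF hn nn(1)])
      finally have Xle: "(cmod X)\<^sup>2 \<le> W.nsq v * (e / 2 * W.nsq ?u)" .
      have "(cmod Z)\<^sup>2 \<le> (\<integral>s. (cmod (g s))\<^sup>2 \<partial>lborel) * ((C.F.A.sq \<phi> - C.E1 * C.nsq \<phi>) * W.F.A.sq v)"
        unfolding Z_def by (rule transverse_remainder[OF g p(1) v])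
      also have "\<dots> \<le> (\<integral>s. (cmod (g s))\<^sup>2 \<partial>lborel) * ((e / 2 * C.nsq \<phi>) * W.F.A.sq v)"
        by (intro mult_left_mono mult_right_mono p(3) nn) (use gn in simp)
      also have "\<dots> = W.F.A.sq v * (e / 2 * W.nsq ?u)" unfolding un by (simp add: mult_ac)
      finally have Zle: "(cmod Z)\<^sup>2 \<le> W.F.A.sq v * (e / 2 * W.nsq ?u)" .
      have "(cmod (X + Z))\<^sup>2 \<le> (cmod X + cmod Z)\<^sup>2" by (intro power_mono norm_triangle_ineq) simp
      also have "\<dots> \<le> 2 * (cmod X)\<^sup>2 + 2 * (cmod Z)\<^sup>2"
        using zero_le_power2[of "cmod X - cmod Z"] unfolding power2_sum power2_diff by linarith
      also have "\<dots> \<le> 2 * (W.nsq v * (e / 2 * W.nsq ?u)) + 2 * (W.F.A.sq v * (e / 2 * W.nsq ?u))"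
        using Xle Zle by simp
      also have "\<dots> = e * W.nsq ?u * W.F.Q.sq v" unfolding W.F.Q_sq by (simp add: algebra_simps)
      finally show "(cmod (W.wform (\<lambda>_. 1) ?u v - complex_of_real r * W.ip ?u v))\<^sup>2 \<le> e * W.nsq ?u * W.F.Q.sq v"
        unfolding eq .
    qed
  qed
qed

end

theorem proposition1:
  fixes S :: "(real \<times> real) set" and \<beta> :: real
  assumes "open S" and "connected S" and "bounded S" and "S \<noteq> {}"
    and "\<beta> > 0"
  shows "essential_spectrum (broken_sheared_waveguide \<beta> S)
           (dirichlet_laplacian (broken_sheared_waveguide \<beta> S))
         = complex_of_real ` {first_eigenvalue S (transverse_operator \<beta> S)..}"
proof -
  interpret waveguide S \<beta> by unfold_locales (use assms in auto)
  show ?thesis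
    unfolding C.first_eigenvalue_eq
    by (rule W.essential_spectrum_eqI[OF garding_below not_resolvent_above])
qed

end
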